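(* Let $(g,X)$ be a Kähler--Ricci soliton on a complex manifold $M$. If the Kähler manifold $(M,g)$ can be Kähler immersed into a definite or indefinite (finite dimensional) complex space form $(S,g_c)$ of constant holomorphic sectional curvature $2c$, then $g$ is Kähler--Einstein. Moreover, its Einstein constant is a rational multiple of $c$.
   Context: A Kähler--Ricci soliton (KRS) on a complex manifold $M$ is a pair $(g,X)$ consisting of a (positive definite) Kähler metric $g$ and a holomorphic vector field $X$ (regarded as a real vector field, i.e. the real part of a holomorphic vector field, locally $X=\sum_j (f_j\,\partial/\partial z_j+\bar f_j\,\partial/\partial\bar z_j)$ with $f_j$ holomorphic) such that $\mathrm{Ric}_g=\lambda g+L_Xg$ for some $\lambda\in\mathbb{R}$, where $\mathrm{Ric}_g$ is the Ricci tensor of $g$ and $L_X$ the Lie derivative. $g$ is Kähler--Einstein (KE) if $\mathrm{Ric}_g=\lambda' g$ for a constant $\lambda'\in\mathbb{R}$, called the Einstein constant. A definite or indefinite complex space form $(S,g_c)$ is a finite dimensional complex manifold with a definite or indefinite Kähler metric of constant holomorphic sectional curvature $2c$, $c\in\mathbb{R}$. With $N=\dim_{\mathbb C}S$, $0\le s\le N$ and $|z|_s^2=|z_1|^2+\cdots+|z_s|^2-|z_{s+1}|^2-\cdots-|z_N|^2$, the models (to which every such form is locally holomorphically isometric) are: for $c=0$, $\mathbb{C}^N$ with Kähler form $\frac i2\partial\bar\partial|z|_s^2$; for $c>0$, the open set $\mathbb{C}\mathrm{P}^N_s=\{[Z_0,\dots,Z_N]\in\mathbb{C}\mathrm{P}^N: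 |Z_0|^2+\cdots+|Z_s|^2-|Z_{s+1}|^2-\cdots-|Z_N|^2>0\}$ with Kähler form $\frac ic\partial\bar\partial\log(1+|z|_s^2)$ in the affine chart $Z_0\ne0$, $z_j=Z_j/Z_0$; for $c<0$, $\mathbb{C}\mathrm{H}^N_s=\{z\in\mathbb{C}^N: |z|_s^2<1\}$ with Kähler form $\frac ic\partial\bar\partial\log(1-|z|_s^2)$. A Kähler immersion $\varphi:(M,g)\to(S,g_c)$ is a holomorphic map with $\varphi^*g_c=g$; it is not required to be injective. No topological assumption (compactness, completeness) is made on $M$. *)

theory Defs
  imports "HOL-Analysis.Analysis"
begin

section \<open>Pseudo-Riemannian geometry on an open subset of a Euclidean space\<close>

text \<open>
  A field of bilinear forms \<open>g\<close> is a function of a point and two tangent vectors. Its derivatives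
  are only ever taken at interior points of an open coordinate domain.
\<close>

abbreviation dir_deriv ::
  "('a::euclidean_space \<Rightarrow> 'b::euclidean_space) \<Rightarrow> 'a \<Rightarrow> 'a \<Rightarrow> 'b" where
  "dir_deriv f x v \<equiv> frechet_derivative f (at x) v"

fun Ck_on :: "nat \<Rightarrow> 'a::euclidean_space set \<Rightarrow> ('a \<Rightarrow> 'b::euclidean_space) \<Rightarrow> bool" where
  "Ck_on 0 A f \<longleftrightarrow> continuous_on A f"
| "Ck_on (Suc k) A f \<longleftrightarrow>
     (\<forall>x\<in>A. f differentiable (at x)) \<and> (\<forall>v. Ck_on k A (\<lambda>x. dir_deriv f x v))"

definition Cinf_on :: "'a::euclidean_space set \<Rightarrow> ('a \<Rightarrow> 'b::euclidean_space) \<Rightarrow> bool" where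
  "Cinf_on A f \<longleftrightarrow> (\<forall>k. Ck_on k A f)"

definition pseudo_riemannian_on ::
  "'a::euclidean_space set \<Rightarrow> ('a \<Rightarrow> 'a \<Rightarrow> 'a \<Rightarrow> real) \<Rightarrow> bool" where
  "pseudo_riemannian_on A g \<longleftrightarrow>
     (\<forall>v w. Cinf_on A (\<lambda>x. g x v w)) \<and>
     (\<forall>x\<in>A. bilinear (g x) \<and> (\<forall>v w. g x v w = g x w v) \<and>
       (\<forall>v. (\<forall>w. g x v w = 0) \<longrightarrow> v = 0))"

text \<open>
  For constant vector fields \<open>v\<close>, \<open>w\<close> this is the Levi-Civita derivative of \<open>w\<close> along \<open>v\<close>, given
  by the Koszul formula; nondegeneracy of \<open>g x\<close> makes it unique.
\<close>

definition christoffel ::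
  "('a::euclidean_space \<Rightarrow> 'a \<Rightarrow> 'a \<Rightarrow> real) \<Rightarrow> 'a \<Rightarrow> 'a \<Rightarrow> 'a \<Rightarrow> 'a" where
  "christoffel g x v w = (THE u. \<forall>z. 2 * g x u z =
     dir_deriv (\<lambda>y. g y w z) x v + dir_deriv (\<lambda>y. g y v z) x w - dir_deriv (\<lambda>y. g y v w) x z)"

text \<open>
  Sign convention: \<open>R(u,v)w\<close> is \<open>\<nabla>\<^sub>u\<nabla>\<^sub>v w - \<nabla>\<^sub>v\<nabla>\<^sub>u w\<close> for constant \<open>u\<close>, \<open>v\<close>, \<open>w\<close>; round spheres have
  positive sectional and Ricci curvature.
\<close>

definition curvature ::
  "('a::euclidean_space \<Rightarrow> 'a \<Rightarrow> 'a \<Rightarrow> real) \<Rightarrow> 'a \<Rightarrow> 'a \<Rightarrow> 'a \<Rightarrow> 'a \<Rightarrow> 'a" where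
  "curvature g x u v w =
     dir_deriv (\<lambda>y. christoffel g y v w) x u - dir_deriv (\<lambda>y. christoffel g y u w) x v
     + christoffel g x u (christoffel g x v w) - christoffel g x v (christoffel g x u w)"

definition sectional_curvature ::
  "('a::euclidean_space \<Rightarrow> 'a \<Rightarrow> 'a \<Rightarrow> real) \<Rightarrow> 'a \<Rightarrow> 'a \<Rightarrow> 'a \<Rightarrow> real" where
  "sectional_curvature g x v w =
     g x (curvature g x v w w) v / (g x v v * g x w w - (g x v w)\<^sup>2)"

text \<open>
  \<open>Ric(v,w)\<close> is the trace of \<open>u \<mapsto> R(u,v)w\<close>. The ambient inner product only serves to compute the
  trace of an endomorphism, which does not depend on it.
\<close>

definition ricci ::
  "('a::euclidean_space \<Rightarrow> 'a \<Rightarrow> 'a \<Rightarrow> real) \<Rightarrow> 'a \<Rightarrow> 'a \<Rightarrow> 'a \<Rightarrow> real" where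
  "ricci g x v w = (\<Sum>b\<in>Basis. curvature g x b v w \<bullet> b)"

definition lie_derivative ::
  "('a::euclidean_space \<Rightarrow> 'a) \<Rightarrow> ('a \<Rightarrow> 'a \<Rightarrow> 'a \<Rightarrow> real) \<Rightarrow> 'a \<Rightarrow> 'a \<Rightarrow> 'a \<Rightarrow> real" where
  "lie_derivative X g x v w =
     dir_deriv (\<lambda>y. g y v w) x (X x) + g x (dir_deriv X x v) w + g x v (dir_deriv X x w)"

section \<open>Complex manifolds\<close>

definition holomorphic_map_on ::
  "(complex^'n) set \<Rightarrow> (complex^'n \<Rightarrow> complex^'k) \<Rightarrow> bool" where
  "holomorphic_map_on A f \<longleftrightarrow>
     (\<forall>x\<in>A. \<exists>D. (f has_derivative D) (at x) \<and> (\<forall>a v. D (a *s v) = a *s D v))"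

text \<open>
  A chart is a pair of its domain and its coordinate map (whose values off the domain are
  irrelevant); its range is the coordinate domain. Atlases need not be maximal.
\<close>

type_synonym ('m, 'n) chart = "'m set \<times> ('m \<Rightarrow> complex^'n)"

definition chart_range :: "('m, 'n::finite) chart \<Rightarrow> (complex^'n) set" where
  "chart_range C = snd C ` fst C"

definition chart_inv :: "('m, 'n::finite) chart \<Rightarrow> complex^'n \<Rightarrow> 'm" where
  "chart_inv C = inv_into (fst C) (snd C)"

definition transition ::
  "('m, 'n::finite) chart \<Rightarrow> ('m, 'n) chart \<Rightarrow> complex^'n \<Rightarrow> complex^'n" where
  "transition C C' = snd C' \<circ> chart_inv C"

definition chart_overlap ::
  "('m, 'n::finite) chart \<Rightarrow> ('m, 'n) chart \<Rightarrow> (complex^'n) set" where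
  "chart_overlap C C' = snd C ` (fst C \<inter> fst C')"

definition complex_manifold :: "'m topology \<Rightarrow> ('m, 'n::finite) chart set \<Rightarrow> bool" where
  "complex_manifold M \<A> \<longleftrightarrow>
     Hausdorff_space M \<and> second_countable M \<and>
     \<Union> (fst ` \<A>) = topspace M \<and>
     (\<forall>C\<in>\<A>. openin M (fst C) \<and> open (chart_range C) \<and>
        homeomorphic_map (subtopology M (fst C)) (top_of_set (chart_range C)) (snd C)) \<and>
     (\<forall>C\<in>\<A>. \<forall>C'\<in>\<A>. holomorphic_map_on (chart_overlap C C') (transition C C'))"

text \<open>
  Tensor fields are given by their representatives in all charts of the atlas, which must transform
  correctly under changes of charts. The tangent space at a point of a chart is \<open>complex^'n\<close>, with
  complex structure \<open>v \<mapsto> \<i> *s v\<close>.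
\<close>

type_synonym ('m, 'n) metric_field =
  "('m, 'n) chart \<Rightarrow> complex^'n \<Rightarrow> complex^'n \<Rightarrow> complex^'n \<Rightarrow> real"

type_synonym ('m, 'n) vector_field = "('m, 'n) chart \<Rightarrow> complex^'n \<Rightarrow> complex^'n"

text \<open>
  Definite or indefinite: only nondegeneracy is required. The last condition says that the Kaehler
  form \<open>\<omega>(v,w) = g(Jv,w)\<close> is closed.
\<close>

definition pseudo_kahler_metric ::
  "('m, 'n::finite) chart set \<Rightarrow> ('m, 'n) metric_field \<Rightarrow> bool" where
  "pseudo_kahler_metric \<A> g \<longleftrightarrow>
     (\<forall>C\<in>\<A>. pseudo_riemannian_on (chart_range C) (g C)) \<and>
     (\<forall>C\<in>\<A>. \<forall>C'\<in>\<A>. \<forall>x\<in>chart_overlap C C'. \<forall>v w.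
        g C x v w = g C' (transition C C' x)
          (dir_deriv (transition C C') x v) (dir_deriv (transition C C') x w)) \<and>
     (\<forall>C\<in>\<A>. \<forall>x\<in>chart_range C. \<forall>v w. g C x (\<i> *s v) (\<i> *s w) = g C x v w) \<and>
     (\<forall>C\<in>\<A>. \<forall>x\<in>chart_range C. \<forall>u v w.
        dir_deriv (\<lambda>y. g C y (\<i> *s v) w) x u + dir_deriv (\<lambda>y. g C y (\<i> *s w) u) x v
        + dir_deriv (\<lambda>y. g C y (\<i> *s u) v) x w = 0)"

definition kahler_metric ::
  "('m, 'n::finite) chart set \<Rightarrow> ('m, 'n) metric_field \<Rightarrow> bool" where
  "kahler_metric \<A> g \<longleftrightarrow> pseudo_kahler_metric \<A> g \<and>
     (\<forall>C\<in>\<A>. \<forall>x\<in>chart_range C. \<forall>v. v \<noteq> 0 \<longrightarrow> g C x v v > 0)"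

text \<open>
  The real vector field \<open>\<Sum>j. f\<^sub>j \<partial>/\<partial>z\<^sub>j + cnj f\<^sub>j \<partial>/\<partial>(cnj z\<^sub>j)\<close> equals
  \<open>\<Sum>j. Re f\<^sub>j \<partial>/\<partial>x\<^sub>j + Im f\<^sub>j \<partial>/\<partial>y\<^sub>j\<close>, so in a chart it is the function \<open>f\<close> itself.
\<close>

definition holomorphic_vector_field ::
  "('m, 'n::finite) chart set \<Rightarrow> ('m, 'n) vector_field \<Rightarrow> bool" where
  "holomorphic_vector_field \<A> X \<longleftrightarrow>
     (\<forall>C\<in>\<A>. holomorphic_map_on (chart_range C) (X C)) \<and>
     (\<forall>C\<in>\<A>. \<forall>C'\<in>\<A>. \<forall>x\<in>chart_overlap C C'.
        X C' (transition C C' x) = dir_deriv (transition C C') x (X C x))"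

definition kahler_ricci_soliton ::
  "('m, 'n::finite) chart set \<Rightarrow> ('m, 'n) metric_field \<Rightarrow> ('m, 'n) vector_field \<Rightarrow> bool" where
  "kahler_ricci_soliton \<A> g X \<longleftrightarrow>
     kahler_metric \<A> g \<and> holomorphic_vector_field \<A> X \<and>
     (\<exists>l::real. \<forall>C\<in>\<A>. \<forall>x\<in>chart_range C. \<forall>v w.
        ricci (g C) x v w = l * g C x v w + lie_derivative (X C) (g C) x v w)"

definition kahler_einstein ::
  "('m, 'n::finite) chart set \<Rightarrow> ('m, 'n) metric_field \<Rightarrow> real \<Rightarrow> bool" where
  "kahler_einstein \<A> g \<mu> \<longleftrightarrow> kahler_metric \<A> g \<and>
     (\<forall>C\<in>\<A>. \<forall>x\<in>chart_range C. \<forall>v w. ricci (g C) x v w = \<mu> * g C x v w)"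

text \<open>
  The holomorphic sectional curvature is the sectional curvature of the plane spanned by \<open>v\<close> and
  \<open>Jv\<close>, which is nondegenerate iff \<open>g(v,v) \<noteq> 0\<close>.
\<close>

definition complex_space_form ::
  "'s topology \<Rightarrow> ('s, 'k::finite) chart set \<Rightarrow> ('s, 'k) metric_field \<Rightarrow> real \<Rightarrow> bool" where
  "complex_space_form S \<B> h \<kappa> \<longleftrightarrow>
     complex_manifold S \<B> \<and> pseudo_kahler_metric \<B> h \<and>
     (\<forall>C\<in>\<B>. \<forall>x\<in>chart_range C. \<forall>v. h C x v v \<noteq> 0 \<longrightarrow>
        sectional_curvature (h C) x v (\<i> *s v) = \<kappa>)"

definition local_rep ::
  "('m, 'n::finite) chart \<Rightarrow> ('s, 'k::finite) chart \<Rightarrow> ('m \<Rightarrow> 's) \<Rightarrow> complex^'n \<Rightarrow> complex^'k" where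
  "local_rep C C' \<phi> = snd C' \<circ> \<phi> \<circ> chart_inv C"

definition kahler_immersion ::
  "'m topology \<Rightarrow> ('m, 'n::finite) chart set \<Rightarrow> ('m, 'n) metric_field \<Rightarrow>
   's topology \<Rightarrow> ('s, 'k::finite) chart set \<Rightarrow> ('s, 'k) metric_field \<Rightarrow> ('m \<Rightarrow> 's) \<Rightarrow> bool" where
  "kahler_immersion M \<A> g S \<B> h \<phi> \<longleftrightarrow>
     continuous_map M S \<phi> \<and>
     (\<forall>C\<in>\<A>. \<forall>C'\<in>\<B>.
        holomorphic_map_on (snd C ` (fst C \<inter> \<phi> -` fst C')) (local_rep C C' \<phi>) \<and>
        (\<forall>x \<in> snd C ` (fst C \<inter> \<phi> -` fst C'). \<forall>v w.
           g C x v w = h C' (local_rep C C' \<phi> x)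
             (dir_deriv (local_rep C C' \<phi>) x v) (dir_deriv (local_rep C C' \<phi>) x w)))"

end

theory Submission
  imports Defs "HOL-Complex_Analysis.Complex_Analysis" "HOL-Computational_Algebra.Fundamental_Theorem_Algebra"
begin

text \<open>
  Everything happens along one complex disc \<open>t \<mapsto> x0 + t v\<close>. If \<open>c \<noteq> 0\<close>, the space form carries a real
  function \<open>P > 0\<close> such that the mixed second derivatives of \<open>log P\<close> give \<open>c/2\<close> times the metric and the
  second holomorphic derivatives of \<open>P\<close> are combinations of \<open>P\<close> and its first ones with holomorphic
  coefficients. Restricted to the disc, \<open>P\<close> and its derivatives therefore solve a holomorphic linear
  differential equation, and are finite sums of products \<open>\<phi>(t) cnj (\<eta>(t))\<close> with holomorphic factors.
  The same holds for \<open>q = (c P\<^sup>2 / 2)^n det g\<close> and for a function \<open>N\<close> such that the mixed derivative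
  of \<open>N/P\<close> is half of \<open>L\<^sub>X g\<close>, and the soliton equation says that
  \<open>log q + r log P + N/P\<close> has vanishing mixed derivative, where \<open>r = l/c - 2n\<close>. For \<open>c = 0\<close> one
  takes \<open>P = 1\<close> and lets \<open>N\<close> account for \<open>l g + L\<^sub>X g\<close>.

  Replacing \<open>t\<close> and its conjugate by independent variables \<open>w\<close>, \<open>s\<close>, one obtains a logarithmic
  differential equation in \<open>w\<close> over the algebra generated by countably many functions of \<open>s\<close>. Unless
  \<open>N/P\<close> splits as \<open>a(w) + b(s)\<close>, the uncountable Nullstellensatz provides homomorphisms of this
  algebra to the complex numbers under which a difference \<open>(N/P)(w1) - (N/P)(w0)\<close> takes arbitrarily large
  values. A limit of the resulting normalized solutions solves the same equation, and comparing orders of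
  poles shows that such differences are bounded, a contradiction. Hence \<open>N/P\<close> splits, and its mixed
  derivative vanishes. In the same way \<open>P\<close> splits as a product, which is impossible for \<open>c \<noteq> 0\<close>
  and definite \<open>g\<close>, unless there is a limit solution with \<open>P(w1) = 0\<close>, and then \<open>r\<close> is rational.
\<close>

section \<open>Smooth functions\<close>

text \<open>For c \<noteq> 0 the metric need not be of finite rank on the disc, but its product with
  P^2 is, because the mixed derivative of log P is a polynomial in P and its derivatives divided by
  P^2. Clearing these denominators in an n by n determinant costs P^(2n), which explains that power
  in q and the shift of l/c by 2n in r.

  Evaluation at points s of the disc would not suffice, since N/P may be bounded there.
  Homomorphisms of the coefficient algebra act as points beyond the disc: however transcendental the
  coefficients are, a nonscalar element misses only countably many values. The equation in w
  survives every homomorphism, as s enters it only through the coefficients, and limits are taken in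
  a finite dimensional space of coefficient vectors.

  A pole of N/P would give its derivative a pole of order at least two, while logarithmic
  derivatives have simple poles; this keeps differences bounded. Where a limit solution has P
  vanishing to order m > 0 and q to order j, the residues must cancel: r m + j = 0. Rationality has
  no other source.\<close>

lemma dir_deriv_eqI: "(f has_derivative D) (at x) \<Longrightarrow> dir_deriv f x v = D v"
  using frechet_derivative_at[of f D x] by simp

lemma has_derivative_dir_deriv: "f differentiable (at x) \<Longrightarrow> (f has_derivative dir_deriv f x) (at x)"
  by (simp add: frechet_derivative_works)

lemma dir_deriv_cong_open:
  assumes "open A" "x \<in> A" "\<And>y. y \<in> A \<Longrightarrow> f y = g y"
  shows "dir_deriv f x v = dir_deriv g x v"
proof -
  have "(f has_derivative D) (at x) \<longleftrightarrow> (g has_derivative D) (at x)" for D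
    using assms by (metis has_derivative_transform_within_open)
  then show ?thesis by (simp add: frechet_derivative_def)
qed

lemma differentiable_cong_open:
  assumes "open A" "x \<in> A" "\<And>y. y \<in> A \<Longrightarrow> f y = g y"
  shows "f differentiable (at x) \<longleftrightarrow> g differentiable (at x)"
  unfolding differentiable_def using assms by (metis has_derivative_transform_within_open)

lemma Ck_on_cong:
  assumes "open A" "\<And>y. y \<in> A \<Longrightarrow> f y = g y"
  shows "Ck_on k A f \<longleftrightarrow> Ck_on k A g"
  using assms(2)
proof (induction k arbitrary: f g)
  case 0
  then show ?case by (simp cong: continuous_on_cong)
next
  case (Suc k)
  have "Ck_on k A (\<lambda>x. dir_deriv f x v) \<longleftrightarrow> Ck_on k A (\<lambda>x. dir_deriv g x v)" for v
    by (intro Suc.IH dir_deriv_cong_open[OF assms(1)] Suc.prems)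
  moreover have "f differentiable (at x) \<longleftrightarrow> g differentiable (at x)" if "x \<in> A" for x
    by (rule differentiable_cong_open[OF assms(1) that Suc.prems])
  ultimately show ?case by auto
qed

lemma Ck_on_SucD: "Ck_on (Suc k) A f \<Longrightarrow> Ck_on k A f"
proof (induction k arbitrary: f)
  case 0
  then show ?case
    by (auto intro!: continuous_at_imp_continuous_on differentiable_imp_continuous_within)
next
  case (Suc k)
  from Suc.prems Suc.IH show ?case by (subst Ck_on.simps(2)) (metis Ck_on.simps(2))
qed

lemma Ck_on_SucI:
  assumes "open A" "\<And>x. x \<in> A \<Longrightarrow> (f has_derivative D x) (at x)" "\<And>v. Ck_on k A (\<lambda>x. D x v)"
  shows "Ck_on (Suc k) A f"
proof -
  have "Ck_on k A (\<lambda>x. dir_deriv f x v)" for v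
    using assms(3)[of v] Ck_on_cong[OF assms(1), of "\<lambda>x. dir_deriv f x v" "\<lambda>x. D x v" k]
      dir_deriv_eqI[OF assms(2)] by blast
  then show ?thesis using assms(2) by (auto simp: differentiable_def)
qed

lemma Ck_on_SucE:
  assumes "Ck_on (Suc k) A f"
  shows "\<And>x. x \<in> A \<Longrightarrow> (f has_derivative dir_deriv f x) (at x)" "\<And>v. Ck_on k A (\<lambda>x. dir_deriv f x v)"
  using assms has_derivative_dir_deriv by auto

lemma Ck_on_const: "open A \<Longrightarrow> Ck_on k A (\<lambda>x. c)"
proof (induction k arbitrary: c)
  case (Suc k)
  then show ?case by (intro Ck_on_SucI[where D = "\<lambda>_ _. 0"]) (auto intro!: derivative_eq_intros)
qed auto

lemma Ck_on_add: "open A \<Longrightarrow> Ck_on k A f \<Longrightarrow> Ck_on k A g \<Longrightarrow> Ck_on k A (\<lambda>x. f x + g x)"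
proof (induction k arbitrary: f g)
  case (Suc k)
  show ?case
    using Ck_on_SucE[OF Suc.prems(2)] Ck_on_SucE[OF Suc.prems(3)] Suc.IH[OF Suc.prems(1)]
    by (intro Ck_on_SucI[where D = "\<lambda>x v. dir_deriv f x v + dir_deriv g x v"] has_derivative_add Suc.prems(1) Suc.IH[OF Suc.prems(1)])
qed (auto intro: continuous_on_add)

lemma Ck_on_bounded_linear:
  "bounded_linear L \<Longrightarrow> open A \<Longrightarrow> Ck_on k A f \<Longrightarrow> Ck_on k A (\<lambda>x. L (f x))"
proof (induction k arbitrary: f)
  case 0
  then show ?case by (auto intro: bounded_linear.continuous_on)
next
  case (Suc k)
  show ?case
    using Ck_on_SucE[OF Suc.prems(3)] Suc.IH[OF Suc.prems(1,2)]
    by (intro Ck_on_SucI[where D = "\<lambda>x v. L (dir_deriv f x v)"]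
        bounded_linear.has_derivative[OF Suc.prems(1)] Suc.prems(2) Suc.IH[OF Suc.prems(1,2)])
qed

lemma Ck_on_mult:
  fixes f g :: "'a::euclidean_space \<Rightarrow> complex"
  shows "open A \<Longrightarrow> Ck_on k A f \<Longrightarrow> Ck_on k A g \<Longrightarrow> Ck_on k A (\<lambda>x. f x * g x)"
proof (induction k arbitrary: f g)
  case (Suc k)
  have "Ck_on k A f" "Ck_on k A g" using Suc.prems Ck_on_SucD by blast+
  then show ?case
    using Ck_on_SucE[OF Suc.prems(2)] Ck_on_SucE[OF Suc.prems(3)] Suc.IH[OF Suc.prems(1)]
    by (intro Ck_on_SucI[where D = "\<lambda>x v. f x * dir_deriv g x v + dir_deriv f x v * g x"]
        has_derivative_mult Ck_on_add Suc.prems(1) Suc.IH[OF Suc.prems(1)])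
qed (auto intro: continuous_on_mult)

lemma Ck_on_inverse:
  fixes f :: "'a::euclidean_space \<Rightarrow> complex"
  shows "open A \<Longrightarrow> (\<And>x. x \<in> A \<Longrightarrow> f x \<noteq> 0) \<Longrightarrow> Ck_on k A f \<Longrightarrow> Ck_on k A (\<lambda>x. inverse (f x))"
proof (induction k arbitrary: f)
  case (Suc k)
  have f: "Ck_on k A f" using Suc.prems Ck_on_SucD by blast
  have inv: "Ck_on k A (\<lambda>x. inverse (f x))" using Suc f by auto
  have "Ck_on k A (\<lambda>x. (-1) * (inverse (f x) * dir_deriv f x v * inverse (f x)))" for v
    by (intro Ck_on_mult Ck_on_const inv Ck_on_SucE(2)[OF Suc.prems(3)] Suc.prems(1))
  then have "Ck_on k A (\<lambda>x. - (inverse (f x) * dir_deriv f x v * inverse (f x)))" for v by simp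
  then show ?case
    using Suc.prems
    by (intro Ck_on_SucI[where D = "\<lambda>x v. - (inverse (f x) * dir_deriv f x v * inverse (f x))"]
        Deriv.has_derivative_inverse Ck_on_SucE(1)[OF Suc.prems(3)])
qed (auto intro: continuous_on_inverse)

text \<open>Openness belongs to the notion so that the closure rules need no separate side
  condition; \<open>Cinf_on\<close> can be written down on any set.\<close>

definition smooth :: "'a::euclidean_space set \<Rightarrow> ('a \<Rightarrow> complex) \<Rightarrow> bool" where
  "smooth A f \<longleftrightarrow> open A \<and> Cinf_on A f"

lemma smooth_open: "smooth A f \<Longrightarrow> open A"
  by (simp add: smooth_def)

lemma smooth_differentiable: "smooth A f \<Longrightarrow> x \<in> A \<Longrightarrow> f differentiable (at x)"
  unfolding smooth_def Cinf_on_def by (metis Ck_on.simps(2))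

lemma smooth_const: "open A \<Longrightarrow> smooth A (\<lambda>x. c)"
  by (simp add: smooth_def Cinf_on_def Ck_on_const)

lemma smooth_add: "smooth A f \<Longrightarrow> smooth A g \<Longrightarrow> smooth A (\<lambda>x. f x + g x)"
  by (simp add: smooth_def Cinf_on_def Ck_on_add)

lemma smooth_mult: "smooth A f \<Longrightarrow> smooth A g \<Longrightarrow> smooth A (\<lambda>x. f x * g x)"
  by (simp add: smooth_def Cinf_on_def Ck_on_mult)

lemma smooth_minus: "smooth A f \<Longrightarrow> smooth A (\<lambda>x. - f x)"
  using smooth_mult[OF smooth_const[of A "-1"], of f] smooth_open by auto

lemma smooth_diff: "smooth A f \<Longrightarrow> smooth A g \<Longrightarrow> smooth A (\<lambda>x. f x - g x)"
  using smooth_add[OF _ smooth_minus, of A f g] by simp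

lemma smooth_inverse: "smooth A f \<Longrightarrow> (\<And>x. x \<in> A \<Longrightarrow> f x \<noteq> 0) \<Longrightarrow> smooth A (\<lambda>x. inverse (f x))"
  by (simp add: smooth_def Cinf_on_def Ck_on_inverse)

lemma smooth_divide:
  "smooth A f \<Longrightarrow> smooth A g \<Longrightarrow> (\<And>x. x \<in> A \<Longrightarrow> g x \<noteq> 0) \<Longrightarrow> smooth A (\<lambda>x. f x / g x)"
  using smooth_mult[OF _ smooth_inverse, of A f g] by (simp add: divide_inverse)

lemma smooth_of_real: "open A \<Longrightarrow> Cinf_on A f \<Longrightarrow> smooth A (\<lambda>x. of_real (f x))"
  by (simp add: smooth_def Cinf_on_def Ck_on_bounded_linear bounded_linear_of_real)

lemma smooth_sum: "open A \<Longrightarrow> (\<And>i. i \<in> I \<Longrightarrow> smooth A (f i)) \<Longrightarrow> smooth A (\<lambda>x. \<Sum>i\<in>I. f i x)"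
  by (induction I rule: infinite_finite_induct) (auto intro: smooth_add smooth_const)

lemma smooth_prod: "open A \<Longrightarrow> (\<And>i. i \<in> I \<Longrightarrow> smooth A (f i)) \<Longrightarrow> smooth A (\<lambda>x. \<Prod>i\<in>I. f i x)"
  by (induction I rule: infinite_finite_induct) (auto intro: smooth_mult smooth_const)

lemma smooth_dir_deriv: "smooth A f \<Longrightarrow> smooth A (\<lambda>x. dir_deriv f x v)"
  unfolding smooth_def Cinf_on_def by (metis Ck_on.simps(2))

text \<open>Bootstrapping: f is continuous, and if it is of class k then so are its derivatives
  \<open>f x * l v x\<close>. This gives smoothness of a function built with \<open>exp\<close> and
  \<open>ln\<close> without a chain rule for \<open>Ck_on\<close>.\<close>

lemma smooth_linearized_ode:
  assumes "open A" and der: "\<And>x. x \<in> A \<Longrightarrow> (f has_derivative (\<lambda>v. f x * l v x)) (at x)"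
    and l: "\<And>v. smooth A (l v)"
  shows "smooth A f"
proof -
  have "Ck_on k A f" for k
  proof (induction k)
    case 0
    have "f differentiable (at x)" if "x \<in> A" for x using der[OF that] by (auto simp: differentiable_def)
    then show ?case
      by (auto intro!: continuous_at_imp_continuous_on differentiable_imp_continuous_within)
  next
    case (Suc k)
    show ?case
      by (rule Ck_on_SucI[OF assms(1) der]) (use Suc l assms(1) in \<open>auto simp: smooth_def Cinf_on_def intro!: Ck_on_mult\<close>)
  qed
  then show ?thesis using assms(1) by (simp add: smooth_def Cinf_on_def)
qed

section \<open>Symmetry of second derivatives\<close>

lemma second_difference_mean_value:
  fixes f :: "'a::euclidean_space \<Rightarrow> real"
  assumes A: "\<And>\<sigma> \<tau>. 0 \<le> \<sigma> \<Longrightarrow> \<sigma> \<le> s \<Longrightarrow> 0 \<le> \<tau> \<Longrightarrow> \<tau> \<le> s \<Longrightarrow> x + \<sigma> *\<^sub>R v + \<tau> *\<^sub>R w \<in> A"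
    and f: "\<And>y. y \<in> A \<Longrightarrow> f differentiable (at y)"
    and fv: "\<And>y. y \<in> A \<Longrightarrow> (\<lambda>y. dir_deriv f y v) differentiable (at y)" and s: "s > 0"
  shows "\<exists>\<sigma> \<tau>. 0 < \<sigma> \<and> \<sigma> < s \<and> 0 < \<tau> \<and> \<tau> < s \<and>
    f (x + s *\<^sub>R v + s *\<^sub>R w) - f (x + s *\<^sub>R v) - f (x + s *\<^sub>R w) + f x
     = s * s * dir_deriv (\<lambda>y. dir_deriv f y v) (x + \<sigma> *\<^sub>R v + \<tau> *\<^sub>R w) w"
proof -
  have line: "((\<lambda>\<sigma>. h (y + \<sigma> *\<^sub>R u)) has_real_derivative dir_deriv h (y + \<sigma> *\<^sub>R u) u) (at \<sigma>)"
    if "h differentiable (at (y + \<sigma> *\<^sub>R u))" for h :: "'a \<Rightarrow> real" and y u \<sigma>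
  proof -
    have "((\<lambda>\<sigma>. y + \<sigma> *\<^sub>R u) has_derivative (\<lambda>h. h *\<^sub>R u)) (at \<sigma>)"
      by (auto intro!: derivative_eq_intros)
    from has_derivative_compose[OF this has_derivative_dir_deriv[OF that]]
    have "((\<lambda>\<sigma>. h (y + \<sigma> *\<^sub>R u)) has_derivative (\<lambda>t. dir_deriv h (y + \<sigma> *\<^sub>R u) (t *\<^sub>R u))) (at \<sigma>)" .
    moreover have "dir_deriv h (y + \<sigma> *\<^sub>R u) (t *\<^sub>R u) = dir_deriv h (y + \<sigma> *\<^sub>R u) u * t" for t
      using linear_cmul[OF has_derivative_linear[OF has_derivative_dir_deriv[OF that]], of t u]
      by simp
    ultimately show ?thesis by (simp add: has_field_derivative_def)
  qed
  \<comment> \<open>The second difference is an increment of \<phi>; the mean value theorem along v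
    and then along w removes both differences.\<close>
  define \<phi> where "\<phi> \<sigma> = f ((x + s *\<^sub>R w) + \<sigma> *\<^sub>R v) - f (x + \<sigma> *\<^sub>R v)" for \<sigma>
  have "\<exists>z>0. z < s \<and> \<phi> s - \<phi> 0 = (s - 0) * (dir_deriv f ((x + s *\<^sub>R w) + z *\<^sub>R v) v - dir_deriv f (x + z *\<^sub>R v) v)"
    unfolding \<phi>_def
  proof (rule MVT2[OF s])
    fix \<sigma> assume \<sigma>: "0 \<le> \<sigma>" "\<sigma> \<le> s"
    have "x + s *\<^sub>R w + \<sigma> *\<^sub>R v \<in> A" "x + \<sigma> *\<^sub>R v \<in> A"
      using A[OF \<sigma>, of s] A[OF \<sigma>, of 0] s by (simp_all add: algebra_simps)
    then show "((\<lambda>\<sigma>. f (x + s *\<^sub>R w + \<sigma> *\<^sub>R v) - f (x + \<sigma> *\<^sub>R v)) has_real_derivative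
        dir_deriv f (x + s *\<^sub>R w + \<sigma> *\<^sub>R v) v - dir_deriv f (x + \<sigma> *\<^sub>R v) v) (at \<sigma>)"
      using f by (intro DERIV_diff line) auto
  qed
  then obtain \<sigma> where \<sigma>: "0 < \<sigma>" "\<sigma> < s"
    "\<phi> s - \<phi> 0 = s * (dir_deriv f ((x + s *\<^sub>R w) + \<sigma> *\<^sub>R v) v - dir_deriv f (x + \<sigma> *\<^sub>R v) v)" by auto
  have "\<exists>z>0. z < s \<and> dir_deriv f ((x + \<sigma> *\<^sub>R v) + s *\<^sub>R w) v - dir_deriv f ((x + \<sigma> *\<^sub>R v) + 0 *\<^sub>R w) v
      = (s - 0) * dir_deriv (\<lambda>y. dir_deriv f y v) ((x + \<sigma> *\<^sub>R v) + z *\<^sub>R w) w"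
  proof (rule MVT2[OF s])
    fix \<tau> assume \<tau>: "0 \<le> \<tau>" "\<tau> \<le> s"
    have "(x + \<sigma> *\<^sub>R v) + \<tau> *\<^sub>R w \<in> A" using A[of \<sigma> \<tau>] \<sigma> \<tau> by simp
    then show "((\<lambda>\<tau>. dir_deriv f ((x + \<sigma> *\<^sub>R v) + \<tau> *\<^sub>R w) v) has_real_derivative
        dir_deriv (\<lambda>y. dir_deriv f y v) ((x + \<sigma> *\<^sub>R v) + \<tau> *\<^sub>R w) w) (at \<tau>)"
      using fv by (intro line) auto
  qed
  then obtain \<tau> where \<tau>: "0 < \<tau>" "\<tau> < s" "dir_deriv f ((x + \<sigma> *\<^sub>R v) + s *\<^sub>R w) v - dir_deriv f (x + \<sigma> *\<^sub>R v) v
      = s * dir_deriv (\<lambda>y. dir_deriv f y v) ((x + \<sigma> *\<^sub>R v) + \<tau> *\<^sub>R w) w" by auto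
  have "x + s *\<^sub>R w + \<sigma> *\<^sub>R v = x + \<sigma> *\<^sub>R v + s *\<^sub>R w" by (simp add: algebra_simps)
  then have "\<phi> s - \<phi> 0 = s * (s * dir_deriv (\<lambda>y. dir_deriv f y v) ((x + \<sigma> *\<^sub>R v) + \<tau> *\<^sub>R w) w)"
    using \<sigma>(3) \<tau>(3) by (simp only:)
  moreover have "\<phi> s - \<phi> 0 = f (x + s *\<^sub>R v + s *\<^sub>R w) - f (x + s *\<^sub>R v) - f (x + s *\<^sub>R w) + f x"
    unfolding \<phi>_def by (simp add: algebra_simps)
  ultimately show ?thesis using \<sigma> \<tau> by (intro exI[of _ \<sigma>] exI[of _ \<tau>]) simp
qed

text \<open>The second difference of f over the parallelogram spanned by s v and s w is symmetric in
  v and w. It equals s^2 times either mixed derivative at suitable nearby points, and these points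
  converge to x as s tends to 0.\<close>

lemma symmetric_second_derivative_real:
  fixes f :: "'a::euclidean_space \<Rightarrow> real"
  assumes "open A" and f: "Ck_on 2 A f" and x: "x \<in> A"
  shows "dir_deriv (\<lambda>y. dir_deriv f y v) x w = dir_deriv (\<lambda>y. dir_deriv f y w) x v"
proof -
  have f2: "Ck_on (Suc (Suc 0)) A f" using f by (simp add: numeral_2_eq_2)
  have d1: "\<And>y. y \<in> A \<Longrightarrow> f differentiable (at y)" using f2 by simp
  have d2: "\<And>y u. y \<in> A \<Longrightarrow> (\<lambda>y. dir_deriv f y u) differentiable (at y)" using f2 by simp
  have c: "continuous_on A (\<lambda>y. dir_deriv (\<lambda>y. dir_deriv f y u) y u')" for u u' using f2 by simp
  obtain e where e: "e > 0" "ball x e \<subseteq> A" using assms(1) x open_contains_ball by blast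
  \<comment> \<open>A point x + \<sigma> v + \<tau> w with \<sigma>, \<tau> between 0 and s has
    distance at most s M from x; the summand 1 keeps M positive for v = w = 0.\<close>
  define M where "M = norm v + norm w + 1"
  have M: "M > 0" unfolding M_def by (simp add: add_nonneg_pos)
  have inA: "x + \<sigma> *\<^sub>R v + \<tau> *\<^sub>R w \<in> A \<and> dist (x + \<sigma> *\<^sub>R v + \<tau> *\<^sub>R w) x \<le> s * M"
    if "0 \<le> \<sigma>" "\<sigma> \<le> s" "0 \<le> \<tau>" "\<tau> \<le> s" "s * M < e" for \<sigma> \<tau> s
  proof -
    have "dist (x + \<sigma> *\<^sub>R v + \<tau> *\<^sub>R w) x = norm (\<sigma> *\<^sub>R v + \<tau> *\<^sub>R w)" by (simp add: dist_norm)
    also have "\<dots> \<le> \<sigma> * norm v + \<tau> * norm w" using that by (intro norm_triangle_le) simp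
    also have "\<dots> \<le> s * norm v + s * norm w" using that by (intro add_mono mult_right_mono) auto
    also have "\<dots> \<le> s * M" using that by (simp add: M_def algebra_simps)
    finally have "dist (x + \<sigma> *\<^sub>R v + \<tau> *\<^sub>R w) x \<le> s * M" .
    then show ?thesis using that e by (auto simp: dist_commute subset_eq)
  qed
  \<comment> \<open>The factor 1/2 makes s M strictly smaller than e already for n = 0.\<close>
  define s where "s n = e / (2 * M) / real (Suc n)" for n
  have s: "s n > 0" "s n * M < e" for n
  proof -
    show "s n > 0" using e M by (simp add: s_def)
    have "e / (2 * M) / real (Suc n) \<le> e / (2 * M) / 1" using e M by (intro divide_left_mono) auto
    then have "s n \<le> e / (2 * M)" by (simp add: s_def)
    then have "s n * M \<le> e / 2" using M by (simp add: field_simps)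
    then show "s n * M < e" using e by simp
  qed
  have s0: "(\<lambda>n. s n * M) \<longlonglongrightarrow> 0"
    unfolding s_def by (intro tendsto_mult_left_zero LIMSEQ_Suc[OF lim_const_over_n])
  have ex: "\<exists>p q. dist p x \<le> s n * M \<and> dist q x \<le> s n * M \<and> p \<in> A \<and> q \<in> A \<and>
      dir_deriv (\<lambda>y. dir_deriv f y v) p w = dir_deriv (\<lambda>y. dir_deriv f y w) q v" for n
  proof -
    obtain \<sigma> \<tau> where 1: "0 < \<sigma>" "\<sigma> < s n" "0 < \<tau>" "\<tau> < s n"
      "f (x + s n *\<^sub>R v + s n *\<^sub>R w) - f (x + s n *\<^sub>R v) - f (x + s n *\<^sub>R w) + f x
     = s n * s n * dir_deriv (\<lambda>y. dir_deriv f y v) (x + \<sigma> *\<^sub>R v + \<tau> *\<^sub>R w) w"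
      using second_difference_mean_value[of "s n" x v w A f] inA[OF _ _ _ _ s(2)] d1 d2 s(1) by blast
    have "x + \<sigma> *\<^sub>R w + \<tau> *\<^sub>R v \<in> A" if "0 \<le> \<sigma>" "\<sigma> \<le> s n" "0 \<le> \<tau>" "\<tau> \<le> s n" for \<sigma> \<tau>
      using inA[OF that(3,4,1,2) s(2)] by (simp add: algebra_simps)
    then obtain \<sigma>' \<tau>' where 2: "0 < \<sigma>'" "\<sigma>' < s n" "0 < \<tau>'" "\<tau>' < s n"
      "f (x + s n *\<^sub>R w + s n *\<^sub>R v) - f (x + s n *\<^sub>R w) - f (x + s n *\<^sub>R v) + f x
     = s n * s n * dir_deriv (\<lambda>y. dir_deriv f y w) (x + \<sigma>' *\<^sub>R w + \<tau>' *\<^sub>R v) v"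
      using second_difference_mean_value[of "s n" x w v A f] d1 d2 s(1) by blast
    have e: "x + s n *\<^sub>R w + s n *\<^sub>R v = x + s n *\<^sub>R v + s n *\<^sub>R w"
      "x + \<sigma>' *\<^sub>R w + \<tau>' *\<^sub>R v = x + \<tau>' *\<^sub>R v + \<sigma>' *\<^sub>R w" by (simp_all add: algebra_simps)
    have "s n * s n * dir_deriv (\<lambda>y. dir_deriv f y v) (x + \<sigma> *\<^sub>R v + \<tau> *\<^sub>R w) w
       = s n * s n * dir_deriv (\<lambda>y. dir_deriv f y w) (x + \<tau>' *\<^sub>R v + \<sigma>' *\<^sub>R w) v"
      using 1(5) 2(5)[unfolded e] by linarith
    then have "dir_deriv (\<lambda>y. dir_deriv f y v) (x + \<sigma> *\<^sub>R v + \<tau> *\<^sub>R w) w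
       = dir_deriv (\<lambda>y. dir_deriv f y w) (x + \<tau>' *\<^sub>R v + \<sigma>' *\<^sub>R w) v" using s(1)[of n] by simp
    moreover note inA[of \<sigma> "s n" \<tau>, OF _ _ _ _ s(2)] inA[of \<tau>' "s n" \<sigma>', OF _ _ _ _ s(2)]
    ultimately show ?thesis
      using 1(1-4) 2(1-4)
      by (intro exI[of _ "x + \<sigma> *\<^sub>R v + \<tau> *\<^sub>R w"] exI[of _ "x + \<tau>' *\<^sub>R v + \<sigma>' *\<^sub>R w"]) auto
  qed
  then obtain p q where pq: "\<And>n. dist (p n) x \<le> s n * M" "\<And>n. dist (q n) x \<le> s n * M"
      "\<And>n. p n \<in> A" "\<And>n. q n \<in> A"
      "\<And>n. dir_deriv (\<lambda>y. dir_deriv f y v) (p n) w = dir_deriv (\<lambda>y. dir_deriv f y w) (q n) v"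
    by metis
  have lim: "u \<longlonglongrightarrow> x" if "\<And>n. dist (u n) x \<le> s n * M" for u
    unfolding tendsto_dist_iff[of u]
    by (rule tendsto_sandwich[OF _ _ tendsto_const s0]) (simp_all add: that)
  have lim': "(\<lambda>n. dir_deriv (\<lambda>y. dir_deriv f y a) (u n) b) \<longlonglongrightarrow> dir_deriv (\<lambda>y. dir_deriv f y a) x b"
    if "\<And>n. dist (u n) x \<le> s n * M" "\<And>n. u n \<in> A" for u a b
    using that x by (intro continuous_on_tendsto_compose[OF c lim]) simp_all
  have "(\<lambda>n. dir_deriv (\<lambda>y. dir_deriv f y w) (q n) v) \<longlonglongrightarrow> dir_deriv (\<lambda>y. dir_deriv f y v) x w"
    using lim'[OF pq(1,3), of v w] unfolding pq(5) .
  then show ?thesis using lim'[OF pq(2,4), of w v] by (rule LIMSEQ_unique)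
qed

lemma symmetric_second_derivative:
  assumes f: "smooth A f" and x: "x \<in> A"
  shows "dir_deriv (\<lambda>y. dir_deriv f y v) x w = dir_deriv (\<lambda>y. dir_deriv f y w) x v"
proof -
  have A: "open A" using f by (rule smooth_open)
  have eq: "L (dir_deriv (\<lambda>y. dir_deriv f y u) x u') = dir_deriv (\<lambda>y. dir_deriv (\<lambda>y. L (f y)) y u) x u'"
    if L: "bounded_linear L" for L :: "complex \<Rightarrow> real" and u u'
  proof -
    have 1: "dir_deriv (\<lambda>y. L (g y)) z u = L (dir_deriv g z u)" if "smooth A g" "z \<in> A" for g z u
      by (rule dir_deriv_eqI, rule bounded_linear.has_derivative[OF L], rule has_derivative_dir_deriv)
        (rule smooth_differentiable[OF that])
    have "dir_deriv (\<lambda>y. dir_deriv (\<lambda>y. L (f y)) y u) x u' = dir_deriv (\<lambda>y. L (dir_deriv f y u)) x u'"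
      by (intro dir_deriv_cong_open[OF A x] 1 f)
    also have "\<dots> = L (dir_deriv (\<lambda>y. dir_deriv f y u) x u')"
      by (intro 1 smooth_dir_deriv f x)
    finally show ?thesis by simp
  qed
  have "Ck_on 2 A (\<lambda>y. L (f y))" if "bounded_linear L" for L :: "complex \<Rightarrow> real"
    using f that A by (auto simp: smooth_def Cinf_on_def intro: Ck_on_bounded_linear)
  then have "L (dir_deriv (\<lambda>y. dir_deriv f y v) x w) = L (dir_deriv (\<lambda>y. dir_deriv f y w) x v)"
    if "bounded_linear L" for L :: "complex \<Rightarrow> real"
    unfolding eq[OF that] using that A x by (intro symmetric_second_derivative_real) auto
  from this[OF bounded_linear_Re] this[OF bounded_linear_Im] show ?thesis by (rule complex_eqI)
qed

section \<open>Wirtinger derivatives and pseudo-Kaehler metrics\<close>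

text \<open>\<open>wd\<close> and \<open>wdb\<close> are the complex linear and the conjugate linear
  part of the real derivative, evaluated at the direction v.\<close>

definition wd :: "complex^'n \<Rightarrow> (complex^'n \<Rightarrow> complex) \<Rightarrow> complex^'n \<Rightarrow> complex" where
  "wd v f x = (dir_deriv f x v - \<i> * dir_deriv f x (\<i> *s v)) / 2"

definition wdb :: "complex^'n \<Rightarrow> (complex^'n \<Rightarrow> complex) \<Rightarrow> complex^'n \<Rightarrow> complex" where
  "wdb v f x = (dir_deriv f x v + \<i> * dir_deriv f x (\<i> *s v)) / 2"

lemma complex_scale_eq: "c *s v = Re c *\<^sub>R v + Im c *\<^sub>R (\<i> *s (v :: complex^'n))"
  by (simp add: vec_eq_iff complex_eq_iff)

lemma i_scale_i_scale [simp]: "\<i> *s (\<i> *s v) = - (v :: complex^'n)"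
  by (simp add: vec_eq_iff)

lemma dir_deriv_linear: "f differentiable (at x) \<Longrightarrow> linear (dir_deriv f x)"
  by (rule has_derivative_linear[OF has_derivative_dir_deriv])

lemma dir_deriv_wd: "dir_deriv f x v = wd v f x + wdb v f x"
  by (simp add: wd_def wdb_def field_simps)

lemma dir_deriv_i: "dir_deriv f x (\<i> *s v) = \<i> * wd v f x - \<i> * wdb v f x"
  by (simp add: wd_def wdb_def field_simps)

lemma dir_deriv_scale:
  assumes "f differentiable (at x)"
  shows "dir_deriv f x (c *s v) = c * wd v f x + cnj c * wdb v f x"
proof -
  note l = dir_deriv_linear[OF assms]
  have "dir_deriv f x (c *s v) = Re c *\<^sub>R dir_deriv f x v + Im c *\<^sub>R dir_deriv f x (\<i> *s v)"
    by (subst complex_scale_eq) (simp add: linear_add[OF l] linear_cmul[OF l])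
  also have "\<dots> = of_real (Re c) * (wd v f x + wdb v f x) + of_real (Im c) * (\<i> * wd v f x - \<i> * wdb v f x)"
    by (simp add: dir_deriv_i scaleR_conv_of_real flip: dir_deriv_wd)
  also have "\<dots> = (of_real (Re c) + \<i> * of_real (Im c)) * wd v f x + (of_real (Re c) - \<i> * of_real (Im c)) * wdb v f x"
    by (simp add: algebra_simps)
  also have "\<dots> = c * wd v f x + cnj c * wdb v f x"
    by (metis complex_eq complex_cnj_add complex_cnj_complex_of_real complex_cnj_i complex_cnj_mult minus_mult_left diff_conv_add_uminus)
  finally show ?thesis .
qed

lemma wd_scale: "f differentiable (at x) \<Longrightarrow> wd (c *s v) f x = c * wd v f x"
  and wdb_scale: "f differentiable (at x) \<Longrightarrow> wdb (c *s v) f x = cnj c * wdb v f x"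
  unfolding wd_def[of "c *s v"] wdb_def[of "c *s v"] vector_smult_assoc
  by (simp_all add: dir_deriv_scale algebra_simps)

lemma wd_add_vec: "f differentiable (at x) \<Longrightarrow> wd (v + w) f x = wd v f x + wd w f x"
  and wdb_add_vec: "f differentiable (at x) \<Longrightarrow> wdb (v + w) f x = wdb v f x + wdb w f x"
  using linear_add[OF dir_deriv_linear, of f x]
  by (simp_all add: wd_def wdb_def vector_add_ldistrib field_simps)

lemma wd_zero_vec: "f differentiable (at x) \<Longrightarrow> wd 0 f x = 0"
  and wdb_zero_vec: "f differentiable (at x) \<Longrightarrow> wdb 0 f x = 0"
  using wd_scale[of f x 0 0] wdb_scale[of f x 0 0] by simp_all

lemma wd_sum_vec: "f differentiable (at x) \<Longrightarrow> wd (\<Sum>i\<in>I. v i) f x = (\<Sum>i\<in>I. wd (v i) f x)"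
  and wdb_sum_vec: "f differentiable (at x) \<Longrightarrow> wdb (\<Sum>i\<in>I. v i) f x = (\<Sum>i\<in>I. wdb (v i) f x)"
  by (induction I rule: infinite_finite_induct)
    (simp_all add: wd_zero_vec wdb_zero_vec wd_add_vec wdb_add_vec)

lemma wd_expand: "f differentiable (at x) \<Longrightarrow> wd v f x = (\<Sum>a\<in>UNIV. v $ a * wd (axis a 1) f x)"
  and wdb_expand: "f differentiable (at x) \<Longrightarrow> wdb v f x = (\<Sum>a\<in>UNIV. cnj (v $ a) * wdb (axis a 1) f x)"
  by (subst basis_expansion[of v, symmetric], simp add: wd_sum_vec wd_scale wdb_sum_vec wdb_scale)+

lemma wd_cong_open:
  assumes "open A" "x \<in> A" "\<And>y. y \<in> A \<Longrightarrow> f y = g y"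
  shows "wd v f x = wd v g x" "wdb v f x = wdb v g x"
  unfolding wd_def wdb_def using dir_deriv_cong_open[OF assms] by simp_all

lemma wd_const [simp]:
  fixes x :: "complex^'n"
  shows "wd v (\<lambda>x. c) x = 0" "wdb v (\<lambda>x. c) x = 0"
proof -
  have "dir_deriv (\<lambda>x::complex^'n. c) x u = 0" for u
    by (intro dir_deriv_eqI) (auto intro!: derivative_eq_intros)
  then show "wd v (\<lambda>x. c) x = 0" "wdb v (\<lambda>x. c) x = 0" by (simp_all add: wd_def wdb_def)
qed

context
  fixes f g :: "complex^'n \<Rightarrow> complex" and x :: "complex^'n"
  assumes f: "f differentiable (at x)" and g: "g differentiable (at x)"
begin

private lemma df: "(f has_derivative dir_deriv f x) (at x)" and dg: "(g has_derivative dir_deriv g x) (at x)"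
  using f g by (simp_all add: has_derivative_dir_deriv)

lemma wd_add: "wd v (\<lambda>x. f x + g x) x = wd v f x + wd v g x"
  and wdb_add: "wdb v (\<lambda>x. f x + g x) x = wdb v f x + wdb v g x"
  unfolding wd_def wdb_def using dir_deriv_eqI[OF has_derivative_add[OF df dg]] by (simp_all only:) (simp_all add: field_simps)

lemma wd_diff: "wd v (\<lambda>x. f x - g x) x = wd v f x - wd v g x"
  and wdb_diff: "wdb v (\<lambda>x. f x - g x) x = wdb v f x - wdb v g x"
  unfolding wd_def wdb_def using dir_deriv_eqI[OF has_derivative_diff[OF df dg]] by (simp_all only:) (simp_all add: field_simps)

lemma wd_mult: "wd v (\<lambda>x. f x * g x) x = f x * wd v g x + wd v f x * g x"
  and wdb_mult: "wdb v (\<lambda>x. f x * g x) x = f x * wdb v g x + wdb v f x * g x"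
  unfolding wd_def wdb_def using dir_deriv_eqI[OF has_derivative_mult[OF df dg]] by (simp_all only:) (simp_all add: field_simps)

lemma wd_divide: "g x \<noteq> 0 \<Longrightarrow> wd v (\<lambda>x. f x / g x) x = (wd v f x * g x - f x * wd v g x) / (g x * g x)"
  and wdb_divide: "g x \<noteq> 0 \<Longrightarrow> wdb v (\<lambda>x. f x / g x) x = (wdb v f x * g x - f x * wdb v g x) / (g x * g x)"
proof -
  assume nz: "g x \<noteq> 0"
  note e = dir_deriv_eqI[OF has_derivative_divide'[OF df dg nz]]
  show "wd v (\<lambda>x. f x / g x) x = (wd v f x * g x - f x * wd v g x) / (g x * g x)"
    "wdb v (\<lambda>x. f x / g x) x = (wdb v f x * g x - f x * wdb v g x) / (g x * g x)"
    unfolding wd_def wdb_def e using nz by (simp_all add: field_simps)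
qed

end

lemma wd_cnj: "f differentiable (at x) \<Longrightarrow> wd v (\<lambda>x. cnj (f x)) x = cnj (wdb v f x)"
  and wdb_cnj: "f differentiable (at x) \<Longrightarrow> wdb v (\<lambda>x. cnj (f x)) x = cnj (wd v f x)"
  using dir_deriv_eqI[OF bounded_linear.has_derivative[OF bounded_linear_cnj has_derivative_dir_deriv], of f x]
  by (simp_all add: wd_def wdb_def field_simps)

lemma wd_cmult: "f differentiable (at x) \<Longrightarrow> wd v (\<lambda>x. c * f x) x = c * wd v f x"
  and wdb_cmult: "f differentiable (at x) \<Longrightarrow> wdb v (\<lambda>x. c * f x) x = c * wdb v f x"
  using wd_mult[of "\<lambda>_. c" x f v] wdb_mult[of "\<lambda>_. c" x f v] by simp_all

lemma wd_sum: "(\<And>i. i \<in> I \<Longrightarrow> f i differentiable (at x)) \<Longrightarrow> wd v (\<lambda>x. \<Sum>i\<in>I. f i x) x = (\<Sum>i\<in>I. wd v (f i) x)"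
  and wdb_sum: "(\<And>i. i \<in> I \<Longrightarrow> f i differentiable (at x)) \<Longrightarrow> wdb v (\<lambda>x. \<Sum>i\<in>I. f i x) x = (\<Sum>i\<in>I. wdb v (f i) x)"
  by (induction I rule: infinite_finite_induct) (simp_all add: wd_add wdb_add)

lemma smooth_wd: "smooth A f \<Longrightarrow> smooth A (wd v f)"
  and smooth_wdb: "smooth A f \<Longrightarrow> smooth A (wdb v f)"
  unfolding wd_def [abs_def] wdb_def [abs_def]
  by (auto intro!: smooth_divide smooth_add smooth_diff smooth_mult smooth_const smooth_dir_deriv smooth_open)

text \<open>All three rules are combinations of the symmetric real second derivative in the
  directions v, iv, w, iw.\<close>

lemma wd_commute:
  assumes f: "smooth A f" and x: "x \<in> A"
  shows "wd v (wd w f) x = wd w (wd v f) x" "wdb v (wdb w f) x = wdb w (wdb v f) x"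
    "wdb v (wd w f) x = wd w (wdb v f) x"
proof -
  define DD where "DD u u' = dir_deriv (\<lambda>y. dir_deriv f y u) x u'" for u u'
  have sym: "DD u u' = DD u' u" for u u' unfolding DD_def by (rule symmetric_second_derivative[OF f x])
  have d: "((\<lambda>y. dir_deriv f y u) has_derivative DD u) (at x)" for u
    unfolding DD_def by (intro has_derivative_dir_deriv smooth_differentiable[OF smooth_dir_deriv[OF f] x])
  have 1: "dir_deriv (wd w f) x u = (DD w u - \<i> * DD (\<i> *s w) u) / 2" for w u
    unfolding wd_def [abs_def] by (rule dir_deriv_eqI) (auto intro!: derivative_eq_intros d)
  have 2: "dir_deriv (wdb w f) x u = (DD w u + \<i> * DD (\<i> *s w) u) / 2" for w u
    unfolding wdb_def [abs_def] by (rule dir_deriv_eqI) (auto intro!: derivative_eq_intros d)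
  show "wd v (wd w f) x = wd w (wd v f) x" "wdb v (wdb w f) x = wdb w (wdb v f) x"
    "wdb v (wd w f) x = wd w (wdb v f) x"
    unfolding wd_def[of _ "wd _ f"] wd_def[of _ "wdb _ f"] wdb_def[of _ "wd _ f"] wdb_def[of _ "wdb _ f"] 1 2
    using sym[of v w] sym[of v "\<i> *s w"] sym[of "\<i> *s v" w] sym[of "\<i> *s v" "\<i> *s w"]
    by (simp_all add: field_simps)
qed

lemma has_derivative_vec_components:
  fixes f :: "'a::real_normed_vector \<Rightarrow> complex^'n"
  assumes "\<And>k. ((\<lambda>y. f y $ k) has_derivative D k) (at x)"
  shows "(f has_derivative (\<lambda>t. \<chi> k. D k t)) (at x)"
proof -
  have "linear (\<lambda>c. c *s axis k 1 :: complex^'n)" for k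
    by (rule linearI) (simp_all add: vector_sadd_rdistrib vec_eq_iff)
  then have bl: "bounded_linear (\<lambda>c. c *s axis k 1 :: complex^'n)" for k
    by (simp add: linear_conv_bounded_linear)
  have "((\<lambda>y. \<Sum>k\<in>UNIV. f y $ k *s axis k 1) has_derivative (\<lambda>t. \<Sum>k\<in>UNIV. D k t *s axis k 1)) (at x)"
    by (rule has_derivative_sum) (rule bounded_linear.has_derivative[OF bl assms])
  moreover have "(\<Sum>k\<in>UNIV. D k t *s axis k 1) = (\<chi> k. D k t)" for t
    using basis_expansion[of "\<chi> k. D k t"] by simp
  ultimately show ?thesis by (simp only: basis_expansion)
qed

section \<open>Derivatives of determinants\<close>

lemma wd_det:
  fixes M :: "complex^'n \<Rightarrow> complex^'m^'m"
  assumes M: "\<And>i j. (\<lambda>y. M y $ i $ j) differentiable (at x)"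
  shows "wd v (\<lambda>y. det (M y)) x = (\<Sum>k\<in>UNIV. det (\<chi> i. if i = k then \<chi> j. wd v (\<lambda>y. M y $ i $ j) x else M x $ i))"
proof -
  \<comment> \<open>Differentiability of the product is carried along because the product rule of
    the next induction step asks for it.\<close>
  have prod: "wd v (\<lambda>y. \<Prod>i\<in>I. f i y) x = (\<Sum>k\<in>I. \<Prod>i\<in>I. if i = k then wd v (f i) x else f i x)
       \<and> (\<lambda>y. \<Prod>i\<in>I. f i y) differentiable (at x)"
    if "finite I" "\<And>i. i \<in> I \<Longrightarrow> f i differentiable (at x)" for I :: "'m set" and f
    using that
  proof (induction I rule: finite_induct)
    case (insert a I)
    then have IH: "wd v (\<lambda>y. \<Prod>i\<in>I. f i y) x = (\<Sum>k\<in>I. \<Prod>i\<in>I. if i = k then wd v (f i) x else f i x)"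
      "(\<lambda>y. \<Prod>i\<in>I. f i y) differentiable (at x)" by auto
    have "(\<Prod>i\<in>I. if i = a then wd v (f i) x else f i x) = (\<Prod>i\<in>I. f i x)"
      using insert.hyps by (intro prod.cong) auto
    moreover have "(if a = k then wd v (f a) x else f a x) = f a x" if "k \<in> I" for k
      using insert.hyps that by auto
    ultimately have "(\<Sum>k\<in>insert a I. \<Prod>i\<in>insert a I. if i = k then wd v (f i) x else f i x)
      = wd v (f a) x * (\<Prod>i\<in>I. f i x) + f a x * (\<Sum>k\<in>I. \<Prod>i\<in>I. if i = k then wd v (f i) x else f i x)"
      using insert.hyps by (simp add: sum_distrib_left cong: sum.cong)
    then show ?case
      using insert IH by (simp add: wd_mult)
  qed auto
  have "wd v (\<lambda>y. det (M y)) x = (\<Sum>p\<in>{p. p permutes UNIV}. of_int (sign p) *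
      (\<Sum>k\<in>UNIV. \<Prod>i\<in>UNIV. if i = k then wd v (\<lambda>y. M y $ i $ p i) x else M x $ i $ p i))"
    unfolding det_def using prod[of UNIV] M
    by (subst wd_sum) (auto simp: wd_cmult)
  also have "\<dots> = (\<Sum>k\<in>UNIV. \<Sum>p\<in>{p. p permutes UNIV}. of_int (sign p) *
      (\<Prod>i\<in>UNIV. if i = k then wd v (\<lambda>y. M y $ i $ p i) x else M x $ i $ p i))"
    by (simp add: sum_distrib_left) (rule sum.swap)
  also have "\<dots> = (\<Sum>k\<in>UNIV. det (\<chi> i. if i = k then \<chi> j. wd v (\<lambda>y. M y $ i $ j) x else M x $ i))"
    unfolding det_def by (intro sum.cong prod.cong refl arg_cong2[where f = "(*)"]) auto
  finally show ?thesis .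
qed

text \<open>When row k is expanded by linearity, every summand with c \<noteq> k has two equal rows.
  Together with \<open>wd_det\<close> this turns the derivative of a determinant into a
  trace.\<close>

lemma det_replace_row:
  fixes M :: "complex^'m^'m"
  shows "det (\<chi> i. if i = k then \<Sum>c\<in>UNIV. G c *s M $ c else M $ i) = G k * det M"
proof -
  have "det (\<chi> i. if i = k then \<Sum>c\<in>UNIV. G c *s M $ c else M $ i)
      = (\<Sum>c\<in>UNIV. det (\<chi> i. if i = k then G c *s M $ c else M $ i))"
    by (rule det_linear_row_sum) simp
  also have "\<dots> = (\<Sum>c\<in>UNIV. G c * det (\<chi> i. if i = k then M $ c else M $ i))"
    by (simp add: det_row_mul)
  also have "\<dots> = (\<Sum>c\<in>UNIV. if c = k then G k * det M else 0)"
  proof (intro sum.cong refl)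
    fix c
    show "G c * det (\<chi> i. if i = k then M $ c else M $ i) = (if c = k then G k * det M else 0)"
    proof (cases "c = k")
      case True
      then have "(\<chi> i. if i = k then M $ c else M $ i) = M" by (simp add: vec_eq_iff)
      then show ?thesis using True by simp
    next
      case False
      then have "det (\<chi> i. if i = k then M $ c else M $ i) = 0"
        by (intro det_identical_rows[of c k]) (simp_all add: row_def vec_eq_iff)
      then show ?thesis using False by simp
    qed
  qed
  also have "\<dots> = G k * det M" by simp
  finally show ?thesis .
qed

lemma sum_Basis_complex_vec:
  fixes f :: "complex^'n \<Rightarrow> real"
  shows "(\<Sum>b\<in>Basis. f b) = (\<Sum>a\<in>UNIV. f (axis a 1) + f (axis a \<i>))"
proof -
  have "(Basis :: (complex^'n) set) = (\<Union>a\<in>UNIV. {axis a 1, axis a \<i>})"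
    by (auto simp: Basis_vec_def Basis_complex_def)
  moreover have "(\<Sum>b\<in>(\<Union>a\<in>UNIV. {axis a 1, axis a \<i>}). f b) = (\<Sum>a\<in>UNIV. \<Sum>b\<in>{axis a 1, axis a \<i>}. f b)"
    by (rule sum.UNION_disjoint) (auto simp: axis_eq_axis)
  ultimately show ?thesis by (simp add: axis_eq_axis)
qed

text \<open>The Hermitian form with real part g; the sign of its imaginary part makes it linear in v
  and conjugate linear in w.\<close>

definition herm :: "(complex^'n \<Rightarrow> complex^'n \<Rightarrow> complex^'n \<Rightarrow> real) \<Rightarrow> complex^'n \<Rightarrow> complex^'n \<Rightarrow> complex^'n \<Rightarrow> complex" where
  "herm g x v w = of_real (g x v w) + \<i> * of_real (g x v (\<i> *s w))"

section \<open>Pseudo-Kaehler geometry of a coordinate domain\<close>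

locale pseudo_kahler_domain =
  fixes A :: "(complex^'n) set" and g :: "complex^'n \<Rightarrow> complex^'n \<Rightarrow> complex^'n \<Rightarrow> real"
  assumes open_A: "open A" and pr: "pseudo_riemannian_on A g"
    and J_inv: "\<And>x v w. x \<in> A \<Longrightarrow> g x (\<i> *s v) (\<i> *s w) = g x v w"
    and closed_form: "\<And>x u v w. x \<in> A \<Longrightarrow> dir_deriv (\<lambda>y. g y (\<i> *s v) w) x u
        + dir_deriv (\<lambda>y. g y (\<i> *s w) u) x v + dir_deriv (\<lambda>y. g y (\<i> *s u) v) x w = 0"
begin

lemma g_sym: "x \<in> A \<Longrightarrow> g x v w = g x w v"
  using pr by (auto simp: pseudo_riemannian_on_def)

lemma g_bilinear: "x \<in> A \<Longrightarrow> bilinear (g x)"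
  using pr by (auto simp: pseudo_riemannian_on_def)

lemma g_smooth: "Cinf_on A (\<lambda>x. g x v w)"
  using pr by (auto simp: pseudo_riemannian_on_def)

lemma g_differentiable: "x \<in> A \<Longrightarrow> (\<lambda>y. g y v w) differentiable (at x)"
  using g_smooth[of v w] unfolding Cinf_on_def by (metis Ck_on.simps(2))

lemma g_i_left: "x \<in> A \<Longrightarrow> g x (\<i> *s v) w = - g x v (\<i> *s w)"
  using J_inv[of x v "\<i> *s w"] bilinear_rneg[OF g_bilinear, of x "\<i> *s v" w] by simp

abbreviation h where "h \<equiv> herm g"

lemma Re_h [simp]: "Re (h x v w) = g x v w" and Im_h: "Im (h x v w) = g x v (\<i> *s w)"
  by (simp_all add: herm_def)

context
  fixes x assumes x: "x \<in> A"
begin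

lemma h_add_left: "h x (v + w) z = h x v z + h x w z"
  and h_add_right: "h x z (v + w) = h x z v + h x z w"
  using bilinear_ladd[OF g_bilinear[OF x]] bilinear_radd[OF g_bilinear[OF x]]
  by (simp_all add: herm_def vector_add_ldistrib algebra_simps)

lemma h_scale_left: "h x (c *s v) w = c * h x v w"
proof -
  have "h x (\<i> *s v) w = \<i> * h x v w"
    using x bilinear_rneg[OF g_bilinear[OF x], of v w] by (simp add: herm_def g_i_left complex_eq_iff)
  moreover have "h x (r *\<^sub>R v) w = of_real r * h x v w" for r v
    using bilinear_lmul[OF g_bilinear[OF x]] by (simp add: herm_def algebra_simps)
  ultimately have "h x (c *s v) w = of_real (Re c) * h x v w + of_real (Im c) * (\<i> * h x v w)"
    by (subst complex_scale_eq) (simp add: h_add_left)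
  also have "\<dots> = (of_real (Re c) + \<i> * of_real (Im c)) * h x v w" by (simp add: algebra_simps)
  finally show ?thesis by (metis complex_eq)
qed

lemma h_cnj: "cnj (h x v w) = h x w v"
  using x g_sym[OF x, of w v] g_i_left[OF x, of v w] g_sym[OF x, of "\<i> *s v" w]
  by (simp add: herm_def complex_eq_iff)

lemma h_scale_right: "h x v (c *s w) = cnj c * h x v w"
  using h_scale_left[of c w v] h_cnj[of "c *s w" v] h_cnj[of w v] by (metis complex_cnj_mult)

lemma h_zero_left [simp]: "h x 0 w = 0" and h_zero_right [simp]: "h x w 0 = 0"
  using h_scale_left[of 0 0 w] h_scale_right[of w 0 0] by simp_all

lemma h_diff_left: "h x (v - w) z = h x v z - h x w z"
  using h_add_left[of "v - w" w z] by simp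

lemma h_sum_left: "h x (\<Sum>i\<in>I. v i) z = (\<Sum>i\<in>I. h x (v i) z)"
  and h_sum_right: "h x z (\<Sum>i\<in>I. v i) = (\<Sum>i\<in>I. h x z (v i))"
  by (induction I rule: infinite_finite_induct) (simp_all add: h_add_left h_add_right)

lemma h_expand_left: "h x v z = (\<Sum>a\<in>UNIV. v $ a * h x (axis a 1) z)"
  by (subst basis_expansion[of v, symmetric], subst h_sum_left) (simp add: h_scale_left)

lemma h_expand_right: "h x z v = (\<Sum>a\<in>UNIV. cnj (v $ a) * h x z (axis a 1))"
  by (subst basis_expansion[of v, symmetric], subst h_sum_right) (simp add: h_scale_right)

lemma h_nondegenerate:
  assumes "\<And>a. h x v (axis a 1) = 0"
  shows "v = 0"
proof -
  have "h x v w = 0" for w using h_expand_right[of v w] assms by simp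
  then have "g x v w = 0" for w using Re_h[of x v w] by simp
  then show ?thesis using pr x by (auto simp: pseudo_riemannian_on_def)
qed

lemma h_eqI: "(\<And>z. h x v z = h x w z) \<Longrightarrow> v = w"
  using h_nondegenerate[of "v - w"] by (simp add: h_diff_left)

end

lemma smooth_h: "smooth A (\<lambda>x. h x v w)"
  unfolding herm_def
  by (intro smooth_add smooth_mult smooth_const smooth_of_real g_smooth open_A)

lemma h_differentiable: "x \<in> A \<Longrightarrow> (\<lambda>y. h y v w) differentiable (at x)"
  by (rule smooth_differentiable[OF smooth_h])

lemma dir_deriv_h:
  assumes x: "x \<in> A"
  shows "dir_deriv (\<lambda>y. h y v w) x u = of_real (dir_deriv (\<lambda>y. g y v w) x u)
    + \<i> * of_real (dir_deriv (\<lambda>y. g y v (\<i> *s w)) x u)"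
  unfolding herm_def
  by (rule dir_deriv_eqI)
    (auto intro!: derivative_eq_intros has_derivative_dir_deriv g_differentiable[OF x])

text \<open>The right-hand side is the Koszul expression. Closedness of the Kaehler form on v, w and
  iu rewrites the derivative along iu, which \<open>wd\<close> contributes, into the two missing
  Koszul terms: the Chern connection is the Levi-Civita connection.\<close>

lemma Re_wd_h:
  assumes x: "x \<in> A"
  shows "2 * Re (wd u (\<lambda>y. h y v w) x) = dir_deriv (\<lambda>y. g y v w) x u + dir_deriv (\<lambda>y. g y u w) x v
     - dir_deriv (\<lambda>y. g y u v) x w"
proof -
  have neg: "dir_deriv (\<lambda>y. - g y a b) x z = - dir_deriv (\<lambda>y. g y a b) x z" for a b z
    by (rule dir_deriv_eqI) (auto intro!: derivative_eq_intros has_derivative_dir_deriv g_differentiable[OF x])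
  have 1: "dir_deriv (\<lambda>y. g y (\<i> *s v) w) x (\<i> *s u) = - dir_deriv (\<lambda>y. g y v (\<i> *s w)) x (\<i> *s u)"
    unfolding neg[symmetric] by (intro dir_deriv_cong_open[OF open_A x] g_i_left)
  have 2: "dir_deriv (\<lambda>y. g y (\<i> *s w) (\<i> *s u)) x v = dir_deriv (\<lambda>y. g y u w) x v"
    by (intro dir_deriv_cong_open[OF open_A x]) (simp add: J_inv g_sym)
  have 3: "dir_deriv (\<lambda>y. g y (\<i> *s (\<i> *s u)) v) x w = - dir_deriv (\<lambda>y. g y u v) x w"
    unfolding neg[symmetric]
    by (intro dir_deriv_cong_open[OF open_A x]) (simp add: bilinear_lneg[OF g_bilinear])
  have "dir_deriv (\<lambda>y. g y v (\<i> *s w)) x (\<i> *s u) = dir_deriv (\<lambda>y. g y u w) x v - dir_deriv (\<lambda>y. g y u v) x w"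
    using closed_form[OF x, of v w "\<i> *s u"] unfolding 1 2 3 by simp
  then show ?thesis by (simp add: wd_def dir_deriv_h[OF x])
qed

lemma Im_wd_h:
  assumes x: "x \<in> A"
  shows "Im (wd u (\<lambda>y. h y v w) x) = Re (wd u (\<lambda>y. h y v (\<i> *s w)) x)"
proof -
  have "wd u (\<lambda>y. h y v (\<i> *s w)) x = wd u (\<lambda>y. (- \<i>) * h y v w) x"
    by (intro wd_cong_open[OF open_A x]) (simp add: h_scale_right)
  also have "\<dots> = (- \<i>) * wd u (\<lambda>y. h y v w) x" by (rule wd_cmult[OF h_differentiable[OF x]])
  finally show ?thesis by simp
qed

text \<open>The connection is torsion free: the Koszul expression is symmetric in u and v, and
  \<open>Im_wd_h\<close> reduces imaginary parts to real ones.\<close>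

lemma wd_h_sym: "x \<in> A \<Longrightarrow> wd u (\<lambda>y. h y v w) x = wd v (\<lambda>y. h y u w) x"
proof -
  assume x: "x \<in> A"
  have "dir_deriv (\<lambda>y. g y u v) x z = dir_deriv (\<lambda>y. g y v u) x z" for z
    by (intro dir_deriv_cong_open[OF open_A x] g_sym)
  then have "Re (wd u (\<lambda>y. h y v z) x) = Re (wd v (\<lambda>y. h y u z) x)" for z
    using Re_wd_h[OF x, of u v z] Re_wd_h[OF x, of v u z] by simp
  then show ?thesis using x by (simp add: complex_eq_iff Im_wd_h)
qed

definition Hm :: "complex^'n \<Rightarrow> complex^'n^'n" where
  "Hm x = (\<chi> b a. h x (axis b 1) (axis a 1))"

definition \<delta> :: "complex^'n \<Rightarrow> complex" where "\<delta> x = det (Hm x)"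

lemma transpose_Hm_mult: "x \<in> A \<Longrightarrow> (transpose (Hm x) *v u) $ a = h x u (axis a 1)"
  by (simp add: Hm_def matrix_vector_mult_def transpose_def h_expand_left[of x u] mult.commute)

lemma \<delta>_nonzero: assumes "x \<in> A" shows "\<delta> x \<noteq> 0"
proof -
  have "\<forall>u. transpose (Hm x) *v u = 0 \<longrightarrow> u = 0"
    using h_nondegenerate[OF assms] transpose_Hm_mult[OF assms] by (metis zero_index)
  then have "invertible (transpose (Hm x))"
    using matrix_left_invertible_ker invertible_left_inverse by blast
  then show ?thesis by (simp add: \<delta>_def invertible_det_nz)
qed

lemma smooth_det:
  assumes "\<And>i j. smooth A (\<lambda>x. M x i j)"
  shows "smooth A (\<lambda>x. det ((\<chi> i j. M x i j) :: complex^'m^'m))"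
  unfolding det_def
  by (auto intro!: smooth_sum smooth_mult smooth_prod smooth_const open_A assms)

lemma smooth_\<delta>: "smooth A \<delta>"
  unfolding \<delta>_def [abs_def] Hm_def by (intro smooth_det smooth_h)

lemma \<delta>_real: assumes "x \<in> A" shows "cnj (\<delta> x) = \<delta> x"
proof -
  have "cnj (det M) = det (\<chi> i j. cnj (M $ i $ j))" for M :: "complex^'n^'n"
    by (simp add: det_def sign_def)
  moreover have "(\<chi> i j. cnj (Hm x $ i $ j)) = transpose (Hm x)"
    by (simp add: Hm_def transpose_def vec_eq_iff h_cnj[OF assms])
  ultimately show ?thesis by (simp add: \<delta>_def)
qed

text \<open>The Christoffel symbols, obtained by Cramer's rule as the vector that represents the
  derivative of h(w, z) along v. The quotient of determinants makes smoothness visible, unlike the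
  description by \<open>THE\<close> in \<open>christoffel\<close>.\<close>

definition gam :: "complex^'n \<Rightarrow> complex^'n \<Rightarrow> complex^'n \<Rightarrow> complex^'n" where
  "gam x v w = (\<chi> k. det (\<chi> i j. if j = k then wd v (\<lambda>y. h y w (axis i 1)) x
      else transpose (Hm x) $ i $ j) / det (transpose (Hm x)))"

lemma h_gam:
  assumes x: "x \<in> A"
  shows "h x (gam x v w) z = wd v (\<lambda>y. h y w z) x"
proof -
  have "transpose (Hm x) *v gam x v w = (\<chi> i. wd v (\<lambda>y. h y w (axis i 1)) x)"
    using \<delta>_nonzero[OF x] by (subst cramer) (simp_all add: gam_def \<delta>_def cong: if_cong)
  then have a: "h x (gam x v w) (axis a 1) = wd v (\<lambda>y. h y w (axis a 1)) x" for a
    using transpose_Hm_mult[OF x, of "gam x v w" a] by simp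
  have "wd v (\<lambda>y. h y w z) x = wd v (\<lambda>y. \<Sum>a\<in>UNIV. cnj (z $ a) * h y w (axis a 1)) x"
    by (intro wd_cong_open[OF open_A x] h_expand_right)
  also have "\<dots> = (\<Sum>a\<in>UNIV. cnj (z $ a) * wd v (\<lambda>y. h y w (axis a 1)) x)"
    using h_differentiable[OF x] by (simp add: wd_sum wd_cmult)
  also have "\<dots> = h x (gam x v w) z"
    by (subst h_expand_right[OF x, of _ z]) (simp add: a)
  finally show ?thesis by simp
qed

lemma gam_eqI: "x \<in> A \<Longrightarrow> (\<And>z. h x u z = wd v (\<lambda>y. h y w z) x) \<Longrightarrow> gam x v w = u"
  using h_eqI[of x "gam x v w" u] h_gam by simp

lemma gam_sym: "x \<in> A \<Longrightarrow> gam x v w = gam x w v"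
  by (intro gam_eqI) (simp_all add: h_gam wd_h_sym[of x v w])

lemma gam_scale_left: "x \<in> A \<Longrightarrow> gam x (c *s v) w = c *s gam x v w"
  by (intro gam_eqI) (simp_all add: h_gam h_scale_left wd_scale h_differentiable)

lemma gam_add_left: "x \<in> A \<Longrightarrow> gam x (v + v') w = gam x v w + gam x v' w"
  by (intro gam_eqI) (simp_all add: h_gam h_add_left wd_add_vec h_differentiable)

lemma smooth_gam: "smooth A (\<lambda>x. gam x v w $ k)"
proof -
  have "smooth A (\<lambda>x. if j = k then wd v (\<lambda>y. h y w (axis i 1)) x else transpose (Hm x) $ i $ j)" for i j
    using smooth_wd[OF smooth_h] smooth_h by (cases "j = k") (simp_all add: Hm_def transpose_def)
  then show ?thesis
    unfolding gam_def using smooth_\<delta> \<delta>_nonzero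
    by (auto intro!: smooth_divide smooth_det simp: \<delta>_def [abs_def])
qed

lemma gam_differentiable: "x \<in> A \<Longrightarrow> (\<lambda>y. gam y v w $ k) differentiable (at x)"
  by (rule smooth_differentiable[OF smooth_gam])

lemma christoffel_eq_gam:
  assumes x: "x \<in> A"
  shows "christoffel g x v w = gam x v w"
  unfolding christoffel_def
proof (rule the_equality)
  have K: "2 * g x (gam x v w) z = dir_deriv (\<lambda>y. g y w z) x v + dir_deriv (\<lambda>y. g y v z) x w
     - dir_deriv (\<lambda>y. g y v w) x z" for z
    using Re_wd_h[OF x, of v w z] h_gam[OF x, of v w z] Re_h[of x "gam x v w" z] by simp
  then show "\<forall>z. 2 * g x (gam x v w) z = dir_deriv (\<lambda>y. g y w z) x v + dir_deriv (\<lambda>y. g y v z) x w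
     - dir_deriv (\<lambda>y. g y v w) x z" by blast
  fix u assume u: "\<forall>z. 2 * g x u z = dir_deriv (\<lambda>y. g y w z) x v + dir_deriv (\<lambda>y. g y v z) x w
     - dir_deriv (\<lambda>y. g y v w) x z"
  have eq: "g x u z = g x (gam x v w) z" for z
    using trans[OF u[rule_format] K[symmetric], of z] by simp
  show "u = gam x v w"
    by (rule h_eqI[OF x]) (simp add: herm_def eq)
qed

section \<open>Curvature and Ricci tensor\<close>

definition dgam :: "complex^'n \<Rightarrow> complex^'n \<Rightarrow> complex^'n \<Rightarrow> complex^'n \<Rightarrow> complex^'n" where
  "dgam x u v w = (\<chi> k. wd u (\<lambda>y. gam y v w $ k) x)"

text \<open>The curvature of the Chern connection, as the conjugate derivative of its Christoffel
  symbols. It is conjugate linear in u and complex linear in v and w.\<close>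

definition S :: "complex^'n \<Rightarrow> complex^'n \<Rightarrow> complex^'n \<Rightarrow> complex^'n \<Rightarrow> complex^'n" where
  "S x u v w = (\<chi> k. wdb u (\<lambda>y. gam y v w $ k) x)"

lemma wd_h_field:
  fixes G :: "complex^'n \<Rightarrow> complex^'n"
  assumes x: "x \<in> A" and G: "\<And>k. (\<lambda>y. G y $ k) differentiable (at x)"
  shows "wd u (\<lambda>y. h y (G y) z) x = h x (\<chi> k. wd u (\<lambda>y. G y $ k) x) z + wd u (\<lambda>y. h y (G x) z) x"
    and "wdb u (\<lambda>y. h y (G y) z) x = h x (\<chi> k. wdb u (\<lambda>y. G y $ k) x) z + wdb u (\<lambda>y. h y (G x) z) x"
proof -
  have 1: "wd u (\<lambda>y. h y (G' y) z) x = wd u (\<lambda>y. \<Sum>a\<in>UNIV. G' y $ a * h y (axis a 1) z) x"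
    "wdb u (\<lambda>y. h y (G' y) z) x = wdb u (\<lambda>y. \<Sum>a\<in>UNIV. G' y $ a * h y (axis a 1) z) x" for G'
    by (intro wd_cong_open[OF open_A x] h_expand_left; assumption)+
  have d: "(\<lambda>y. G y $ a * h y (axis a 1) z) differentiable (at x)" for a
    using G h_differentiable[OF x] by simp
  show "wd u (\<lambda>y. h y (G y) z) x = h x (\<chi> k. wd u (\<lambda>y. G y $ k) x) z + wd u (\<lambda>y. h y (G x) z) x"
    unfolding 1(1)[of G] 1(1)[of "\<lambda>_. G x"] h_expand_left[OF x, of "\<chi> k. wd u (\<lambda>y. G y $ k) x"]
    using d G h_differentiable[OF x]
    by (simp add: wd_sum wd_mult wd_cmult sum.distrib)
  show "wdb u (\<lambda>y. h y (G y) z) x = h x (\<chi> k. wdb u (\<lambda>y. G y $ k) x) z + wdb u (\<lambda>y. h y (G x) z) x"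
    unfolding 1(2)[of G] 1(2)[of "\<lambda>_. G x"] h_expand_left[OF x, of "\<chi> k. wdb u (\<lambda>y. G y $ k) x"]
    using d G h_differentiable[OF x]
    by (simp add: wdb_sum wdb_mult wdb_cmult sum.distrib)
qed

lemma wdb_h: "x \<in> A \<Longrightarrow> wdb u (\<lambda>y. h y v z) x = h x v (gam x u z)"
proof -
  assume x: "x \<in> A"
  have "wdb u (\<lambda>y. h y v z) x = wdb u (\<lambda>y. cnj (h y z v)) x"
    by (intro wd_cong_open[OF open_A x]) (simp add: h_cnj)
  also have "\<dots> = cnj (wd u (\<lambda>y. h y z v) x)" by (rule wdb_cnj[OF h_differentiable[OF x]])
  finally show ?thesis using x by (simp add: h_gam[symmetric] h_cnj)
qed

lemma wd_wd_h:
  assumes x: "x \<in> A"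
  shows "wd u (wd v (\<lambda>y. h y w z)) x = h x (dgam x u v w + gam x u (gam x v w)) z"
    and "wdb u (wd v (\<lambda>y. h y w z)) x = h x (S x u v w) z + h x (gam x v w) (gam x u z)"
proof -
  have "wd u (wd v (\<lambda>y. h y w z)) x = wd u (\<lambda>y. h y (gam y v w) z) x"
    "wdb u (wd v (\<lambda>y. h y w z)) x = wdb u (\<lambda>y. h y (gam y v w) z) x"
    by (intro wd_cong_open[OF open_A x]; simp add: h_gam)+
  then show "wd u (wd v (\<lambda>y. h y w z)) x = h x (dgam x u v w + gam x u (gam x v w)) z"
    "wdb u (wd v (\<lambda>y. h y w z)) x = h x (S x u v w) z + h x (gam x v w) (gam x u z)"
    unfolding wd_h_field(1)[where G = "\<lambda>y. gam y v w", OF x gam_differentiable[OF x]]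
      wd_h_field(2)[where G = "\<lambda>y. gam y v w", OF x gam_differentiable[OF x]]
    using x by (simp_all add: h_gam h_add_left wdb_h dgam_def S_def)
qed

text \<open>Both sides represent a second \<open>wd\<close> derivative of h(w, z), and these
  commute. Hence the curvature has no part of type (2,0).\<close>

lemma dgam_antisym:
  "x \<in> A \<Longrightarrow> dgam x u v w + gam x u (gam x v w) = dgam x v u w + gam x v (gam x u w)"
proof (rule h_eqI)
  assume x: "x \<in> A"
  fix z
  have "wd u (wd v (\<lambda>y. h y w z)) x = wd v (wd u (\<lambda>y. h y w z)) x"
    by (rule wd_commute(1)[OF smooth_h x])
  then show "h x (dgam x u v w + gam x u (gam x v w)) z = h x (dgam x v u w + gam x v (gam x u w)) z"
    unfolding wd_wd_h(1)[OF x] .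
qed

lemma curvature_eq:
  assumes x: "x \<in> A"
  shows "curvature g x u v w = S x u v w - S x v u w"
proof -
  have d: "dir_deriv (\<lambda>y. christoffel g y v w) x u = dgam x u v w + S x u v w" for u v w
  proof -
    have "((\<lambda>y. gam y v w) has_derivative (\<lambda>t. \<chi> k. dir_deriv (\<lambda>y. gam y v w $ k) x t)) (at x)"
      by (rule has_derivative_vec_components) (simp add: has_derivative_dir_deriv gam_differentiable x)
    then have "dir_deriv (\<lambda>y. gam y v w) x u = (\<chi> k. dir_deriv (\<lambda>y. gam y v w $ k) x u)"
      by (rule dir_deriv_eqI)
    moreover have "dir_deriv (\<lambda>y. christoffel g y v w) x u = dir_deriv (\<lambda>y. gam y v w) x u"
      by (intro dir_deriv_cong_open[OF open_A x] christoffel_eq_gam)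
    ultimately show ?thesis by (simp add: vec_eq_iff dgam_def S_def dir_deriv_wd)
  qed
  have "curvature g x u v w = (dgam x u v w + gam x u (gam x v w)) - (dgam x v u w + gam x v (gam x u w))
     + (S x u v w - S x v u w)"
    unfolding curvature_def d christoffel_eq_gam[OF x] by (simp add: algebra_simps)
  also have "\<dots> = S x u v w - S x v u w" by (simp add: dgam_antisym[OF x, of u v w])
  finally show ?thesis .
qed

lemma S_scale_1: "x \<in> A \<Longrightarrow> S x (c *s u) v w = cnj c *s S x u v w"
  by (simp add: S_def vec_eq_iff wdb_scale gam_differentiable)

lemma S_add_1: "x \<in> A \<Longrightarrow> S x (u + u') v w = S x u v w + S x u' v w"
  by (simp add: S_def vec_eq_iff wdb_add_vec gam_differentiable)

lemma S_scale_2: "x \<in> A \<Longrightarrow> S x u (c *s v) w = c *s S x u v w"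
proof -
  assume x: "x \<in> A"
  have "wdb u (\<lambda>y. gam y (c *s v) w $ k) x = wdb u (\<lambda>y. c * gam y v w $ k) x" for k
    by (intro wd_cong_open[OF open_A x]) (simp add: gam_scale_left)
  then show ?thesis using x by (simp add: S_def vec_eq_iff wdb_cmult gam_differentiable)
qed

lemma S_add_2: "x \<in> A \<Longrightarrow> S x u (v + v') w = S x u v w + S x u v' w"
proof -
  assume x: "x \<in> A"
  have "wdb u (\<lambda>y. gam y (v + v') w $ k) x = wdb u (\<lambda>y. gam y v w $ k + gam y v' w $ k) x" for k
    by (intro wd_cong_open[OF open_A x]) (simp add: gam_add_left)
  then show ?thesis using x by (simp add: S_def vec_eq_iff wdb_add gam_differentiable)
qed

lemma S_sym: "x \<in> A \<Longrightarrow> S x u v w = S x u w v"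
proof -
  assume x: "x \<in> A"
  have "wdb u (\<lambda>y. gam y v w $ k) x = wdb u (\<lambda>y. gam y w v $ k) x" for k
    by (intro wd_cong_open[OF open_A x]) (simp add: gam_sym)
  then show ?thesis by (simp add: S_def)
qed

text \<open>Row k of the derivative of \<open>Hm\<close> is the combination of the rows of
  \<open>Hm\<close> with the coefficients of \<open>gam x v (axis k 1)\<close>, so
  \<open>det_replace_row\<close> keeps only the diagonal coefficients.\<close>

lemma wd_\<delta>:
  assumes x: "x \<in> A"
  shows "wd v \<delta> x = \<delta> x * (\<Sum>a\<in>UNIV. gam x v (axis a 1) $ a)"
proof -
  have "wd v \<delta> x = (\<Sum>k\<in>UNIV. det (\<chi> i. if i = k then \<chi> j. wd v (\<lambda>y. Hm y $ i $ j) x else Hm x $ i))"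
    unfolding \<delta>_def [abs_def] by (rule wd_det) (simp add: Hm_def h_differentiable[OF x])
  also have "\<dots> = (\<Sum>k\<in>UNIV. gam x v (axis k 1) $ k * det (Hm x))"
  proof (intro sum.cong refl)
    fix k
    have "(\<chi> j. wd v (\<lambda>y. Hm y $ k $ j) x) = (\<Sum>c\<in>UNIV. gam x v (axis k 1) $ c *s Hm x $ c)"
      by (simp add: vec_eq_iff Hm_def h_gam[OF x, symmetric] h_expand_left[OF x, of "gam x v (axis k 1)"])
    then have "(\<chi> i. if i = k then \<chi> j. wd v (\<lambda>y. Hm y $ i $ j) x else Hm x $ i)
        = (\<chi> i. if i = k then \<Sum>c\<in>UNIV. gam x v (axis k 1) $ c *s Hm x $ c else Hm x $ i)"
      by (simp add: vec_eq_iff)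
    then show "det (\<chi> i. if i = k then \<chi> j. wd v (\<lambda>y. Hm y $ i $ j) x else Hm x $ i)
        = gam x v (axis k 1) $ k * det (Hm x)"
      using det_replace_row[of k "\<lambda>c. gam x v (axis k 1) $ c" "Hm x"] by simp
  qed
  finally show ?thesis by (simp add: \<delta>_def sum_distrib_left mult.commute)
qed

text \<open>The real trace runs over the vectors \<open>axis a 1\<close> and their multiples by
  \<i>. In each such pair the part of the curvature that is conjugate linear in the basis vector
  cancels, and the complex linear part doubles.\<close>

lemma ricci_eq_trace:
  assumes x: "x \<in> A"
  shows "ricci g x v w = - 2 * Re (\<Sum>a\<in>UNIV. S x v w (axis a 1) $ a)"
proof -
  have ax: "axis a \<i> = \<i> *s axis a 1" for a :: 'n
    by (simp add: vec_eq_iff axis_def)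
  have in1: "u \<bullet> axis a c = Re (cnj c * u $ a)" for u :: "complex^'n" and a c
    by (simp add: inner_axis inner_complex_def)
  have S2: "S x v (\<i> *s u) w = \<i> *s S x v u w" "S x (\<i> *s u) v w = (- \<i>) *s S x u v w" for u
    using S_scale_2[OF x] S_scale_1[OF x, of \<i>] by simp_all
  have "curvature g x (axis a 1) v w \<bullet> axis a 1 + curvature g x (axis a \<i>) v w \<bullet> axis a \<i>
      = - 2 * Re (S x v (axis a 1) w $ a)" for a
    unfolding curvature_eq[OF x] in1 unfolding ax S2 by (simp add: algebra_simps)
  then show ?thesis
    unfolding ricci_def sum_Basis_complex_vec by (simp add: sum_negf sum_distrib_left S_sym[OF x, of v w])
qed

text \<open>Together with \<open>ricci_eq_trace\<close> this expresses the Ricci tensor by mixed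
  second derivatives of log |\<delta>|, the form in which the soliton equation is used along
  discs.\<close>

lemma trace_S:
  assumes x: "x \<in> A"
  shows "(\<Sum>a\<in>UNIV. S x v w (axis a 1) $ a) = wdb v (\<lambda>y. wd w \<delta> y / \<delta> y) x"
proof -
  have "wdb v (\<lambda>y. wd w \<delta> y / \<delta> y) x = wdb v (\<lambda>y. \<Sum>a\<in>UNIV. gam y w (axis a 1) $ a) x"
    by (intro wd_cong_open[OF open_A x]) (simp add: wd_\<delta> \<delta>_nonzero)
  also have "\<dots> = (\<Sum>a\<in>UNIV. S x v w (axis a 1) $ a)"
    by (simp add: wdb_sum gam_differentiable[OF x] S_def)
  finally show ?thesis by simp
qed

end

section \<open>Homomorphisms of countably generated complex algebras\<close>

lemma homogeneous_system_nontrivial: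
  fixes c :: "'i \<Rightarrow> nat \<Rightarrow> 'a::field"
  assumes "finite I" "n < card I"
  shows "\<exists>d. (\<exists>i\<in>I. d i \<noteq> 0) \<and> (\<forall>j<n. (\<Sum>i\<in>I. d i * c i j) = 0)"
  using assms
proof (induction n arbitrary: I c)
  case 0
  then have "I \<noteq> {}" by auto
  then show ?case by (intro exI[of _ "\<lambda>_. 1"]) auto
next
  case (Suc n)
  show ?case
  proof (cases "\<forall>i\<in>I. c i n = 0")
    case True
    obtain d where "\<exists>i\<in>I. d i \<noteq> 0" "\<forall>j<n. (\<Sum>i\<in>I. d i * c i j) = 0"
      using Suc.IH[of I c] Suc.prems by auto
    then show ?thesis using True by (intro exI[of _ d]) (auto simp: less_Suc_eq)
  next
    case False
    then obtain p where p: "p \<in> I" "c p n \<noteq> 0" by auto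
    \<comment> \<open>Gaussian elimination: equation n is solved for the unknown p and substituted
      into the others.\<close>
    define c' where "c' = (\<lambda>i j. c i j - c i n / c p n * c p j)"
    have "n < card (I - {p})" using Suc.prems p by auto
    then obtain d where d: "\<exists>i\<in>I - {p}. d i \<noteq> 0" "\<forall>j<n. (\<Sum>i\<in>I - {p}. d i * c' i j) = 0"
      using Suc.IH[of "I - {p}" c'] Suc.prems(1) by blast
    define e where "e = (\<lambda>i. if i = p then - (\<Sum>i\<in>I - {p}. d i * (c i n / c p n)) else d i)"
    have e: "(\<Sum>i\<in>I. e i * c i j) = (\<Sum>i\<in>I - {p}. d i * c' i j)" for j
    proof -
      have "(\<Sum>i\<in>I. e i * c i j) = e p * c p j + (\<Sum>i\<in>I - {p}. e i * c i j)"
        using p Suc.prems(1) by (simp add: sum.remove)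
      also have "(\<Sum>i\<in>I - {p}. e i * c i j) = (\<Sum>i\<in>I - {p}. d i * c i j)"
        by (intro sum.cong) (auto simp: e_def)
      finally show ?thesis
        by (simp add: e_def c'_def algebra_simps sum_subtractf sum_distrib_left sum_distrib_right)
    qed
    have "(\<Sum>i\<in>I. e i * c i n) = 0" unfolding e using p by (simp add: c'_def)
    then have "\<forall>j<Suc n. (\<Sum>i\<in>I. e i * c i j) = 0" using d(2) e by (auto simp: less_Suc_eq)
    moreover have "\<exists>i\<in>I. e i \<noteq> 0" using d(1) by (auto simp: e_def)
    ultimately show ?thesis by blast
  qed
qed

text \<open>A complex algebra of countable dimension inside a field. The absence of zero divisors
  makes the zero ideal prime. Countable dimension replaces finite generation in the Nullstellensatz
  because the complex numbers are uncountable.\<close>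

locale countable_complex_algebra =
  fixes \<iota> :: "complex \<Rightarrow> 'e::field" and B :: "'e set" and S :: "nat \<Rightarrow> 'e"
  assumes \<iota>_1 [simp]: "\<iota> 1 = 1"
    and \<iota>_add: "\<iota> (a + b) = \<iota> a + \<iota> b"
    and \<iota>_mult: "\<iota> (a * b) = \<iota> a * \<iota> b"
    and \<iota>_in: "\<iota> a \<in> B"
    and add_in: "x \<in> B \<Longrightarrow> y \<in> B \<Longrightarrow> x + y \<in> B"
    and mult_in: "x \<in> B \<Longrightarrow> y \<in> B \<Longrightarrow> x * y \<in> B"
    and countable_span: "x \<in> B \<Longrightarrow> \<exists>n c. x = (\<Sum>i<n. \<iota> (c i) * S i)"
begin

lemma \<iota>_0 [simp]: "\<iota> 0 = 0"
  using \<iota>_add[of 0 0] by (metis add_cancel_right_right add_0)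

lemma \<iota>_minus: "\<iota> (- a) = - \<iota> a"
  using \<iota>_add[of a "- a"] by (simp add: eq_neg_iff_add_eq_0 add.commute)

lemma \<iota>_diff: "\<iota> (a - b) = \<iota> a - \<iota> b"
  using \<iota>_add[of a "- b"] \<iota>_minus[of b] by simp

lemma \<iota>_sum: "\<iota> (sum f A) = (\<Sum>i\<in>A. \<iota> (f i))"
  by (induction A rule: infinite_finite_induct) (auto simp: \<iota>_add)

lemma \<iota>_eq_0 [simp]: "\<iota> a = 0 \<longleftrightarrow> a = 0"
proof
  assume "\<iota> a = 0"
  then have "\<iota> (a * inverse a) = 0" by (simp add: \<iota>_mult)
  then show "a = 0" by (cases "a = 0") auto
qed auto

lemma in_B [simp]: "0 \<in> B" "1 \<in> B"
  using \<iota>_in[of 0] \<iota>_in[of 1] by auto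

lemma minus_in: "x \<in> B \<Longrightarrow> - x \<in> B"
  using mult_in[OF \<iota>_in[of "-1"], of x] by (simp add: \<iota>_minus)

lemma diff_in: "x \<in> B \<Longrightarrow> y \<in> B \<Longrightarrow> x - y \<in> B"
  using add_in[of x "- y"] minus_in[of y] by simp

lemma prod_in: "(\<And>i. i \<in> A \<Longrightarrow> f i \<in> B) \<Longrightarrow> prod f A \<in> B"
  by (induction A rule: infinite_finite_induct) (auto intro: mult_in)

section \<open>Prime ideals, maximal ideals and residues\<close>

definition proper_ideal :: "'e set \<Rightarrow> bool" where
  "proper_ideal M \<longleftrightarrow> M \<subseteq> B \<and> 0 \<in> M \<and> 1 \<notin> M \<and> (\<forall>x\<in>M. \<forall>y\<in>M. x + y \<in> M) \<and>
     (\<forall>x\<in>B. \<forall>y\<in>M. x * y \<in> M)"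

definition prime_ideal :: "'e set \<Rightarrow> bool" where
  "prime_ideal M \<longleftrightarrow> proper_ideal M \<and> (\<forall>x\<in>B. \<forall>y\<in>B. x * y \<in> M \<longrightarrow> x \<in> M \<or> y \<in> M)"

context
  fixes y :: 'e
  assumes y: "y \<in> B"
begin

private definition ev :: "complex poly \<Rightarrow> 'e" where "ev p = poly (map_poly \<iota> p) y"

private lemma ev_pCons: "ev (pCons a p) = \<iota> a + y * ev p"
  by (simp add: ev_def map_poly_pCons)

private lemma ev_0 [simp]: "ev 0 = 0"
  by (simp add: ev_def)

private lemma ev_in: "ev p \<in> B"
  by (induction p) (auto simp: ev_pCons y intro!: add_in mult_in \<iota>_in)

private lemma ev_add: "ev (p + q) = ev p + ev q"
  by (induction p q rule: poly_induct2) (auto simp: ev_pCons \<iota>_add algebra_simps)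

private lemma ev_smult: "ev (smult a p) = \<iota> a * ev p"
  by (induction p) (auto simp: ev_pCons \<iota>_mult algebra_simps)

private lemma ev_mult: "ev (p * q) = ev p * ev q"
  by (induction p) (auto simp: ev_pCons ev_add ev_smult algebra_simps)

private lemma ev_sum: "ev (sum f A) = (\<Sum>i\<in>A. ev (f i))"
  by (induction A rule: infinite_finite_induct) (auto simp: ev_add)

private lemma ev_prod: "ev (prod f A) = (\<Prod>i\<in>A. ev (f i))"
  by (induction A rule: infinite_finite_induct) (auto simp: ev_mult one_pCons ev_pCons)

text \<open>p splits into linear factors over the complex numbers, and a prime ideal that contains
  their product contains one of them.\<close>

private lemma root_in_prime_ideal:
  assumes "prime_ideal M" "p \<noteq> 0" "ev p \<in> M"
  shows "\<exists>\<mu>. y - \<iota> \<mu> \<in> M"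
  using assms(2,3)
proof (induction "degree p" arbitrary: p rule: less_induct)
  case less
  have M: "proper_ideal M" using assms(1) by (auto simp: prime_ideal_def)
  show ?case
  proof (cases "degree p = 0")
    case True
    then obtain a where a: "p = [:a:]" by (rule degree_eq_zeroE)
    with less have "a \<noteq> 0" "\<iota> a \<in> M" by (auto simp: ev_pCons)
    moreover have "\<iota> (inverse a) * \<iota> a \<in> M"
      using M \<open>\<iota> a \<in> M\<close> \<iota>_in by (auto simp: proper_ideal_def)
    ultimately have "1 \<in> M" by (simp flip: \<iota>_mult)
    with M show ?thesis by (auto simp: proper_ideal_def)
  next
    case False
then obtain \<mu> where "poly p \<mu> = 0"
      using alg_closed_imp_poly_has_root[of p] by auto
    then obtain q where q: "p = [:-\<mu>, 1:] * q" using poly_eq_0_iff_dvd by blast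
    with less have "q \<noteq> 0" by auto
    then have deg: "degree q < degree p" unfolding q by (subst degree_mult_eq) auto
    have "ev p = (y - \<iota> \<mu>) * ev q" unfolding q ev_mult by (simp add: ev_pCons \<iota>_minus)
    then have "y - \<iota> \<mu> \<in> M \<or> ev q \<in> M"
      using assms(1) less.prems ev_in diff_in[OF y \<iota>_in] by (auto simp: prime_ideal_def)
    then show ?thesis using less.hyps[OF deg \<open>q \<noteq> 0\<close>] by blast
  qed
qed

text \<open>
  The uncountably many inverses of \<open>y - l\<close> modulo \<open>M\<close> cannot be linearly independent, and clearing
  denominators in a linear relation gives a polynomial relation for \<open>y\<close> modulo \<open>M\<close>.
\<close>

lemma residue_of_uncountable_inverses:
  assumes M: "prime_ideal M" and U: "uncountable U"
    and inv: "\<And>l. l \<in> U \<Longrightarrow> \<exists>u\<in>B. u * (y - \<iota> l) - 1 \<in> M"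
  shows "\<exists>\<mu>. y - \<iota> \<mu> \<in> M"
proof -
  obtain u where u: "\<And>l. l \<in> U \<Longrightarrow> u l \<in> B" "\<And>l. l \<in> U \<Longrightarrow> u l * (y - \<iota> l) - 1 \<in> M"
    using inv by metis
  have "\<forall>l\<in>U. \<exists>n c. u l = (\<Sum>i<n. \<iota> (c i) * S i)"
    using u(1) countable_span by blast
  then obtain n c where nc: "\<And>l. l \<in> U \<Longrightarrow> u l = (\<Sum>i<n l. \<iota> (c l i) * S i)" by metis
  \<comment> \<open>Uncountably many of the chosen inverses use the same number k of spanning
    elements, so any k + 1 of them are linearly dependent.\<close>
  have "\<exists>k. uncountable {l\<in>U. n l = k}"
  proof (rule ccontr)
    assume "\<not> ?thesis"
    then have "countable (\<Union>k. {l\<in>U. n l = k})" by (intro countable_UN) auto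
    also have "(\<Union>k. {l\<in>U. n l = k}) = U" by auto
    finally show False using U by simp
  qed
  then obtain k where k: "uncountable {l\<in>U. n l = k}" ..
  then have "infinite {l\<in>U. n l = k}" by (auto intro: countable_finite)
  then obtain I where I: "I \<subseteq> {l\<in>U. n l = k}" "card I = Suc k" "finite I"
    by (metis infinite_arbitrarily_large)
  obtain d where d: "\<exists>i\<in>I. d i \<noteq> 0" "\<forall>j<k. (\<Sum>i\<in>I. d i * c i j) = 0"
    using homogeneous_system_nontrivial[of I k c] I by auto
  have rel: "(\<Sum>i\<in>I. \<iota> (d i) * u i) = 0"
  proof -
    have "(\<Sum>i\<in>I. \<iota> (d i) * u i) = (\<Sum>i\<in>I. \<Sum>j<k. \<iota> (d i) * (\<iota> (c i j) * S j))"
      using I by (intro sum.cong refl) (auto simp: nc sum_distrib_left)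
    also have "\<dots> = (\<Sum>j<k. \<iota> (\<Sum>i\<in>I. d i * c i j) * S j)"
      by (subst sum.swap) (simp add: \<iota>_sum \<iota>_mult sum_distrib_right mult.assoc)
    also have "\<dots> = 0" using d(2) by simp
    finally show ?thesis .
  qed
  \<comment> \<open>The formal relation "sum of d i / (y - i) = 0" with denominators cleared. At a
    node i0 with d i0 \<noteq> 0 all other summands vanish, so p is not the zero polynomial.\<close>
  define p where "p = (\<Sum>i\<in>I. smult (d i) (\<Prod>j\<in>I - {i}. [:- j, 1:]))"
  obtain i0 where i0: "i0 \<in> I" "d i0 \<noteq> 0" using d by auto
  have "poly p i0 = (\<Sum>i\<in>I. d i * (\<Prod>j\<in>I - {i}. i0 - j))"
    by (simp add: p_def poly_sum poly_prod)
  also have "\<dots> = d i0 * (\<Prod>j\<in>I - {i0}. i0 - j) + (\<Sum>i\<in>I - {i0}. d i * (\<Prod>j\<in>I - {i}. i0 - j))"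
    using I i0 by (simp add: sum.remove)
  also have "(\<Sum>i\<in>I - {i0}. d i * (\<Prod>j\<in>I - {i}. i0 - j)) = 0"
    using I i0 by (intro sum.neutral ballI) auto
  finally have "poly p i0 \<noteq> 0" using I i0 by auto
  then have "p \<noteq> 0" by auto
  have Mi: "proper_ideal M" using M by (auto simp: prime_ideal_def)
  have Mdiff: "x - z \<in> M" if "x \<in> M" "z \<in> M" for x z
  proof -
    have "\<iota> (-1) * z \<in> M" using that Mi \<iota>_in by (auto simp: proper_ideal_def)
    then have "x + \<iota> (-1) * z \<in> M" using that Mi by (auto simp: proper_ideal_def)
    then show ?thesis by (simp add: \<iota>_minus)
  qed
  have Msum: "sum f A \<in> M" if "\<And>i. i \<in> A \<Longrightarrow> f i \<in> M" for f and A :: "complex set"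
    using that Mi by (induction A rule: infinite_finite_induct) (auto simp: proper_ideal_def)
  define e where "e = (\<lambda>i. \<Prod>j\<in>I - {i}. y - \<iota> j)"
  have e_in: "e i \<in> B" for i
    unfolding e_def using y by (auto intro!: prod_in diff_in \<iota>_in)
  have ev_p: "ev p = (\<Sum>i\<in>I. \<iota> (d i) * e i)"
    by (simp add: p_def ev_sum ev_smult ev_prod ev_pCons \<iota>_minus e_def)
  \<comment> \<open>Each u i inverts y - i only modulo M, so the exact relation \<open>rel\<close>
    shows \<open>ev p\<close> to be an element of M rather than 0.\<close>
  have "(\<Prod>j\<in>I. y - \<iota> j) * (\<Sum>i\<in>I. \<iota> (d i) * u i)
        = (\<Sum>i\<in>I. (\<iota> (d i) * e i) * (u i * (y - \<iota> i)))"
    unfolding sum_distrib_left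
  proof (intro sum.cong refl)
    fix i assume "i \<in> I"
    then have "(\<Prod>j\<in>I. y - \<iota> j) = (y - \<iota> i) * e i"
      using I by (simp add: e_def prod.remove)
    then show "(\<Prod>j\<in>I. y - \<iota> j) * (\<iota> (d i) * u i) = \<iota> (d i) * e i * (u i * (y - \<iota> i))"
      by (simp only: mult_ac)
  qed
  then have 0: "(\<Sum>i\<in>I. (\<iota> (d i) * e i) * (u i * (y - \<iota> i))) = 0"
    using rel by simp
  have "(\<Sum>i\<in>I. (\<iota> (d i) * e i) * (u i * (y - \<iota> i) - 1)) \<in> M"
    using I u(2) Mi e_in \<iota>_in mult_in by (intro Msum) (auto simp: proper_ideal_def)
  moreover have "a * (z - 1) = a * z - a" for a z :: 'e by (simp add: algebra_simps)
  then have "(\<Sum>i\<in>I. (\<iota> (d i) * e i) * (u i * (y - \<iota> i) - 1)) = 0 - ev p"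
    unfolding ev_p by (simp only: sum_subtractf 0)
  ultimately have "0 - ev p \<in> M" by simp
  then have "0 - (0 - ev p) \<in> M"
    using Mdiff Mi unfolding proper_ideal_def by blast
  then show ?thesis using root_in_prime_ideal[OF M \<open>p \<noteq> 0\<close>] by simp
qed

end

text \<open>If 1 = m + u y with m in M, then u y - 1 lies in M, so y would be invertible modulo
  M.\<close>

lemma proper_ideal_extend:
  assumes M: "proper_ideal M" and y: "y \<in> B" "\<not> (\<exists>u\<in>B. u * y - 1 \<in> M)"
  shows "proper_ideal {m + u * y |m u. m \<in> M \<and> u \<in> B}" (is "proper_ideal ?N")
    and "insert y M \<subseteq> {m + u * y |m u. m \<in> M \<and> u \<in> B}"
proof -
  have Mneg: "- z \<in> M" if "z \<in> M" for z
  proof -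
    have "\<iota> (-1) * z \<in> M" using that M \<iota>_in by (auto simp: proper_ideal_def)
    then show ?thesis by (simp add: \<iota>_minus)
  qed
  have "1 \<notin> ?N"
  proof
    assume "1 \<in> ?N"
    then obtain m u where mu: "m \<in> M" "u \<in> B" "1 = m + u * y" by auto
    then have "u * y - 1 = - m" by (simp add: algebra_simps)
    then show False using y(2) mu Mneg by metis
  qed
  moreover have "0 \<in> ?N" using M by (auto simp: proper_ideal_def intro!: exI[of _ 0])
  moreover have "?N \<subseteq> B" using M y by (auto simp: proper_ideal_def intro!: add_in mult_in)
  moreover have "x + z \<in> ?N" if xz: "x \<in> ?N" "z \<in> ?N" for x z
  proof -
    obtain m u m' u' where "x = m + u * y" "z = m' + u' * y" "m \<in> M" "m' \<in> M" "u \<in> B" "u' \<in> B"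
      using xz by auto
    moreover then have "m + m' \<in> M" "u + u' \<in> B" using M add_in by (auto simp: proper_ideal_def)
    moreover have "x + z = (m + m') + (u + u') * y" using calculation by (simp add: algebra_simps)
    ultimately show ?thesis by blast
  qed
  moreover have "x * z \<in> ?N" if xz: "x \<in> B" "z \<in> ?N" for x z
  proof -
    obtain m u where "z = m + u * y" "m \<in> M" "u \<in> B" using xz by auto
    moreover then have "x * m \<in> M" "x * u \<in> B" using M mult_in xz by (auto simp: proper_ideal_def)
    moreover have "x * z = (x * m) + (x * u) * y" using calculation by (simp add: algebra_simps)
    ultimately show ?thesis by blast
  qed
  ultimately show "proper_ideal ?N" unfolding proper_ideal_def by blast
  show "insert y M \<subseteq> ?N"
  proof
    fix x assume "x \<in> insert y M"
    then consider "x = y" | "x \<in> M" by auto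
    then show "x \<in> ?N"
    proof cases
      case 1
      then have "x = 0 + 1 * y" by simp
      then show ?thesis using M in_B unfolding proper_ideal_def by blast
    next
      case 2
      then have "x = x + 0 * y" by simp
      then show ?thesis using 2 in_B by blast
    qed
  qed
qed

text \<open>Zorn's lemma for the proper ideals above M0. Maximality is recorded as invertibility
  modulo M of every element outside M, the form that \<open>residue_of_uncountable_inverses\<close>
  consumes.\<close>

lemma exists_maximal_ideal:
  assumes "proper_ideal M0"
  shows "\<exists>M. M0 \<subseteq> M \<and> prime_ideal M \<and> (\<forall>y\<in>B. y \<notin> M \<longrightarrow> (\<exists>u\<in>B. u * y - 1 \<in> M))"
proof -
  define \<C> where "\<C> = {M. proper_ideal M \<and> M0 \<subseteq> M}"
  have "\<exists>M\<in>\<C>. \<forall>X\<in>\<C>. M \<subseteq> X \<longrightarrow> X = M"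
  proof (rule subset_Zorn_nonempty)
    show "\<C> \<noteq> {}" using assms by (auto simp: \<C>_def)
    fix C assume C: "C \<noteq> {}" "subset.chain \<C> C"
    then have sub: "C \<subseteq> \<C>" and lin: "\<And>X Y. X \<in> C \<Longrightarrow> Y \<in> C \<Longrightarrow> X \<subseteq> Y \<or> Y \<subseteq> X"
      by (auto simp: subset.chain_def)
    have "x + z \<in> \<Union>C" if xz: "x \<in> \<Union>C" "z \<in> \<Union>C" for x z
    proof -
      obtain X Z where XZ: "X \<in> C" "Z \<in> C" "x \<in> X" "z \<in> Z" using xz by auto
      then obtain W where "W \<in> C" "x \<in> W" "z \<in> W" using lin[of X Z] by auto
      then have "x + z \<in> W" using sub by (auto simp: \<C>_def proper_ideal_def)
      then show ?thesis using \<open>W \<in> C\<close> by auto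
    qed
    moreover have pi: "proper_ideal X" "M0 \<subseteq> X" if "X \<in> C" for X
      using that sub by (auto simp: \<C>_def)
    moreover have "x * z \<in> \<Union>C" if "x \<in> B" "z \<in> \<Union>C" for x z
      using that pi(1) unfolding proper_ideal_def by blast
    moreover have "\<Union>C \<subseteq> B" "1 \<notin> \<Union>C" using pi(1) unfolding proper_ideal_def by blast+
    moreover obtain X where X: "X \<in> C" using C(1) by auto
    then have "0 \<in> \<Union>C" "M0 \<subseteq> \<Union>C" using pi[OF X] unfolding proper_ideal_def by blast+
    ultimately show "\<Union>C \<in> \<C>"
      unfolding \<C>_def proper_ideal_def mem_Collect_eq by blast
  qed
  then obtain M where M: "proper_ideal M" "M0 \<subseteq> M"
    and max: "\<And>X. proper_ideal X \<Longrightarrow> M0 \<subseteq> X \<Longrightarrow> M \<subseteq> X \<Longrightarrow> X = M"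
    by (auto simp: \<C>_def)
  have inv: "\<exists>u\<in>B. u * y - 1 \<in> M" if y: "y \<in> B" "y \<notin> M" for y
  proof (rule ccontr)
    assume "\<not> ?thesis"
    note ext = proper_ideal_extend[OF M(1) y(1) this]
    then have "{m + u * y |m u. m \<in> M \<and> u \<in> B} = M"
      using M(2) by (intro max) auto
    then have "y \<in> M" using ext(2) by simp
    with y show False by simp
  qed
  have "x \<in> M \<or> y \<in> M" if xy: "x \<in> B" "y \<in> B" "x * y \<in> M" for x y
  proof (rule ccontr)
    assume "\<not> ?thesis"
    then obtain u where u: "u \<in> B" "u * y - 1 \<in> M" using inv xy by auto
    moreover have "- x \<in> B" using xy minus_in by simp
    ultimately have "u * (x * y) \<in> M" "(- x) * (u * y - 1) \<in> M"
      using u xy M(1) unfolding proper_ideal_def by blast+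
    then have "u * (x * y) + (- x) * (u * y - 1) \<in> M" using M(1) by (auto simp: proper_ideal_def)
    then have "x \<in> M" by (simp add: algebra_simps)
    with \<open>\<not> ?thesis\<close> show False by simp
  qed
  then have "prime_ideal M" using M by (auto simp: prime_ideal_def)
  then show ?thesis using M inv by blast
qed

text \<open>If f - A is not a unit, a maximal ideal contains it, whose residue field is the field of
  complex numbers by \<open>residue_of_uncountable_inverses\<close>; the residue map sends f to A.
  The same lemma for the zero ideal shows that only countably many f - A are units, since f is not a
  scalar.\<close>

theorem countable_nonvalues:
  assumes f: "f \<in> B" "f \<notin> range \<iota>"
  shows "countable {A. \<not> (\<exists>\<theta>. (\<forall>a. \<theta> (\<iota> a) = a) \<and>
           (\<forall>x\<in>B. \<forall>y\<in>B. \<theta> (x + y) = \<theta> x + \<theta> y \<and> \<theta> (x * y) = \<theta> x * \<theta> y) \<and> \<theta> f = A)}"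
    (is "countable {A. \<not> ?ex A}")
proof -
  define U where "U = {A. \<exists>u\<in>B. u * (f - \<iota> A) = 1}"
  have P0: "prime_ideal {0}"
    by (auto simp: prime_ideal_def proper_ideal_def)
  have cU: "countable U"
  proof (rule ccontr)
    assume "uncountable U"
    then have "\<exists>\<mu>. f - \<iota> \<mu> \<in> {0}"
      by (intro residue_of_uncountable_inverses[OF f(1) P0]) (auto simp: U_def)
    then show False using f(2) by auto
  qed
  have "?ex A" if A: "A \<notin> U" for A
  proof -
    have "\<not> (\<exists>u\<in>B. u * (f - \<iota> A) - 1 \<in> {0})" using A by (auto simp: U_def)
    note ext = proper_ideal_extend[OF _ diff_in[OF f(1) \<iota>_in] this]
    obtain M0 where M0: "proper_ideal M0" "f - \<iota> A \<in> M0"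
      using ext P0 unfolding prime_ideal_def by blast
    then obtain M where M: "M0 \<subseteq> M" "prime_ideal M"
      and inv: "\<And>y. y \<in> B \<Longrightarrow> y \<notin> M \<Longrightarrow> \<exists>u\<in>B. u * y - 1 \<in> M"
      using exists_maximal_ideal by metis
    have Mi: "proper_ideal M" using M by (auto simp: prime_ideal_def)
    have res: "\<exists>\<mu>. y - \<iota> \<mu> \<in> M" if y: "y \<in> B" for y
    proof (rule ccontr)
      assume *: "\<not> ?thesis"
      \<comment> \<open>If y had no residue, y - l would be invertible modulo M for every complex
        number l.\<close>
      have "\<exists>\<mu>. y - \<iota> \<mu> \<in> M"
        by (rule residue_of_uncountable_inverses[OF y M(2) uncountable_UNIV_complex])
          (use * inv y diff_in \<iota>_in in blast)
      then show False using * by simp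
    qed
    have Madd: "x + z \<in> M" if "x \<in> M" "z \<in> M" for x z
      using that Mi by (auto simp: proper_ideal_def)
    have Mmul: "x * z \<in> M" if "x \<in> B" "z \<in> M" for x z
      using that Mi by (auto simp: proper_ideal_def)
    have Mneg: "- z \<in> M" if "z \<in> M" for z
      using Mmul[OF \<iota>_in[of "-1"] that] by (simp add: \<iota>_minus)
    have uniq: "\<mu> = \<nu>" if "y - \<iota> \<mu> \<in> M" "y - \<iota> \<nu> \<in> M" for y \<mu> \<nu>
    proof (rule ccontr)
      assume "\<mu> \<noteq> \<nu>"
      have "(y - \<iota> \<nu>) + - (y - \<iota> \<mu>) \<in> M" using that Madd Mneg by blast
      then have "\<iota> (\<mu> - \<nu>) \<in> M" by (simp add: \<iota>_diff)
      then have "\<iota> (inverse (\<mu> - \<nu>)) * \<iota> (\<mu> - \<nu>) \<in> M" using Mmul \<iota>_in by blast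
      then have "1 \<in> M" using \<open>\<mu> \<noteq> \<nu>\<close> by (simp flip: \<iota>_mult)
      then show False using Mi by (auto simp: proper_ideal_def)
    qed
    define \<theta> where "\<theta> = (\<lambda>y. THE \<mu>. y - \<iota> \<mu> \<in> M)"
    have \<theta>_eq: "\<theta> y = \<mu>" if "y - \<iota> \<mu> \<in> M" for y \<mu>
      unfolding \<theta>_def using that uniq by blast
    have \<theta>_in: "y - \<iota> (\<theta> y) \<in> M" if "y \<in> B" for y
      using res[OF that] \<theta>_eq by auto
    have 1: "\<theta> (\<iota> a) = a" for a
      by (rule \<theta>_eq) (use Mi in \<open>auto simp: proper_ideal_def\<close>)
    have 2: "\<theta> (x + y) = \<theta> x + \<theta> y" if "x \<in> B" "y \<in> B" for x y
    proof (rule \<theta>_eq)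
      have "(x - \<iota> (\<theta> x)) + (y - \<iota> (\<theta> y)) \<in> M" using \<theta>_in that Madd by blast
      then show "x + y - \<iota> (\<theta> x + \<theta> y) \<in> M" by (simp add: \<iota>_add algebra_simps)
    qed
    have 3: "\<theta> (x * y) = \<theta> x * \<theta> y" if "x \<in> B" "y \<in> B" for x y
    proof (rule \<theta>_eq)
      have "y * (x - \<iota> (\<theta> x)) + \<iota> (\<theta> x) * (y - \<iota> (\<theta> y)) \<in> M"
        using \<theta>_in that Madd Mmul \<iota>_in by blast
      then show "x * y - \<iota> (\<theta> x * \<theta> y) \<in> M" by (simp add: \<iota>_mult algebra_simps)
    qed
    have 4: "\<theta> f = A" using M0 M by (intro \<theta>_eq) auto
    show ?thesis by (rule exI[of _ \<theta>]) (auto simp: 1 2 3 4)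
  qed
  then have "{A. \<not> ?ex A} \<subseteq> U" by blast
  then show ?thesis using cU countable_subset by blast
qed

end

section \<open>Orders of poles in logarithmic equations\<close>

lemma finite_family_convergent_subseq:
  fixes a :: "nat \<Rightarrow> 'i \<Rightarrow> complex"
  assumes "finite I" "\<And>n i. i \<in> I \<Longrightarrow> norm (a n i) \<le> K"
  shows "\<exists>s l. strict_mono s \<and> (\<forall>i\<in>I. (\<lambda>n. a (s n) i) \<longlonglongrightarrow> l i)"
  using assms
proof (induction I rule: finite_induct)
  case empty
  show ?case by (rule exI[of _ id]) (simp add: strict_mono_def)
next
  case (insert p I)
  obtain s l where s: "strict_mono s" "\<forall>i\<in>I. (\<lambda>n. a (s n) i) \<longlonglongrightarrow> l i"
    using insert by auto
  have "bounded (range (\<lambda>n. a (s n) p))"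
    using insert.prems[of p] by (auto simp: bounded_iff)
  then obtain lp t where t: "strict_mono t" "((\<lambda>n. a (s n) p) \<circ> t) \<longlonglongrightarrow> lp"
    using bounded_imp_convergent_subsequence by blast
  have "(\<lambda>n. a ((s \<circ> t) n) i) \<longlonglongrightarrow> l i" if "i \<in> I" for i
    using LIMSEQ_subseq_LIMSEQ[OF s(2)[rule_format, OF that] t(1)] by (simp add: o_def)
  moreover have "(\<lambda>n. a ((s \<circ> t) n) p) \<longlonglongrightarrow> lp" using t by (simp add: o_def)
  ultimately show ?case
    using s(1) t(1) insert.hyps
    by (intro exI[of _ "s \<circ> t"] exI[of _ "l(p := lp)"]) (auto simp: strict_mono_def)
qed

lemma constant_subseq:
  fixes p :: "nat \<Rightarrow> 'i"
  assumes "finite I" "\<And>n. p n \<in> I"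
  shows "\<exists>s q. strict_mono (s :: nat \<Rightarrow> nat) \<and> q \<in> I \<and> (\<forall>n. p (s n) = q)"
proof -
  have "finite (range p)" using assms by (meson finite_subset image_subsetI)
  then obtain n0 where "infinite {n. p n = p n0}"
    using pigeonhole_infinite[of "UNIV :: nat set" p] by auto
  then obtain s :: "nat \<Rightarrow> nat" where "strict_mono s" "\<forall>n. s n \<in> {n. p n = p n0}"
    using infinite_enumerate by blast
  then have "strict_mono s \<and> p n0 \<in> I \<and> (\<forall>n. p (s n) = p n0)" using assms(2) by auto
  then show ?thesis by blast
qed

lemma finite_max_norm:
  fixes a :: "'i \<Rightarrow> complex"
  assumes "finite I" "\<exists>i\<in>I. a i \<noteq> 0"
  shows "\<exists>p\<in>I. a p \<noteq> 0 \<and> (\<forall>i\<in>I. norm (a i) \<le> norm (a p))"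
proof -
  have "Max ((\<lambda>i. norm (a i)) ` I) \<in> (\<lambda>i. norm (a i)) ` I" using assms by (intro Max_in) auto
  then obtain p where p: "p \<in> I" "norm (a p) = Max ((\<lambda>i. norm (a i)) ` I)" by auto
  then have le: "norm (a i) \<le> norm (a p)" if "i \<in> I" for i
    using that assms(1) by (metis Max_ge finite_imageI image_eqI)
  obtain i where "i \<in> I" "a i \<noteq> 0" using assms by auto
  then have "a p \<noteq> 0" using le by force
  then show ?thesis using p le by auto
qed

section \<open>The logarithmic equation for formal power series\<close>

text \<open>
  The equation says that \<open>N / P + r log P + log q\<close> has derivative \<open>\<kappa>\<close>; comparing the orders of the
  poles, the first term has none and the residues of the other two cancel.
\<close>

lemma logarithmic_equation_fps_aux:
  fixes N P q \<kappa> :: "complex fps" and r :: complex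
  assumes eq: "(fps_deriv (fps_X ^ n * N) * (fps_X ^ m * P) - (fps_X ^ n * N) * fps_deriv (fps_X ^ m * P)) * (fps_X ^ l * q)
      + fps_const r * fps_deriv (fps_X ^ m * P) * (fps_X ^ m * P) * (fps_X ^ l * q)
      + fps_deriv (fps_X ^ l * q) * (fps_X ^ m * P) ^ 2 = \<kappa> * (fps_X ^ m * P) ^ 2 * (fps_X ^ l * q)"
    and P: "fps_nth P 0 \<noteq> 0" and q: "fps_nth q 0 \<noteq> 0"
  shows "n < m \<Longrightarrow> fps_nth N 0 = 0" "m \<le> n \<Longrightarrow> r * of_nat m + of_nat l = 0"
proof -
  \<comment> \<open>The Euler operator X d/dX preserves powers of X, so they can be split off
    without shifting exponents; for this the equation is multiplied by X once.\<close>
  have th: "fps_X * fps_deriv (fps_X ^ k * f) = fps_X ^ k * (of_nat k * f + fps_X * fps_deriv f)"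
    for k and f :: "complex fps"
  proof -
    have "fps_X * fps_deriv (fps_X ^ k :: complex fps) = of_nat k * fps_X ^ k"
      by (induction k) (simp_all add: algebra_simps)
    then have "fps_X * fps_deriv (fps_X ^ k) * f = of_nat k * fps_X ^ k * f" by simp
    then show ?thesis by (simp add: algebra_simps)
  qed
  \<comment> \<open>A and C are the Wronskian part and the logarithmic part, freed from their powers
    of X. Their constant terms carry the factors n - m and r m + l. The lower power of X forces its
    constant term to vanish; for n = m that of A vanishes by itself.\<close>
  define A where "A = (of_nat n * N + fps_X * fps_deriv N) * P - N * (of_nat m * P + fps_X * fps_deriv P)"
  define C where "C = fps_const r * (of_nat m * P + fps_X * fps_deriv P) * P * q
     + (of_nat l * q + fps_X * fps_deriv q) * P ^ 2 - fps_X * \<kappa> * P ^ 2 * q"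
  have "0 = fps_X * ((fps_deriv (fps_X ^ n * N) * (fps_X ^ m * P) - (fps_X ^ n * N) * fps_deriv (fps_X ^ m * P)) * (fps_X ^ l * q)
      + fps_const r * fps_deriv (fps_X ^ m * P) * (fps_X ^ m * P) * (fps_X ^ l * q)
      + fps_deriv (fps_X ^ l * q) * (fps_X ^ m * P) ^ 2 - \<kappa> * (fps_X ^ m * P) ^ 2 * (fps_X ^ l * q))"
    using eq by simp
  also have "\<dots> = ((fps_X * fps_deriv (fps_X ^ n * N)) * (fps_X ^ m * P) - (fps_X ^ n * N) * (fps_X * fps_deriv (fps_X ^ m * P))) * (fps_X ^ l * q)
      + fps_const r * (fps_X * fps_deriv (fps_X ^ m * P)) * (fps_X ^ m * P) * (fps_X ^ l * q)
      + (fps_X * fps_deriv (fps_X ^ l * q)) * (fps_X ^ m * P) ^ 2 - fps_X * \<kappa> * (fps_X ^ m * P) ^ 2 * (fps_X ^ l * q)"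
    by (simp only: algebra_simps)
  also have "\<dots> = fps_X ^ (n + m + l) * (A * q) + fps_X ^ (2 * m + l) * C"
  proof -
    have e: "fps_X ^ (n + m + l) = (fps_X ^ n * fps_X ^ m * fps_X ^ l :: complex fps)"
      "fps_X ^ (2 * m + l) = (fps_X ^ m * fps_X ^ m * fps_X ^ l :: complex fps)"
      by (simp_all add: power_add mult_2)
    show ?thesis unfolding th A_def C_def e power2_eq_square by (simp only: algebra_simps)
  qed
  finally have *: "fps_X ^ (n + m + l) * (A * q) + fps_X ^ (2 * m + l) * C = 0" by simp
  have A0: "fps_nth A 0 = (of_nat n - of_nat m) * fps_nth N 0 * fps_nth P 0"
    by (simp add: A_def algebra_simps)
  have C0: "fps_nth C 0 = (r * of_nat m + of_nat l) * fps_nth P 0 ^ 2 * fps_nth q 0"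
    by (simp add: C_def algebra_simps power2_eq_square)
  show "fps_nth N 0 = 0" if "n < m"
  proof -
    have "fps_X ^ (n + m + l) * (A * q + fps_X ^ (m - n) * C) = 0"
    proof -
      have "n + m + l + (m - n) = 2 * m + l" using that by simp
      then have "fps_X ^ (2 * m + l) = (fps_X ^ (n + m + l) * fps_X ^ (m - n) :: complex fps)"
        by (metis power_add)
      then show ?thesis using * by (simp only: distrib_left mult.assoc)
    qed
    then have "A * q + fps_X ^ (m - n) * C = 0" by simp
    then have "fps_nth (A * q + fps_X ^ (m - n) * C) 0 = 0" by simp
    then show ?thesis using that P q A0 by simp
  qed
  show "r * of_nat m + of_nat l = 0" if "m \<le> n"
  proof -
    have "fps_X ^ (2 * m + l) * (fps_X ^ (n - m) * (A * q) + C) = 0"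
    proof -
      have "2 * m + l + (n - m) = n + m + l" using that by simp
      then have "fps_X ^ (n + m + l) = (fps_X ^ (2 * m + l) * fps_X ^ (n - m) :: complex fps)"
        by (metis power_add)
      then show ?thesis using * by (simp only: distrib_left mult.assoc)
    qed
    then have "fps_X ^ (n - m) * (A * q) + C = 0" by simp
    then have "fps_nth (fps_X ^ (n - m) * (A * q)) 0 + fps_nth C 0 = 0"
      unfolding fps_add_nth[symmetric] by (simp only: fps_zero_nth)
    moreover have "fps_nth (fps_X ^ (n - m) * (A * q)) 0 = 0"
      using that A0 by (cases "n = m") auto
    ultimately have "fps_nth C 0 = 0" by (simp only: add_0_left)
    then show ?thesis using C0 P q by simp
  qed
qed

lemma logarithmic_equation_fps:
  fixes N P q \<kappa> :: "complex fps" and r :: complex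
  assumes eq: "(fps_deriv N * P - N * fps_deriv P) * q + fps_const r * fps_deriv P * P * q
      + fps_deriv q * P ^ 2 = \<kappa> * P ^ 2 * q"
    and "P \<noteq> 0" "q \<noteq> 0"
  shows "N = 0 \<or> subdegree P \<le> subdegree N" "r * of_nat (subdegree P) + of_nat (subdegree q) = 0"
proof -
  define sh where "sh = (\<lambda>f::complex fps. fps_shift (subdegree f) f)"
  have dec: "f = fps_X ^ subdegree f * sh f" for f
    unfolding sh_def by (subst subdegree_decompose) (simp add: mult.commute)
  have sh0: "fps_nth (sh f) 0 \<noteq> 0" if "f \<noteq> 0" for f
    using that by (simp add: sh_def)
  note aux = logarithmic_equation_fps_aux[of _ _ "subdegree P" "sh P" "subdegree q" "sh q" r \<kappa>,
      folded dec, OF _ sh0[OF assms(2)] sh0[OF assms(3)]]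
  have N: "N = 0 \<or> subdegree P \<le> subdegree N"
  proof (rule ccontr)
    assume *: "\<not> ?thesis"
    have "fps_nth (sh N) 0 = 0"
      by (rule aux(1)[of "subdegree N" "sh N"]) (use eq * in \<open>simp_all flip: dec\<close>)
    then show False using * sh0[of N] by auto
  qed
  then show "N = 0 \<or> subdegree P \<le> subdegree N" .
  \<comment> \<open>The zero series has no order of its own; it is written as X^n times 0 with n the
    order of P.\<close>
  obtain n N' where n: "N = fps_X ^ n * N'" "subdegree P \<le> n"
  proof (cases "N = 0")
    case True
    then show ?thesis using that[of "subdegree P" 0] by simp
  next
    case False
    then show ?thesis using that[OF dec] N by simp
  qed
  show "r * of_nat (subdegree P) + of_nat (subdegree q) = 0"
    by (rule aux(2)[of n N']) (use eq n in simp_all)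
qed

section \<open>Removable singularities of quotients\<close>

lemma holomorphic_common_nonzero:
  fixes f g :: "complex \<Rightarrow> complex"
  assumes "f holomorphic_on D" "g holomorphic_on D" "open D" "connected D"
    and "a \<in> D" "f a \<noteq> 0" "b \<in> D" "g b \<noteq> 0"
  shows "\<exists>w\<in>D. f w \<noteq> 0 \<and> g w \<noteq> 0"
proof -
  have "\<forall>\<^sub>F w in at a. f w \<noteq> 0 \<and> w \<in> D" "\<forall>\<^sub>F w in at a. g w \<noteq> 0 \<and> w \<in> D"
    using assms by (auto intro: non_zero_neighbour_alt)
  then have "\<forall>\<^sub>F w in at a. f w \<noteq> 0 \<and> g w \<noteq> 0 \<and> w \<in> D" by eventually_elim auto
  then have "\<exists>w. f w \<noteq> 0 \<and> g w \<noteq> 0 \<and> w \<in> D"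
    by (rule eventually_happens'[rotated]) simp
  then show ?thesis by blast
qed

lemma has_fps_expansion_0_imp_eventually:
  fixes f :: "complex \<Rightarrow> complex"
  shows "f has_fps_expansion 0 \<Longrightarrow> \<forall>\<^sub>F x in nhds 0. f x = 0"
  unfolding has_fps_expansion_def by (auto elim!: eventually_mono)

text \<open>At a zero of P the order condition makes N / P a power series. The pointwise values c
  glue to a holomorphic function because N = P c determines c away from the isolated zeros of
  P.\<close>

lemma holomorphic_local_quotient:
  fixes N P :: "complex \<Rightarrow> complex"
  assumes hol: "N holomorphic_on D" "P holomorphic_on D" and D: "open D" "connected D"
    and nz: "b \<in> D" "P b \<noteq> 0"
    and ord: "\<And>w F G. w \<in> D \<Longrightarrow> (\<lambda>x. N (w + x)) has_fps_expansion F \<Longrightarrow>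
       (\<lambda>x. P (w + x)) has_fps_expansion G \<Longrightarrow> G \<noteq> 0 \<Longrightarrow> F = 0 \<or> subdegree G \<le> subdegree F"
  shows "\<exists>R. R holomorphic_on D \<and> (\<forall>w\<in>D. N w = P w * R w)"
proof -
  have ex: "\<exists>c. (\<lambda>x. if x = 0 then c else N (w + x) / P (w + x)) analytic_on {0}
     \<and> N w = P w * c" if w: "w \<in> D" for w
  proof -
    have "N analytic_on {w}" "P analytic_on {w}" using hol D w analytic_at by blast+
    then obtain F G where F: "(\<lambda>x. N (w + x)) has_fps_expansion F"
      and G: "(\<lambda>x. P (w + x)) has_fps_expansion G"
      using analytic_at_imp_has_fps_expansion[of N w] analytic_at_imp_has_fps_expansion[of P w] by blast
    have ev: "\<forall>\<^sub>F x in at w. P x \<noteq> 0"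
      using non_zero_neighbour_alt[OF hol(2) D w nz] by eventually_elim auto
    have "G \<noteq> 0"
    proof
      assume "G = 0"
      then have "\<forall>\<^sub>F x in nhds 0. P (w + x) = 0" using G has_fps_expansion_0_imp_eventually by blast
      then have "\<forall>\<^sub>F x in at 0. P (w + x) = 0" by (auto simp: eventually_at_filter elim: eventually_mono)
      then have "\<forall>\<^sub>F x in at w. P x = 0"
        using at_to_0'[of w] by (simp add: eventually_filtermap at_to_0[of w] add.commute)
      with ev have "\<forall>\<^sub>F x in at w. False" by eventually_elim auto
      then show False by simp
    qed
    have 1: "(\<lambda>x. if x = 0 then 0 else N (w + x) / P (w + x)) has_fps_expansion 0 \<and> N w = 0" if "F = 0"
    proof -
      have "\<forall>\<^sub>F x in nhds 0. N (w + x) = 0" using F that has_fps_expansion_0_imp_eventually by blast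
      moreover from this have "N w = 0" by (auto dest: eventually_nhds_x_imp_x)
      moreover from calculation(1)
      have "\<forall>\<^sub>F x in nhds 0. eval_fps 0 x = (if x = 0 then 0 else N (w + x) / P (w + x))"
        by eventually_elim auto
      ultimately show ?thesis by (simp add: has_fps_expansion_def)
    qed
    have 2: "\<exists>c. (\<lambda>x. if x = 0 then c else N (w + x) / P (w + x)) has_fps_expansion (F / G) \<and> N w = P w * c"
      if FG: "subdegree G \<le> subdegree F" "F \<noteq> 0"
    proof -
      \<comment> \<open>The constant term of F / G: the coefficient of F at the order of G, which is
        0 if F vanishes to higher order.\<close>
      define c where "c = fps_nth F (subdegree G) / fps_nth G (subdegree G)"
      have "fps_nth F 0 = N w" "fps_nth G 0 = P w"
        using F G by (auto simp: has_fps_expansion_def eval_fps_at_0 dest: eventually_nhds_x_imp_x)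
      moreover have "fps_nth F 0 = fps_nth G 0 * c"
      proof (cases "subdegree G = 0")
        case True
        then show ?thesis using \<open>G \<noteq> 0\<close> nth_subdegree_nonzero[of G] by (simp add: c_def)
      next
        case False
        then have "0 < subdegree G" "0 < subdegree F" using FG by linarith+
        then have "fps_nth F 0 = 0" "fps_nth G 0 = 0" using nth_less_subdegree_zero by blast+
        then show ?thesis by simp
      qed
      ultimately show ?thesis
        using has_fps_expansion_divide[OF F G FG(1) \<open>G \<noteq> 0\<close> c_def] by auto
    qed
    show ?thesis
    proof (cases "F = 0")
      case True
      show ?thesis
        using has_fps_expansion_imp_analytic_0[OF 1[OF True, THEN conjunct1]] 1[OF True]
        by (intro exI[of _ 0] conjI) auto
    next
      case False
      then obtain c where "(\<lambda>x. if x = 0 then c else N (w + x) / P (w + x)) has_fps_expansion (F / G)"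
        and c: "N w = P w * c"
        using 2 ord[OF w F G \<open>G \<noteq> 0\<close>] by auto
      from has_fps_expansion_imp_analytic_0[OF this(1)] c show ?thesis by (intro exI[of _ c] conjI)
    qed
  qed
  then obtain c where c: "\<And>w. w \<in> D \<Longrightarrow> (\<lambda>x. if x = 0 then c w else N (w + x) / P (w + x)) analytic_on {0}"
    "\<And>w. w \<in> D \<Longrightarrow> N w = P w * c w" by metis
  have "c analytic_on {w}" if w: "w \<in> D" for w
  proof -
    let ?f = "\<lambda>x. if x = 0 then c w else N (w + x) / P (w + x)"
    have "?f analytic_on {w - w}" using c(1)[OF w] by simp
    then have "(?f \<circ> (\<lambda>z. z - w)) analytic_on {w}"
      by (intro analytic_on_compose_gen[where T = "{w - w}"]) (auto intro!: analytic_intros)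
    moreover have "\<forall>\<^sub>F z in nhds w. (?f \<circ> (\<lambda>z. z - w)) z = c z"
    proof -
      have "\<forall>\<^sub>F z in at w. P z \<noteq> 0 \<and> z \<in> D"
        using non_zero_neighbour_alt[OF hol(2) D w nz] .
      then have "\<forall>\<^sub>F z in nhds w. z \<noteq> w \<longrightarrow> P z \<noteq> 0 \<and> z \<in> D" by (simp add: eventually_at_filter)
      then show ?thesis by eventually_elim (use c(2) in auto)
    qed
    ultimately show ?thesis using analytic_at_cong by blast
  qed
  then have "c holomorphic_on D" by (meson analytic_imp_holomorphic analytic_on_analytic_at)
  then show ?thesis using c(2) by blast
qed

section \<open>Spans of holomorphic functions\<close>

lemma holomorphic_vanish_on_open:
  assumes "f holomorphic_on D" "open D" "connected D" "open W" "W \<subseteq> D" "W \<noteq> {}"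
    and "\<And>w. w \<in> W \<Longrightarrow> f w = 0" "z \<in> D"
  shows "f z = (0::complex)"
proof (rule ccontr)
  assume nz: "f z \<noteq> 0"
  obtain w where w: "w \<in> W" using assms by auto
  then have "\<forall>\<^sub>F x in at w. f x \<noteq> 0 \<and> x \<in> D"
    using assms nz by (intro non_zero_neighbour_alt[of f D w z]) auto
  moreover have "\<forall>\<^sub>F x in at w. x \<in> W"
    using w assms(4) by (intro eventually_at_in_open') auto
  ultimately have "\<forall>\<^sub>F x in at w. False" by eventually_elim (use assms(7) in auto)
  then show False by simp
qed

text \<open>Functions of w are handled through coefficient vectors over I. By linear independence a
  nonzero vector is a nonzero function, so limits of normalized vectors give functions that do not
  vanish identically.\<close>

locale holomorphic_span =
  fixes I :: "'i set" and \<phi> :: "'i \<Rightarrow> complex \<Rightarrow> complex" and D :: "complex set"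
    and \<kappa> :: "complex \<Rightarrow> complex" and r :: complex
  assumes finI: "finite I" and hol: "\<And>i. i \<in> I \<Longrightarrow> \<phi> i holomorphic_on D"
    and D: "open D" "connected D" and hol_\<kappa>: "\<kappa> holomorphic_on D"
    and indep: "\<And>a i. \<forall>w\<in>D. (\<Sum>i\<in>I. a i * \<phi> i w) = 0 \<Longrightarrow> i \<in> I \<Longrightarrow> a i = 0"
begin

definition ev :: "('i \<Rightarrow> complex) \<Rightarrow> complex \<Rightarrow> complex" where
  "ev a w = (\<Sum>i\<in>I. a i * \<phi> i w)"

definition ev' :: "('i \<Rightarrow> complex) \<Rightarrow> complex \<Rightarrow> complex" where
  "ev' a w = (\<Sum>i\<in>I. a i * deriv (\<phi> i) w)"

text \<open>The equation (b/a)' + r a'/a + d'/d = \<kappa> for the functions with coefficient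
  vectors b, a and d, multiplied by a^2 d. Without denominators it passes to limits and to
  homomorphic images.\<close>

definition sol :: "('i \<Rightarrow> complex) \<Rightarrow> ('i \<Rightarrow> complex) \<Rightarrow> ('i \<Rightarrow> complex) \<Rightarrow> bool" where
  "sol b a d \<longleftrightarrow> (\<exists>i\<in>I. a i \<noteq> 0) \<and> (\<exists>i\<in>I. d i \<noteq> 0) \<and>
     (\<forall>w\<in>D. (ev' b w * ev a w - ev b w * ev' a w) * ev d w + r * ev' a w * ev a w * ev d w
        + ev' d w * (ev a w)\<^sup>2 = \<kappa> w * (ev a w)\<^sup>2 * ev d w)"

lemma hol_ev: "ev a holomorphic_on D"
  unfolding ev_def using hol by (intro holomorphic_intros) auto

lemma deriv_ev: "w \<in> D \<Longrightarrow> deriv (ev a) w = ev' a w"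
  unfolding ev_def ev'_def using hol D
  by (intro DERIV_imp_deriv DERIV_sum DERIV_cmult holomorphic_derivI[of _ D]) auto

lemma ev_scale: "ev (\<lambda>i. c * a i) w = c * ev a w" "ev' (\<lambda>i. c * a i) w = c * ev' a w"
  by (simp_all add: ev_def ev'_def sum_distrib_left mult.assoc)

lemma ev_diff: "ev (\<lambda>i. a i - b i) w = ev a w - ev b w" "ev' (\<lambda>i. a i - b i) w = ev' a w - ev' b w"
  by (simp_all add: ev_def ev'_def sum_subtractf left_diff_distrib)

lemma ev_eq_0D: "(\<And>w. w \<in> D \<Longrightarrow> ev a w = 0) \<Longrightarrow> i \<in> I \<Longrightarrow> a i = 0"
  using indep[of a i] by (auto simp: ev_def)

lemma ev_nonzero: "\<exists>i\<in>I. a i \<noteq> 0 \<Longrightarrow> \<exists>w\<in>D. ev a w \<noteq> 0"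
  using ev_eq_0D by blast

lemma ev_tendsto:
  assumes "\<And>i. i \<in> I \<Longrightarrow> (\<lambda>n. a n i) \<longlonglongrightarrow> l i"
  shows "(\<lambda>n. ev (a n) w) \<longlonglongrightarrow> ev l w" "(\<lambda>n. ev' (a n) w) \<longlonglongrightarrow> ev' l w"
  unfolding ev_def ev'_def using assms by (auto intro!: tendsto_intros)

text \<open>A common factor of a and b leaves b/a unchanged, a factor of d leaves d'/d unchanged,
  and subtracting g a from b changes b/a by a constant.\<close>

lemma sol_normalize:
  assumes "sol b a d" "c \<noteq> 0" "e \<noteq> 0"
  shows "sol (\<lambda>i. c * b i - g * (c * a i)) (\<lambda>i. c * a i) (\<lambda>i. e * d i)"
  unfolding sol_def ev_diff ev_scale
proof (intro conjI ballI)
  fix w assume w: "w \<in> D"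
  have "(ev' b w * ev a w - ev b w * ev' a w) * ev d w + r * ev' a w * ev a w * ev d w
        + ev' d w * (ev a w)\<^sup>2 = \<kappa> w * (ev a w)\<^sup>2 * ev d w"
    using assms w by (auto simp: sol_def)
  then have 0: "(ev' b w * ev a w - ev b w * ev' a w) * ev d w + r * ev' a w * ev a w * ev d w
        + ev' d w * (ev a w)\<^sup>2 - \<kappa> w * (ev a w)\<^sup>2 * ev d w = 0" by simp
  have "(c * ev' b w - g * (c * ev' a w)) * (c * ev a w) * (e * ev d w) -
        (c * ev b w - g * (c * ev a w)) * (c * ev' a w) * (e * ev d w) +
       r * (c * ev' a w) * (c * ev a w) * (e * ev d w) + e * ev' d w * (c * ev a w)\<^sup>2 -
       \<kappa> w * (c * ev a w)\<^sup>2 * (e * ev d w)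
     = c\<^sup>2 * e * ((ev' b w * ev a w - ev b w * ev' a w) * ev d w + r * ev' a w * ev a w * ev d w
        + ev' d w * (ev a w)\<^sup>2 - \<kappa> w * (ev a w)\<^sup>2 * ev d w)"
    by (simp add: power2_eq_square algebra_simps)
  also have "\<dots> = 0" by (simp only: 0) simp
  finally show "((c * ev' b w - g * (c * ev' a w)) * (c * ev a w) -
        (c * ev b w - g * (c * ev a w)) * (c * ev' a w)) * (e * ev d w) +
       r * (c * ev' a w) * (c * ev a w) * (e * ev d w) + e * ev' d w * (c * ev a w)\<^sup>2 =
       \<kappa> w * (c * ev a w)\<^sup>2 * (e * ev d w)"
    by (simp add: left_diff_distrib)
qed (use assms in \<open>auto simp: sol_def\<close>)

text \<open>C is the expansion at w of the function that belongs to d. The case \<open>B = 0\<close>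
  is listed separately because \<open>subdegree\<close> takes the value 0 there.\<close>

lemma sol_fps:
  assumes s: "sol b a d" and w: "w \<in> D" and A: "(\<lambda>x. ev a (w + x)) has_fps_expansion A"
    and B: "(\<lambda>x. ev b (w + x)) has_fps_expansion B"
  obtains C :: "complex fps" where "A \<noteq> 0" "C \<noteq> 0" "B = 0 \<or> subdegree A \<le> subdegree B"
    "r * of_nat (subdegree A) + of_nat (subdegree C) = 0"
proof -
  have an: "f analytic_on {w}" if "f holomorphic_on D" for f
    using that w D analytic_at by blast
  obtain C where C: "(\<lambda>x. ev d (w + x)) has_fps_expansion C"
    using analytic_at_imp_has_fps_expansion[OF an[OF hol_ev]] by blast
  obtain K where K: "(\<lambda>x. \<kappa> (w + x)) has_fps_expansion K"
    using analytic_at_imp_has_fps_expansion[OF an[OF hol_\<kappa>]] by blast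
  have nbhd: "\<forall>\<^sub>F x in nhds 0. w + x \<in> D"
  proof -
    have "open ((\<lambda>x. w + x) -` D)" using D by (intro open_vimage) (auto intro!: continuous_intros)
    moreover have "0 \<in> (\<lambda>x. w + x) -` D" using w by simp
    ultimately show ?thesis using eventually_nhds_in_open by fastforce
  qed
  have der: "(\<lambda>x. ev' e (w + x)) has_fps_expansion fps_deriv E"
    if "(\<lambda>x. ev e (w + x)) has_fps_expansion E" for e E
  proof -
    have "\<forall>\<^sub>F x in nhds 0. deriv (\<lambda>x. ev e (w + x)) x = ev' e (w + x)"
      using nbhd
    proof eventually_elim
      case (elim x)
      have "((ev e \<circ> (\<lambda>x. w + x)) has_field_derivative ev' e (w + x) * 1) (at x)"
      proof (rule DERIV_chain)
        show "(ev e has_field_derivative ev' e (w + x)) (at (w + x))"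
          using holomorphic_derivI[OF hol_ev D(1) elim, of e] deriv_ev[OF elim, of e] by simp
      qed (auto intro!: derivative_eq_intros)
      then show ?case by (intro DERIV_imp_deriv) (simp add: o_def)
    qed
    then show ?thesis using has_fps_expansion_deriv[OF that] by (subst (asm) has_fps_expansion_cong[OF _ refl])
  qed
  have nz: "E \<noteq> 0" if "(\<lambda>x. ev e (w + x)) has_fps_expansion E" "\<exists>i\<in>I. e i \<noteq> 0" for e E
  proof
    assume "E = 0"
    then have "\<forall>\<^sub>F x in nhds 0. ev e (w + x) = 0"
      using that has_fps_expansion_0_imp_eventually by blast
    then have "\<forall>\<^sub>F x in nhds w. ev e x = 0"
      by (simp add: nhds_to_0[of w] eventually_filtermap add.commute)
    then obtain W where W: "open W" "w \<in> W" "\<And>x. x \<in> W \<Longrightarrow> ev e x = 0"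
      by (auto simp: eventually_nhds)
    have "ev e z = 0" if "z \<in> D" for z
      by (rule holomorphic_vanish_on_open[OF hol_ev D, of "W \<inter> D"]) (use W D w that in auto)
    then show False using ev_nonzero[OF that(2)] by blast
  qed
  note E = has_fps_expansion_add has_fps_expansion_diff has_fps_expansion_mult has_fps_expansion_const
  have e1: "(\<lambda>x. (ev' b (w + x) * ev a (w + x) - ev b (w + x) * ev' a (w + x)) * ev d (w + x)
      + r * ev' a (w + x) * ev a (w + x) * ev d (w + x) + ev' d (w + x) * (ev a (w + x) * ev a (w + x)))
      has_fps_expansion (fps_deriv B * A - B * fps_deriv A) * C + fps_const r * fps_deriv A * A * C + fps_deriv C * (A * A)"
    by (intro E A B C der)
  have e2: "(\<lambda>x. \<kappa> (w + x) * (ev a (w + x) * ev a (w + x)) * ev d (w + x))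
      has_fps_expansion K * (A * A) * C"
    by (intro E A C K)
  have e12: "\<forall>\<^sub>F x in nhds 0. (ev' b (w + x) * ev a (w + x) - ev b (w + x) * ev' a (w + x)) * ev d (w + x)
      + r * ev' a (w + x) * ev a (w + x) * ev d (w + x) + ev' d (w + x) * (ev a (w + x) * ev a (w + x))
     = \<kappa> (w + x) * (ev a (w + x) * ev a (w + x)) * ev d (w + x)"
    using nbhd by eventually_elim (use s in \<open>auto simp: sol_def power2_eq_square\<close>)
  have "(fps_deriv B * A - B * fps_deriv A) * C + fps_const r * fps_deriv A * A * C
      + fps_deriv C * (A * A) = K * (A * A) * C"
    using fps_expansion_unique_complex[OF e1[unfolded has_fps_expansion_cong[OF e12 refl]] e2] .
  then have eq: "(fps_deriv B * A - B * fps_deriv A) * C + fps_const r * fps_deriv A * A * C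
      + fps_deriv C * A ^ 2 = K * A ^ 2 * C" by (simp add: power2_eq_square)
  have "A \<noteq> 0" "C \<noteq> 0" using nz A C s by (auto simp: sol_def)
  then show ?thesis
    using that[of C] logarithmic_equation_fps[OF eq] by blast
qed

lemma sol_quotient:
  assumes s: "sol b a d"
  shows "\<exists>R. R holomorphic_on D \<and> (\<forall>w\<in>D. ev b w = ev a w * R w)"
proof -
  obtain w0 where w0: "w0 \<in> D" "ev a w0 \<noteq> 0" using s ev_nonzero by (auto simp: sol_def)
  show ?thesis
    using sol_fps[OF s] by (intro holomorphic_local_quotient[OF hol_ev hol_ev D w0]) metis
qed

text \<open>m and l are the orders of a and d at w. Since b/a has no pole there, the residues of r
  a'/a and d'/d have to cancel.\<close>

lemma sol_zero_rational:
  assumes s: "sol b a d" and w: "w \<in> D" "ev a w = 0"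
  shows "\<exists>m l::nat. m > 0 \<and> r * of_nat m + of_nat l = 0"
proof -
  have an: "f analytic_on {w}" if "f holomorphic_on D" for f
    using that w D analytic_at by blast
  obtain A B where AB: "(\<lambda>x. ev a (w + x)) has_fps_expansion A" "(\<lambda>x. ev b (w + x)) has_fps_expansion B"
    using analytic_at_imp_has_fps_expansion[OF an[OF hol_ev]] by blast
  obtain C :: "complex fps" where "A \<noteq> 0" "r * of_nat (subdegree A) + of_nat (subdegree C) = 0"
    using sol_fps[OF s w(1) AB] by metis
  moreover have "fps_nth A 0 = ev a w"
    using AB(1) by (auto simp: has_fps_expansion_def eval_fps_at_0 dest: eventually_nhds_x_imp_x)
  then have "subdegree A > 0" using w \<open>A \<noteq> 0\<close> using subdegree_eq_0_iff[of A] by auto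
  ultimately show ?thesis by blast
qed

section \<open>Limits of normalized solutions\<close>

lemma wronskian_zero:
  assumes a: "\<exists>i\<in>I. a i \<noteq> 0" and d: "\<exists>i\<in>I. d i \<noteq> 0"
    and eq: "\<And>w. w \<in> D \<Longrightarrow> (ev' b w * ev a w - ev b w * ev' a w) * ev d w = 0"
  shows "\<exists>c. \<forall>i\<in>I. b i = c * a i"
proof -
  obtain w where w: "w \<in> D" "ev a w \<noteq> 0" "ev d w \<noteq> 0"
    using holomorphic_common_nonzero[OF hol_ev hol_ev D] ev_nonzero[OF a] ev_nonzero[OF d] by metis
  have "open (D \<inter> ev a -` (- {0}) \<inter> ev d -` (- {0}))"
  proof -
    have "open (D \<inter> ev e -` (- {0}))" for e
      using D hol_ev by (intro continuous_open_preimage holomorphic_on_imp_continuous_on) auto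
    then have "open ((D \<inter> ev a -` (- {0})) \<inter> (D \<inter> ev d -` (- {0})))" by blast
    then show ?thesis by (simp add: Int_assoc Int_left_commute)
  qed
  then obtain \<epsilon> where \<epsilon>: "\<epsilon> > 0" "ball w \<epsilon> \<subseteq> D \<inter> ev a -` (- {0}) \<inter> ev d -` (- {0})"
    using w by (metis (no_types, lifting) ComplI IntI open_contains_ball singletonD vimageI)
  \<comment> \<open>On a disc without zeros of a and d the assumption says that b / a has derivative
    0.\<close>
  have "\<exists>c. \<forall>x\<in>ball w \<epsilon>. ev b x / ev a x = c"
  proof (rule has_field_derivative_zero_constant)
    fix x assume "x \<in> ball w \<epsilon>"
    then have x: "x \<in> D" "ev a x \<noteq> 0" "ev d x \<noteq> 0" using \<epsilon> by auto
    have "(ev e has_field_derivative ev' e x) (at x)" for e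
      using holomorphic_derivI[OF hol_ev D(1) x(1), of e] deriv_ev[OF x(1), of e] by simp
    then have "((\<lambda>x. ev b x / ev a x) has_field_derivative
        (ev' b x * ev a x - ev b x * ev' a x) / (ev a x * ev a x)) (at x)"
      using x by (intro DERIV_divide) auto
    then show "((\<lambda>x. ev b x / ev a x) has_field_derivative 0) (at x within ball w \<epsilon>)"
      using eq[OF x(1)] x by (auto intro: DERIV_subset)
  qed simp
  then obtain c where c: "\<And>x. x \<in> ball w \<epsilon> \<Longrightarrow> ev b x / ev a x = c" by auto
  have "ev (\<lambda>i. b i - c * a i) z = 0" if "z \<in> D" for z
  proof (rule holomorphic_vanish_on_open[OF hol_ev D, of "ball w \<epsilon>"])
    fix x assume x: "x \<in> ball w \<epsilon>"
    then have "ev a x \<noteq> 0" using \<epsilon> by auto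
    then have "ev b x = c * ev a x" using c[OF x] by (auto simp: field_simps)
    then show "ev (\<lambda>i. b i - c * a i) x = 0" by (simp add: ev_diff ev_scale)
  qed (use \<epsilon> that in auto)
  then have "\<forall>i\<in>I. b i - c * a i = 0" using ev_eq_0D by blast
  then show ?thesis by (intro exI[of _ c]) auto
qed


text \<open>
  Solutions can be rescaled, and multiples of \<open>a\<close> can be subtracted from \<open>b\<close>. After normalizing \<open>a\<close> and
  \<open>d\<close> to have a largest coordinate \<open>1\<close> and \<open>b\<close> to vanish at that coordinate of \<open>a\<close>, the numerators
  \<open>b\<close> stay bounded: otherwise a limit would give \<open>b' = c a'\<close> with \<open>b' \<noteq> 0\<close>.
\<close>

lemma sol_limit:
  assumes sol: "\<And>n. sol (b n) (a n) (d n)"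
  shows "\<exists>(s :: nat \<Rightarrow> nat) c g a' b' d'. strict_mono s \<and> (\<forall>n. c n \<noteq> 0) \<and>
     (\<forall>i\<in>I. (\<lambda>n. c n * a (s n) i) \<longlonglongrightarrow> a' i) \<and>
     (\<forall>i\<in>I. (\<lambda>n. c n * b (s n) i - g n * (c n * a (s n) i)) \<longlonglongrightarrow> b' i) \<and> sol b' a' d'"
proof -
  have "\<exists>p. p \<in> I \<and> a n p \<noteq> 0 \<and> (\<forall>i\<in>I. norm (a n i) \<le> norm (a n p))" for n
    using finite_max_norm[OF finI, of "a n"] sol[of n] by (auto simp: sol_def)
  then obtain p where p: "\<And>n. p n \<in> I" "\<And>n. a n (p n) \<noteq> 0"
      "\<And>n i. i \<in> I \<Longrightarrow> norm (a n i) \<le> norm (a n (p n))" by metis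
  have "\<exists>p. p \<in> I \<and> d n p \<noteq> 0 \<and> (\<forall>i\<in>I. norm (d n i) \<le> norm (d n p))" for n
    using finite_max_norm[OF finI, of "d n"] sol[of n] by (auto simp: sol_def)
  then obtain q where q: "\<And>n. q n \<in> I" "\<And>n. d n (q n) \<noteq> 0"
      "\<And>n i. i \<in> I \<Longrightarrow> norm (d n i) \<le> norm (d n (q n))" by metis
  define c0 where "c0 n = inverse (a n (p n))" for n
  define e0 where "e0 n = inverse (d n (q n))" for n
  define g0 where "g0 n = c0 n * b n (p n)" for n
  define A where "A n i = c0 n * a n i" for n i
  define E where "E n i = e0 n * d n i" for n i
  define G where "G n i = c0 n * b n i - g0 n * (c0 n * a n i)" for n i
  \<comment> \<open>The size of the numerator, kept at least 1 so that dividing by it is harmless.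
    Whether T stays bounded is read off from the limit \<epsilon> of 1 / T.\<close>
  define T where "T n = 1 + (\<Sum>i\<in>I. norm (G n i))" for n
  have T1: "T n \<ge> 1" for n unfolding T_def by (simp add: sum_nonneg)
  have c0: "c0 n \<noteq> 0" and e0: "e0 n \<noteq> 0" for n using p q by (auto simp: c0_def e0_def)
  have solN: "sol (G n) (A n) (E n)" for n
    using sol_normalize[OF sol[of n] c0[of n] e0[of n], of "g0 n"] by (simp add: A_def [abs_def] E_def [abs_def] G_def [abs_def])
  have Ap: "A n (p n) = 1" and Eq: "E n (q n) = 1" and Gp: "G n (p n) = 0" for n
    using p q by (auto simp: A_def E_def G_def c0_def e0_def g0_def)
  have inv_le: "norm (inverse y * x) \<le> 1" if "norm x \<le> norm y" "y \<noteq> 0" for x y :: complex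
  proof -
    have "norm (inverse y * x) = norm x / norm y"
      by (simp add: norm_mult norm_inverse divide_inverse mult.commute)
    then show ?thesis using that by simp
  qed
  have A1: "norm (A n i) \<le> 1" and E1: "norm (E n i) \<le> 1" if "i \<in> I" for n i
    unfolding A_def E_def c0_def e0_def using p q that by (intro inv_le; simp)+
  have G1: "norm (G n i) \<le> T n" if "i \<in> I" for n i
  proof -
    have "norm (G n i) \<le> (\<Sum>i\<in>I. norm (G n i))" using finI that by (intro member_le_sum) auto
    then show ?thesis by (simp add: T_def)
  qed
  \<comment> \<open>The positions p n and q n of the largest coordinates take finitely many values
    and become constant along a subsequence.\<close>
  obtain s1 :: "nat \<Rightarrow> nat" and pq where s1: "strict_mono s1" "\<And>n. (p (s1 n), q (s1 n)) = pq"
    using constant_subseq[of "I \<times> I" "\<lambda>n. (p n, q n)"] finI p q by auto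
  \<comment> \<open>Four bounded families under one index, so that a single subsequence serves them
    all: the tags 0, 1, 2, 3 stand for A, E, G / T and 1 / T.\<close>
  define F where "F n k = (if fst k = (0::nat) then A (s1 n) (snd k)
      else if fst k = 1 then E (s1 n) (snd k)
      else if fst k = 2 then G (s1 n) (snd k) / of_real (T (s1 n)) else 1 / of_real (T (s1 n)))" for n k
  have "norm (F n k) \<le> 1" if "k \<in> {0,1,2,3} \<times> I" for n k
    using that A1 E1 G1 T1[of "s1 n"] by (auto simp: F_def norm_divide field_simps)
  moreover have "finite ({0,1,2,3::nat} \<times> I)" using finI by simp
  ultimately obtain s2 l where s2: "strict_mono s2" "\<And>k. k \<in> {0,1,2,3} \<times> I \<Longrightarrow> (\<lambda>n. F (s2 n) k) \<longlonglongrightarrow> l k"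
    using finite_family_convergent_subseq[of "{0,1,2,3} \<times> I" F 1] by blast
  define s where "s n = s1 (s2 n)" for n
  have s: "strict_mono s" using s1(1) s2(1) by (auto simp: s_def strict_mono_def)
  define p0 q0 where "p0 = fst pq" and "q0 = snd pq"
  have "p (s1 n) = p0" "q (s1 n) = q0" for n using s1(2)[of n] by (auto simp: p0_def q0_def)
  then have pq: "\<And>n. p (s n) = p0" "\<And>n. q (s n) = q0" "p0 \<in> I" "q0 \<in> I"
    unfolding s_def using p(1) q(1) by metis+
  define a' where "a' i = l (0, i)" for i
  define d' where "d' i = l (1, i)" for i
  define h where "h i = l (2, i)" for i
  define \<epsilon> where "\<epsilon> = l (3, p0)"
  have la: "(\<lambda>n. A (s n) i) \<longlonglongrightarrow> a' i" and ld: "(\<lambda>n. E (s n) i) \<longlonglongrightarrow> d' i"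
    and lh: "(\<lambda>n. G (s n) i / of_real (T (s n))) \<longlonglongrightarrow> h i" if "i \<in> I" for i
    using s2(2)[of "(0, i)"] s2(2)[of "(1, i)"] s2(2)[of "(2, i)"] that
    by (simp_all add: F_def s_def a'_def d'_def h_def)
  have l\<epsilon>: "(\<lambda>n. 1 / of_real (T (s n))) \<longlonglongrightarrow> \<epsilon>"
    using s2(2)[of "(3, p0)"] pq by (simp add: F_def s_def \<epsilon>_def)
  have "A (s n) p0 = 1" "E (s n) q0 = 1" "G (s n) p0 = 0" for n
    using Ap[of "s n"] Eq[of "s n"] Gp[of "s n"] pq by simp_all
  then have "a' p0 = 1" "d' q0 = 1" "h p0 = 0"
    using la[OF pq(3)] ld[OF pq(4)] lh[OF pq(3)] by (simp_all add: LIMSEQ_const_iff)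
  then have nz: "\<exists>i\<in>I. a' i \<noteq> 0" "\<exists>i\<in>I. d' i \<noteq> 0"
    using pq(3,4) by (metis zero_neq_one)+
  have lim_eq: "(ev' h w * ev a' w - ev h w * ev' a' w) * ev d' w + \<epsilon> * (r * ev' a' w * ev a' w * ev d' w
        + ev' d' w * (ev a' w)\<^sup>2 - \<kappa> w * (ev a' w)\<^sup>2 * ev d' w) = 0" if w: "w \<in> D" for w
  proof -
    define H where "H n i = inverse (of_real (T (s n))) * G (s n) i" for n i
    have H: "(\<lambda>n. H n i) \<longlonglongrightarrow> h i" if "i \<in> I" for i
      using lh[OF that] by (simp add: H_def divide_inverse mult.commute)
    have "(ev' (H n) w * ev (A (s n)) w - ev (H n) w * ev' (A (s n)) w) * ev (E (s n)) w
       + 1 / of_real (T (s n)) * (r * ev' (A (s n)) w * ev (A (s n)) w * ev (E (s n)) w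
        + ev' (E (s n)) w * (ev (A (s n)) w)\<^sup>2 - \<kappa> w * (ev (A (s n)) w)\<^sup>2 * ev (E (s n)) w) = 0" for n
    proof -
      have eq: "(ev' (G (s n)) w * ev (A (s n)) w - ev (G (s n)) w * ev' (A (s n)) w) * ev (E (s n)) w
        + r * ev' (A (s n)) w * ev (A (s n)) w * ev (E (s n)) w
        + ev' (E (s n)) w * (ev (A (s n)) w)\<^sup>2 - \<kappa> w * (ev (A (s n)) w)\<^sup>2 * ev (E (s n)) w = 0"
        using solN[of "s n"] w by (auto simp: sol_def)
      have "ev (H n) w = inverse (of_real (T (s n))) * ev (G (s n)) w"
        "ev' (H n) w = inverse (of_real (T (s n))) * ev' (G (s n)) w"
        unfolding H_def by (simp_all add: ev_scale)
      then have "(ev' (H n) w * ev (A (s n)) w - ev (H n) w * ev' (A (s n)) w) * ev (E (s n)) w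
       + 1 / of_real (T (s n)) * (r * ev' (A (s n)) w * ev (A (s n)) w * ev (E (s n)) w
        + ev' (E (s n)) w * (ev (A (s n)) w)\<^sup>2 - \<kappa> w * (ev (A (s n)) w)\<^sup>2 * ev (E (s n)) w)
        = inverse (of_real (T (s n))) * ((ev' (G (s n)) w * ev (A (s n)) w - ev (G (s n)) w * ev' (A (s n)) w) * ev (E (s n)) w
        + r * ev' (A (s n)) w * ev (A (s n)) w * ev (E (s n)) w
        + ev' (E (s n)) w * (ev (A (s n)) w)\<^sup>2 - \<kappa> w * (ev (A (s n)) w)\<^sup>2 * ev (E (s n)) w)"
        by (simp add: divide_inverse algebra_simps)
      then show ?thesis unfolding eq by simp
    qed
    moreover have "(\<lambda>n. (ev' (H n) w * ev (A (s n)) w - ev (H n) w * ev' (A (s n)) w) * ev (E (s n)) w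
       + 1 / of_real (T (s n)) * (r * ev' (A (s n)) w * ev (A (s n)) w * ev (E (s n)) w
        + ev' (E (s n)) w * (ev (A (s n)) w)\<^sup>2 - \<kappa> w * (ev (A (s n)) w)\<^sup>2 * ev (E (s n)) w))
      \<longlonglongrightarrow> (ev' h w * ev a' w - ev h w * ev' a' w) * ev d' w + \<epsilon> * (r * ev' a' w * ev a' w * ev d' w
        + ev' d' w * (ev a' w)\<^sup>2 - \<kappa> w * (ev a' w)\<^sup>2 * ev d' w)"
      by (intro tendsto_intros ev_tendsto la ld H l\<epsilon>)
    ultimately show ?thesis by (simp add: LIMSEQ_const_iff)
  qed
  \<comment> \<open>For \<epsilon> = 0 the limit equation says that the Wronskian of h and a'
    vanishes, so h = c a'. At p0, where h is 0 and a' is 1, this gives c = 0 and thus h = 0; but the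
    norms of the coordinates of G / T add up to 1 - 1 / T.\<close>
  have "\<epsilon> \<noteq> 0"
  proof
    assume "\<epsilon> = 0"
    then obtain c where c: "\<forall>i\<in>I. h i = c * a' i"
      using wronskian_zero[OF nz, of h] lim_eq by auto
    with \<open>a' p0 = 1\<close> \<open>h p0 = 0\<close> pq have "c = 0" by auto
    with c have "h i = 0" if "i \<in> I" for i using that by simp
    then have "(\<lambda>n. \<Sum>i\<in>I. norm (G (s n) i / of_real (T (s n)))) \<longlonglongrightarrow> (\<Sum>i\<in>I. norm (0::complex))"
      using lh by (intro tendsto_sum tendsto_norm) simp
    moreover have "(\<Sum>i\<in>I. norm (G n i / of_real (T n))) = 1 - norm (1 / complex_of_real (T n))" for n
    proof -
      have nT: "norm (complex_of_real (T n)) = T n" using T1[of n] by simp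
      have "(\<Sum>i\<in>I. norm (G n i)) = T n - 1" by (simp add: T_def)
      then have "(\<Sum>i\<in>I. norm (G n i / of_real (T n))) = (T n - 1) / T n"
        unfolding norm_divide nT by (simp flip: sum_divide_distrib)
      then show ?thesis using T1[of n] unfolding norm_divide nT by (simp add: field_simps)
    qed
    moreover have "(\<lambda>n. 1 - norm (1 / complex_of_real (T (s n)))) \<longlonglongrightarrow> 1 - norm \<epsilon>"
      using l\<epsilon> by (intro tendsto_intros)
    ultimately have "1 - norm \<epsilon> = 0" using LIMSEQ_unique by fastforce
    then show False using \<open>\<epsilon> = 0\<close> by simp
  qed
  define b' where "b' i = inverse \<epsilon> * h i" for i
  have lb: "(\<lambda>n. G (s n) i) \<longlonglongrightarrow> b' i" if "i \<in> I" for i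
  proof -
    have "(\<lambda>n. (G (s n) i / of_real (T (s n))) / (1 / of_real (T (s n)))) \<longlonglongrightarrow> h i / \<epsilon>"
      by (intro tendsto_divide lh l\<epsilon> that \<open>\<epsilon> \<noteq> 0\<close>)
    moreover have "(G n i / of_real (T n)) / (1 / of_real (T n)) = G n i" for n
      using T1[of n] by simp
    ultimately show ?thesis by (simp add: b'_def divide_inverse[of "h i"] mult.commute)
  qed
  have "sol b' a' d'"
    unfolding sol_def
  proof (intro conjI ballI nz)
    fix w assume w: "w \<in> D"
    have "ev b' w = inverse \<epsilon> * ev h w" "ev' b' w = inverse \<epsilon> * ev' h w"
      unfolding b'_def by (simp_all add: ev_scale)
    then have h: "ev h w = \<epsilon> * ev b' w" "ev' h w = \<epsilon> * ev' b' w" using \<open>\<epsilon> \<noteq> 0\<close> by auto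
    have "\<epsilon> * ((ev' b' w * ev a' w - ev b' w * ev' a' w) * ev d' w + (r * ev' a' w * ev a' w * ev d' w
        + ev' d' w * (ev a' w)\<^sup>2 - \<kappa> w * (ev a' w)\<^sup>2 * ev d' w)) = 0"
      using lim_eq[OF w] unfolding h by (simp add: algebra_simps)
    then have "(ev' b' w * ev a' w - ev b' w * ev' a' w) * ev d' w + (r * ev' a' w * ev a' w * ev d' w
        + ev' d' w * (ev a' w)\<^sup>2 - \<kappa> w * (ev a' w)\<^sup>2 * ev d' w) = 0"
      using \<open>\<epsilon> \<noteq> 0\<close> by (simp only: mult_eq_0_iff) simp
    then show "(ev' b' w * ev a' w - ev b' w * ev' a' w) * ev d' w + r * ev' a' w * ev a' w * ev d' w
        + ev' d' w * (ev a' w)\<^sup>2 = \<kappa> w * (ev a' w)\<^sup>2 * ev d' w"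
      by (simp add: algebra_simps)
  qed
  moreover have "\<forall>i\<in>I. (\<lambda>n. c0 (s n) * a (s n) i) \<longlonglongrightarrow> a' i"
    using la unfolding A_def by blast
  moreover have "\<forall>i\<in>I. (\<lambda>n. c0 (s n) * b (s n) i - g0 (s n) * (c0 (s n) * a (s n) i)) \<longlonglongrightarrow> b' i"
    using lb unfolding G_def by blast
  ultimately show ?thesis
    using s c0
    by (intro exI[of _ s] exI[of _ "\<lambda>n. c0 (s n)"] exI[of _ "\<lambda>n. g0 (s n)"] exI[of _ a'] exI[of _ b'] exI[of _ d'] conjI allI)
qed

text \<open>The function of a n may be tiny at w, but that of the limit a' has no zeros on a small
  circle around w. There the quotients are bounded; they extend holomorphically by
  \<open>sol_quotient\<close>, so the maximum modulus principle carries the bound to w.\<close>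

lemma sol_values_bounded:
  assumes sol: "\<And>n. sol (b n) (a n) (d n)" and nz: "\<exists>i\<in>I. a' i \<noteq> 0"
    and la: "\<And>i. i \<in> I \<Longrightarrow> (\<lambda>n. a n i) \<longlonglongrightarrow> a' i" and lb: "\<And>i. i \<in> I \<Longrightarrow> (\<lambda>n. b n i) \<longlonglongrightarrow> b' i"
    and w: "w \<in> D"
  shows "\<exists>K. \<forall>\<^sub>F n in sequentially. ev (a n) w \<noteq> 0 \<longrightarrow> norm (ev (b n) w / ev (a n) w) \<le> K"
proof -
  obtain z where z: "z \<in> D" "ev a' z \<noteq> 0" using ev_nonzero[OF nz] by auto
  have "\<forall>\<^sub>F x in at w. ev a' x \<noteq> 0 \<and> x \<in> D"
    by (rule non_zero_neighbour_alt[OF hol_ev D w z])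
  then obtain \<delta> where \<delta>: "\<delta> > 0" "\<And>x. x \<noteq> w \<Longrightarrow> dist x w < \<delta> \<Longrightarrow> ev a' x \<noteq> 0 \<and> x \<in> D"
    unfolding eventually_at by auto
  define \<rho> where "\<rho> = \<delta> / 2"
  have \<rho>: "\<rho> > 0" "\<rho> < \<delta>" using \<delta> by (auto simp: \<rho>_def)
  have sub: "cball w \<rho> \<subseteq> D"
  proof
    fix x assume "x \<in> cball w \<rho>"
    then show "x \<in> D" using \<delta>(2)[of x] w \<rho> by (cases "x = w") (auto simp: dist_commute)
  qed
  have sphD: "sphere w \<rho> \<subseteq> D" using sub sphere_cball by blast
  have cont: "continuous_on (sphere w \<rho>) (ev e)" for e
    using holomorphic_on_imp_continuous_on[OF hol_ev] continuous_on_subset sphD by blast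
  have "\<exists>x\<in>sphere w \<rho>. \<forall>y\<in>sphere w \<rho>. norm (ev a' x) \<le> norm (ev a' y)"
    using \<rho> by (intro continuous_attains_inf continuous_intros cont) auto
  then obtain x0 where x0: "x0 \<in> sphere w \<rho>" "\<And>y. y \<in> sphere w \<rho> \<Longrightarrow> norm (ev a' x0) \<le> norm (ev a' y)" by auto
  define m where "m = norm (ev a' x0)"
  have "x0 \<noteq> w" "dist x0 w < \<delta>" using x0(1) \<rho> by (auto simp: dist_commute)
  then have m: "m > 0" using \<delta>(2) by (simp add: m_def)
  have "\<exists>M. \<forall>x\<in>sphere w \<rho>. norm (\<phi> i x) \<le> M" if "i \<in> I" for i
  proof -
    have "compact (\<phi> i ` sphere w \<rho>)"
      using holomorphic_on_imp_continuous_on[OF hol[OF that]] continuous_on_subset sphD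
      by (intro compact_continuous_image) auto
    then have "bounded (\<phi> i ` sphere w \<rho>)" by (rule compact_imp_bounded)
    then obtain M where "\<forall>y\<in>\<phi> i ` sphere w \<rho>. norm y \<le> M" unfolding bounded_iff ..
    then show ?thesis by (intro exI[of _ M]) simp
  qed
  then obtain M where M: "\<And>i x. i \<in> I \<Longrightarrow> x \<in> sphere w \<rho> \<Longrightarrow> norm (\<phi> i x) \<le> M i" by metis
  have bd: "norm (ev e x) \<le> (\<Sum>i\<in>I. norm (e i) * M i)" if "x \<in> sphere w \<rho>" for e x
    unfolding ev_def using M that
    by (intro order_trans[OF norm_sum] sum_mono) (auto simp: norm_mult intro: mult_left_mono)
  have "(\<lambda>n. \<Sum>i\<in>I. norm (a n i - a' i) * M i) \<longlonglongrightarrow> (\<Sum>i\<in>I. norm (a' i - a' i) * M i)"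
    using la by (intro tendsto_intros)
  then have ev1: "\<forall>\<^sub>F n in sequentially. (\<Sum>i\<in>I. norm (a n i - a' i) * M i) < m / 2"
    using m by (intro order_tendstoD(2)) auto
  have "(\<lambda>n. \<Sum>i\<in>I. norm (b n i) * M i) \<longlonglongrightarrow> (\<Sum>i\<in>I. norm (b' i) * M i)"
    using lb by (intro tendsto_intros)
  then have ev2: "\<forall>\<^sub>F n in sequentially. (\<Sum>i\<in>I. norm (b n i) * M i) < (\<Sum>i\<in>I. norm (b' i) * M i) + 1"
    by (intro order_tendstoD(2)) auto
  \<comment> \<open>Eventually the denominators stay above m / 2 on the circle, and the numerators
    below the bound for b' plus 1.\<close>
  define K where "K = ((\<Sum>i\<in>I. norm (b' i) * M i) + 1) / (m / 2)"
  have "\<forall>\<^sub>F n in sequentially. ev (a n) w \<noteq> 0 \<longrightarrow> norm (ev (b n) w / ev (a n) w) \<le> K"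
    using ev1 ev2
  proof eventually_elim
    case (elim n)
    obtain R where R: "R holomorphic_on D" "\<And>w. w \<in> D \<Longrightarrow> ev (b n) w = ev (a n) w * R w"
      using sol_quotient[OF sol[of n]] by auto
    have "norm (R x) \<le> K" if x: "x \<in> sphere w \<rho>" for x
    proof -
      have "norm (ev a' x) - norm (ev (a n) x) \<le> norm (ev (a n) x - ev a' x)"
        using norm_triangle_ineq2[of "ev a' x" "ev (a n) x"] by (simp add: norm_minus_commute)
      also have "\<dots> \<le> (\<Sum>i\<in>I. norm (a n i - a' i) * M i)"
        using bd[OF x, of "\<lambda>i. a n i - a' i"] by (simp add: ev_diff)
      finally have "norm (ev (a n) x) \<ge> m / 2" using elim(1) x0(2)[OF x] by (simp add: m_def)
      moreover have "norm (ev (b n) x) \<le> (\<Sum>i\<in>I. norm (b' i) * M i) + 1"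
        using bd[OF x, of "b n"] elim(2) by linarith
      moreover from order_trans[OF norm_ge_zero this] have "0 \<le> (\<Sum>i\<in>I. norm (b' i) * M i) + 1" .
      ultimately have "norm (ev (b n) x / ev (a n) x) \<le> K"
        unfolding K_def norm_divide using m by (intro frac_le) simp_all
      moreover have "ev (a n) x \<noteq> 0" using \<open>norm (ev (a n) x) \<ge> m / 2\<close> m by auto
      ultimately show ?thesis using R(2)[of x] x sphD by (simp add: subset_eq)
    qed
    moreover have "R holomorphic_on cball w \<rho>" using R(1) sub by (rule holomorphic_on_subset)
    ultimately have "norm (R w) \<le> K"
      using \<rho>(1) by (intro maximum_modulus_frontier[of R "cball w \<rho>" K w])
        (simp_all add: holomorphic_on_imp_continuous_on holomorphic_on_subset[OF _ ball_subset_cball])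
    then show ?case using R(2)[OF w] by auto
  qed
  then show ?thesis by blast
qed

text \<open>A difference of b / a at two points does not see the multiples of a that
  \<open>sol_limit\<close> subtracts from b. Solutions with unbounded differences would have bounded
  values at both points after normalization, along a subsequence.\<close>

lemma sol_ratio_difference_bounded:
  assumes w: "w0 \<in> D" "w1 \<in> D"
  shows "\<exists>K. \<forall>b a d. sol b a d \<longrightarrow> ev a w0 \<noteq> 0 \<longrightarrow> ev a w1 \<noteq> 0 \<longrightarrow>
    norm (ev b w1 / ev a w1 - ev b w0 / ev a w0) \<le> K"
proof (rule ccontr)
  assume "\<not> ?thesis"
  then have "\<forall>n::nat. \<exists>b a d. sol b a d \<and> ev a w0 \<noteq> 0 \<and> ev a w1 \<noteq> 0 \<and>
    real n < norm (ev b w1 / ev a w1 - ev b w0 / ev a w0)" by (metis not_le)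
  then obtain b a d where sol: "\<And>n. sol (b n) (a n) (d n)"
    and nz: "\<And>n. ev (a n) w0 \<noteq> 0" "\<And>n. ev (a n) w1 \<noteq> 0"
    and big: "\<And>n::nat. real n < norm (ev (b n) w1 / ev (a n) w1 - ev (b n) w0 / ev (a n) w0)" by metis
  obtain s c g a' b' d' where s: "strict_mono s" and c: "\<And>n. c n \<noteq> 0"
    and la: "\<And>i. i \<in> I \<Longrightarrow> (\<lambda>n. c n * a (s n) i) \<longlonglongrightarrow> a' i"
    and lb: "\<And>i. i \<in> I \<Longrightarrow> (\<lambda>n. c n * b (s n) i - g n * (c n * a (s n) i)) \<longlonglongrightarrow> b' i"
    and sol': "sol b' a' d'"
    using sol_limit[of b a d, OF sol] by blast
  define A where "A n i = c n * a (s n) i" for n i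
  define B where "B n i = c n * b (s n) i - g n * (c n * a (s n) i)" for n i
  have solN: "sol (B n) (A n) (\<lambda>i. 1 * d (s n) i)" for n
    using sol_normalize[OF sol[of "s n"] c[of n], of 1 "g n"] by (simp add: A_def [abs_def] B_def [abs_def])
  have nz': "\<exists>i\<in>I. a' i \<noteq> 0" using sol' by (auto simp: sol_def)
  have bd: "\<exists>K. \<forall>\<^sub>F n in sequentially. ev (A n) w \<noteq> 0 \<longrightarrow> norm (ev (B n) w / ev (A n) w) \<le> K"
    if "w \<in> D" for w
    by (rule sol_values_bounded[where a = A and b = B and a' = a' and b' = b', OF solN nz' _ _ that])
      (simp_all add: A_def B_def la lb)
  obtain K0 K1
    where K: "\<forall>\<^sub>F n in sequentially. ev (A n) w0 \<noteq> 0 \<longrightarrow> norm (ev (B n) w0 / ev (A n) w0) \<le> K0"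
      "\<forall>\<^sub>F n in sequentially. ev (A n) w1 \<noteq> 0 \<longrightarrow> norm (ev (B n) w1 / ev (A n) w1) \<le> K1"
    using bd[OF w(1)] bd[OF w(2)] by (elim exE)
  have evA: "ev (A n) w = c n * ev (a (s n)) w" and
    evB: "ev (B n) w = c n * ev (b (s n)) w - g n * (c n * ev (a (s n)) w)" for n w
    unfolding A_def B_def ev_diff ev_scale by (rule refl)+
  have quo: "ev (B n) w / ev (A n) w = ev (b (s n)) w / ev (a (s n)) w - g n"
    if "ev (a (s n)) w \<noteq> 0" for n w
    using that c[of n] by (simp add: evA evB field_simps)
  have "\<forall>\<^sub>F n in sequentially. real n < K0 + K1" using K
  proof eventually_elim
    case (elim n)
    have "norm (ev (B n) w0 / ev (A n) w0) \<le> K0" "norm (ev (B n) w1 / ev (A n) w1) \<le> K1"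
      using elim nz[of "s n"] c[of n] by (simp_all add: evA)
    then have "norm (ev (B n) w1 / ev (A n) w1 - ev (B n) w0 / ev (A n) w0) \<le> K0 + K1"
      using norm_triangle_ineq4[of "ev (B n) w1 / ev (A n) w1" "ev (B n) w0 / ev (A n) w0"] by linarith
    then have "norm (ev (b (s n)) w1 / ev (a (s n)) w1 - ev (b (s n)) w0 / ev (a (s n)) w0) \<le> K0 + K1"
      using nz[of "s n"] by (simp add: quo)
    with big[of "s n"] have "real (s n) < K0 + K1" by linarith
    then show ?case using seq_suble[OF s, of n] by linarith
  qed
  moreover have "\<forall>\<^sub>F n in sequentially. K0 + K1 \<le> real n"
    using filterlim_real_sequentially unfolding filterlim_at_top by blast
  ultimately have "\<forall>\<^sub>F n::nat in sequentially. False" by eventually_elim auto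
  then show False by simp
qed

text \<open>The assumption concerns a ratio, which normalization does not change; so the limit
  solution vanishes at w1, and \<open>sol_zero_rational\<close> applies.\<close>

lemma sol_degenerate_rational:
  assumes sol: "\<And>n. sol (b n) (a n) (d n)" and w: "w0 \<in> D" "w1 \<in> D"
    and nz: "\<And>n. ev (a n) w0 \<noteq> 0" and lim: "(\<lambda>n. ev (a n) w1 / ev (a n) w0) \<longlonglongrightarrow> 0"
  shows "\<exists>m l::nat. m > 0 \<and> r * of_nat m + of_nat l = 0"
proof -
  obtain s c g a' b' d' where s: "strict_mono s" and c: "\<And>n. c n \<noteq> (0::complex)"
    and la: "\<And>i. i \<in> I \<Longrightarrow> (\<lambda>n. c n * a (s n) i) \<longlonglongrightarrow> a' i" and sol': "sol b' a' d'"
    using sol_limit[of b a d, OF sol] by blast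
  have l: "(\<lambda>n. c n * ev (a (s n)) w) \<longlonglongrightarrow> ev a' w" for w
    using ev_tendsto(1)[where a = "\<lambda>n i. c n * a (s n) i" and w = w, OF la] by (simp add: ev_scale)
  have "(\<lambda>n. ev (a (s n)) w1 / ev (a (s n)) w0) \<longlonglongrightarrow> 0"
    using LIMSEQ_subseq_LIMSEQ[OF lim s] by (simp add: o_def)
  then have "(\<lambda>n. ev (a (s n)) w1 / ev (a (s n)) w0 * (c n * ev (a (s n)) w0)) \<longlonglongrightarrow> 0 * ev a' w0"
    by (intro tendsto_mult l)
  moreover have "ev (a (s n)) w1 / ev (a (s n)) w0 * (c n * ev (a (s n)) w0) = c n * ev (a (s n)) w1" for n
    using nz[of "s n"] by simp
  ultimately have "ev a' w1 = 0" using LIMSEQ_unique[OF l[of w1]] by simp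
  then show ?thesis using sol_zero_rational[OF sol' w(2)] by blast
qed

end

section \<open>Functions of finite rank\<close>

text \<open>Finite sums of products \<phi>(w) \<eta>(s), where s takes the place of the conjugate of
  w. Equality is asked only on the bidisc, so values outside it never matter.\<close>

inductive fr2 :: "real \<Rightarrow> (complex \<Rightarrow> complex \<Rightarrow> complex) \<Rightarrow> bool" for \<rho> where
  fr2_prod: "\<phi> holomorphic_on ball 0 \<rho> \<Longrightarrow> \<eta> holomorphic_on ball 0 \<rho> \<Longrightarrow>
     (\<And>w s. w \<in> ball 0 \<rho> \<Longrightarrow> s \<in> ball 0 \<rho> \<Longrightarrow> G w s = \<phi> w * \<eta> s) \<Longrightarrow> fr2 \<rho> G"
| fr2_sum2: "fr2 \<rho> F \<Longrightarrow> fr2 \<rho> G \<Longrightarrow>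
     (\<And>w s. w \<in> ball 0 \<rho> \<Longrightarrow> s \<in> ball 0 \<rho> \<Longrightarrow> H w s = F w s + G w s) \<Longrightarrow> fr2 \<rho> H"

lemma fr2_left: "\<phi> holomorphic_on ball 0 \<rho> \<Longrightarrow> fr2 \<rho> (\<lambda>w s. \<phi> w)"
  by (rule fr2_prod[where \<eta> = "\<lambda>_. 1"]) auto

lemma fr2_right: "\<eta> holomorphic_on ball 0 \<rho> \<Longrightarrow> fr2 \<rho> (\<lambda>w s. \<eta> s)"
  by (rule fr2_prod[where \<phi> = "\<lambda>_. 1"]) auto

lemma fr2_const: "fr2 \<rho> (\<lambda>w s. c)"
  by (rule fr2_left) simp

lemma fr2_add: "fr2 \<rho> F \<Longrightarrow> fr2 \<rho> G \<Longrightarrow> fr2 \<rho> (\<lambda>w s. F w s + G w s)"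
  by (rule fr2_sum2) auto

lemma fr2_mult: "fr2 \<rho> F \<Longrightarrow> fr2 \<rho> G \<Longrightarrow> fr2 \<rho> (\<lambda>w s. F w s * G w s)"
proof (induction F rule: fr2.induct)
  case (fr2_prod \<phi> \<eta> F)
  from fr2_prod(4) show ?case
  proof (induction G rule: fr2.induct)
    case (fr2_prod \<phi>' \<eta>' G)
    then show ?case using \<open>\<phi> holomorphic_on _\<close> \<open>\<eta> holomorphic_on _\<close> \<open>\<And>w s. _ \<Longrightarrow> _ \<Longrightarrow> F w s = _\<close>
      by (intro fr2.fr2_prod[where \<phi> = "\<lambda>w. \<phi> w * \<phi>' w" and \<eta> = "\<lambda>s. \<eta> s * \<eta>' s"])
        (auto intro!: holomorphic_intros)
  next
    case (fr2_sum2 G1 G2 H)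
    then show ?case by (intro fr2.fr2_sum2[OF fr2_sum2(4,5)]) (auto simp: algebra_simps)
  qed
next
  case (fr2_sum2 F1 F2 H)
  then show ?case
    by (intro fr2.fr2_sum2[OF fr2_sum2(4)[OF fr2_sum2(6)] fr2_sum2(5)[OF fr2_sum2(6)]]) (simp add: distrib_right)
qed

lemma fr2_minus: "fr2 \<rho> F \<Longrightarrow> fr2 \<rho> (\<lambda>w s. - F w s)"
  using fr2_mult[OF fr2_const[of \<rho> "-1"], of F] by simp

lemma fr2_diff: "fr2 \<rho> F \<Longrightarrow> fr2 \<rho> G \<Longrightarrow> fr2 \<rho> (\<lambda>w s. F w s - G w s)"
  using fr2_add[OF _ fr2_minus, of \<rho> F G] by simp

lemma fr2_sum: "(\<And>i. i \<in> I \<Longrightarrow> fr2 \<rho> (F i)) \<Longrightarrow> fr2 \<rho> (\<lambda>w s. \<Sum>i\<in>I. F i w s)"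
  by (induction I rule: infinite_finite_induct) (auto intro: fr2_add fr2_const)

lemma fr2_power: "fr2 \<rho> F \<Longrightarrow> fr2 \<rho> (\<lambda>w s. F w s ^ n)"
  by (induction n) (auto intro: fr2_mult fr2_const)

lemma fr2_subset: "fr2 \<rho> F \<Longrightarrow> \<rho>' \<le> \<rho> \<Longrightarrow> fr2 \<rho>' F"
proof (induction F rule: fr2.induct)
  case (fr2_prod \<phi> \<eta> G)
  have "ball 0 \<rho>' \<subseteq> ball (0::complex) \<rho>" using fr2_prod by auto
  then show ?case using fr2_prod by (intro fr2.fr2_prod[of \<phi> \<rho>' \<eta>]) (auto intro: holomorphic_on_subset)
next
  case (fr2_sum2 F G H)
  have "ball 0 \<rho>' \<subseteq> ball (0::complex) \<rho>" using fr2_sum2 by auto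
  then show ?case
    using fr2_sum2(3) by (intro fr2.fr2_sum2[OF fr2_sum2(4)[OF fr2_sum2(6)] fr2_sum2(5)[OF fr2_sum2(6)]]) blast
qed

lemma cnj_ball: "cnj ` ball 0 \<rho> = ball 0 \<rho>"
proof (intro equalityI subsetI)
  fix z :: complex assume "z \<in> ball 0 \<rho>"
  then have "cnj z \<in> ball 0 \<rho>" by simp
  then have "cnj (cnj z) \<in> cnj ` ball 0 \<rho>" by (rule imageI)
  then show "z \<in> cnj ` ball 0 \<rho>" by simp
qed auto

text \<open>Conjugation exchanges the roles of the two factors; on the diagonal s = cnj w the new
  function is the conjugate of F.\<close>

lemma fr2_cnj: "fr2 \<rho> F \<Longrightarrow> fr2 \<rho> (\<lambda>w s. cnj (F (cnj s) (cnj w)))"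
proof (induction F rule: fr2.induct)
  case (fr2_prod \<phi> \<eta> G)
  have "cnj \<circ> \<phi> \<circ> cnj holomorphic_on ball 0 \<rho>" "cnj \<circ> \<eta> \<circ> cnj holomorphic_on ball 0 \<rho>"
    using fr2_prod by (auto intro!: holomorphic_on_compose_cnj_cnj simp: cnj_ball)
  then show ?case using fr2_prod
    by (intro fr2.fr2_prod[of "cnj \<circ> \<eta> \<circ> cnj" \<rho> "cnj \<circ> \<phi> \<circ> cnj"]) auto
next
  case (fr2_sum2 F G H)
  then show ?case by (intro fr2.fr2_sum2[OF fr2_sum2(4,5)]) auto
qed

section \<open>Partial derivatives and polarization\<close>

definition D1 :: "(complex \<Rightarrow> complex \<Rightarrow> complex) \<Rightarrow> complex \<Rightarrow> complex \<Rightarrow> complex" where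
  "D1 G w s = deriv (\<lambda>w. G w s) w"

definition D2 :: "(complex \<Rightarrow> complex \<Rightarrow> complex) \<Rightarrow> complex \<Rightarrow> complex \<Rightarrow> complex" where
  "D2 G w s = deriv (\<lambda>s. G w s) s"

lemma fr2_holomorphic:
  "fr2 \<rho> G \<Longrightarrow> s \<in> ball 0 \<rho> \<Longrightarrow> (\<lambda>w. G w s) holomorphic_on ball 0 \<rho>"
  "fr2 \<rho> G \<Longrightarrow> w \<in> ball 0 \<rho> \<Longrightarrow> (\<lambda>s. G w s) holomorphic_on ball 0 \<rho>"
proof -
  show "(\<lambda>w. G w s) holomorphic_on ball 0 \<rho>" if "fr2 \<rho> G" "s \<in> ball 0 \<rho>"
    using that
  proof (induction G rule: fr2.induct)
    case (fr2_prod \<phi> \<eta> G)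
    then have "(\<lambda>w. \<phi> w * \<eta> s) holomorphic_on ball 0 \<rho>" by (intro holomorphic_intros) auto
    then show ?case by (rule holomorphic_transform) (use fr2_prod in auto)
  next
    case (fr2_sum2 F G H)
    then have "(\<lambda>w. F w s + G w s) holomorphic_on ball 0 \<rho>" by (intro holomorphic_intros) auto
    then show ?case by (rule holomorphic_transform) (use fr2_sum2 in auto)
  qed
  show "(\<lambda>s. G w s) holomorphic_on ball 0 \<rho>" if "fr2 \<rho> G" "w \<in> ball 0 \<rho>"
    using that
  proof (induction G rule: fr2.induct)
    case (fr2_prod \<phi> \<eta> G)
    then have "(\<lambda>s. \<phi> w * \<eta> s) holomorphic_on ball 0 \<rho>" by (intro holomorphic_intros) auto
    then show ?case by (rule holomorphic_transform) (use fr2_prod in auto)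
  next
    case (fr2_sum2 F G H)
    then have "(\<lambda>s. F w s + G w s) holomorphic_on ball 0 \<rho>" by (intro holomorphic_intros) auto
    then show ?case by (rule holomorphic_transform) (use fr2_sum2 in auto)
  qed
qed

lemma D_prod:
  assumes "\<phi> holomorphic_on ball 0 \<rho>" "\<eta> holomorphic_on ball 0 \<rho>"
    "\<And>w s. w \<in> ball 0 \<rho> \<Longrightarrow> s \<in> ball 0 \<rho> \<Longrightarrow> G w s = \<phi> w * \<eta> s"
    and "w \<in> ball 0 \<rho>" "s \<in> ball 0 \<rho>"
  shows "D1 G w s = deriv \<phi> w * \<eta> s" "D2 G w s = \<phi> w * deriv \<eta> s"
proof -
  have "((\<lambda>w. \<phi> w * \<eta> s) has_field_derivative deriv \<phi> w * \<eta> s) (at w)"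
    by (intro DERIV_cmult_right holomorphic_derivI[OF assms(1)]) (use assms in auto)
  then have "((\<lambda>w. G w s) has_field_derivative deriv \<phi> w * \<eta> s) (at w)"
    by (rule has_field_derivative_transform_within_open[of _ _ _ "ball 0 \<rho>"]) (use assms in auto)
  then show "D1 G w s = deriv \<phi> w * \<eta> s" unfolding D1_def by (rule DERIV_imp_deriv)
  have "((\<lambda>s. \<phi> w * \<eta> s) has_field_derivative \<phi> w * deriv \<eta> s) (at s)"
    by (intro DERIV_cmult holomorphic_derivI[OF assms(2)]) (use assms in auto)
  then have "((\<lambda>s. G w s) has_field_derivative \<phi> w * deriv \<eta> s) (at s)"
    by (rule has_field_derivative_transform_within_open[of _ _ _ "ball 0 \<rho>"]) (use assms in auto)
  then show "D2 G w s = \<phi> w * deriv \<eta> s" unfolding D2_def by (rule DERIV_imp_deriv)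
qed

lemma fr2_DERIV:
  assumes "fr2 \<rho> G" "w \<in> ball 0 \<rho>" "s \<in> ball 0 \<rho>"
  shows "((\<lambda>w. G w s) has_field_derivative D1 G w s) (at w)"
    "((\<lambda>s. G w s) has_field_derivative D2 G w s) (at s)"
  unfolding D1_def D2_def
  using holomorphic_derivI[OF fr2_holomorphic(1)[OF assms(1,3)] open_ball assms(2)]
    holomorphic_derivI[OF fr2_holomorphic(2)[OF assms(1,2)] open_ball assms(3)] by blast+

lemma D_sum2:
  assumes "fr2 \<rho> F" "fr2 \<rho> G"
    "\<And>w s. w \<in> ball 0 \<rho> \<Longrightarrow> s \<in> ball 0 \<rho> \<Longrightarrow> H w s = F w s + G w s"
    and "w \<in> ball 0 \<rho>" "s \<in> ball 0 \<rho>"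
  shows "D1 H w s = D1 F w s + D1 G w s" "D2 H w s = D2 F w s + D2 G w s"
proof -
  have "((\<lambda>w. F w s + G w s) has_field_derivative D1 F w s + D1 G w s) (at w)"
    using assms by (intro DERIV_add fr2_DERIV) auto
  then have "((\<lambda>w. H w s) has_field_derivative D1 F w s + D1 G w s) (at w)"
    by (rule has_field_derivative_transform_within_open[of _ _ _ "ball 0 \<rho>"]) (use assms in auto)
  then show "D1 H w s = D1 F w s + D1 G w s" unfolding D1_def[of H] by (rule DERIV_imp_deriv)
  have "((\<lambda>s. F w s + G w s) has_field_derivative D2 F w s + D2 G w s) (at s)"
    using assms by (intro DERIV_add fr2_DERIV) auto
  then have "((\<lambda>s. H w s) has_field_derivative D2 F w s + D2 G w s) (at s)"
    by (rule has_field_derivative_transform_within_open[of _ _ _ "ball 0 \<rho>"]) (use assms in auto)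
  then show "D2 H w s = D2 F w s + D2 G w s" unfolding D2_def[of H] by (rule DERIV_imp_deriv)
qed

lemma fr2_D: "fr2 \<rho> G \<Longrightarrow> fr2 \<rho> (D1 G)" "fr2 \<rho> G \<Longrightarrow> fr2 \<rho> (D2 G)"
proof -
  show "fr2 \<rho> (D1 G)" if "fr2 \<rho> G" using that
  proof (induction G rule: fr2.induct)
    case (fr2_prod \<phi> \<eta> G)
    then show ?case
      using D_prod(1)[OF fr2_prod] by (intro fr2.fr2_prod[of "deriv \<phi>" \<rho> \<eta>] holomorphic_deriv) auto
  next
    case (fr2_sum2 F G H)
    then show ?case using D_sum2(1)[OF fr2_sum2(1,2,3)] by (intro fr2.fr2_sum2[OF fr2_sum2(4,5)]) auto
  qed
  show "fr2 \<rho> (D2 G)" if "fr2 \<rho> G" using that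
  proof (induction G rule: fr2.induct)
    case (fr2_prod \<phi> \<eta> G)
    then show ?case
      using D_prod(2)[OF fr2_prod] by (intro fr2.fr2_prod[of \<phi> \<rho> "deriv \<eta>"] holomorphic_deriv) auto
  next
    case (fr2_sum2 F G H)
    then show ?case using D_sum2(2)[OF fr2_sum2(1,2,3)] by (intro fr2.fr2_sum2[OF fr2_sum2(4,5)]) auto
  qed
qed

lemma D_commute:
  "fr2 \<rho> G \<Longrightarrow> w \<in> ball 0 \<rho> \<Longrightarrow> s \<in> ball 0 \<rho> \<Longrightarrow> D2 (D1 G) w s = D1 (D2 G) w s"
proof (induction G rule: fr2.induct)
  case (fr2_prod \<phi> \<eta> G)
  have "D2 (D1 G) w s = deriv \<phi> w * deriv \<eta> s"
    using fr2_prod by (intro D_prod(2)[of _ \<rho>] D_prod(1)[of _ \<rho>] holomorphic_deriv) auto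
  moreover have "D1 (D2 G) w s = deriv \<phi> w * deriv \<eta> s"
    using fr2_prod by (intro D_prod(1)[of _ \<rho>] D_prod(2)[of _ \<rho>] holomorphic_deriv) auto
  ultimately show ?case by simp
next
  case (fr2_sum2 F G H)
  have "D2 (D1 H) w s = D2 (D1 F) w s + D2 (D1 G) w s"
    using fr2_sum2 by (intro D_sum2(2)[of \<rho>] D_sum2(1)[of \<rho>] fr2_D) auto
  moreover have "D1 (D2 H) w s = D1 (D2 F) w s + D1 (D2 G) w s"
    using fr2_sum2 by (intro D_sum2(1)[of \<rho>] D_sum2(2)[of \<rho>] fr2_D) auto
  ultimately show ?case using fr2_sum2 by simp
qed

text \<open>On the diagonal the two partial derivatives become the Wirtinger derivatives. Through
  this, equations in t translate into equations in w and s.\<close>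

lemma fr2_diagonal_has_derivative:
  "fr2 \<rho> G \<Longrightarrow> t \<in> ball 0 \<rho> \<Longrightarrow>
    ((\<lambda>t. G t (cnj t)) has_derivative (\<lambda>h. D1 G t (cnj t) * h + D2 G t (cnj t) * cnj h)) (at t)"
proof (induction G rule: fr2.induct)
  case (fr2_prod \<phi> \<eta> G)
  have ct: "cnj t \<in> ball 0 \<rho>" using fr2_prod by simp
  have 1: "(\<phi> has_derivative (\<lambda>h. deriv \<phi> t * h)) (at t)"
    using holomorphic_derivI[OF fr2_prod(1) _ fr2_prod(4)] by (auto simp: has_field_derivative_def)
  have "(\<eta> has_derivative (\<lambda>h. deriv \<eta> (cnj t) * h)) (at (cnj t))"
    using holomorphic_derivI[OF fr2_prod(2) _ ct] by (auto simp: has_field_derivative_def)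
  from has_derivative_compose[OF has_derivative_cnj[OF has_derivative_ident] this]
  have 2: "((\<lambda>t. \<eta> (cnj t)) has_derivative (\<lambda>h. deriv \<eta> (cnj t) * cnj h)) (at t)" .
  have "((\<lambda>t. \<phi> t * \<eta> (cnj t)) has_derivative
      (\<lambda>h. \<phi> t * (deriv \<eta> (cnj t) * cnj h) + (deriv \<phi> t * h) * \<eta> (cnj t))) (at t)"
    by (rule has_derivative_mult[OF 1 2])
  then have "((\<lambda>t. G t (cnj t)) has_derivative
      (\<lambda>h. \<phi> t * (deriv \<eta> (cnj t) * cnj h) + (deriv \<phi> t * h) * \<eta> (cnj t))) (at t)"
    by (rule has_derivative_transform_within_open[of _ _ _ _ "ball 0 \<rho>"]) (use fr2_prod in auto)
  then show ?case using D_prod[OF fr2_prod ct] by (simp add: algebra_simps)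
next
  case (fr2_sum2 F G H)
  have ct: "cnj t \<in> ball 0 \<rho>" using fr2_sum2 by simp
  have "((\<lambda>t. F t (cnj t) + G t (cnj t)) has_derivative
     (\<lambda>h. (D1 F t (cnj t) * h + D2 F t (cnj t) * cnj h) + (D1 G t (cnj t) * h + D2 G t (cnj t) * cnj h))) (at t)"
    using fr2_sum2 by (intro has_derivative_add) auto
  then have "((\<lambda>t. H t (cnj t)) has_derivative
     (\<lambda>h. (D1 F t (cnj t) * h + D2 F t (cnj t) * cnj h) + (D1 G t (cnj t) * h + D2 G t (cnj t) * cnj h))) (at t)"
    by (rule has_derivative_transform_within_open[of _ _ _ _ "ball 0 \<rho>"]) (use fr2_sum2 in auto)
  then show ?case using D_sum2[OF fr2_sum2(1,2,3) fr2_sum2(6) ct] by (simp add: algebra_simps)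
qed

lemma wirtinger_unique:
  assumes "(f has_derivative (\<lambda>h. a * h + b * cnj h)) (at t)" "(f has_derivative (\<lambda>h. a' * h + b' * cnj h)) (at t)"
  shows "a = a'" "b = (b' :: complex)"
proof -
  have eq: "a * h + b * cnj h = a' * h + b' * cnj h" for h
    using has_derivative_unique[OF assms] by meson
  have "\<i> * (a - b) = \<i> * (a' - b')" using eq[of \<i>] by (simp add: algebra_simps)
  then have "a + b = a' + b'" "a - b = a' - b'" using eq[of 1] by simp_all
  then have "(a + b) + (a - b) = (a' + b') + (a' - b')" "(a + b) - (a - b) = (a' + b') - (a' - b')" by simp_all
  then show "a = a'" "b = b'" by simp_all
qed

lemma D1_zero_on_diagonal:
  assumes "fr2 \<rho> G" "\<And>t. t \<in> ball 0 \<rho> \<Longrightarrow> G t (cnj t) = 0" "t \<in> ball 0 \<rho>"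
  shows "D1 G t (cnj t) = 0"
proof -
  have "((\<lambda>_. 0) has_derivative (\<lambda>h. D1 G t (cnj t) * h + D2 G t (cnj t) * cnj h)) (at t)"
    by (rule has_derivative_transform_within_open[OF fr2_diagonal_has_derivative[OF assms(1,3)], of "ball 0 \<rho>"])
      (use assms in auto)
  moreover have "((\<lambda>_. 0) has_derivative (\<lambda>h. 0 * h + 0 * cnj h)) (at t)" by simp
  ultimately show ?thesis by (rule wirtinger_unique(1))
qed

text \<open>The diagonal s = cnj w is totally real. G and all its derivatives in w vanish on it, so
  for fixed s the function of w has a vanishing Taylor series at cnj s.\<close>

lemma fr2_polarize:
  assumes G: "fr2 \<rho> G" and z: "\<And>t. t \<in> ball 0 \<rho> \<Longrightarrow> G t (cnj t) = 0"
    and "w \<in> ball 0 \<rho>" "s \<in> ball 0 \<rho>"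
  shows "G w s = 0"
proof -
  define E where "E n = (D1 ^^ n) G" for n
  have E: "fr2 \<rho> (E n) \<and> (\<forall>t\<in>ball 0 \<rho>. E n t (cnj t) = 0)" for n
    by (induction n) (use G z in \<open>auto simp: E_def intro: fr2_D D1_zero_on_diagonal\<close>)
  define t where "t = cnj s"
  have t: "t \<in> ball 0 \<rho>" "s = cnj t" using assms by (auto simp: t_def)
  have En: "E n w s = (deriv ^^ n) (\<lambda>w. G w s) w" for n w
  proof (induction n arbitrary: w)
    case (Suc n)
    have "E (Suc n) w s = deriv (\<lambda>w. E n w s) w" by (simp add: E_def D1_def)
    then show ?case using Suc by simp
  qed (simp add: E_def)
  have conn: "connected (ball (0::complex) \<rho>)" by (rule convex_connected) simp
  have "(deriv ^^ n) (\<lambda>w. G w s) t = 0" for n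
    using E[of n] t unfolding En[symmetric] by simp
  then show ?thesis
    by (rule holomorphic_fun_eq_0_on_connected[OF fr2_holomorphic(1)[OF G assms(4)] open_ball conn _ t(1) assms(3)])
qed

section \<open>Coefficients over a finite independent family\<close>

text \<open>The first arguments enter through a finite set of functions of \<open>w\<close>, the second through their coefficients.\<close>

definition rep :: "real \<Rightarrow> (complex \<Rightarrow> complex) set \<Rightarrow> (complex \<Rightarrow> complex \<Rightarrow> complex) \<Rightarrow> bool" where
  "rep \<rho> \<Phi> G \<longleftrightarrow> (\<exists>\<eta>. (\<forall>\<phi>\<in>\<Phi>. \<eta> \<phi> holomorphic_on ball 0 \<rho>) \<and>
     (\<forall>w\<in>ball 0 \<rho>. \<forall>s\<in>ball 0 \<rho>. G w s = (\<Sum>\<phi>\<in>\<Phi>. \<eta> \<phi> s * \<phi> w)))"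

lemma rep_mono:
  assumes "rep \<rho> \<Phi> G" "\<Phi> \<subseteq> \<Psi>" "finite \<Psi>"
  shows "rep \<rho> \<Psi> G"
proof -
  obtain \<eta> where \<eta>: "\<forall>\<phi>\<in>\<Phi>. \<eta> \<phi> holomorphic_on ball 0 \<rho>"
    "\<forall>w\<in>ball 0 \<rho>. \<forall>s\<in>ball 0 \<rho>. G w s = (\<Sum>\<phi>\<in>\<Phi>. \<eta> \<phi> s * \<phi> w)" using assms by (auto simp: rep_def)
  have "(\<Sum>\<phi>\<in>\<Psi>. (if \<phi> \<in> \<Phi> then \<eta> \<phi> s else 0) * \<phi> w) = (\<Sum>\<phi>\<in>\<Phi>. \<eta> \<phi> s * \<phi> w)" for w s
    using assms by (intro sum.mono_neutral_cong_right) auto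
  moreover have "\<forall>\<phi>\<in>\<Psi>. (\<lambda>s. if \<phi> \<in> \<Phi> then \<eta> \<phi> s else 0) holomorphic_on ball 0 \<rho>"
  proof
    fix \<phi>
    show "(\<lambda>s. if \<phi> \<in> \<Phi> then \<eta> \<phi> s else 0) holomorphic_on ball 0 \<rho>"
      using \<eta>(1) by (cases "\<phi> \<in> \<Phi>") auto
  qed
  ultimately show ?thesis
    unfolding rep_def using \<eta>(2) by (intro exI[of _ "\<lambda>\<phi> s. if \<phi> \<in> \<Phi> then \<eta> \<phi> s else 0"]) auto
qed

lemma fr2_rep: "fr2 \<rho> G \<Longrightarrow> \<exists>\<Phi>. finite \<Phi> \<and> (\<forall>\<phi>\<in>\<Phi>. \<phi> holomorphic_on ball 0 \<rho>) \<and> rep \<rho> \<Phi> G"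
proof (induction G rule: fr2.induct)
  case (fr2_prod \<phi> \<eta> G)
  then have "rep \<rho> {\<phi>} G" by (auto simp: rep_def mult.commute intro!: exI[of _ "\<lambda>_. \<eta>"])
  then show ?case using fr2_prod by (intro exI[of _ "{\<phi>}"]) auto
next
  case (fr2_sum2 F G H)
  obtain \<Phi> \<Psi> where fin: "finite \<Phi>" "\<forall>\<phi>\<in>\<Phi>. \<phi> holomorphic_on ball 0 \<rho>" "rep \<rho> \<Phi> F"
    "finite \<Psi>" "\<forall>\<phi>\<in>\<Psi>. \<phi> holomorphic_on ball 0 \<rho>" "rep \<rho> \<Psi> G" using fr2_sum2 by blast
  have "rep \<rho> (\<Phi> \<union> \<Psi>) F" "rep \<rho> (\<Phi> \<union> \<Psi>) G" using fin by (auto intro: rep_mono)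
  then obtain \<eta> \<eta>' where \<eta>: "\<forall>\<phi>\<in>\<Phi> \<union> \<Psi>. \<eta> \<phi> holomorphic_on ball 0 \<rho>" "\<forall>\<phi>\<in>\<Phi> \<union> \<Psi>. \<eta>' \<phi> holomorphic_on ball 0 \<rho>"
    "\<forall>w\<in>ball 0 \<rho>. \<forall>s\<in>ball 0 \<rho>. F w s = (\<Sum>\<phi>\<in>\<Phi> \<union> \<Psi>. \<eta> \<phi> s * \<phi> w)"
    "\<forall>w\<in>ball 0 \<rho>. \<forall>s\<in>ball 0 \<rho>. G w s = (\<Sum>\<phi>\<in>\<Phi> \<union> \<Psi>. \<eta>' \<phi> s * \<phi> w)" unfolding rep_def by blast
  have "rep \<rho> (\<Phi> \<union> \<Psi>) H" unfolding rep_def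
    using \<eta> fr2_sum2(3)
    by (intro exI[of _ "\<lambda>\<phi> s. \<eta> \<phi> s + \<eta>' \<phi> s"]) (auto intro!: holomorphic_intros simp: distrib_right sum.distrib)
  then show ?case using fin by (intro exI[of _ "\<Phi> \<union> \<Psi>"]) auto
qed

text \<open>\<Psi> is a maximal independent subset. Independence and spanning are understood on the
  disc, not on the whole plane.\<close>

lemma independent_subfamily:
  assumes fin: "finite \<Phi>"
  shows "\<exists>\<Psi>\<subseteq>\<Phi>. (\<forall>a. (\<forall>w\<in>ball 0 \<rho>. (\<Sum>\<phi>\<in>\<Psi>. a \<phi> * \<phi> w) = 0) \<longrightarrow> (\<forall>\<phi>\<in>\<Psi>. a \<phi> = 0)) \<and>
     (\<forall>\<phi>\<in>\<Phi>. \<exists>c. \<forall>w\<in>ball 0 \<rho>. \<phi> w = (\<Sum>\<psi>\<in>\<Psi>. c \<psi> * \<psi> (w::complex) :: complex))"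
proof -
  define ind where "ind \<Psi> \<longleftrightarrow> (\<forall>a. (\<forall>w\<in>ball 0 \<rho>. (\<Sum>\<phi>\<in>\<Psi>. a \<phi> * \<phi> w) = 0) \<longrightarrow> (\<forall>\<phi>\<in>\<Psi>. a \<phi> = 0))"
    for \<Psi> :: "(complex \<Rightarrow> complex) set"
  let ?S = "{\<Psi>. \<Psi> \<subseteq> \<Phi> \<and> ind \<Psi>}"
  have "finite ?S" using fin by simp
  moreover have "{} \<in> ?S" by (simp add: ind_def)
  ultimately have "\<exists>m\<in>?S. {} \<subseteq> m \<and> (\<forall>X\<in>?S. m \<subseteq> X \<longrightarrow> m = X)" by (rule finite_has_maximal2)
  then obtain \<Psi> where "\<Psi> \<in> ?S" and max: "\<forall>X\<in>?S. \<Psi> \<subseteq> X \<longrightarrow> \<Psi> = X" by (elim bexE conjE)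
  then have \<Psi>: "\<Psi> \<subseteq> \<Phi>" "ind \<Psi>" by simp_all
  have fin\<Psi>: "finite \<Psi>" using \<Psi>(1) fin finite_subset by blast
  have "\<exists>c. \<forall>w\<in>ball 0 \<rho>. \<phi> w = (\<Sum>\<psi>\<in>\<Psi>. c \<psi> * \<psi> w)" if \<phi>: "\<phi> \<in> \<Phi>" for \<phi>
  proof (cases "\<phi> \<in> \<Psi>")
    case True
    have "(\<Sum>\<psi>\<in>\<Psi>. (if \<psi> = \<phi> then 1 else 0) * \<psi> w) = \<phi> w" for w
      using True fin\<Psi> by (simp add: if_distrib[of "\<lambda>x. x * _"] cong: if_cong)
    then show ?thesis by (intro exI[of _ "\<lambda>\<psi>. if \<psi> = \<phi> then 1 else 0"]) simp
  next
    case False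
    have "\<not> ind (insert \<phi> \<Psi>)" using bspec[OF max, of "insert \<phi> \<Psi>"] \<phi> \<Psi>(1) False by auto
    then obtain a where a: "\<forall>w\<in>ball 0 \<rho>. (\<Sum>\<psi>\<in>insert \<phi> \<Psi>. a \<psi> * \<psi> w) = 0" "\<exists>\<psi>\<in>insert \<phi> \<Psi>. a \<psi> \<noteq> 0"
      unfolding ind_def by blast
    have s: "a \<phi> * \<phi> w + (\<Sum>\<psi>\<in>\<Psi>. a \<psi> * \<psi> w) = 0" if "w \<in> ball 0 \<rho>" for w
      using a(1) that fin\<Psi> False by simp
    have "a \<phi> \<noteq> 0"
    proof
      assume "a \<phi> = 0"
      then have "\<forall>\<psi>\<in>\<Psi>. a \<psi> = 0" using s \<Psi>(2) unfolding ind_def by auto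
      with \<open>a \<phi> = 0\<close> a(2) show False by auto
    qed
    have "\<phi> w = (\<Sum>\<psi>\<in>\<Psi>. (- (inverse (a \<phi>)) * a \<psi>) * \<psi> w)" if "w \<in> ball 0 \<rho>" for w
    proof -
      have "a \<phi> * \<phi> w = - (\<Sum>\<psi>\<in>\<Psi>. a \<psi> * \<psi> w)" using s[OF that] by (simp add: eq_neg_iff_add_eq_0)
      then have "\<phi> w = - inverse (a \<phi>) * (\<Sum>\<psi>\<in>\<Psi>. a \<psi> * \<psi> w)"
        using \<open>a \<phi> \<noteq> 0\<close> by (simp add: field_simps)
      then show ?thesis by (simp add: sum_distrib_left mult.assoc)
    qed
    then show ?thesis by (intro exI[of _ "\<lambda>\<psi>. - inverse (a \<phi>) * a \<psi>"] ballI)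
  qed
  then show ?thesis
    by (intro exI[of _ \<Psi>] conjI ballI \<Psi>(1) \<Psi>(2)[unfolded ind_def])
qed

lemma rep_reduce:
  assumes "rep \<rho> \<Phi> G" and c: "\<And>\<phi>. \<phi> \<in> \<Phi> \<Longrightarrow> \<exists>c. \<forall>w\<in>ball 0 \<rho>. \<phi> w = (\<Sum>\<psi>\<in>\<Psi>. c \<psi> * \<psi> w)"
  shows "rep \<rho> \<Psi> G"
proof -
  obtain \<eta> where \<eta>: "\<forall>\<phi>\<in>\<Phi>. \<eta> \<phi> holomorphic_on ball 0 \<rho>"
    "\<forall>w\<in>ball 0 \<rho>. \<forall>s\<in>ball 0 \<rho>. G w s = (\<Sum>\<phi>\<in>\<Phi>. \<eta> \<phi> s * \<phi> w)" using assms by (auto simp: rep_def)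
  obtain c where c: "\<And>\<phi> w. \<phi> \<in> \<Phi> \<Longrightarrow> w \<in> ball 0 \<rho> \<Longrightarrow> \<phi> w = (\<Sum>\<psi>\<in>\<Psi>. c \<phi> \<psi> * \<psi> w)" using c by metis
  have "G w s = (\<Sum>\<psi>\<in>\<Psi>. (\<Sum>\<phi>\<in>\<Phi>. c \<phi> \<psi> * \<eta> \<phi> s) * \<psi> w)" if ws: "w \<in> ball 0 \<rho>" "s \<in> ball 0 \<rho>" for w s
  proof -
    have "G w s = (\<Sum>\<phi>\<in>\<Phi>. \<eta> \<phi> s * (\<Sum>\<psi>\<in>\<Psi>. c \<phi> \<psi> * \<psi> w))"
      using \<eta>(2) c ws by (auto intro!: sum.cong)
    also have "\<dots> = (\<Sum>\<phi>\<in>\<Phi>. \<Sum>\<psi>\<in>\<Psi>. c \<phi> \<psi> * \<eta> \<phi> s * \<psi> w)" by (simp add: sum_distrib_left algebra_simps)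
    also have "\<dots> = (\<Sum>\<psi>\<in>\<Psi>. \<Sum>\<phi>\<in>\<Phi>. c \<phi> \<psi> * \<eta> \<phi> s * \<psi> w)" by (rule sum.swap)
    finally show ?thesis by (simp add: sum_distrib_right)
  qed
  moreover have "(\<lambda>s. \<Sum>\<phi>\<in>\<Phi>. c \<phi> \<psi> * \<eta> \<phi> s) holomorphic_on ball 0 \<rho>" for \<psi>
    using \<eta>(1) by (intro holomorphic_intros) auto
  ultimately show ?thesis
    unfolding rep_def by (intro exI[of _ "\<lambda>\<psi> s. \<Sum>\<phi>\<in>\<Phi>. c \<phi> \<psi> * \<eta> \<phi> s"]) auto
qed

text \<open>One independent family serves all three functions, so that they become coefficient
  vectors over the same index set, as \<open>holomorphic_span\<close> demands.\<close>

lemma fr2_common_rep: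
  assumes "fr2 \<rho> N" "fr2 \<rho> P" "fr2 \<rho> q"
  shows "\<exists>\<Psi>. finite \<Psi> \<and> (\<forall>\<phi>\<in>\<Psi>. \<phi> holomorphic_on ball 0 \<rho>) \<and> rep \<rho> \<Psi> N \<and> rep \<rho> \<Psi> P \<and> rep \<rho> \<Psi> q \<and>
    (\<forall>a. (\<forall>w\<in>ball 0 \<rho>. (\<Sum>\<phi>\<in>\<Psi>. a \<phi> * \<phi> w) = 0) \<longrightarrow> (\<forall>\<phi>\<in>\<Psi>. a \<phi> = 0))"
proof -
  obtain X where X: "finite X" "\<forall>\<phi>\<in>X. \<phi> holomorphic_on ball 0 \<rho>" "rep \<rho> X N" using fr2_rep[OF assms(1)] by blast
  obtain Y where Y: "finite Y" "\<forall>\<phi>\<in>Y. \<phi> holomorphic_on ball 0 \<rho>" "rep \<rho> Y P" using fr2_rep[OF assms(2)] by blast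
  obtain Z where Z: "finite Z" "\<forall>\<phi>\<in>Z. \<phi> holomorphic_on ball 0 \<rho>" "rep \<rho> Z q" using fr2_rep[OF assms(3)] by blast
  define \<Phi> where "\<Phi> = X \<union> Y \<union> Z"
  have fin: "finite \<Phi>" using X Y Z by (simp add: \<Phi>_def)
  have r: "rep \<rho> \<Phi> N" "rep \<rho> \<Phi> P" "rep \<rho> \<Phi> q"
    using X(3) Y(3) Z(3) fin by (auto simp: \<Phi>_def intro: rep_mono)
  obtain \<Psi> where \<Psi>: "\<Psi> \<subseteq> \<Phi>" "\<forall>a. (\<forall>w\<in>ball 0 \<rho>. (\<Sum>\<phi>\<in>\<Psi>. a \<phi> * \<phi> w) = 0) \<longrightarrow> (\<forall>\<phi>\<in>\<Psi>. a \<phi> = 0)"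
    "\<forall>\<phi>\<in>\<Phi>. \<exists>c. \<forall>w\<in>ball 0 \<rho>. \<phi> w = (\<Sum>\<psi>\<in>\<Psi>. c \<psi> * \<psi> w)"
    using independent_subfamily[OF fin, of \<rho>] by blast
  have "rep \<rho> \<Psi> N" "rep \<rho> \<Psi> P" "rep \<rho> \<Psi> q" 
    using rep_reduce[OF r(1)] rep_reduce[OF r(2)] rep_reduce[OF r(3)] \<Psi>(3) by simp_all
  moreover have "finite \<Psi>" "\<forall>\<phi>\<in>\<Psi>. \<phi> holomorphic_on ball 0 \<rho>"
    using \<Psi>(1) fin X Y Z by (auto simp: \<Phi>_def intro: finite_subset)
  ultimately show ?thesis using \<Psi>(2) by blast
qed

section \<open>The polarized equation\<close>

inductive_set alg :: "complex fls set \<Rightarrow> complex fls set" for X where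
  alg_const: "fls_const a \<in> alg X"
| alg_gen: "x \<in> X \<Longrightarrow> x \<in> alg X"
| alg_add: "x \<in> alg X \<Longrightarrow> y \<in> alg X \<Longrightarrow> x + y \<in> alg X"
| alg_mult: "x \<in> alg X \<Longrightarrow> y \<in> alg X \<Longrightarrow> x * y \<in> alg X"

text \<open>The monomials in countably many generators are countable and span the algebra. Laurent
  series are used because they form a field, so inverses of power series can be generators.\<close>

lemma alg_countable_span:
  assumes X: "countable X"
  shows "\<exists>S. \<forall>y\<in>alg X. \<exists>n c. y = (\<Sum>i<(n::nat). fls_const (c i) * S i)"
proof -
  define Mon where "Mon = prod_list ` lists X"
  have "countable Mon" unfolding Mon_def using X by (intro countable_image countable_lists)
  have "prod_list [] \<in> Mon" unfolding Mon_def by (intro imageI) simp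
  then have "Mon \<noteq> {}" by auto
  define S where "S = from_nat_into Mon"
  have ran: "range S = Mon" unfolding S_def by (rule range_from_nat_into) fact+
  define Q where "Q y \<longleftrightarrow> (\<exists>n c. y = (\<Sum>i<(n::nat). fls_const (c i) * S i))" for y
  have Q_add: "Q (x + y)" if Qx: "Q x" and Qy: "Q y" for x y
  proof -
    obtain n c where x: "x = (\<Sum>i<(n::nat). fls_const (c i) * S i)" using Qx unfolding Q_def by blast
    obtain m d where y: "y = (\<Sum>i<(m::nat). fls_const (d i) * S i)" using Qy unfolding Q_def by blast
    have ext: "(\<Sum>i<k. fls_const (e i) * S i) = (\<Sum>i<max n m. fls_const (if i < k then e i else 0) * S i)"
      if "k \<le> max n m" for k e
      using that by (intro sum.mono_neutral_cong_left) auto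
    have "x + y = (\<Sum>i<max n m. fls_const ((if i < n then c i else 0) + (if i < m then d i else 0)) * S i)"
      unfolding x y ext[of n c, OF max.cobounded1] ext[of m d, OF max.cobounded2] fls_plus_const[symmetric]
      by (simp only: distrib_right sum.distrib)
    then show ?thesis
      unfolding Q_def
      by (intro exI[of _ "max n m"] exI[of _ "\<lambda>i. (if i < n then c i else 0) + (if i < m then d i else 0)"])
  qed
  have Q_S: "Q (fls_const a * S k)" for a k
  proof -
    have "(\<Sum>i<Suc k. fls_const (if i = k then a else 0) * S i) = fls_const a * S k" by simp
    then show ?thesis unfolding Q_def by metis
  qed
  have Q_0: "Q 0" unfolding Q_def by (intro exI[of _ 0]) simp
  have Q_sum: "Q (sum f I)" if "\<And>i. i \<in> I \<Longrightarrow> Q (f i)" for f and I :: "nat set"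
    using that by (induction I rule: infinite_finite_induct) (auto intro: Q_add Q_0)
  have Q_Mon: "Q (fls_const a * z)" if "z \<in> Mon" for a z
    using that Q_S unfolding ran[symmetric] by auto
  have "Q y" if "y \<in> alg X" for y
    using that
  proof (induction rule: alg.induct)
    case (alg_const a)
    have "prod_list [] \<in> Mon" by fact
    from Q_Mon[OF this, of a] show ?case by simp
  next
    case (alg_gen x)
    then have "prod_list [x] \<in> Mon" unfolding Mon_def by (intro imageI) simp
    from Q_Mon[OF this, of 1] show ?case by simp
  next
    case (alg_add x y)
    then show ?case by (simp add: Q_add)
  next
    case (alg_mult x y)
    obtain n c where x: "x = (\<Sum>i<(n::nat). fls_const (c i) * S i)" using alg_mult unfolding Q_def by blast
    obtain m d where y: "y = (\<Sum>i<(m::nat). fls_const (d i) * S i)" using alg_mult unfolding Q_def by blast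
    have SS: "S i * S j \<in> Mon" for i j
    proof -
      have "S i \<in> Mon" "S j \<in> Mon" using ran by auto
      then obtain xs ys where "S i = prod_list xs" "xs \<in> lists X" "S j = prod_list ys" "ys \<in> lists X"
        unfolding Mon_def by auto
      then have "S i * S j = prod_list (xs @ ys)" "xs @ ys \<in> lists X" by simp_all
      then show ?thesis unfolding Mon_def by (intro image_eqI)
    qed
    have "x * y = (\<Sum>i<n. \<Sum>j<m. fls_const (c i * d j) * (S i * S j))"
      unfolding x y sum_product fls_const_mult_const[symmetric] by (simp only: mult_ac)
    then show ?case by (simp only:) (intro Q_sum Q_Mon SS)
  qed
  then show ?thesis unfolding Q_def by blast
qed

lemma alg_nonvalues:
  assumes "countable X" "f \<in> alg X" "f \<notin> range fls_const"
  shows "countable {A. \<not> (\<exists>\<tau>. (\<forall>a. \<tau> (fls_const a) = a) \<and>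
     (\<forall>x\<in>alg X. \<forall>y\<in>alg X. \<tau> (x + y) = \<tau> x + \<tau> y \<and> \<tau> (x * y) = \<tau> x * \<tau> y) \<and> \<tau> f = A)}"
proof -
  obtain S where S: "\<forall>y\<in>alg X. \<exists>n c. y = (\<Sum>i<(n::nat). fls_const (c i) * S i)"
    using alg_countable_span[OF assms(1)] by blast
  interpret countable_complex_algebra fls_const "alg X" S
    by unfold_locales (use S in \<open>auto simp: fls_plus_const intro: alg.intros\<close>)
  show ?thesis by (rule countable_nonvalues[OF assms(2,3)])
qed

section \<open>The equation in two independent variables\<close>

lemma fr2_continuous:
  "fr2 \<rho> G \<Longrightarrow> continuous_on (ball 0 \<rho> \<times> ball 0 \<rho>) (\<lambda>p. G (fst p) (snd p))"
proof (induction G rule: fr2.induct)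
  case (fr2_prod \<phi> \<eta> G)
  have "continuous_on (ball 0 \<rho>) \<phi>" "continuous_on (ball 0 \<rho>) \<eta>"
    using fr2_prod by (simp_all add: holomorphic_on_imp_continuous_on)
  then have "continuous_on (ball 0 \<rho> \<times> ball 0 \<rho>) (\<lambda>p. \<phi> (fst p) * \<eta> (snd p))"
    by (intro continuous_on_mult continuous_on_compose2[of _ \<phi> _ fst] continuous_on_compose2[of _ \<eta> _ snd])
      (auto intro!: continuous_intros)
  then show ?case using fr2_prod(3) by (subst continuous_on_cong[OF refl]) auto
next
  case (fr2_sum2 F G H)
  have "continuous_on (ball 0 \<rho> \<times> ball 0 \<rho>) (\<lambda>p. F (fst p) (snd p) + G (fst p) (snd p))"
    by (intro continuous_on_add fr2_sum2)
  then show ?case using fr2_sum2(3) by (subst continuous_on_cong[OF refl]) auto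
qed

lemma fr2_nonzero_near_0:
  assumes "fr2 \<rho> G" "\<rho> > 0" "G 0 0 \<noteq> 0"
  shows "\<exists>\<rho>'>0. \<rho>' \<le> \<rho> \<and> (\<forall>w\<in>ball 0 \<rho>'. \<forall>s\<in>ball 0 \<rho>'. G w s \<noteq> 0)"
proof -
  have "open ((ball 0 \<rho> \<times> ball 0 \<rho>) \<inter> (\<lambda>p. G (fst p) (snd p)) -` (- {0}))"
    using fr2_continuous[OF assms(1)] by (intro continuous_open_preimage open_Times) auto
  moreover have "(0, 0) \<in> (ball 0 \<rho> \<times> ball 0 \<rho>) \<inter> (\<lambda>p. G (fst p) (snd p)) -` (- {0})" using assms by simp
  ultimately obtain e where e: "e > 0" "ball (0, 0) e \<subseteq> (ball 0 \<rho> \<times> ball 0 \<rho>) \<inter> (\<lambda>p. G (fst p) (snd p)) -` (- {0})"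
    using open_contains_ball by blast
  have "G w s \<noteq> 0" if "w \<in> ball 0 (e / 2)" "s \<in> ball 0 (e / 2)" for w s
  proof -
    have "norm (w, s) \<le> norm w + norm s" by (rule norm_Pair_le)
    then have "(w, s) \<in> ball (0, 0) e" using that by (simp add: dist_Pair_Pair norm_Pair)
    then show ?thesis using e(2) by auto
  qed
  then show ?thesis using e(1) assms(2) by (intro exI[of _ "min \<rho> (e / 2)"]) auto
qed

text \<open>\<open>eq_diag\<close> is (N/P)' + r P'/P + q'/q = \<kappa> with denominators cleared,
  where the prime is the derivative in the first variable. It is given only for s = cnj t. That
  \<kappa> depends on t holomorphically expresses the vanishing of a mixed derivative.\<close>

locale fr_equation =
  fixes \<rho> :: real and N P q :: "complex \<Rightarrow> complex \<Rightarrow> complex" and \<kappa> :: "complex \<Rightarrow> complex" and r :: complex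
  assumes \<rho>: "\<rho> > 0" and frN: "fr2 \<rho> N" and frP: "fr2 \<rho> P" and frq: "fr2 \<rho> q"
    and hol\<kappa>: "\<kappa> holomorphic_on ball 0 \<rho>" and P0: "P 0 0 \<noteq> 0" and q0: "q 0 0 \<noteq> 0"
    and eq_diag: "\<And>t. t \<in> ball 0 \<rho> \<Longrightarrow> (D1 N t (cnj t) * P t (cnj t) - N t (cnj t) * D1 P t (cnj t)) * q t (cnj t)
      + r * D1 P t (cnj t) * P t (cnj t) * q t (cnj t) + D1 q t (cnj t) * (P t (cnj t))\<^sup>2
      = \<kappa> t * (P t (cnj t))\<^sup>2 * q t (cnj t)"
begin

lemma eq2:
  assumes "w \<in> ball 0 \<rho>" "s \<in> ball 0 \<rho>"
  shows "(D1 N w s * P w s - N w s * D1 P w s) * q w s + r * D1 P w s * P w s * q w s + D1 q w s * (P w s)\<^sup>2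
      = \<kappa> w * (P w s)\<^sup>2 * q w s"
proof -
  define G where "G w s = (D1 N w s * P w s - N w s * D1 P w s) * q w s + r * D1 P w s * P w s * q w s
     + D1 q w s * (P w s)\<^sup>2 - \<kappa> w * (P w s)\<^sup>2 * q w s" for w s
  have "fr2 \<rho> G" unfolding G_def [abs_def]
    by (intro fr2_diff fr2_add fr2_mult fr2_power fr2_const fr2_D frN frP frq fr2_left hol\<kappa>)
  then have "G w s = 0"
    by (rule fr2_polarize[OF _ _ assms]) (use eq_diag in \<open>simp add: G_def\<close>)
  then show ?thesis by (simp add: G_def)
qed

text \<open>Taylor expansion in s at 0, which embeds the holomorphic functions of s into a
  field.\<close>

definition fx :: "(complex \<Rightarrow> complex) \<Rightarrow> complex fls" where
  "fx f = fps_to_fls (fps_expansion f 0)"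

lemma fx_expansion:
  assumes "f holomorphic_on ball 0 \<rho>"
  shows "f has_fps_expansion fps_expansion f 0"
proof -
  have "(0::complex) \<in> ball 0 \<rho>" using \<rho> by simp
  then have "f analytic_on {0}" using assms analytic_at open_ball by blast
  then show ?thesis by (rule analytic_at_imp_has_fps_expansion_0)
qed

lemma fx_eqI: "f has_fps_expansion F \<Longrightarrow> f holomorphic_on ball 0 \<rho> \<Longrightarrow> fx f = fps_to_fls F"
  unfolding fx_def using fps_expansion_unique_complex[OF fx_expansion] by simp

lemma fx_add:
  assumes "f holomorphic_on ball 0 \<rho>" "g holomorphic_on ball 0 \<rho>"
  shows "fx (\<lambda>s. f s + g s) = fx f + fx g"
  using fx_eqI[OF has_fps_expansion_add[OF fx_expansion[OF assms(1)] fx_expansion[OF assms(2)]]] assms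
  by (simp add: fx_def holomorphic_on_add)

lemma fx_mult:
  assumes "f holomorphic_on ball 0 \<rho>" "g holomorphic_on ball 0 \<rho>"
  shows "fx (\<lambda>s. f s * g s) = fx f * fx g"
  using fx_eqI[OF has_fps_expansion_mult[OF fx_expansion[OF assms(1)] fx_expansion[OF assms(2)]]] assms
  by (simp add: fx_def holomorphic_on_mult fls_times_fps_to_fls)

lemma fx_const: "fx (\<lambda>s. a) = fls_const a"
  using fx_eqI[OF has_fps_expansion_const[of a]] by simp

lemma fx_diff:
  assumes "f holomorphic_on ball 0 \<rho>" "g holomorphic_on ball 0 \<rho>"
  shows "fx (\<lambda>s. f s - g s) = fx f - fx g"
  using fx_eqI[OF has_fps_expansion_diff[OF fx_expansion[OF assms(1)] fx_expansion[OF assms(2)]]] assms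
  by (simp add: fx_def holomorphic_on_diff)

lemma fx_sum:
  assumes "\<And>i. i \<in> I \<Longrightarrow> f i holomorphic_on ball 0 \<rho>"
  shows "fx (\<lambda>s. \<Sum>i\<in>I. f i s) = (\<Sum>i\<in>I. fx (f i))"
  using assms
proof (induction I rule: infinite_finite_induct)
  case (insert x I)
  then show ?case by (simp add: fx_add holomorphic_on_sum)
qed (simp_all add: fx_const)

lemma fx_cong:
  assumes "\<And>s. s \<in> ball 0 \<rho> \<Longrightarrow> f s = g s" "f holomorphic_on ball 0 \<rho>"
  shows "fx f = fx g"
proof -
  have "\<forall>\<^sub>F s in nhds 0. s \<in> ball (0::complex) \<rho>" using \<rho> by (intro eventually_nhds_in_open) auto
  then have ev: "\<forall>\<^sub>F s in nhds 0. f s = g s" by eventually_elim (use assms in auto)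
  have g: "g holomorphic_on ball 0 \<rho>" using holomorphic_transform[OF assms(2,1)] by simp
  have "f has_fps_expansion fps_expansion g 0"
    using fx_expansion[OF g] unfolding has_fps_expansion_cong[OF ev refl] .
  from fx_eqI[OF this assms(2)] show ?thesis by (simp add: fx_def)
qed

lemma fx_eq_0D:
  assumes f: "f holomorphic_on ball 0 \<rho>" and 0: "fx f = 0" and s: "s \<in> ball 0 \<rho>"
  shows "f s = 0"
proof -
  have "f has_fps_expansion 0" using fx_expansion[OF f] 0 by (simp add: fx_def)
  then have "\<forall>\<^sub>F s in nhds 0. f s = 0" by (rule has_fps_expansion_0_imp_eventually)
  then obtain W where W: "open W" "0 \<in> W" "\<And>x. x \<in> W \<Longrightarrow> f x = 0" by (auto simp: eventually_nhds)
  show ?thesis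
    by (rule holomorphic_vanish_on_open[OF f open_ball _, of "W \<inter> ball 0 \<rho>"])
      (use W \<rho> s in \<open>auto simp: convex_connected\<close>)
qed

end

section \<open>Homomorphic images of the equation\<close>

locale fr_equation_rep = fr_equation +
  fixes \<Psi> :: "(complex \<Rightarrow> complex) set" and \<nu> \<pi>' \<theta> :: "(complex \<Rightarrow> complex) \<Rightarrow> complex \<Rightarrow> complex"
  assumes fin: "finite \<Psi>" and hol\<Psi>: "\<And>\<phi>. \<phi> \<in> \<Psi> \<Longrightarrow> \<phi> holomorphic_on ball 0 \<rho>"
    and hol_coeff: "\<And>\<phi>. \<phi> \<in> \<Psi> \<Longrightarrow> \<nu> \<phi> holomorphic_on ball 0 \<rho>" "\<And>\<phi>. \<phi> \<in> \<Psi> \<Longrightarrow> \<pi>' \<phi> holomorphic_on ball 0 \<rho>"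
      "\<And>\<phi>. \<phi> \<in> \<Psi> \<Longrightarrow> \<theta> \<phi> holomorphic_on ball 0 \<rho>"
    and N_eq: "\<And>w s. w \<in> ball 0 \<rho> \<Longrightarrow> s \<in> ball 0 \<rho> \<Longrightarrow> N w s = (\<Sum>\<phi>\<in>\<Psi>. \<nu> \<phi> s * \<phi> w)"
    and P_eq: "\<And>w s. w \<in> ball 0 \<rho> \<Longrightarrow> s \<in> ball 0 \<rho> \<Longrightarrow> P w s = (\<Sum>\<phi>\<in>\<Psi>. \<pi>' \<phi> s * \<phi> w)"
    and q_eq: "\<And>w s. w \<in> ball 0 \<rho> \<Longrightarrow> s \<in> ball 0 \<rho> \<Longrightarrow> q w s = (\<Sum>\<phi>\<in>\<Psi>. \<theta> \<phi> s * \<phi> w)"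
    and indep\<Psi>: "\<And>a \<phi>. \<forall>w\<in>ball 0 \<rho>. (\<Sum>\<phi>\<in>\<Psi>. a \<phi> * \<phi> w) = 0 \<Longrightarrow> \<phi> \<in> \<Psi> \<Longrightarrow> a \<phi> = 0"
begin

sublocale hs: holomorphic_span \<Psi> "\<lambda>\<phi>. \<phi>" "ball 0 \<rho>" \<kappa> r
  by unfold_locales (use fin hol\<Psi> hol\<kappa> indep\<Psi> in \<open>auto simp: convex_connected\<close>)

definition gens :: "complex fls set" where
  "gens = (\<lambda>\<phi>. fx (\<nu> \<phi>)) ` \<Psi> \<union> (\<lambda>\<phi>. fx (\<pi>' \<phi>)) ` \<Psi> \<union> (\<lambda>\<phi>. fx (\<theta> \<phi>)) ` \<Psi>"

lemma fx_family:
  assumes G: "fr2 \<rho> G" and G_eq: "\<And>w s. w \<in> ball 0 \<rho> \<Longrightarrow> s \<in> ball 0 \<rho> \<Longrightarrow> G w s = (\<Sum>\<phi>\<in>\<Psi>. \<gamma> \<phi> s * \<phi> w)"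
    and \<gamma>: "\<And>\<phi>. \<phi> \<in> \<Psi> \<Longrightarrow> \<gamma> \<phi> holomorphic_on ball 0 \<rho>" and w: "w \<in> ball 0 \<rho>"
  shows "fx (G w) = (\<Sum>\<phi>\<in>\<Psi>. fls_const (\<phi> w) * fx (\<gamma> \<phi>))"
    and "fx (D1 G w) = (\<Sum>\<phi>\<in>\<Psi>. fls_const (deriv \<phi> w) * fx (\<gamma> \<phi>))"
proof -
  have lin: "fx (\<lambda>s. \<Sum>\<phi>\<in>\<Psi>. c \<phi> * \<gamma> \<phi> s) = (\<Sum>\<phi>\<in>\<Psi>. fls_const (c \<phi>) * fx (\<gamma> \<phi>))" for c
    using \<gamma> by (subst fx_sum) (auto intro!: holomorphic_intros sum.cong simp: fx_mult fx_const)
  have "fx (G w) = fx (\<lambda>s. \<Sum>\<phi>\<in>\<Psi>. \<phi> w * \<gamma> \<phi> s)"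
    using fr2_holomorphic(2)[OF G w] G_eq[OF w] by (intro fx_cong) (auto simp: mult.commute)
  then show "fx (G w) = (\<Sum>\<phi>\<in>\<Psi>. fls_const (\<phi> w) * fx (\<gamma> \<phi>))" by (simp add: lin)
  have "D1 G w s = (\<Sum>\<phi>\<in>\<Psi>. deriv \<phi> w * \<gamma> \<phi> s)" if s: "s \<in> ball 0 \<rho>" for s
  proof -
    have "((\<lambda>w. \<Sum>\<phi>\<in>\<Psi>. \<gamma> \<phi> s * \<phi> w) has_field_derivative (\<Sum>\<phi>\<in>\<Psi>. \<gamma> \<phi> s * deriv \<phi> w)) (at w)"
      using hol\<Psi> w by (intro DERIV_sum DERIV_cmult holomorphic_derivI[of _ "ball 0 \<rho>"]) auto
    then have "((\<lambda>w. G w s) has_field_derivative (\<Sum>\<phi>\<in>\<Psi>. \<gamma> \<phi> s * deriv \<phi> w)) (at w)"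
      by (rule has_field_derivative_transform_within_open[of _ _ _ "ball 0 \<rho>"]) (use w s G_eq in auto)
    then show ?thesis unfolding D1_def by (simp add: DERIV_imp_deriv mult.commute)
  qed
  then have "fx (D1 G w) = fx (\<lambda>s. \<Sum>\<phi>\<in>\<Psi>. deriv \<phi> w * \<gamma> \<phi> s)"
    using fr2_holomorphic(2)[OF fr2_D(1)[OF G] w] by (intro fx_cong) auto
  then show "fx (D1 G w) = (\<Sum>\<phi>\<in>\<Psi>. fls_const (deriv \<phi> w) * fx (\<gamma> \<phi>))" by (simp add: lin)
qed

lemma fx_NPq:
  assumes w: "w \<in> ball 0 \<rho>"
  shows "fx (N w) = (\<Sum>\<phi>\<in>\<Psi>. fls_const (\<phi> w) * fx (\<nu> \<phi>))"
    "fx (P w) = (\<Sum>\<phi>\<in>\<Psi>. fls_const (\<phi> w) * fx (\<pi>' \<phi>))"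
    "fx (q w) = (\<Sum>\<phi>\<in>\<Psi>. fls_const (\<phi> w) * fx (\<theta> \<phi>))"
    "fx (D1 N w) = (\<Sum>\<phi>\<in>\<Psi>. fls_const (deriv \<phi> w) * fx (\<nu> \<phi>))"
    "fx (D1 P w) = (\<Sum>\<phi>\<in>\<Psi>. fls_const (deriv \<phi> w) * fx (\<pi>' \<phi>))"
    "fx (D1 q w) = (\<Sum>\<phi>\<in>\<Psi>. fls_const (deriv \<phi> w) * fx (\<theta> \<phi>))"
  by (rule fx_family[OF frN _ _ w] fx_family[OF frP _ _ w] fx_family[OF frq _ _ w];
      simp add: N_eq P_eq q_eq hol_coeff)+

lemma fls_equation:
  assumes w: "w \<in> ball 0 \<rho>"
  shows "(fx (D1 N w) * fx (P w) - fx (N w) * fx (D1 P w)) * fx (q w) + fls_const r * fx (D1 P w) * fx (P w) * fx (q w)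
     + fx (D1 q w) * (fx (P w) * fx (P w)) = fls_const (\<kappa> w) * (fx (P w) * fx (P w)) * fx (q w)"
proof -
  note h = fr2_holomorphic(2)[OF frN w] fr2_holomorphic(2)[OF frP w] fr2_holomorphic(2)[OF frq w]
    fr2_holomorphic(2)[OF fr2_D(1)[OF frN] w] fr2_holomorphic(2)[OF fr2_D(1)[OF frP] w]
    fr2_holomorphic(2)[OF fr2_D(1)[OF frq] w]
  have "fx (\<lambda>s. (D1 N w s * P w s - N w s * D1 P w s) * q w s + r * D1 P w s * P w s * q w s
      + D1 q w s * (P w s * P w s)) = fx (\<lambda>s. \<kappa> w * (P w s * P w s) * q w s)"
    using eq2[OF w] h by (intro fx_cong holomorphic_intros) (auto simp: power2_eq_square)
  then show ?thesis
    using h by (simp add: fx_add fx_diff fx_mult fx_const holomorphic_on_add holomorphic_on_diff holomorphic_on_mult)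
qed

context
  fixes X \<tau>
  assumes X: "gens \<subseteq> X" and const: "\<And>a. \<tau> (fls_const a) = a"
    and hom: "\<forall>x\<in>alg X. \<forall>y\<in>alg X. \<tau> (x + y) = \<tau> x + \<tau> y \<and> \<tau> (x * y) = \<tau> x * \<tau> y"
begin

lemma gens_alg:
  assumes "\<phi> \<in> \<Psi>"
  shows "fx (\<nu> \<phi>) \<in> alg X" "fx (\<pi>' \<phi>) \<in> alg X" "fx (\<theta> \<phi>) \<in> alg X"
  using assms X by (auto simp: gens_def intro!: alg_gen)

lemma hom_add: "x \<in> alg X \<Longrightarrow> y \<in> alg X \<Longrightarrow> \<tau> (x + y) = \<tau> x + \<tau> y"
  and hom_mult: "x \<in> alg X \<Longrightarrow> y \<in> alg X \<Longrightarrow> \<tau> (x * y) = \<tau> x * \<tau> y"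
  using hom by auto

lemma alg_diff: "x \<in> alg X \<Longrightarrow> y \<in> alg X \<Longrightarrow> x - y \<in> alg X"
  using alg_add[of x X "fls_const (-1) * y"] alg_mult[OF alg_const[of "-1" X], of y] by simp

lemma hom_diff: "x \<in> alg X \<Longrightarrow> y \<in> alg X \<Longrightarrow> \<tau> (x - y) = \<tau> x - \<tau> y"
  using hom_add[OF alg_diff, of x y y] by simp

lemma hom_linear:
  assumes "\<And>\<phi>. \<phi> \<in> \<Phi> \<Longrightarrow> x \<phi> \<in> alg X" "finite \<Phi>"
  shows "(\<Sum>\<phi>\<in>\<Phi>. fls_const (c \<phi>) * x \<phi>) \<in> alg X \<and>
    \<tau> (\<Sum>\<phi>\<in>\<Phi>. fls_const (c \<phi>) * x \<phi>) = (\<Sum>\<phi>\<in>\<Phi>. \<tau> (x \<phi>) * c \<phi>)"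
  using assms(2,1)
proof (induction \<Phi> rule: finite_induct)
  case empty
  show ?case using alg_const[of 0 X] const[of 0] by simp
next
  case (insert a F)
  then have "fls_const (c a) * x a \<in> alg X" by (auto intro: alg_mult alg_const)
  moreover have "\<tau> (fls_const (c a) * x a) = \<tau> (x a) * c a"
    using insert by (simp add: hom_mult alg_const const)
  ultimately show ?case using insert by (simp add: hom_add alg_add)
qed

lemma hom_ev:
  assumes w: "w \<in> ball 0 \<rho>"
  shows "fx (N w) \<in> alg X" "fx (P w) \<in> alg X" "fx (q w) \<in> alg X"
    "fx (D1 N w) \<in> alg X" "fx (D1 P w) \<in> alg X" "fx (D1 q w) \<in> alg X"
    "\<tau> (fx (N w)) = hs.ev (\<lambda>\<phi>. \<tau> (fx (\<nu> \<phi>))) w" "\<tau> (fx (P w)) = hs.ev (\<lambda>\<phi>. \<tau> (fx (\<pi>' \<phi>))) w"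
    "\<tau> (fx (q w)) = hs.ev (\<lambda>\<phi>. \<tau> (fx (\<theta> \<phi>))) w"
    "\<tau> (fx (D1 N w)) = hs.ev' (\<lambda>\<phi>. \<tau> (fx (\<nu> \<phi>))) w" "\<tau> (fx (D1 P w)) = hs.ev' (\<lambda>\<phi>. \<tau> (fx (\<pi>' \<phi>))) w"
    "\<tau> (fx (D1 q w)) = hs.ev' (\<lambda>\<phi>. \<tau> (fx (\<theta> \<phi>))) w"
  using hom_linear[OF gens_alg(1) fin] hom_linear[OF gens_alg(2) fin] hom_linear[OF gens_alg(3) fin]
  by (simp_all add: fx_NPq[OF w] hs.ev_def hs.ev'_def)

text \<open>In the equation w enters only through the numbers \<open>\<phi> w\<close>,
  \<open>deriv \<phi> w\<close> and \<open>\<kappa> w\<close>, which \<open>\<tau>\<close> fixes. So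
  \<open>\<tau>\<close> takes the coefficient functions of s to coefficient vectors of a solution,
  as long as the images of P and q do not vanish identically.\<close>

lemma hom_sol:
  assumes "w0 \<in> ball 0 \<rho>" "\<tau> (fx (P w0)) \<noteq> 0" "w1 \<in> ball 0 \<rho>" "\<tau> (fx (q w1)) \<noteq> 0"
  shows "hs.sol (\<lambda>\<phi>. \<tau> (fx (\<nu> \<phi>))) (\<lambda>\<phi>. \<tau> (fx (\<pi>' \<phi>))) (\<lambda>\<phi>. \<tau> (fx (\<theta> \<phi>)))"
  unfolding hs.sol_def
proof (intro conjI ballI)
  show "\<exists>\<phi>\<in>\<Psi>. \<tau> (fx (\<pi>' \<phi>)) \<noteq> 0"
    using assms(2) unfolding hom_ev(8)[OF assms(1)] hs.ev_def by (metis (mono_tags, lifting) mult_zero_left sum.neutral)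
  show "\<exists>\<phi>\<in>\<Psi>. \<tau> (fx (\<theta> \<phi>)) \<noteq> 0"
    using assms(4) unfolding hom_ev(9)[OF assms(3)] hs.ev_def by (metis (mono_tags, lifting) mult_zero_left sum.neutral)
  fix w :: complex assume w: "w \<in> ball 0 \<rho>"
  note m = hom_ev(1-6)[OF w]
  have "\<tau> ((fx (D1 N w) * fx (P w) - fx (N w) * fx (D1 P w)) * fx (q w) + fls_const r * fx (D1 P w) * fx (P w) * fx (q w)
     + fx (D1 q w) * (fx (P w) * fx (P w))) = \<tau> (fls_const (\<kappa> w) * (fx (P w) * fx (P w)) * fx (q w))"
    by (simp only: fls_equation[OF w])
  then have "(\<tau> (fx (D1 N w)) * \<tau> (fx (P w)) - \<tau> (fx (N w)) * \<tau> (fx (D1 P w))) * \<tau> (fx (q w)) + r * \<tau> (fx (D1 P w)) * \<tau> (fx (P w)) * \<tau> (fx (q w))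
     + \<tau> (fx (D1 q w)) * (\<tau> (fx (P w)) * \<tau> (fx (P w))) = \<kappa> w * (\<tau> (fx (P w)) * \<tau> (fx (P w))) * \<tau> (fx (q w))"
    using m by (simp only: hom_add hom_mult hom_diff alg_add alg_mult alg_diff alg_const const)
  then show "(hs.ev' (\<lambda>\<phi>. \<tau> (fx (\<nu> \<phi>))) w * hs.ev (\<lambda>\<phi>. \<tau> (fx (\<pi>' \<phi>))) w - hs.ev (\<lambda>\<phi>. \<tau> (fx (\<nu> \<phi>))) w * hs.ev' (\<lambda>\<phi>. \<tau> (fx (\<pi>' \<phi>))) w) *
        hs.ev (\<lambda>\<phi>. \<tau> (fx (\<theta> \<phi>))) w + r * hs.ev' (\<lambda>\<phi>. \<tau> (fx (\<pi>' \<phi>))) w * hs.ev (\<lambda>\<phi>. \<tau> (fx (\<pi>' \<phi>))) w * hs.ev (\<lambda>\<phi>. \<tau> (fx (\<theta> \<phi>))) w +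
       hs.ev' (\<lambda>\<phi>. \<tau> (fx (\<theta> \<phi>))) w * (hs.ev (\<lambda>\<phi>. \<tau> (fx (\<pi>' \<phi>))) w)\<^sup>2 =
       \<kappa> w * (hs.ev (\<lambda>\<phi>. \<tau> (fx (\<pi>' \<phi>))) w)\<^sup>2 * hs.ev (\<lambda>\<phi>. \<tau> (fx (\<theta> \<phi>))) w"
    unfolding hom_ev(7-12)[OF w] power2_eq_square .
qed

text \<open>Adjoining the inverse of y to the algebra prevents every homomorphism from vanishing at
  y.\<close>

lemma hom_inverse:
  assumes "y \<in> alg X" "inverse y \<in> alg X" "y \<noteq> 0"
  shows "\<tau> y \<noteq> 0" "\<tau> (inverse y) = inverse (\<tau> y)"
proof -
  have "\<tau> (inverse y) * \<tau> y = \<tau> (inverse y * y)" by (rule hom_mult[OF assms(2,1), symmetric])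
  also have "\<dots> = 1" using assms(3) const[of 1] by simp
  finally have 1: "\<tau> (inverse y) * \<tau> y = 1" .
  then show "\<tau> y \<noteq> 0" by auto
  from 1 show "\<tau> (inverse y) = inverse (\<tau> y)" by (metis inverse_unique mult.commute)
qed

end

lemma fx_nonzero: "f holomorphic_on ball 0 \<rho> \<Longrightarrow> f 0 \<noteq> 0 \<Longrightarrow> fx f \<noteq> 0"
  using fx_eq_0D[of f 0] \<rho> by auto

lemma ball_0: "(0::complex) \<in> ball 0 \<rho>"
  using \<rho> by simp

text \<open>If the difference of N / P at w1 and w0 were not a scalar of the algebra, homomorphisms
  would give it values beyond the bound of \<open>sol_ratio_difference_bounded\<close>.\<close>

lemma quotient_difference_constant:
  assumes w: "w0 \<in> ball 0 \<rho>" "w1 \<in> ball 0 \<rho>" and nz: "P w0 0 \<noteq> 0" "P w1 0 \<noteq> 0"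
  shows "\<exists>c. \<forall>s\<in>ball 0 \<rho>. N w1 s * P w0 s - N w0 s * P w1 s = c * (P w0 s * P w1 s)"
proof -
  define p0 p1 q0' where "p0 = fx (P w0)" and "p1 = fx (P w1)" and "q0' = fx (q 0)"
  note holP = fr2_holomorphic(2)[OF frP] and holN = fr2_holomorphic(2)[OF frN]
  have nzx: "p0 \<noteq> 0" "p1 \<noteq> 0" "q0' \<noteq> 0"
    unfolding p0_def p1_def q0'_def
    using nz q0 w by (simp_all only: fx_nonzero[OF holP] fx_nonzero[OF fr2_holomorphic(2)[OF frq]] ball_0 not_False_eq_True)
  \<comment> \<open>The inverses put the quotients into the algebra and keep \<open>P w0\<close>,
    \<open>P w1\<close> and \<open>q 0\<close> nonzero under every homomorphism.\<close>
  define X where "X = gens \<union> {inverse p0, inverse p1, inverse q0'}"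
  have cX: "countable X" using fin by (auto simp: X_def gens_def intro: countable_finite)
  have X: "gens \<subseteq> X" by (auto simp: X_def)
  have inX: "inverse p0 \<in> alg X" "inverse p1 \<in> alg X" "inverse q0' \<in> alg X" by (auto simp: X_def intro!: alg_gen)
  have lin: "(\<Sum>\<phi>\<in>\<Phi>. fls_const (c \<phi>) * x \<phi>) \<in> alg X"
    if "finite \<Phi>" "\<And>\<phi>. \<phi> \<in> \<Phi> \<Longrightarrow> x \<phi> \<in> alg X" for \<Phi> :: "(complex \<Rightarrow> complex) set" and c x
    using that
  proof (induction \<Phi> rule: finite_induct)
    case empty
    show ?case using alg_const[of 0 X] by simp
  next
    case (insert a F)
    then show ?case by (auto intro!: alg_add alg_mult alg_const)
  qed
  have inA: "fx (N w) \<in> alg X" "fx (P w) \<in> alg X" if "w \<in> ball 0 \<rho>" for w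
  proof -
    have "fx (\<nu> \<phi>) \<in> alg X" "fx (\<pi>' \<phi>) \<in> alg X" if "\<phi> \<in> \<Psi>" for \<phi>
      using that X by (auto simp: gens_def intro!: alg_gen)
    then show "fx (N w) \<in> alg X" "fx (P w) \<in> alg X" unfolding fx_NPq[OF that] by (intro lin fin; simp)+
  qed
  define f where "f = fx (N w1) * inverse p1 + fls_const (-1) * (fx (N w0) * inverse p0)"
  have fA: "f \<in> alg X" unfolding f_def
    by (intro alg_add alg_mult alg_const inA inX w)
  have "f \<in> range fls_const"
  proof (rule ccontr)
    assume f: "f \<notin> range fls_const"
    define Bad where "Bad = {A. \<not> (\<exists>\<tau>. (\<forall>a. \<tau> (fls_const a) = a) \<and>
       (\<forall>x\<in>alg X. \<forall>y\<in>alg X. \<tau> (x + y) = \<tau> x + \<tau> y \<and> \<tau> (x * y) = \<tau> x * \<tau> y) \<and> \<tau> f = A)}"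
    have cB: "countable Bad" unfolding Bad_def by (rule alg_nonvalues[OF cX fA f])
    obtain K where K: "\<And>b a d. hs.sol b a d \<Longrightarrow> hs.ev a w0 \<noteq> 0 \<Longrightarrow> hs.ev a w1 \<noteq> 0 \<Longrightarrow>
      norm (hs.ev b w1 / hs.ev a w1 - hs.ev b w0 / hs.ev a w0) \<le> K"
      using hs.sol_ratio_difference_bounded[OF w] by blast
    \<comment> \<open>All points of this disc have norm larger than K, and the countably many
      exceptional values cannot fill it.\<close>
    have "uncountable (ball (complex_of_real (\<bar>K\<bar> + 2)) 1)" by (rule uncountable_ball) simp
    then have "\<not> ball (complex_of_real (\<bar>K\<bar> + 2)) 1 \<subseteq> Bad" using cB countable_subset by blast
    then obtain A where A: "A \<in> ball (complex_of_real (\<bar>K\<bar> + 2)) 1" "A \<notin> Bad" by blast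
    have "norm A > K"
    proof -
      have "norm (complex_of_real (\<bar>K\<bar> + 2)) - norm A \<le> norm (complex_of_real (\<bar>K\<bar> + 2) - A)"
        by (rule norm_triangle_ineq2)
      then show ?thesis using A(1) by (simp add: dist_norm del: of_real_add)
    qed
    obtain \<tau> where \<tau>: "\<And>a. \<tau> (fls_const a) = a"
       "\<forall>x\<in>alg X. \<forall>y\<in>alg X. \<tau> (x + y) = \<tau> x + \<tau> y \<and> \<tau> (x * y) = \<tau> x * \<tau> y" "\<tau> f = A"
      using A(2) unfolding Bad_def by blast
    note ev = hom_ev[OF X \<tau>(1,2)]
    have ev0: "\<tau> p0 \<noteq> 0" "\<tau> (inverse p0) = inverse (\<tau> p0)" and ev1: "\<tau> p1 \<noteq> 0" "\<tau> (inverse p1) = inverse (\<tau> p1)"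
      and evq: "\<tau> q0' \<noteq> 0"
      using hom_inverse[OF X \<tau>(1,2)] inX nzx ev(2)[OF w(1)] ev(2)[OF w(2)] ev(3)[OF ball_0]
      unfolding p0_def p1_def q0'_def by auto
    have sol: "hs.sol (\<lambda>\<phi>. \<tau> (fx (\<nu> \<phi>))) (\<lambda>\<phi>. \<tau> (fx (\<pi>' \<phi>))) (\<lambda>\<phi>. \<tau> (fx (\<theta> \<phi>)))"
      by (rule hom_sol[OF X \<tau>(1,2) w(1) _ ball_0]) (use ev0 evq in \<open>auto simp: p0_def q0'_def\<close>)
    have "\<tau> f = \<tau> (fx (N w1)) * \<tau> (inverse p1) + (-1) * (\<tau> (fx (N w0)) * \<tau> (inverse p0))"
      unfolding f_def using inA[OF w(1)] inA[OF w(2)] inX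
      by (simp only: hom_add[OF X \<tau>(1,2)] hom_mult[OF X \<tau>(1,2)] alg_mult alg_const \<tau>(1))
    also have "\<dots> = \<tau> (fx (N w1)) / \<tau> (fx (P w1)) - \<tau> (fx (N w0)) / \<tau> (fx (P w0))"
      unfolding ev0 ev1 by (simp add: divide_inverse p0_def p1_def)
    finally have "A = hs.ev (\<lambda>\<phi>. \<tau> (fx (\<nu> \<phi>))) w1 / hs.ev (\<lambda>\<phi>. \<tau> (fx (\<pi>' \<phi>))) w1
       - hs.ev (\<lambda>\<phi>. \<tau> (fx (\<nu> \<phi>))) w0 / hs.ev (\<lambda>\<phi>. \<tau> (fx (\<pi>' \<phi>))) w0"
      unfolding \<tau>(3) ev(7,8)[OF w(1)] ev(7,8)[OF w(2)] .
    then have "norm A \<le> K"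
      using K[OF sol] ev0(1) ev1(1) unfolding p0_def p1_def ev(8)[OF w(1)] ev(8)[OF w(2)] by simp
    with \<open>norm A > K\<close> show False by simp
  qed
  then obtain c where c: "f = fls_const c" by blast
  have "fx (N w1) * p0 - fx (N w0) * p1 = (fx (N w1) * inverse p1 + fls_const (-1) * (fx (N w0) * inverse p0)) * (p0 * p1)"
    using nzx by (simp add: field_simps)
  then have eq: "fx (N w1) * p0 - fx (N w0) * p1 = fls_const c * (p0 * p1)" using c unfolding f_def by simp
  define F where "F s = N w1 s * P w0 s - N w0 s * P w1 s - c * (P w0 s * P w1 s)" for s
  have holF: "F holomorphic_on ball 0 \<rho>" unfolding F_def [abs_def]
    by (intro holomorphic_intros holN holP w)
  have "fx F = fx (N w1) * p0 - fx (N w0) * p1 - fls_const c * (p0 * p1)"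
    unfolding F_def [abs_def] p0_def p1_def using holN[OF w(1)] holN[OF w(2)] holP[OF w(1)] holP[OF w(2)]
    by (simp add: fx_diff fx_mult fx_const holomorphic_on_diff holomorphic_on_mult)
  then have "fx F = 0" using eq by simp
  then have "F s = 0" if "s \<in> ball 0 \<rho>" for s using fx_eq_0D[OF holF _ that] by simp
  then show ?thesis by (intro exI[of _ c] ballI) (simp add: F_def)
qed

text \<open>If the quotient of P at w1 and w0 were not a scalar, homomorphisms would give it values
  tending to 0, and \<open>sol_degenerate_rational\<close> would produce the relation that
  \<open>irr\<close> excludes.\<close>

lemma ratio_constant:
  assumes w: "w0 \<in> ball 0 \<rho>" "w1 \<in> ball 0 \<rho>" and nz: "P w0 0 \<noteq> 0"
    and irr: "\<not> (\<exists>m l::nat. m > 0 \<and> r * of_nat m + of_nat l = 0)"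
  shows "\<exists>c. \<forall>s\<in>ball 0 \<rho>. P w1 s = c * P w0 s"
proof -
  define p0 p1 q0' where "p0 = fx (P w0)" and "p1 = fx (P w1)" and "q0' = fx (q 0)"
  note holP = fr2_holomorphic(2)[OF frP]
  have nzx: "p0 \<noteq> 0" "q0' \<noteq> 0"
    unfolding p0_def q0'_def
    using nz q0 w by (simp_all only: fx_nonzero[OF holP] fx_nonzero[OF fr2_holomorphic(2)[OF frq]] ball_0 not_False_eq_True)
  \<comment> \<open>Only \<open>P w0\<close> and \<open>q 0\<close> are inverted:
    \<open>P w1\<close> may vanish at s = 0, and its images are meant to become small relative to
    those of \<open>P w0\<close>.\<close>
  define X where "X = gens \<union> {inverse p0, inverse q0'}"
  have cX: "countable X" using fin by (auto simp: X_def gens_def intro: countable_finite)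
  have X: "gens \<subseteq> X" by (auto simp: X_def)
  have inX: "inverse p0 \<in> alg X" "inverse q0' \<in> alg X" by (auto simp: X_def intro!: alg_gen)
  have "(\<Sum>\<phi>\<in>\<Phi>. fls_const (c \<phi>) * fx (\<pi>' \<phi>)) \<in> alg X"
    if "finite \<Phi>" "\<Phi> \<subseteq> \<Psi>" for \<Phi> and c :: "(complex \<Rightarrow> complex) \<Rightarrow> complex"
    using that
  proof (induction \<Phi> rule: finite_induct)
    case empty
    show ?case using alg_const[of 0 X] by simp
  next
    case (insert a F)
    then have "fx (\<pi>' a) \<in> alg X" using X by (auto simp: gens_def intro!: alg_gen)
    then show ?case using insert by (auto intro!: alg_add alg_mult alg_const)
  qed
  from this[OF fin order_refl] have inA: "fx (P w) \<in> alg X" if "w \<in> ball 0 \<rho>" for w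
    using that by (simp add: fx_NPq)
  define f where "f = p1 * inverse p0"
  have fA: "f \<in> alg X" unfolding f_def p1_def by (intro alg_mult inA inX w)
  have "f \<in> range fls_const"
  proof (rule ccontr)
    assume f: "f \<notin> range fls_const"
    define Bad where "Bad = {A. \<not> (\<exists>\<tau>. (\<forall>a. \<tau> (fls_const a) = a) \<and>
       (\<forall>x\<in>alg X. \<forall>y\<in>alg X. \<tau> (x + y) = \<tau> x + \<tau> y \<and> \<tau> (x * y) = \<tau> x * \<tau> y) \<and> \<tau> f = A)}"
    have cB: "countable Bad" unfolding Bad_def by (rule alg_nonvalues[OF cX fA f])
    have "\<exists>A. A \<in> ball 0 (1 / real (Suc n)) \<and> A \<notin> Bad" for n
    proof -
      have "uncountable (ball (0::complex) (1 / real (Suc n)))" by (rule uncountable_ball) simp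
      then have "\<not> ball (0::complex) (1 / real (Suc n)) \<subseteq> Bad" using cB countable_subset by blast
      then show ?thesis by blast
    qed
    then obtain A where A: "\<And>n. A n \<in> ball 0 (1 / real (Suc n))" "\<And>n. A n \<notin> Bad" by metis
    have "\<exists>\<tau>. (\<forall>a. \<tau> (fls_const a) = a) \<and>
       (\<forall>x\<in>alg X. \<forall>y\<in>alg X. \<tau> (x + y) = \<tau> x + \<tau> y \<and> \<tau> (x * y) = \<tau> x * \<tau> y) \<and> \<tau> f = A n" for n
      using A(2)[of n] unfolding Bad_def by blast
    then obtain \<tau> where \<tau>: "\<And>n a. \<tau> n (fls_const a) = a"
       "\<And>n. \<forall>x\<in>alg X. \<forall>y\<in>alg X. \<tau> n (x + y) = \<tau> n x + \<tau> n y \<and> \<tau> n (x * y) = \<tau> n x * \<tau> n y"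
       "\<And>n. \<tau> n f = A n" by metis
    note ev = hom_ev[OF X \<tau>(1,2)]
    have ev0: "\<tau> n p0 \<noteq> 0" "\<tau> n (inverse p0) = inverse (\<tau> n p0)" and evq: "\<tau> n q0' \<noteq> 0" for n
      using hom_inverse[OF X \<tau>(1,2)] inX nzx ev(2)[OF w(1)] ev(3)[OF ball_0]
      unfolding p0_def q0'_def by auto
    have sol: "hs.sol (\<lambda>\<phi>. \<tau> n (fx (\<nu> \<phi>))) (\<lambda>\<phi>. \<tau> n (fx (\<pi>' \<phi>))) (\<lambda>\<phi>. \<tau> n (fx (\<theta> \<phi>)))" for n
      by (rule hom_sol[OF X \<tau>(1,2) w(1) _ ball_0]) (use ev0 evq in \<open>auto simp: p0_def q0'_def\<close>)
    have An: "A n = hs.ev (\<lambda>\<phi>. \<tau> n (fx (\<pi>' \<phi>))) w1 / hs.ev (\<lambda>\<phi>. \<tau> n (fx (\<pi>' \<phi>))) w0" for n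
    proof -
      have "\<tau> n f = \<tau> n p1 * \<tau> n (inverse p0)"
        unfolding f_def using inA[OF w(2)] inX by (simp only: hom_mult[OF X \<tau>(1,2)] p1_def)
      then show ?thesis
        unfolding ev0(2) unfolding \<tau>(3) p0_def p1_def ev(8)[OF w(1)] ev(8)[OF w(2)] by (simp add: divide_inverse)
    qed
    have "A \<longlonglongrightarrow> 0"
    proof (rule tendsto_norm_zero_cancel, rule tendsto_sandwich[OF _ _ tendsto_const])
      show "\<forall>\<^sub>F n in sequentially. 0 \<le> norm (A n)" by simp
      show "\<forall>\<^sub>F n in sequentially. norm (A n) \<le> 1 / real (Suc n)"
        using A(1) by (intro always_eventually allI) (auto intro: less_imp_le)
      show "(\<lambda>n. 1 / real (Suc n)) \<longlonglongrightarrow> 0" by (rule LIMSEQ_Suc[OF lim_1_over_n])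
    qed
    then have lim: "(\<lambda>n. hs.ev (\<lambda>\<phi>. \<tau> n (fx (\<pi>' \<phi>))) w1 / hs.ev (\<lambda>\<phi>. \<tau> n (fx (\<pi>' \<phi>))) w0) \<longlonglongrightarrow> 0"
      unfolding An[symmetric] .
    have nz: "hs.ev (\<lambda>\<phi>. \<tau> n (fx (\<pi>' \<phi>))) w0 \<noteq> 0" for n
      using ev0(1)[of n] unfolding p0_def ev(8)[OF w(1)] .
    show False
      using hs.sol_degenerate_rational[where a = "\<lambda>n \<phi>. \<tau> n (fx (\<pi>' \<phi>))", OF sol w nz lim] irr by blast
  qed
  then obtain c where c: "f = fls_const c" by blast
  then have eq: "p1 = fls_const c * p0" using nzx by (simp add: f_def field_simps)
  define F where "F s = P w1 s - c * P w0 s" for s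
  have holF: "F holomorphic_on ball 0 \<rho>" unfolding F_def [abs_def]
    by (intro holomorphic_intros holP w)
  have "fx F = p1 - fls_const c * p0"
    unfolding F_def [abs_def] p0_def p1_def using holP[OF w(1)] holP[OF w(2)]
    by (simp add: fx_diff fx_mult fx_const holomorphic_on_mult)
  then have "fx F = 0" using eq by simp
  then have "F s = 0" if "s \<in> ball 0 \<rho>" for s using fx_eq_0D[OF holF _ that] by simp
  then show ?thesis by (intro exI[of _ c] ballI) (simp add: F_def)
qed

end

section \<open>Splitting of the quotient and of the denominator\<close>

context fr_equation
begin

lemma exists_rep: "\<exists>\<Psi> \<nu> \<pi>' \<theta>. fr_equation_rep \<rho> N P q \<kappa> r \<Psi> \<nu> \<pi>' \<theta>"
proof -
  obtain \<Psi> where \<Psi>: "finite \<Psi>" "\<forall>\<phi>\<in>\<Psi>. \<phi> holomorphic_on ball 0 \<rho>" "rep \<rho> \<Psi> N" "rep \<rho> \<Psi> P" "rep \<rho> \<Psi> q"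
    "\<forall>a. (\<forall>w\<in>ball 0 \<rho>. (\<Sum>\<phi>\<in>\<Psi>. a \<phi> * \<phi> w) = 0) \<longrightarrow> (\<forall>\<phi>\<in>\<Psi>. a \<phi> = 0)"
    using fr2_common_rep[OF frN frP frq] by blast
  obtain \<nu> where \<nu>: "\<forall>\<phi>\<in>\<Psi>. \<nu> \<phi> holomorphic_on ball 0 \<rho>"
     "\<forall>w\<in>ball 0 \<rho>. \<forall>s\<in>ball 0 \<rho>. N w s = (\<Sum>\<phi>\<in>\<Psi>. \<nu> \<phi> s * \<phi> w)" using \<Psi>(3) unfolding rep_def by (elim exE conjE)
  obtain \<pi>' where \<pi>': "\<forall>\<phi>\<in>\<Psi>. \<pi>' \<phi> holomorphic_on ball 0 \<rho>"
     "\<forall>w\<in>ball 0 \<rho>. \<forall>s\<in>ball 0 \<rho>. P w s = (\<Sum>\<phi>\<in>\<Psi>. \<pi>' \<phi> s * \<phi> w)" using \<Psi>(4) unfolding rep_def by (elim exE conjE)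
  obtain \<theta> where \<theta>: "\<forall>\<phi>\<in>\<Psi>. \<theta> \<phi> holomorphic_on ball 0 \<rho>"
     "\<forall>w\<in>ball 0 \<rho>. \<forall>s\<in>ball 0 \<rho>. q w s = (\<Sum>\<phi>\<in>\<Psi>. \<theta> \<phi> s * \<phi> w)" using \<Psi>(5) unfolding rep_def by (elim exE conjE)
  have "fr_equation_rep \<rho> N P q \<kappa> r \<Psi> \<nu> \<pi>' \<theta>"
    by unfold_locales (use \<Psi>(1,2) \<nu> \<pi>' \<theta> \<Psi>(6)[rule_format] in \<open>blast+\<close>)
  then show ?thesis by blast
qed

theorem quotient_splits:
  "\<exists>\<rho>'>0. \<exists>a b. a holomorphic_on ball 0 \<rho>' \<and> b holomorphic_on ball 0 \<rho>' \<and> \<rho>' \<le> \<rho> \<and>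
     (\<forall>w\<in>ball 0 \<rho>'. \<forall>s\<in>ball 0 \<rho>'. P w s \<noteq> 0 \<and> N w s / P w s = a w + b s)"
proof -
  obtain \<Psi> \<nu> \<pi>' \<theta> where "fr_equation_rep \<rho> N P q \<kappa> r \<Psi> \<nu> \<pi>' \<theta>" using exists_rep by blast
  then interpret fr_equation_rep \<rho> N P q \<kappa> r \<Psi> \<nu> \<pi>' \<theta> .
  obtain \<rho>' where \<rho>': "\<rho>' > 0" "\<rho>' \<le> \<rho>" "\<And>w s. w \<in> ball 0 \<rho>' \<Longrightarrow> s \<in> ball 0 \<rho>' \<Longrightarrow> P w s \<noteq> 0"
    using fr2_nonzero_near_0[OF frP \<rho> P0] by blast
  have sub: "ball 0 \<rho>' \<subseteq> ball (0::complex) \<rho>" using \<rho>' by auto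
  have z: "(0::complex) \<in> ball 0 \<rho>'" using \<rho>' by simp
  \<comment> \<open>The difference of N / P at (w, s) and (0, s) is independent of s; a is this
    difference at s = 0, and b is N / P at w = 0.\<close>
  define a b where "a w = N w 0 / P w 0 - N 0 0 / P 0 0" and "b s = N 0 s / P 0 s" for w s
  have "a holomorphic_on ball 0 \<rho>'" unfolding a_def [abs_def]
    using \<rho>'(3) z fr2_holomorphic(1)[OF frN ball_0] fr2_holomorphic(1)[OF frP ball_0] sub
    by (intro holomorphic_intros) (auto intro: holomorphic_on_subset)
  moreover have "b holomorphic_on ball 0 \<rho>'" unfolding b_def [abs_def]
    using \<rho>'(3) z fr2_holomorphic(2)[OF frN ball_0] fr2_holomorphic(2)[OF frP ball_0] sub
    by (intro holomorphic_intros) (auto intro: holomorphic_on_subset)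
  moreover have "N w s / P w s = a w + b s" if ws: "w \<in> ball 0 \<rho>'" "s \<in> ball 0 \<rho>'" for w s
  proof -
    obtain c where c: "\<And>s. s \<in> ball 0 \<rho> \<Longrightarrow> N w s * P 0 s - N 0 s * P w s = c * (P 0 s * P w s)"
      using quotient_difference_constant[of 0 w] \<rho>'(3)[OF z z] \<rho>'(3)[OF ws(1) z] ws(1) z sub by blast
    have "N w s / P w s - N 0 s / P 0 s = c" if s: "s \<in> ball 0 \<rho>'" for s
      using c[of s] s sub \<rho>'(3)[OF ws(1) s] \<rho>'(3)[OF z s] by (auto simp: field_simps)
    from this[OF ws(2)] this[OF z] show ?thesis by (simp add: a_def b_def algebra_simps)
  qed
  ultimately show ?thesis using \<rho>' by blast
qed

theorem denominator_splits:
  assumes irr: "\<not> (\<exists>m l::nat. m > 0 \<and> r * of_nat m + of_nat l = 0)"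
  shows "\<exists>\<rho>'>0. \<exists>a b. a holomorphic_on ball 0 \<rho>' \<and> b holomorphic_on ball 0 \<rho>' \<and> \<rho>' \<le> \<rho> \<and>
     (\<forall>w\<in>ball 0 \<rho>'. \<forall>s\<in>ball 0 \<rho>'. P w s \<noteq> 0 \<and> P w s = a w * b s)"
proof -
  obtain \<Psi> \<nu> \<pi>' \<theta> where "fr_equation_rep \<rho> N P q \<kappa> r \<Psi> \<nu> \<pi>' \<theta>" using exists_rep by blast
  then interpret fr_equation_rep \<rho> N P q \<kappa> r \<Psi> \<nu> \<pi>' \<theta> .
  obtain \<rho>' where \<rho>': "\<rho>' > 0" "\<rho>' \<le> \<rho>" "\<And>w s. w \<in> ball 0 \<rho>' \<Longrightarrow> s \<in> ball 0 \<rho>' \<Longrightarrow> P w s \<noteq> 0"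
    using fr2_nonzero_near_0[OF frP \<rho> P0] by blast
  have sub: "ball 0 \<rho>' \<subseteq> ball (0::complex) \<rho>" using \<rho>' by auto
  have z: "(0::complex) \<in> ball 0 \<rho>'" using \<rho>' by simp
  \<comment> \<open>The quotient of P at (w, s) and (0, s) is independent of s; a is its value at s
    = 0.\<close>
  define a b where "a w = P w 0 / P 0 0" and "b s = P 0 s" for w s
  have "a holomorphic_on ball 0 \<rho>'" unfolding a_def [abs_def]
    using P0 fr2_holomorphic(1)[OF frP ball_0] sub
    by (intro holomorphic_intros) (auto intro: holomorphic_on_subset)
  moreover have "b holomorphic_on ball 0 \<rho>'" unfolding b_def [abs_def]
    using fr2_holomorphic(2)[OF frP ball_0] sub by (auto intro: holomorphic_on_subset)
  moreover have "P w s = a w * b s" if ws: "w \<in> ball 0 \<rho>'" "s \<in> ball 0 \<rho>'" for w s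
  proof -
    obtain c where c: "\<And>s. s \<in> ball 0 \<rho> \<Longrightarrow> P w s = c * P 0 s"
      using ratio_constant[of 0 w, OF _ _ P0 irr] ws(1) z sub by blast
    have "P w s = c * P 0 s" "P w 0 = c * P 0 0" using c[of s] c[of 0] ws \<rho> sub by auto
    then show ?thesis using P0 by (simp add: a_def b_def)
  qed
  ultimately show ?thesis using \<rho>' by blast
qed

end

section \<open>Finite rank functions on a disc\<close>

definition hw :: "(complex \<Rightarrow> complex) \<Rightarrow> complex \<Rightarrow> complex \<Rightarrow> complex \<Rightarrow> bool" where
  "hw f a b t \<longleftrightarrow> (f has_derivative (\<lambda>h. a * h + b * cnj h)) (at t)"

lemma hw_unique: "hw f a b t \<Longrightarrow> hw f a' b' t \<Longrightarrow> a = a'" "hw f a b t \<Longrightarrow> hw f a' b' t \<Longrightarrow> b = b'"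
  unfolding hw_def using wirtinger_unique by blast+

lemma hw_cong:
  assumes "hw f a b t" "open A" "t \<in> A" "\<And>z. z \<in> A \<Longrightarrow> f z = g z"
  shows "hw g a b t"
  using assms unfolding hw_def by (auto intro: has_derivative_transform_within_open)

lemma hw_const: "hw (\<lambda>t. c) 0 0 t"
  by (simp add: hw_def)

lemma hw_add: "hw f a b t \<Longrightarrow> hw g a' b' t \<Longrightarrow> hw (\<lambda>t. f t + g t) (a + a') (b + b') t"
  unfolding hw_def by (drule (1) has_derivative_add) (simp add: algebra_simps)

lemma hw_mult: "hw f a b t \<Longrightarrow> hw g a' b' t \<Longrightarrow> hw (\<lambda>t. f t * g t) (f t * a' + a * g t) (f t * b' + b * g t) t"
  unfolding hw_def by (drule (1) has_derivative_mult) (simp add: algebra_simps)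

lemma hw_cmult: "hw f a b t \<Longrightarrow> hw (\<lambda>t. c * f t) (c * a) (c * b) t"
  using hw_mult[OF hw_const, of f a b t c] by simp

lemma hw_diff: "hw f a b t \<Longrightarrow> hw g a' b' t \<Longrightarrow> hw (\<lambda>t. f t - g t) (a - a') (b - b') t"
  using hw_add[OF _ hw_cmult, of f a b t g a' b' "-1"] by simp

lemma hw_sum: "(\<And>i. i \<in> I \<Longrightarrow> hw (f i) (a i) (b i) t) \<Longrightarrow> hw (\<lambda>t. \<Sum>i\<in>I. f i t) (\<Sum>i\<in>I. a i) (\<Sum>i\<in>I. b i) t"
  by (induction I rule: infinite_finite_induct) (auto intro: hw_add hw_const)

lemma hw_divide:
  assumes "hw f a b t" "hw g a' b' t" "g t \<noteq> 0"
  shows "hw (\<lambda>t. f t / g t) ((a * g t - f t * a') / (g t * g t)) ((b * g t - f t * b') / (g t * g t)) t"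
proof -
  have "((\<lambda>t. f t / g t) has_derivative (\<lambda>h. ((a * h + b * cnj h) * g t - f t * (a' * h + b' * cnj h)) / (g t * g t))) (at t)"
    using assms unfolding hw_def by (intro has_derivative_divide') auto
  moreover have "((a * h + b * cnj h) * g t - f t * (a' * h + b' * cnj h)) / (g t * g t)
     = (a * g t - f t * a') / (g t * g t) * h + (b * g t - f t * b') / (g t * g t) * cnj h" for h
    by (simp add: add_divide_distrib[symmetric] diff_divide_distrib[symmetric] algebra_simps)
  ultimately show ?thesis unfolding hw_def by simp
qed

lemma hw_cnj: "hw f a b t \<Longrightarrow> hw (\<lambda>t. cnj (f t)) (cnj b) (cnj a) t"
  unfolding hw_def by (drule has_derivative_cnj) (simp add: algebra_simps)

lemma hw_holomorphic: "(f has_field_derivative a) (at t) \<longleftrightarrow> hw f a 0 t"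
  by (simp add: hw_def has_field_derivative_def)

text \<open>The derivative appears as a multiple of the power itself, which is the form suited to
  logarithmic derivatives.\<close>

lemma hw_power: "hw f a b t \<Longrightarrow> f t \<noteq> 0 \<Longrightarrow> hw (\<lambda>t. f t ^ n) (of_nat n * (a / f t) * f t ^ n) (of_nat n * (b / f t) * f t ^ n) t"
proof (induction n)
  case 0
  then show ?case using hw_const[of 1] by simp
next
  case (Suc n)
  then have "hw (\<lambda>t. f t * f t ^ n) (f t * (of_nat n * (a / f t) * f t ^ n) + a * f t ^ n)
    (f t * (of_nat n * (b / f t) * f t ^ n) + b * f t ^ n) t" by (intro hw_mult)
  moreover have "f t * (of_nat n * (x / f t) * f t ^ n) + x * f t ^ n = of_nat (Suc n) * (x / f t) * f t ^ Suc n" for x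
    using Suc.prems by (simp add: field_simps)
  ultimately show ?case by simp
qed

section \<open>Finite rank functions on the diagonal\<close>

definition frd :: "real \<Rightarrow> (complex \<Rightarrow> complex) \<Rightarrow> bool" where
  "frd \<rho> f \<longleftrightarrow> (\<exists>G. fr2 \<rho> G \<and> (\<forall>t\<in>ball 0 \<rho>. f t = G t (cnj t)))"

lemma frdI: "fr2 \<rho> G \<Longrightarrow> (\<And>t. t \<in> ball 0 \<rho> \<Longrightarrow> f t = G t (cnj t)) \<Longrightarrow> frd \<rho> f"
  unfolding frd_def by blast

lemma frd_cong: "frd \<rho> f \<Longrightarrow> (\<And>t. t \<in> ball 0 \<rho> \<Longrightarrow> g t = f t) \<Longrightarrow> frd \<rho> g"
  unfolding frd_def by auto

lemma frd_holomorphic: "f holomorphic_on ball 0 \<rho> \<Longrightarrow> frd \<rho> f"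
  by (rule frdI[OF fr2_left]) auto

lemma frd_const: "frd \<rho> (\<lambda>t. c)"
  by (rule frd_holomorphic) simp

lemma frd_add: "frd \<rho> f \<Longrightarrow> frd \<rho> g \<Longrightarrow> frd \<rho> (\<lambda>t. f t + g t)"
  unfolding frd_def by (elim exE conjE, rule exI, rule conjI, erule (1) fr2_add) auto

lemma frd_mult: "frd \<rho> f \<Longrightarrow> frd \<rho> g \<Longrightarrow> frd \<rho> (\<lambda>t. f t * g t)"
  unfolding frd_def by (elim exE conjE, rule exI, rule conjI, erule (1) fr2_mult) auto

lemma frd_diff: "frd \<rho> f \<Longrightarrow> frd \<rho> g \<Longrightarrow> frd \<rho> (\<lambda>t. f t - g t)"
  using frd_add[OF _ frd_mult[OF frd_const[of \<rho> "-1"]], of f g] by simp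

lemma frd_sum: "(\<And>i. i \<in> I \<Longrightarrow> frd \<rho> (f i)) \<Longrightarrow> frd \<rho> (\<lambda>t. \<Sum>i\<in>I. f i t)"
  by (induction I rule: infinite_finite_induct) (auto intro: frd_add frd_const)

lemma frd_prod: "(\<And>i. i \<in> I \<Longrightarrow> frd \<rho> (f i)) \<Longrightarrow> frd \<rho> (\<lambda>t. \<Prod>i\<in>I. f i t)"
  by (induction I rule: infinite_finite_induct) (auto intro: frd_mult frd_const)

lemma frd_cnj: "frd \<rho> f \<Longrightarrow> frd \<rho> (\<lambda>t. cnj (f t))"
  unfolding frd_def by (elim exE conjE, rule exI, rule conjI, erule fr2_cnj) auto

lemma frd_det:
  fixes M :: "complex \<Rightarrow> complex^'m^'m"
  assumes "\<And>i j. frd \<rho> (\<lambda>t. M t $ i $ j)"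
  shows "frd \<rho> (\<lambda>t. det (M t))"
  unfolding det_def by (intro frd_sum frd_mult frd_prod frd_const assms)

lemma frd_mono: "frd \<rho> f \<Longrightarrow> \<rho>' \<le> \<rho> \<Longrightarrow> frd \<rho>' f"
  unfolding frd_def by (elim exE conjE, rule exI, rule conjI, erule (1) fr2_subset) auto

lemma fr2_hw: "fr2 \<rho> G \<Longrightarrow> t \<in> ball 0 \<rho> \<Longrightarrow> hw (\<lambda>t. G t (cnj t)) (D1 G t (cnj t)) (D2 G t (cnj t)) t"
  unfolding hw_def by (rule fr2_diagonal_has_derivative)

text \<open>m is the mixed second derivative of f / g. The finite rank representations supply
  explicit formulas for it in both orders of differentiation, and \<open>D_commute\<close> makes
  them agree.\<close>

lemma frd_quotient_commute:
  assumes "frd \<rho> f" "frd \<rho> g" "\<And>t. t \<in> ball 0 \<rho> \<Longrightarrow> g t \<noteq> 0"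
  shows "\<exists>u v m. \<forall>t\<in>ball 0 \<rho>. hw (\<lambda>t. f t / g t) (u t) (v t) t \<and> (\<exists>a. hw u a (m t) t) \<and> (\<exists>b. hw v (m t) b t)"
proof -
  obtain F where F: "fr2 \<rho> F" "\<And>t. t \<in> ball 0 \<rho> \<Longrightarrow> f t = F t (cnj t)" using assms(1) unfolding frd_def by blast
  obtain G where G: "fr2 \<rho> G" "\<And>t. t \<in> ball 0 \<rho> \<Longrightarrow> g t = G t (cnj t)" using assms(2) unfolding frd_def by blast
  define u where "u t = (D1 F t (cnj t) * G t (cnj t) - F t (cnj t) * D1 G t (cnj t)) / (G t (cnj t) * G t (cnj t))" for t
  define v where "v t = (D2 F t (cnj t) * G t (cnj t) - F t (cnj t) * D2 G t (cnj t)) / (G t (cnj t) * G t (cnj t))" for t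
  define m where "m t = (((D1 F t (cnj t) * D2 G t (cnj t) + D2 (D1 F) t (cnj t) * G t (cnj t)) - (F t (cnj t) * D2 (D1 G) t (cnj t) + D2 F t (cnj t) * D1 G t (cnj t))) * (G t (cnj t) * G t (cnj t))
     - (D1 F t (cnj t) * G t (cnj t) - F t (cnj t) * D1 G t (cnj t)) * (G t (cnj t) * D2 G t (cnj t) + D2 G t (cnj t) * G t (cnj t))) / ((G t (cnj t) * G t (cnj t)) * (G t (cnj t) * G t (cnj t)))" for t
  have "hw (\<lambda>t. f t / g t) (u t) (v t) t \<and> (\<exists>a. hw u a (m t) t) \<and> (\<exists>b. hw v (m t) b t)" if t: "t \<in> ball 0 \<rho>" for t
  proof (intro conjI)
    have nz: "G t (cnj t) \<noteq> 0" using assms(3)[OF t] G(2)[OF t] by simp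
    have nz2: "G t (cnj t) * G t (cnj t) \<noteq> 0" using nz by simp
    note hF = fr2_hw[OF F(1) t] and hG = fr2_hw[OF G(1) t]
    note h1F = fr2_hw[OF fr2_D(1)[OF F(1)] t] and h1G = fr2_hw[OF fr2_D(1)[OF G(1)] t]
    note h2F = fr2_hw[OF fr2_D(2)[OF F(1)] t] and h2G = fr2_hw[OF fr2_D(2)[OF G(1)] t]
    have "hw (\<lambda>t. F t (cnj t) / G t (cnj t)) (u t) (v t) t"
      unfolding u_def v_def by (rule hw_divide[OF hF hG nz])
    then show "hw (\<lambda>t. f t / g t) (u t) (v t) t"
      by (rule hw_cong[OF _ open_ball t]) (simp add: F(2) G(2))
    show "\<exists>a. hw u a (m t) t"
      unfolding u_def [abs_def] m_def
      by (rule exI, rule hw_divide[OF hw_diff[OF hw_mult[OF h1F hG] hw_mult[OF hF h1G]] hw_mult[OF hG hG] nz2])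
    have c: "D1 (D2 F) t (cnj t) = D2 (D1 F) t (cnj t)" "D1 (D2 G) t (cnj t) = D2 (D1 G) t (cnj t)"
      using D_commute[OF F(1) t, of "cnj t"] D_commute[OF G(1) t, of "cnj t"] t by simp_all
    note hv = hw_divide[OF hw_diff[OF hw_mult[OF h2F hG] hw_mult[OF hF h2G]] hw_mult[OF hG hG] nz2]
    have "m t = ((D2 F t (cnj t) * D1 G t (cnj t) + D1 (D2 F) t (cnj t) * G t (cnj t) -
       (F t (cnj t) * D1 (D2 G) t (cnj t) + D1 F t (cnj t) * D2 G t (cnj t))) * (G t (cnj t) * G t (cnj t)) -
      (D2 F t (cnj t) * G t (cnj t) - F t (cnj t) * D2 G t (cnj t)) *
      (G t (cnj t) * D1 G t (cnj t) + D1 G t (cnj t) * G t (cnj t))) / (G t (cnj t) * G t (cnj t) * (G t (cnj t) * G t (cnj t)))"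
      unfolding m_def c by (intro arg_cong2[where f = "(/)"] refl) (simp only: algebra_simps)
    then show "\<exists>b. hw v (m t) b t"
      unfolding v_def [abs_def] using hv by auto
  qed
  then show ?thesis by blast
qed

text \<open>For the flat case, where potentials of the metric and of X are produced by integration
  in s and in w.\<close>

lemma fr2_primitive:
  "fr2 \<rho> G \<Longrightarrow> \<exists>I. fr2 \<rho> I \<and> (\<forall>w\<in>ball 0 \<rho>. \<forall>s\<in>ball 0 \<rho>. D2 I w s = G w s)"
  "fr2 \<rho> G \<Longrightarrow> \<exists>I. fr2 \<rho> I \<and> (\<forall>w\<in>ball 0 \<rho>. \<forall>s\<in>ball 0 \<rho>. D1 I w s = G w s)"
proof -
  have prim: "\<exists>f. f holomorphic_on ball 0 \<rho> \<and> (\<forall>t\<in>ball 0 \<rho>. deriv f t = g t)" if "g holomorphic_on ball 0 \<rho>" for g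
  proof -
    obtain f where f: "\<And>x. x \<in> ball 0 \<rho> \<Longrightarrow> (f has_field_derivative g x) (at x within ball 0 \<rho>)"
      using holomorphic_convex_primitive'[OF convex_ball open_ball \<open>g holomorphic_on ball 0 \<rho>\<close>] by blast
    then have f': "(f has_field_derivative g x) (at x)" if "x \<in> ball 0 \<rho>" for x
      using that at_within_open[OF that open_ball] by metis
    have "f holomorphic_on ball 0 \<rho>" unfolding holomorphic_on_open[OF open_ball] using f' by blast
    then show ?thesis using DERIV_imp_deriv[OF f'] by blast
  qed
  show "\<exists>I. fr2 \<rho> I \<and> (\<forall>w\<in>ball 0 \<rho>. \<forall>s\<in>ball 0 \<rho>. D2 I w s = G w s)" if "fr2 \<rho> G"
    using that
  proof (induction G rule: fr2.induct)
    case (fr2_prod \<phi> \<eta> G)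
    obtain f where f: "f holomorphic_on ball 0 \<rho>" "\<forall>t\<in>ball 0 \<rho>. deriv f t = \<eta> t" using prim[OF fr2_prod(2)] by blast
    have "fr2 \<rho> (\<lambda>w s. \<phi> w * f s)" by (rule fr2.fr2_prod[OF fr2_prod(1) f(1)]) simp
    moreover have "D2 (\<lambda>w s. \<phi> w * f s) w s = G w s" if "w \<in> ball 0 \<rho>" "s \<in> ball 0 \<rho>" for w s
      using D_prod(2)[OF fr2_prod(1) f(1) refl that] f(2) fr2_prod(3) that by simp
    ultimately show ?case by (intro exI[of _ "\<lambda>w s. \<phi> w * f s"]) blast
  next
    case (fr2_sum2 F G H)
    obtain I J where IJ: "fr2 \<rho> I" "\<forall>w\<in>ball 0 \<rho>. \<forall>s\<in>ball 0 \<rho>. D2 I w s = F w s"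
      "fr2 \<rho> J" "\<forall>w\<in>ball 0 \<rho>. \<forall>s\<in>ball 0 \<rho>. D2 J w s = G w s" using fr2_sum2(4,5) by (elim exE conjE)
    have "D2 (\<lambda>w s. I w s + J w s) w s = H w s" if "w \<in> ball 0 \<rho>" "s \<in> ball 0 \<rho>" for w s
      using D_sum2(2)[OF IJ(1,3) refl that] IJ(2,4) fr2_sum2(3) that by simp
    then show ?case using fr2_add[OF IJ(1,3)] by (intro exI[of _ "\<lambda>w s. I w s + J w s"]) blast
  qed
  show "\<exists>I. fr2 \<rho> I \<and> (\<forall>w\<in>ball 0 \<rho>. \<forall>s\<in>ball 0 \<rho>. D1 I w s = G w s)" if "fr2 \<rho> G"
    using that
  proof (induction G rule: fr2.induct)
    case (fr2_prod \<phi> \<eta> G)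
    obtain f where f: "f holomorphic_on ball 0 \<rho>" "\<forall>t\<in>ball 0 \<rho>. deriv f t = \<phi> t" using prim[OF fr2_prod(1)] by blast
    have "fr2 \<rho> (\<lambda>w s. f w * \<eta> s)" by (rule fr2.fr2_prod[OF f(1) fr2_prod(2)]) simp
    moreover have "D1 (\<lambda>w s. f w * \<eta> s) w s = G w s" if "w \<in> ball 0 \<rho>" "s \<in> ball 0 \<rho>" for w s
      using D_prod(1)[OF f(1) fr2_prod(2) refl that] f(2) fr2_prod(3) that by simp
    ultimately show ?case by (intro exI[of _ "\<lambda>w s. f w * \<eta> s"]) blast
  next
    case (fr2_sum2 F G H)
    obtain I J where IJ: "fr2 \<rho> I" "\<forall>w\<in>ball 0 \<rho>. \<forall>s\<in>ball 0 \<rho>. D1 I w s = F w s"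
      "fr2 \<rho> J" "\<forall>w\<in>ball 0 \<rho>. \<forall>s\<in>ball 0 \<rho>. D1 J w s = G w s" using fr2_sum2(4,5) by (elim exE conjE)
    have "D1 (\<lambda>w s. I w s + J w s) w s = H w s" if "w \<in> ball 0 \<rho>" "s \<in> ball 0 \<rho>" for w s
      using D_sum2(1)[OF IJ(1,3) refl that] IJ(2,4) fr2_sum2(3) that by simp
    then show ?case using fr2_add[OF IJ(1,3)] by (intro exI[of _ "\<lambda>w s. I w s + J w s"]) blast
  qed
qed

text \<open>The interface to geometry. \<open>Rt\<close>, \<open>B\<close> and \<open>Q\<close> are
  the t-derivatives of N / P, log P and log q, and the last assumption makes
  \<open>Rt t + r * B t + Q t\<close> holomorphic. The conclusions concern the mixed derivatives of
  N / P and of log P at 0.\<close>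

theorem disc_equation_splits:
  assumes \<rho>: "\<rho> > 0" and N: "frd \<rho> N" and P: "frd \<rho> P" and q: "frd \<rho> q"
    and nz: "\<And>t. t \<in> ball 0 \<rho> \<Longrightarrow> P t \<noteq> 0" "\<And>t. t \<in> ball 0 \<rho> \<Longrightarrow> q t \<noteq> 0"
    and R: "\<And>t. t \<in> ball 0 \<rho> \<Longrightarrow> \<exists>x. hw (\<lambda>t. N t / P t) (Rt t) x t"
    and B: "\<And>t. t \<in> ball 0 \<rho> \<Longrightarrow> \<exists>y. hw P (B t * P t) y t"
    and Q: "\<And>t. t \<in> ball 0 \<rho> \<Longrightarrow> \<exists>z. hw q (Q t * q t) z t"
    and \<kappa>: "\<And>t. t \<in> ball 0 \<rho> \<Longrightarrow> \<exists>k. hw (\<lambda>t. Rt t + r * B t + Q t) k 0 t"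
  shows "hw Rt a0 b0 0 \<Longrightarrow> b0 = 0"
    and "\<not> (\<exists>m l::nat. m > 0 \<and> r * of_nat m + of_nat l = 0) \<Longrightarrow> hw B a0 b0 0 \<Longrightarrow> b0 = 0"
proof -
  obtain GN where GN: "fr2 \<rho> GN" "\<And>t. t \<in> ball 0 \<rho> \<Longrightarrow> N t = GN t (cnj t)" using N unfolding frd_def by blast
  obtain GP where GP: "fr2 \<rho> GP" "\<And>t. t \<in> ball 0 \<rho> \<Longrightarrow> P t = GP t (cnj t)" using P unfolding frd_def by blast
  obtain Gq where Gq: "fr2 \<rho> Gq" "\<And>t. t \<in> ball 0 \<rho> \<Longrightarrow> q t = Gq t (cnj t)" using q unfolding frd_def by blast
  have z: "(0::complex) \<in> ball 0 \<rho>" using \<rho> by simp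
  define \<kappa>' where "\<kappa>' t = Rt t + r * B t + Q t" for t
  have hol: "\<kappa>' holomorphic_on ball 0 \<rho>"
    using \<kappa> unfolding hw_holomorphic[symmetric] \<kappa>'_def [abs_def] holomorphic_on_open[OF open_ball] by blast
  have hN: "hw N (D1 GN t (cnj t)) (D2 GN t (cnj t)) t" and hP: "hw P (D1 GP t (cnj t)) (D2 GP t (cnj t)) t"
    and hq: "hw q (D1 Gq t (cnj t)) (D2 Gq t (cnj t)) t" if t: "t \<in> ball 0 \<rho>" for t :: complex
    by (rule hw_cong[OF fr2_hw[OF GN(1) t] open_ball t] hw_cong[OF fr2_hw[OF GP(1) t] open_ball t]
        hw_cong[OF fr2_hw[OF Gq(1) t] open_ball t]; simp add: GN GP Gq)+
  interpret fr_equation \<rho> GN GP Gq \<kappa>' r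
  proof
    show "\<rho> > 0" "fr2 \<rho> GN" "fr2 \<rho> GP" "fr2 \<rho> Gq" "\<kappa>' holomorphic_on ball 0 \<rho>" by fact+
    show "GP 0 0 \<noteq> 0" "Gq 0 0 \<noteq> 0" using nz[OF z] GP(2)[OF z] Gq(2)[OF z] by simp_all
    fix t :: complex assume t: "t \<in> ball 0 \<rho>"
    have 1: "D1 GP t (cnj t) = B t * P t" using hw_unique(1)[OF hP[OF t]] B[OF t] by blast
    have 2: "D1 Gq t (cnj t) = Q t * q t" using hw_unique(1)[OF hq[OF t]] Q[OF t] by blast
    obtain x where "hw (\<lambda>t. N t / P t) (Rt t) x t" using R[OF t] by blast
    from hw_unique(1)[OF hw_divide[OF hN[OF t] hP[OF t] nz(1)[OF t]] this]
    have "D1 GN t (cnj t) * P t - N t * D1 GP t (cnj t) = Rt t * (P t * P t)"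
      using nz(1)[OF t] by (simp add: divide_eq_eq)
    then have 3: "D1 GN t (cnj t) * P t - N t * (B t * P t) = Rt t * (P t * P t)" unfolding 1 .
    show "(D1 GN t (cnj t) * GP t (cnj t) - GN t (cnj t) * D1 GP t (cnj t)) * Gq t (cnj t)
      + r * D1 GP t (cnj t) * GP t (cnj t) * Gq t (cnj t) + D1 Gq t (cnj t) * (GP t (cnj t))\<^sup>2
      = \<kappa>' t * (GP t (cnj t))\<^sup>2 * Gq t (cnj t)"
      unfolding 1 2 GN(2)[OF t, symmetric] GP(2)[OF t, symmetric] Gq(2)[OF t, symmetric] 3 \<kappa>'_def
      by (simp add: power2_eq_square algebra_simps)
  qed
  show "b0 = 0" if h: "hw Rt a0 b0 0"
  proof -
    obtain \<rho>' a b where \<rho>': "\<rho>' > 0" "\<rho>' \<le> \<rho>" "a holomorphic_on ball 0 \<rho>'" "b holomorphic_on ball 0 \<rho>'"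
      "\<And>w s. w \<in> ball 0 \<rho>' \<Longrightarrow> s \<in> ball 0 \<rho>' \<Longrightarrow> GP w s \<noteq> 0 \<and> GN w s / GP w s = a w + b s"
      using quotient_splits by blast
    have sub: "ball 0 \<rho>' \<subseteq> ball (0::complex) \<rho>" using \<rho>' by auto
    \<comment> \<open>After splitting, N / P is a(t) + b(cnj t), whose t-derivative is holomorphic;
      hence the conjugate derivative b0 of \<open>Rt\<close> is 0.\<close>
    have "Rt t = deriv a t" if t: "t \<in> ball 0 \<rho>'" for t
    proof -
      have tr: "t \<in> ball 0 \<rho>" using t sub by blast
      have "fr2 \<rho>' (\<lambda>w s. a w + b s)" by (intro fr2_add fr2_left fr2_right \<rho>')
      from fr2_hw[OF this t] have "hw (\<lambda>t. a t + b (cnj t)) (D1 (\<lambda>w s. a w + b s) t (cnj t)) (D2 (\<lambda>w s. a w + b s) t (cnj t)) t" .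
      then have "hw (\<lambda>t. N t / P t) (D1 (\<lambda>w s. a w + b s) t (cnj t)) (D2 (\<lambda>w s. a w + b s) t (cnj t)) t"
        by (rule hw_cong[OF _ open_ball t]) (use \<rho>'(5) GN(2) GP(2) sub in \<open>auto simp: subset_eq\<close>)
      then have "Rt t = D1 (\<lambda>w s. a w + b s) t (cnj t)" using R[OF tr] hw_unique(1) by blast
      also have "\<dots> = deriv a t" unfolding D1_def
        by (intro DERIV_imp_deriv)
          (auto intro!: derivative_eq_intros holomorphic_derivI[OF \<rho>'(3) open_ball t])
      finally show ?thesis .
    qed
    moreover have z': "(0::complex) \<in> ball 0 \<rho>'" using \<rho>' by simp
    ultimately have "hw (deriv a) a0 b0 0" by (intro hw_cong[OF h open_ball z'])
    moreover have "hw (deriv a) (deriv (deriv a) 0) 0 0"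
      unfolding hw_holomorphic[symmetric]
      by (rule holomorphic_derivI[OF holomorphic_deriv[OF \<rho>'(3) open_ball] open_ball z'])
    ultimately show ?thesis by (rule hw_unique(2))
  qed
  show "b0 = 0" if irr: "\<not> (\<exists>m l::nat. m > 0 \<and> r * of_nat m + of_nat l = 0)" and h: "hw B a0 b0 0"
  proof -
    obtain \<rho>' a b where \<rho>': "\<rho>' > 0" "\<rho>' \<le> \<rho>" "a holomorphic_on ball 0 \<rho>'" "b holomorphic_on ball 0 \<rho>'"
      "\<And>w s. w \<in> ball 0 \<rho>' \<Longrightarrow> s \<in> ball 0 \<rho>' \<Longrightarrow> GP w s \<noteq> 0 \<and> GP w s = a w * b s"
      using denominator_splits[OF irr] by blast
    have sub: "ball 0 \<rho>' \<subseteq> ball (0::complex) \<rho>" using \<rho>' by auto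
    have anz: "a t \<noteq> 0" if t: "t \<in> ball 0 \<rho>'" for t
      using \<rho>'(5)[OF t, of "cnj t"] t by auto
    \<comment> \<open>After splitting, P is a(t) b(cnj t), so its logarithmic t-derivative is
      holomorphic.\<close>
    have "B t = deriv a t / a t" if t: "t \<in> ball 0 \<rho>'" for t
    proof -
      have tr: "t \<in> ball 0 \<rho>" using t sub by blast
      have ct: "cnj t \<in> ball 0 \<rho>'" using t by simp
      have "fr2 \<rho>' (\<lambda>w s. a w * b s)" by (intro fr2_mult fr2_left fr2_right \<rho>')
      from fr2_hw[OF this t] have "hw (\<lambda>t. a t * b (cnj t)) (D1 (\<lambda>w s. a w * b s) t (cnj t)) (D2 (\<lambda>w s. a w * b s) t (cnj t)) t" .
      then have "hw P (D1 (\<lambda>w s. a w * b s) t (cnj t)) (D2 (\<lambda>w s. a w * b s) t (cnj t)) t"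
        by (rule hw_cong[OF _ open_ball t]) (use \<rho>'(5) GP(2) sub in \<open>auto simp: subset_eq\<close>)
      then have "B t * P t = D1 (\<lambda>w s. a w * b s) t (cnj t)" using B[OF tr] hw_unique(1) by blast
      also have "\<dots> = deriv a t * b (cnj t)" by (rule D_prod(1)[OF \<rho>'(3,4) refl t ct])
      finally have "B t * (a t * b (cnj t)) = deriv a t * b (cnj t)" using GP(2)[OF tr] \<rho>'(5)[OF t ct] by simp
      moreover have "b (cnj t) \<noteq> 0" using \<rho>'(5)[OF t ct] by auto
      ultimately show ?thesis using anz[OF t] by (simp add: field_simps)
    qed
    moreover have z': "(0::complex) \<in> ball 0 \<rho>'" using \<rho>' by simp
    ultimately have "hw (\<lambda>t. deriv a t / a t) a0 b0 0" by (intro hw_cong[OF h open_ball z'])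
    moreover have "hw (\<lambda>t. deriv a t / a t) (deriv (\<lambda>t. deriv a t / a t) 0) 0 0"
      unfolding hw_holomorphic[symmetric]
      using anz by (intro holomorphic_derivI[OF _ open_ball z'] holomorphic_intros \<rho>') auto
    ultimately show ?thesis by (rule hw_unique(2))
  qed
qed

section \<open>Holomorphic linear differential equations\<close>

lemma holomorphic_linear_ode:
  fixes M :: "'m::finite \<Rightarrow> 'm \<Rightarrow> complex \<Rightarrow> complex"
  assumes \<rho>: "\<rho> > 0" and M: "\<And>i j. M i j holomorphic_on ball 0 \<rho>"
  shows "\<exists>\<rho>'>0. \<rho>' \<le> \<rho> \<and> (\<forall>a. \<exists>y. \<forall>i. y i 0 = a i \<and>
    (\<forall>t\<in>ball 0 \<rho>'. (y i has_field_derivative (\<Sum>j\<in>UNIV. M i j t * y j t)) (at t)))"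
proof -
  have sub2: "cball 0 (\<rho> / 2) \<subseteq> ball (0::complex) \<rho>" using \<rho> by auto
  have "\<exists>K. \<forall>t\<in>cball 0 (\<rho> / 2). norm (M i j t) \<le> K" for i j
  proof -
    have "continuous_on (cball 0 (\<rho> / 2)) (M i j)"
      using holomorphic_on_imp_continuous_on[OF M] sub2 continuous_on_subset by blast
    then have "compact (M i j ` cball 0 (\<rho> / 2))" by (intro compact_continuous_image) auto
    then have "bounded (M i j ` cball 0 (\<rho> / 2))" by (rule compact_imp_bounded)
    then obtain K where "\<forall>y\<in>M i j ` cball 0 (\<rho> / 2). norm y \<le> K" unfolding bounded_iff ..
    then show ?thesis by (intro exI[of _ K]) simp
  qed
  then obtain Kf where Kf: "\<And>i j t. t \<in> cball 0 (\<rho> / 2) \<Longrightarrow> norm (M i j t) \<le> Kf i j" by metis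
  define K where "K = 1 + (\<Sum>i\<in>UNIV. \<Sum>j\<in>UNIV. \<bar>Kf i j\<bar>)"
  have K1: "K \<ge> 1" unfolding K_def by (simp add: sum_nonneg)
  have K: "(\<Sum>j\<in>UNIV. norm (M i j t)) \<le> K" if "t \<in> cball 0 (\<rho> / 2)" for i t
  proof -
    have "(\<Sum>j\<in>UNIV. norm (M i j t)) \<le> (\<Sum>j\<in>UNIV. \<bar>Kf i j\<bar>)"
      using Kf[OF that] by (intro sum_mono) (meson abs_ge_self order_trans)
    also have "\<dots> \<le> (\<Sum>i\<in>UNIV. \<Sum>j\<in>UNIV. \<bar>Kf i j\<bar>)"
      by (rule member_le_sum) (auto intro: sum_nonneg)
    finally show ?thesis by (simp add: K_def)
  qed
  \<comment> \<open>Since K \<rho>' is at most 1/2, each integration over a segment in the smaller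
    disc halves the bound for the terms of the Picard series. The radius depends on M but not on the
    initial value.\<close>
  define \<rho>' where "\<rho>' = min (\<rho> / 2) (1 / (2 * K))"
  have \<rho>': "\<rho>' > 0" "\<rho>' \<le> \<rho> / 2" "K * \<rho>' \<le> 1 / 2" "\<rho>' \<le> \<rho>"
  proof -
    show "\<rho>' > 0" "\<rho>' \<le> \<rho> / 2" "\<rho>' \<le> \<rho>" using \<rho> K1 by (auto simp: \<rho>'_def)
    have "K * \<rho>' \<le> K * (1 / (2 * K))" using K1 by (intro mult_left_mono) (auto simp: \<rho>'_def)
    then show "K * \<rho>' \<le> 1 / 2" using K1 by simp
  qed
  have sub: "ball 0 \<rho>' \<subseteq> ball (0::complex) \<rho>" "ball 0 \<rho>' \<subseteq> cball (0::complex) (\<rho> / 2)"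
    using \<rho>' \<rho> by auto
  have z: "(0::complex) \<in> ball 0 \<rho>'" using \<rho>' by simp
  have M': "M i j holomorphic_on ball 0 \<rho>'" for i j using M sub(1) holomorphic_on_subset by blast
  have prim: "\<exists>f. f 0 = 0 \<and> (\<forall>t\<in>ball 0 \<rho>'. (f has_field_derivative g t) (at t))" if g: "g holomorphic_on ball 0 \<rho>'" for g
  proof -
    obtain f where f: "\<And>x. x \<in> ball 0 \<rho>' \<Longrightarrow> (f has_field_derivative g x) (at x within ball 0 \<rho>')"
      using holomorphic_convex_primitive'[OF convex_ball open_ball g] by blast
    then have "(f has_field_derivative g x) (at x)" if "x \<in> ball 0 \<rho>'" for x
      using that at_within_open[OF that open_ball] by metis
    then have "\<forall>t\<in>ball 0 \<rho>'. ((\<lambda>t. f t - f 0) has_field_derivative g t) (at t)"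
      by (auto intro!: derivative_eq_intros)
    then show ?thesis by (intro exI[of _ "\<lambda>t. f t - f 0"]) simp
  qed
  define pr where "pr g = (SOME f. f 0 = 0 \<and> (\<forall>t\<in>ball 0 \<rho>'. (f has_field_derivative g t) (at t)))" for g :: "complex \<Rightarrow> complex"
  have pr: "pr g 0 = 0 \<and> (\<forall>t\<in>ball 0 \<rho>'. (pr g has_field_derivative g t) (at t))" if "g holomorphic_on ball 0 \<rho>'" for g
    unfolding pr_def using someI_ex[OF prim[OF that]] .
  have "\<exists>y. \<forall>i. y i 0 = a i \<and> (\<forall>t\<in>ball 0 \<rho>'. (y i has_field_derivative (\<Sum>j\<in>UNIV. M i j t * y j t)) (at t))" for a
  proof -
    \<comment> \<open>f n is the n-th term of the Picard series: the constant initial value, then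
      repeatedly the primitive, vanishing at 0, of M times the previous term.\<close>
    define f where "f = rec_nat (\<lambda>i t. a i) (\<lambda>n g i. pr (\<lambda>t. \<Sum>j\<in>UNIV. M i j t * g j t))"
    have f0: "f 0 i t = a i" and fS: "f (Suc n) i = pr (\<lambda>t. \<Sum>j\<in>UNIV. M i j t * f n j t)" for n i t
      by (simp_all add: f_def)
    have fhol: "f n i holomorphic_on ball 0 \<rho>'" for n i
    proof (induction n arbitrary: i)
      case 0
      have "f 0 i = (\<lambda>t. a i)" by (simp add: f0 fun_eq_iff)
      then show ?case by simp
    next
      case (Suc n)
      have "(\<lambda>t. \<Sum>j\<in>UNIV. M i j t * f n j t) holomorphic_on ball 0 \<rho>'" by (intro holomorphic_intros M' Suc)
      from pr[OF this] show ?case unfolding fS holomorphic_on_open[OF open_ball] by blast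
    qed
    have gh: "(\<lambda>t. \<Sum>j\<in>UNIV. M i j t * f n j t) holomorphic_on ball 0 \<rho>'" for n i
      by (intro holomorphic_intros M' fhol)
    define f' where "f' n i t = (case n of 0 \<Rightarrow> 0 | Suc n \<Rightarrow> (\<Sum>j\<in>UNIV. M i j t * f n j t))" for n i t
    have fd: "(f n i has_field_derivative f' n i t) (at t)" if "t \<in> ball 0 \<rho>'" for n i t
    proof (cases n)
      case 0
      have "f 0 i = (\<lambda>t. a i)" by (simp add: f0 fun_eq_iff)
      then show ?thesis using 0 by (simp add: f'_def)
    next
      case (Suc m)
      then show ?thesis using pr[OF gh, of i m] that by (simp add: fS f'_def)
    qed
    define A where "A = (\<Sum>i\<in>UNIV. norm (a i))"
    have A: "norm (a i) \<le> A" for i unfolding A_def by (rule member_le_sum) auto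
    have A0: "A \<ge> 0" by (simp add: A_def sum_nonneg)
    have step: "norm (\<Sum>j\<in>UNIV. M i j t * f n j t) \<le> K * B" if "t \<in> ball 0 \<rho>'" "\<And>j. norm (f n j t) \<le> B" "B \<ge> 0" for i t n B
    proof -
      have "norm (\<Sum>j\<in>UNIV. M i j t * f n j t) \<le> (\<Sum>j\<in>UNIV. norm (M i j t) * B)"
        using that(2) by (intro order_trans[OF norm_sum] sum_mono) (auto simp: norm_mult intro: mult_left_mono)
      also have "\<dots> = (\<Sum>j\<in>UNIV. norm (M i j t)) * B" by (simp add: sum_distrib_right)
      also have "\<dots> \<le> K * B" using K[of t i] that sub(2) by (intro mult_right_mono) auto
      finally show ?thesis .
    qed
    have bd: "norm (f n i t) \<le> A * (1 / 2) ^ n" if "t \<in> ball 0 \<rho>'" for n i t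
      using that
    proof (induction n arbitrary: i t)
      case 0
      then show ?case by (simp add: f0 A)
    next
      case (Suc n)
      have nn: "A * (1 / 2) ^ n \<ge> 0" using A0 by simp
      have "norm (f (Suc n) i t - f (Suc n) i 0) \<le> (K * (A * (1 / 2) ^ n)) * norm (t - 0)"
      proof (rule field_differentiable_bound[of "ball 0 \<rho>'"])
        fix x :: complex assume x: "x \<in> ball 0 \<rho>'"
        show "(f (Suc n) i has_field_derivative f' (Suc n) i x) (at x within ball 0 \<rho>')"
          using fd[OF x] by (rule has_field_derivative_at_within)
        show "norm (f' (Suc n) i x) \<le> K * (A * (1 / 2) ^ n)"
          using step[OF x Suc.IH[OF x] nn] by (simp add: f'_def)
      qed (use Suc z in auto)
      moreover have "f (Suc n) i 0 = 0" using pr[OF gh, of i n] by (simp add: fS)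
      ultimately have "norm (f (Suc n) i t) \<le> (K * (A * (1 / 2) ^ n)) * norm t" by simp
      also have "\<dots> \<le> (K * (A * (1 / 2) ^ n)) * \<rho>'"
        using Suc.prems nn K1 by (intro mult_left_mono) auto
      also have "\<dots> = (K * \<rho>') * (A * (1 / 2) ^ n)" by simp
      also have "\<dots> \<le> (1 / 2) * (A * (1 / 2) ^ n)" using \<rho>'(3) nn by (intro mult_right_mono)
      finally show ?case by simp
    qed
    have smA: "summable (\<lambda>n. A * (1 / 2) ^ n :: real)" by (intro summable_mult summable_geometric) simp
    have sm: "summable (\<lambda>n. f n i t)" if "t \<in> ball 0 \<rho>'" for i t
      by (rule summable_comparison_test[OF _ smA]) (use bd[OF that] in auto)
    \<comment> \<open>The derivative of a term is controlled by the term one index lower, which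
      costs the factor 2.\<close>
    have bd': "norm (f' n i t) \<le> 2 * K * (A * (1 / 2) ^ n)" if t: "t \<in> ball 0 \<rho>'" for n i t
    proof (cases n)
      case 0
      then show ?thesis using A0 K1 by (simp add: f'_def)
    next
      case (Suc m)
      have "norm (f' n i t) \<le> K * (A * (1 / 2) ^ m)" using step[OF t bd[OF t]] A0 Suc by (simp add: f'_def)
      then show ?thesis using Suc by simp
    qed
    have uc: "uniformly_convergent_on (ball 0 \<rho>') (\<lambda>n t. \<Sum>k<n. f' k i t)" for i
      by (rule Weierstrass_m_test'[where M = "\<lambda>n. 2 * K * (A * (1 / 2) ^ n)"]) (use bd' smA in \<open>auto intro: summable_mult\<close>)
    have der: "((\<lambda>t. \<Sum>n. f n i t) has_field_derivative (\<Sum>j\<in>UNIV. M i j t * (\<Sum>n. f n j t))) (at t)"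
      if t: "t \<in> ball 0 \<rho>'" for i t
    proof -
      have "((\<lambda>t. \<Sum>n. f n i t) has_field_derivative (\<Sum>n. f' n i t)) (at t)"
        by (rule has_field_derivative_series'(2)[of "ball 0 \<rho>'" _ _ 0])
          (use fd uc sm z t in \<open>auto intro: has_field_derivative_at_within simp: interior_open\<close>)
      moreover have "(\<Sum>n. f' n i t) = (\<Sum>j\<in>UNIV. M i j t * (\<Sum>n. f n j t))"
      proof -
        have "(\<lambda>n. \<Sum>j\<in>UNIV. M i j t * f n j t) sums (\<Sum>j\<in>UNIV. M i j t * (\<Sum>n. f n j t))"
          by (intro sums_sum sums_mult summable_sums sm t)
        then have "(\<lambda>n. f' (Suc n) i t) sums (\<Sum>j\<in>UNIV. M i j t * (\<Sum>n. f n j t))" by (simp add: f'_def)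
        then have "(\<lambda>n. f' n i t) sums ((\<Sum>j\<in>UNIV. M i j t * (\<Sum>n. f n j t)) + f' 0 i t)"
          by (rule sums_Suc[of "\<lambda>n. f' n i t"])
        then show ?thesis by (simp add: sums_iff f'_def)
      qed
      ultimately show ?thesis by simp
    qed
    have "(\<Sum>n. f n i 0) = a i" for i
    proof -
      have "f (Suc n) i 0 = 0" for n using pr[OF gh, of i n] by (simp add: fS)
      then have "(\<lambda>n. f n i 0) sums f 0 i 0"
        using sums_Suc_iff[of "\<lambda>n. f n i 0" 0] by simp
      then show ?thesis by (simp add: sums_iff f0)
    qed
    then show ?thesis using der by (intro exI[of _ "\<lambda>i t. \<Sum>n. f n i t"]) auto
  qed
  then show ?thesis using \<rho>' by blast
qed

lemma hw_zero_imp_constant: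
  assumes "\<And>t. t \<in> ball 0 \<rho> \<Longrightarrow> hw f 0 0 t" "t \<in> ball 0 \<rho>"
  shows "f t = f 0"
proof -
  have "0 \<le> norm t" "norm t < \<rho>" using assms(2) by auto
  then have \<rho>: "\<rho> > 0" by linarith
  have "\<exists>c. \<forall>x\<in>ball 0 \<rho>. f x = c"
    by (rule has_field_derivative_zero_constant)
      (use assms(1) in \<open>auto simp: hw_holomorphic[symmetric] intro: has_field_derivative_at_within\<close>)
  then show ?thesis using assms(2) \<rho> by auto
qed

text \<open>Let Y be a fundamental matrix of the equation and Z its inverse. Then Z W has vanishing
  t-derivative, so it is antiholomorphic, and W = Y (Z W) is of finite rank. Only the t-derivative
  of W is prescribed, and \<rho>' serves all W at once.\<close>

lemma frd_of_linear_ode: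
  fixes M :: "'m::finite \<Rightarrow> 'm \<Rightarrow> complex \<Rightarrow> complex"
  assumes \<rho>: "\<rho> > 0" and M: "\<And>i j. M i j holomorphic_on ball 0 \<rho>"
  shows "\<exists>\<rho>'>0. \<rho>' \<le> \<rho> \<and> (\<forall>W. (\<forall>i. \<forall>t\<in>ball 0 \<rho>. \<exists>b. hw (W i) (\<Sum>j\<in>UNIV. M i j t * W j t) b t)
     \<longrightarrow> (\<forall>i. frd \<rho>' (W i)))"
proof -
  obtain \<rho>1 where \<rho>1: "\<rho>1 > 0" "\<rho>1 \<le> \<rho>" "\<forall>a. \<exists>y. \<forall>i. y i 0 = a i \<and>
    (\<forall>t\<in>ball 0 \<rho>1. (y i has_field_derivative (\<Sum>j\<in>UNIV. M i j t * y j t)) (at t))"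
    using holomorphic_linear_ode[of \<rho> M, OF \<rho> M] by blast
  \<comment> \<open>The adjoint equation, with matrix minus M transposed; its fundamental matrix
    will invert that of the original equation.\<close>
  obtain \<rho>2 where \<rho>2: "\<rho>2 > 0" "\<rho>2 \<le> \<rho>" "\<forall>a. \<exists>y. \<forall>i. y i 0 = a i \<and>
    (\<forall>t\<in>ball 0 \<rho>2. (y i has_field_derivative (\<Sum>j\<in>UNIV. - M j i t * y j t)) (at t))"
    using holomorphic_linear_ode[OF \<rho>, of "\<lambda>i j t. - M j i t", OF holomorphic_on_minus[OF M]] by blast
  define \<rho>' where "\<rho>' = min \<rho>1 \<rho>2"
  have \<rho>': "\<rho>' > 0" "\<rho>' \<le> \<rho>" using \<rho>1 \<rho>2 by (auto simp: \<rho>'_def)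
  have sub: "ball 0 \<rho>' \<subseteq> ball (0::complex) \<rho>1" "ball 0 \<rho>' \<subseteq> ball (0::complex) \<rho>2" "ball 0 \<rho>' \<subseteq> ball (0::complex) \<rho>"
    using \<rho>1 \<rho>2 by (auto simp: \<rho>'_def)
  have "\<exists>y. \<forall>i. y i 0 = (if i = k then 1 else 0) \<and>
    (\<forall>t\<in>ball 0 \<rho>1. (y i has_field_derivative (\<Sum>j\<in>UNIV. M i j t * y j t)) (at t))" for k
    using \<rho>1(3)[rule_format, of "\<lambda>i. if i = k then 1 else 0"] .
  then obtain y where y0: "\<And>k i. y k i 0 = (if i = k then 1 else 0)"
    and y: "\<And>k i t. t \<in> ball 0 \<rho>1 \<Longrightarrow> (y k i has_field_derivative (\<Sum>j\<in>UNIV. M i j t * y k j t)) (at t)" by metis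
  have "\<exists>y. \<forall>i. y i 0 = (if i = k then 1 else 0) \<and>
    (\<forall>t\<in>ball 0 \<rho>2. (y i has_field_derivative (\<Sum>j\<in>UNIV. - M j i t * y j t)) (at t))" for k
    using \<rho>2(3)[rule_format, of "\<lambda>i. if i = k then 1 else 0"] .
  then obtain z where z0: "\<And>k i. z k i 0 = (if i = k then 1 else 0)"
    and z: "\<And>k i t. t \<in> ball 0 \<rho>2 \<Longrightarrow> (z k i has_field_derivative (\<Sum>j\<in>UNIV. - M j i t * z k j t)) (at t)" by metis
  have pair: "hw (\<lambda>t. \<Sum>i\<in>UNIV. z k i t * W i t) 0 (\<Sum>i\<in>UNIV. z k i t * b i) t"
    if t: "t \<in> ball 0 \<rho>'" and W: "\<And>i. hw (W i) (\<Sum>j\<in>UNIV. M i j t * W j t) (b i) t" for k W b t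
  proof -
    have "hw (z k i) (\<Sum>j\<in>UNIV. - M j i t * z k j t) 0 t" for i
      using z t sub(2) unfolding hw_holomorphic[symmetric] by blast
    then have "hw (\<lambda>t. \<Sum>i\<in>UNIV. z k i t * W i t)
       (\<Sum>i\<in>UNIV. z k i t * (\<Sum>j\<in>UNIV. M i j t * W j t) + (\<Sum>j\<in>UNIV. - M j i t * z k j t) * W i t)
       (\<Sum>i\<in>UNIV. z k i t * b i + 0 * W i t) t"
      by (intro hw_sum hw_mult W)
    moreover have "(\<Sum>i\<in>UNIV. z k i t * (\<Sum>j\<in>UNIV. M i j t * W j t) + (\<Sum>j\<in>UNIV. - M j i t * z k j t) * W i t) = 0"
    proof -
      have "(\<Sum>i\<in>UNIV. (\<Sum>j\<in>UNIV. - M j i t * z k j t) * W i t) = - (\<Sum>i\<in>UNIV. \<Sum>j\<in>UNIV. z k j t * (M j i t * W i t))"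
        by (simp add: sum_distrib_right sum_distrib_left sum_negf algebra_simps)
      also have "(\<Sum>i\<in>UNIV. \<Sum>j\<in>UNIV. z k j t * (M j i t * W i t)) = (\<Sum>j\<in>UNIV. \<Sum>i\<in>UNIV. z k j t * (M j i t * W i t))"
        by (rule sum.swap)
      finally show ?thesis by (simp add: sum.distrib sum_distrib_left)
    qed
    ultimately show ?thesis by simp
  qed
  have ZY: "(\<Sum>i\<in>UNIV. z k i t * y l i t) = (if k = l then 1 else 0)" if t: "t \<in> ball 0 \<rho>'" for k l t
  proof -
    have "hw (\<lambda>t. \<Sum>i\<in>UNIV. z k i t * y l i t) 0 0 t" if t: "t \<in> ball 0 \<rho>'" for t
    proof -
      have "hw (y l i) (\<Sum>j\<in>UNIV. M i j t * y l j t) 0 t" for i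
        using y t sub(1) unfolding hw_holomorphic[symmetric] by blast
      from pair[OF t this] show ?thesis by simp
    qed
    from hw_zero_imp_constant[OF this t]
    have "(\<Sum>i\<in>UNIV. z k i t * y l i t) = (\<Sum>i\<in>UNIV. z k i 0 * y l i 0)" .
    also have "\<dots> = (\<Sum>i\<in>UNIV. if i = k then (if k = l then 1 else 0) else 0)"
      unfolding z0 y0 by (intro sum.cong) auto
    finally show ?thesis by simp
  qed
  \<comment> \<open>By \<open>ZY\<close> one product of the two square matrices is the identity,
    hence so is the other.\<close>
  have YZ: "(\<Sum>l\<in>UNIV. y l i t * z l j t) = (if i = j then 1 else 0)" if t: "t \<in> ball 0 \<rho>'" for i j t
  proof -
    have "(\<chi> k i. z k i t) ** (\<chi> i l. y l i t) = mat 1"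
      by (simp add: vec_eq_iff matrix_matrix_mult_def mat_def ZY[OF t])
    then have "(\<chi> i l. y l i t) ** (\<chi> k i. z k i t) = mat 1" by (simp only: matrix_left_right_inverse)
    then have "((\<chi> i l. y l i t) ** (\<chi> k i. z k i t)) $ i $ j = mat 1 $ i $ j" by (rule arg_cong)
    then show ?thesis by (simp add: matrix_matrix_mult_def mat_def)
  qed
  have "frd \<rho>' (W i)" if W: "\<forall>i. \<forall>t\<in>ball 0 \<rho>. \<exists>b. hw (W i) (\<Sum>j\<in>UNIV. M i j t * W j t) b t" for W i
  proof -
    define V where "V k t = (\<Sum>i\<in>UNIV. z k i t * W i t)" for k t
    have V: "\<exists>b. hw (V k) 0 b t" if t: "t \<in> ball 0 \<rho>'" for k t
    proof -
      have "\<forall>i. \<exists>b. hw (W i) (\<Sum>j\<in>UNIV. M i j t * W j t) b t" using W t sub(3) by blast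
      then obtain b where "\<And>i. hw (W i) (\<Sum>j\<in>UNIV. M i j t * W j t) (b i) t" by metis
      from pair[OF t this] show ?thesis unfolding V_def [abs_def] by blast
    qed
    have Vh: "(\<lambda>s. V k (cnj s)) holomorphic_on ball 0 \<rho>'" for k
      unfolding holomorphic_on_open[OF open_ball]
    proof
      fix s :: complex assume "s \<in> ball 0 \<rho>'"
      then have "cnj s \<in> ball 0 \<rho>'" by simp
      then obtain b where "hw (V k) 0 b (cnj s)" using V by blast
      then have "(V k has_derivative (\<lambda>h. b * cnj h)) (at (cnj s))" by (simp add: hw_def)
      from has_derivative_compose[OF has_derivative_cnj[OF has_derivative_ident] this]
      have "((\<lambda>s. V k (cnj s)) has_derivative (\<lambda>h. b * h)) (at s)" by simp
      then show "\<exists>f'. ((\<lambda>s. V k (cnj s)) has_field_derivative f') (at s)" by (auto simp: has_field_derivative_def)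
    qed
    have yh: "y l i holomorphic_on ball 0 \<rho>'" for l
      unfolding holomorphic_on_open[OF open_ball] using y sub(1) by blast
    have "fr2 \<rho>' (\<lambda>w s. \<Sum>l\<in>UNIV. y l i w * V l (cnj s))"
      by (intro fr2_sum fr2_mult fr2_left fr2_right yh Vh)
    moreover have "W i t = (\<Sum>l\<in>UNIV. y l i t * V l (cnj (cnj t)))" if t: "t \<in> ball 0 \<rho>'" for t
    proof -
      have "(\<Sum>l\<in>UNIV. y l i t * V l t) = (\<Sum>l\<in>UNIV. \<Sum>j\<in>UNIV. (y l i t * z l j t) * W j t)"
        by (simp add: V_def sum_distrib_left mult.assoc)
      also have "\<dots> = (\<Sum>j\<in>UNIV. (\<Sum>l\<in>UNIV. y l i t * z l j t) * W j t)"
        by (subst sum.swap) (simp add: sum_distrib_right)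
      also have "\<dots> = (\<Sum>j\<in>UNIV. if i = j then W j t else 0)"
        unfolding YZ[OF t] by (intro sum.cong) auto
      finally show ?thesis by simp
    qed
    ultimately show ?thesis by (rule frdI)
  qed
  then show ?thesis using \<rho>' by blast
qed

section \<open>Constant holomorphic curvature\<close>

locale constant_holomorphic_curvature = pseudo_kahler_domain A g
  for A :: "(complex^'n) set" and g +
  fixes c :: real
  assumes const_curv: "\<And>x v. x \<in> A \<Longrightarrow> g x v v \<noteq> 0 \<Longrightarrow> sectional_curvature g x v (\<i> *s v) = 2 * c"
begin

text \<open>The deviation of the curvature from that of the model, -c/2 times h(v,u) h(w,z) + h(w,u)
  h(v,z); it will turn out to be 0.\<close>

definition T :: "complex^'n \<Rightarrow> complex^'n \<Rightarrow> complex^'n \<Rightarrow> complex^'n \<Rightarrow> complex^'n \<Rightarrow> complex" where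
  "T x v w u z = h x (S x u v w) z + c / 2 * (h x v u * h x w z + h x w u * h x v z)"

context
  fixes x assumes x: "x \<in> A"
begin

lemma hS_eq: "h x (S x u v w) z = wdb u (wd v (\<lambda>y. h y w z)) x - h x (gam x v w) (gam x u z)"
  using wd_wd_h(2)[OF x, of u v w z] by simp

text \<open>The conjugate derivative of h(w, b) along a is h(w, \<open>gam y a b\<close>), and the
  Christoffel symbols are symmetric.\<close>

lemma wdb_wd_h_sym: "wdb u (wd v (\<lambda>y. h y w z)) x = wdb z (wd v (\<lambda>y. h y w u)) x"
proof -
  have "wdb a (wd v (\<lambda>y. h y w b)) x = wd v (\<lambda>y. h y w (gam y a b)) x" for a b
  proof -
    have "wdb a (wd v (\<lambda>y. h y w b)) x = wd v (wdb a (\<lambda>y. h y w b)) x"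
      by (rule wd_commute(3)[OF smooth_h x])
    also have "\<dots> = wd v (\<lambda>y. h y w (gam y a b)) x"
      by (intro wd_cong_open[OF open_A x] wdb_h)
    finally show ?thesis .
  qed
  moreover have "wd v (\<lambda>y. h y w (gam y u z)) x = wd v (\<lambda>y. h y w (gam y z u)) x"
    by (intro wd_cong_open[OF open_A x]) (simp add: gam_sym)
  ultimately show ?thesis by simp
qed

lemma hS_sym: "h x (S x u v w) z = h x (S x z v w) u"
  unfolding hS_eq using wdb_wd_h_sym[of u v w z] by (simp add: gam_sym[OF x, of u z])

lemma hS_cnj: "cnj (h x (S x u v w) z) = h x (S x v u z) w"
proof -
  have 1: "wdb u (wd v (\<lambda>y. h y w z)) x = wd v (wdb u (\<lambda>y. h y w z)) x"
    by (rule wd_commute(3)[OF smooth_h x])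
  have "cnj (wd v (wdb u (\<lambda>y. h y w z)) x) = wdb v (\<lambda>y. cnj (wdb u (\<lambda>y. h y w z) y)) x"
    by (rule wdb_cnj[symmetric]) (rule smooth_differentiable[OF smooth_wdb[OF smooth_h] x])
  also have "\<dots> = wdb v (wd u (\<lambda>y. h y z w)) x"
  proof (intro wd_cong_open[OF open_A x])
    fix y assume y: "y \<in> A"
    have "wd u (\<lambda>y. h y z w) y = wd u (\<lambda>y. cnj (h y w z)) y"
      by (intro wd_cong_open[OF open_A y]) (simp add: h_cnj)
    also have "\<dots> = cnj (wdb u (\<lambda>y. h y w z) y)" by (rule wd_cnj[OF h_differentiable[OF y]])
    finally show "cnj (wdb u (\<lambda>y. h y w z) y) = wd u (\<lambda>y. h y z w) y" by simp
  qed
  finally show ?thesis unfolding hS_eq 1 by (simp add: h_cnj[OF x])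
qed

lemma T_sym_left: "T x v w u z = T x w v u z"
  by (simp add: T_def S_sym[OF x, of u v w])

lemma T_sym_right: "T x v w u z = T x v w z u"
  by (simp add: T_def hS_sym[of u v w z])

lemma T_add_left: "T x (v + v') w u z = T x v w u z + T x v' w u z"
  by (simp add: T_def S_add_2[OF x] h_add_left[OF x] algebra_simps)

lemma T_scale_left: "T x (a *s v) w u z = a * T x v w u z"
  by (simp add: T_def S_scale_2[OF x] h_scale_left[OF x] algebra_simps)

lemma T_add_left': "T x w (v + v') u z = T x w v u z + T x w v' u z"
  and T_scale_left': "T x w (a *s v) u z = a * T x w v u z"
  using T_sym_left T_add_left T_scale_left by simp_all

lemma T_add_right: "T x v w (u + u') z = T x v w u z + T x v w u' z"
  by (simp add: T_def S_add_1[OF x] h_add_left[OF x] h_add_right[OF x] algebra_simps)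

lemma T_scale_right: "T x v w (a *s u) z = cnj a * T x v w u z"
  by (simp add: T_def S_scale_1[OF x] h_scale_left[OF x] h_scale_right[OF x] algebra_simps)

lemma T_add_right': "T x v w z (u + u') = T x v w z u + T x v w z u'"
  and T_scale_right': "T x v w z (a *s u) = cnj a * T x v w z u"
  using T_sym_right T_add_right T_scale_right by simp_all

text \<open>The curvature operator of v and iv maps iv to -2 S(v, v, v). So the assumption
  determines the real part of h(S(v, v, v), v), and \<open>hS_cnj\<close> shows that there is no
  imaginary part.\<close>

lemma T_diagonal_nonnull:
  assumes nn: "g x v v \<noteq> 0"
  shows "T x v v v v = 0"
proof -
  have hv: "h x v v = of_real (g x v v)"
    using h_cnj[OF x, of v v] Re_h[of x v v] by (metis Reals_cnj_iff of_real_Re)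
  then have giv: "g x v (\<i> *s v) = 0" using Im_h[of x v v] by simp
  have "curvature g x v (\<i> *s v) (\<i> *s v) = S x v (\<i> *s v) (\<i> *s v) - S x (\<i> *s v) v (\<i> *s v)"
    by (rule curvature_eq[OF x])
  also have "S x v (\<i> *s v) (\<i> *s v) = (-1) *s S x v v v"
    by (simp add: S_scale_2[OF x] S_sym[OF x, of v v "\<i> *s v"] vector_smult_assoc)
  also have "S x (\<i> *s v) v (\<i> *s v) = 1 *s S x v v v"
    by (simp add: S_scale_1[OF x] S_scale_2[OF x] S_sym[OF x, of _ v "\<i> *s v"] vector_smult_assoc)
  finally have "curvature g x v (\<i> *s v) (\<i> *s v) = (-2) *s S x v v v"
    by (simp add: vec_eq_iff)
  then have "g x (curvature g x v (\<i> *s v) (\<i> *s v)) v = Re ((-2) * h x (S x v v v) v)"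
    using h_scale_left[OF x, of "-2" "S x v v v" v] Re_h by metis
  then have "- 2 * Re (h x (S x v v v) v) / (g x v v * g x v v) = 2 * c"
    using const_curv[OF x nn] J_inv[OF x, of v v] giv by (simp add: sectional_curvature_def)
  then have "- 2 * Re (h x (S x v v v) v) = 2 * c * (g x v v * g x v v)"
    by (subst (asm) nonzero_divide_eq_eq) (simp_all add: nn)
  then have re: "Re (h x (S x v v v) v) = - c * (g x v v)\<^sup>2"
    by (simp add: power2_eq_square)
  have "Im (h x (S x v v v) v) = 0" using arg_cong[OF hS_cnj[of v v v v], of Im] by simp
  then have "h x (S x v v v) v = of_real (- c * (g x v v)\<^sup>2)" using re by (simp add: complex_eq_iff)
  then show ?thesis by (simp add: T_def hv power2_eq_square)
qed

text \<open>The curvature assumption is silent about null vectors of an indefinite metric. They are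
  limits of vectors v + t u with u not null, because g(v + t u, v + t u) is a nonzero polynomial in
  t.\<close>

lemma T_diagonal: "T x v v v v = 0"
proof (cases "v = 0")
  case True
  then show ?thesis using T_scale_left[of 0 v] by simp
next
  case False
  have "\<exists>u. g x u u \<noteq> 0"
  proof (rule ccontr)
    assume "\<not> ?thesis"
    then have z: "g x u u = 0" for u by auto
    have "g x u w = 0" for u w
      using z[of "u + w"] z[of u] z[of w] g_sym[OF x, of u w]
      by (simp add: bilinear_ladd[OF g_bilinear[OF x]] bilinear_radd[OF g_bilinear[OF x]])
    then show False using False pr x by (auto simp: pseudo_riemannian_on_def)
  qed
  then obtain u where u: "g x u u \<noteq> 0" by auto
  define f where "f t = v + complex_of_real t *s u" for t :: real
  define q where "q t = g x v v + t * (2 * g x v u) + t\<^sup>2 * g x u u" for t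
  have q: "g x (f t) (f t) = q t" for t
  proof -
    have r: "complex_of_real t *s u = t *\<^sub>R u" using complex_scale_eq[of "complex_of_real t" u] by simp
    show ?thesis unfolding f_def r q_def using g_sym[OF x, of u v]
      by (simp add: bilinear_ladd[OF g_bilinear[OF x]] bilinear_radd[OF g_bilinear[OF x]]
          bilinear_lmul[OF g_bilinear[OF x]] bilinear_rmul[OF g_bilinear[OF x]] power2_eq_square algebra_simps)
  qed
  have "finite {t. q t = 0}"
  proof -
    have "q t = poly [:g x v v, 2 * g x v u, g x u u:] t" for t
      by (simp add: q_def power2_eq_square algebra_simps)
    then show ?thesis using poly_roots_finite[of "[:g x v v, 2 * g x v u, g x u u:]"] u by simp
  qed
  then have "open (- ({t. q t = 0} - {0}))" by (intro open_Compl finite_imp_closed) simp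
  then have "\<forall>\<^sub>F t in at 0. t \<in> - ({t. q t = 0} - {0}) - {0}" by (rule eventually_at_in_open) simp
  then have "\<forall>\<^sub>F t in at 0. T x (f t) (f t) (f t) (f t) = 0"
    by eventually_elim (use T_diagonal_nonnull q in auto)
  moreover have "((\<lambda>t. T x (f t) (f t) (f t) (f t)) \<longlongrightarrow> T x (f 0) (f 0) (f 0) (f 0)) (at 0)"
    unfolding f_def T_add_left T_add_left' T_add_right T_add_right' T_scale_left T_scale_left'
      T_scale_right T_scale_right'
    by (intro tendsto_intros)
  ultimately have "T x (f 0) (f 0) (f 0) (f 0) = 0"
    using tendsto_unique[OF trivial_limit_at] tendsto_eventually by (metis (mono_tags))
  then show ?thesis by (simp add: f_def)
qed

text \<open>
  Summing \<open>T\<close> over \<open>v + a w\<close> with \<open>a\<close> a fourth root of unity, weighted by \<open>a\<^sup>2\<close>, isolates the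
  coefficients of \<open>a\<^sup>2\<close> and its conjugate; multiplying \<open>v\<close> by an eighth root of unity separates them.
\<close>

lemma T_eq_0: "T x v w u z = 0"
proof -
  note lin = T_add_left T_add_left' T_add_right T_add_right' T_scale_left T_scale_left'
      T_scale_right T_scale_right'
  have 1: "T x v v w w + T x w w v v = 0" for v w
  proof -
    have "T x (v + 1 *s w) (v + 1 *s w) (v + 1 *s w) (v + 1 *s w) + T x (v + (-1) *s w) (v + (-1) *s w) (v + (-1) *s w) (v + (-1) *s w)
      - T x (v + \<i> *s w) (v + \<i> *s w) (v + \<i> *s w) (v + \<i> *s w) - T x (v + (-\<i>) *s w) (v + (-\<i>) *s w) (v + (-\<i>) *s w) (v + (-\<i>) *s w)
      = 4 * (T x v v w w + T x w w v v)"
      unfolding lin by (simp add: algebra_simps)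
    then have "4 * (T x v v w w + T x w w v v) = 0" unfolding T_diagonal by simp
    then show ?thesis unfolding mult_eq_0_iff by simp
  qed
  have 2: "T x v v w w = 0" for v w
  proof -
    define \<xi> where "\<xi> = csqrt \<i>"
    have \<xi>: "\<xi> * \<xi> = \<i>" unfolding \<xi>_def power2_eq_square[symmetric] by (rule power2_csqrt)
    then have \<xi>': "cnj \<xi> * cnj \<xi> = - \<i>" by (metis complex_cnj_i complex_cnj_mult)
    have "(\<xi> * \<xi>) * T x v v w w + (cnj \<xi> * cnj \<xi>) * T x w w v v = 0"
      using 1[of "\<xi> *s v" w] by (simp add: lin mult.assoc)
    then have "\<i> * (T x v v w w - T x w w v v) = 0" unfolding \<xi> \<xi>' by (simp add: algebra_simps)
    then show ?thesis using 1[of v w] by simp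
  qed
  have 3: "T x v v u z = 0" for v
    using 2[of v "u + z"] 2[of v u] 2[of v z] T_sym_right[of v v u z] by (simp add: lin)
  show ?thesis
    using 3[of "v + w"] 3[of v] 3[of w] T_sym_left[of v w u z] by (simp add: lin)
qed

lemma S_eq: "S x u v w = (- c / 2) *s (h x v u *s w + h x w u *s v)"
proof (rule h_eqI[OF x])
  fix z
  have "h x (S x u v w) z = - (c / 2 * (h x v u * h x w z + h x w u * h x v z))"
    using T_eq_0[of v w u z] by (simp add: T_def eq_neg_iff_add_eq_0)
  also have "\<dots> = h x ((- c / 2) *s (h x v u *s w + h x w u *s v)) z"
    by (simp only: h_scale_left[OF x] h_add_left[OF x]) simp
  finally show "h x (S x u v w) z = h x ((- c / 2) *s (h x v u *s w + h x w u *s v)) z" .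
qed

lemma wdb_gam: "wdb u (\<lambda>y. gam y v w $ k) x = - c / 2 * (h x v u * w $ k + h x w u * v $ k)"
proof -
  have "wdb u (\<lambda>y. gam y v w $ k) x = S x u v w $ k" by (simp add: S_def)
  then show ?thesis by (simp only: S_eq vector_smult_component vector_add_component)
qed

text \<open>With n the complex dimension, the trace yields n + 1 copies of h(v, u): n from the
  identity and one from the rank one term. This is the origin of n + 1 in \<open>P\<close> and
  \<open>\<beta>\<close>.\<close>

lemma wdb_trace_gam:
  "wdb u (\<lambda>y. \<Sum>a\<in>UNIV. gam y v (axis a 1) $ a) x = complex_of_real (- c / 2) * (of_nat CARD('n) + 1) * h x v u"
proof -
  have "wdb u (\<lambda>y. \<Sum>a\<in>UNIV. gam y v (axis a 1) $ a) x
     = (\<Sum>a\<in>UNIV. - c / 2 * (h x v u * (1::complex) + v $ a * h x (axis a 1) u))"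
    by (simp add: wdb_sum gam_differentiable[OF x] wdb_gam mult.commute)
  also have "\<dots> = - c / 2 * (of_nat CARD('n) * h x v u + h x v u)"
    unfolding sum_distrib_left[symmetric] sum.distrib h_expand_left[OF x, of v u, symmetric] by simp
  finally show ?thesis by (simp only: distrib_left distrib_right mult.assoc mult_1_left)
qed

end

text \<open>|\<delta>| to the power -1/(n + 1), n the complex dimension; the square handles negative
  \<delta>, which occurs for some signatures. In the affine charts of the models with c \<noteq> 0
  it is a constant multiple of 1 + |z|_s^2 or 1 - |z|_s^2.\<close>

definition P :: "complex^'n \<Rightarrow> complex" where
  "P x = of_real (exp (- ln ((Re (\<delta> x))\<^sup>2) / (2 * (real CARD('n) + 1))))"

definition \<beta> :: "complex^'n \<Rightarrow> complex^'n \<Rightarrow> complex" where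
  "\<beta> v x = - (\<Sum>a\<in>UNIV. gam x v (axis a 1) $ a) / (of_nat CARD('n) + 1)"

text \<open>As \<beta> is minus the trace of the Christoffel symbols divided by n + 1, these are
  their trace-free parts, known as Thomas' projective parameters.\<close>

definition A2 :: "complex^'n \<Rightarrow> complex^'n \<Rightarrow> 'n \<Rightarrow> complex^'n \<Rightarrow> complex" where
  "A2 v w k x = gam x v w $ k + \<beta> v x * w $ k + \<beta> w x * v $ k"

text \<open>What remains of the second derivative of P, divided by P, after the first order terms
  with coefficients \<open>A2\<close> are removed.\<close>

definition B2 :: "complex^'n \<Rightarrow> complex^'n \<Rightarrow> complex^'n \<Rightarrow> complex" where
  "B2 v w x = wd v (\<beta> w) x - \<beta> v x * \<beta> w x - (\<Sum>k\<in>UNIV. gam x v w $ k * \<beta> (axis k 1) x)"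

lemma P_nonzero: "P x \<noteq> 0" and P_cnj: "cnj (P x) = P x"
  by (simp_all add: P_def)

lemma card_plus_1_nonzero: "(of_nat CARD('n) + 1 :: complex) \<noteq> 0"
  by (metis of_nat_Suc of_nat_eq_0_iff add.commute nat.distinct(1))

lemma smooth_\<beta>: "smooth A (\<beta> v)"
proof -
  have "smooth A (\<lambda>x. (\<Sum>a\<in>UNIV. gam x v (axis a 1) $ a) * (- 1 / (of_nat CARD('n) + 1)))"
    by (intro smooth_mult smooth_sum smooth_gam smooth_const open_A)
  then show ?thesis by (simp add: \<beta>_def [abs_def])
qed

lemma \<beta>_differentiable: "x \<in> A \<Longrightarrow> \<beta> v differentiable (at x)"
  by (rule smooth_differentiable[OF smooth_\<beta>])

lemma \<beta>_wd: "x \<in> A \<Longrightarrow> \<beta> v x = - wd v \<delta> x / \<delta> x / (of_nat CARD('n) + 1)"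
  by (simp add: \<beta>_def wd_\<delta> \<delta>_nonzero)

text \<open>Since \<beta> is the derivative of log P, this makes log P a potential for c/2 times the
  metric.\<close>

lemma wdb_\<beta>:
  assumes x: "x \<in> A"
  shows "wdb u (\<beta> v) x = c / 2 * h x v u"
proof -
  have d: "(\<lambda>y. \<Sum>a\<in>UNIV. gam y v (axis a 1) $ a) differentiable (at x)"
    by (intro smooth_differentiable[OF _ x] smooth_sum smooth_gam open_A)
  have "\<beta> v = (\<lambda>y. (- 1 / (of_nat CARD('n) + 1)) * (\<Sum>a\<in>UNIV. gam y v (axis a 1) $ a))"
    by (simp add: \<beta>_def fun_eq_iff)
  then have "wdb u (\<beta> v) x = (- 1 / (of_nat CARD('n) + 1)) * (complex_of_real (- c / 2) * (of_nat CARD('n) + 1) * h x v u)"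
    using wdb_cmult[OF d, of u "- 1 / (of_nat CARD('n) + 1)"] wdb_trace_gam[OF x, of u v] by simp
  then show ?thesis using card_plus_1_nonzero by simp
qed

lemma \<beta>_expand: "x \<in> A \<Longrightarrow> \<beta> v x = (\<Sum>a\<in>UNIV. v $ a * \<beta> (axis a 1) x)"
  using wd_expand[OF smooth_differentiable[OF smooth_\<delta>], of x v]
  by (simp add: \<beta>_wd sum_divide_distrib sum_negf[symmetric] field_simps del: divide_minus_left)

text \<open>The derivative is P times a smooth function, as \<open>smooth_linearized_ode\<close>
  wants it. \<delta> is real, so its derivative can be computed from its real part.\<close>

lemma has_derivative_P:
  assumes x: "x \<in> A"
  shows "(P has_derivative (\<lambda>v. P x * (- dir_deriv \<delta> x v / \<delta> x / (of_nat CARD('n) + 1)))) (at x)"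
proof -
  have d: "(\<delta> has_derivative dir_deriv \<delta> x) (at x)"
    by (intro has_derivative_dir_deriv smooth_differentiable[OF smooth_\<delta> x])
  have re: "((\<lambda>y. Re (\<delta> y)) has_derivative (\<lambda>v. Re (dir_deriv \<delta> x v))) (at x)"
    by (rule bounded_linear.has_derivative[OF bounded_linear_Re d])
  have \<delta>: "\<delta> y = of_real (Re (\<delta> y))" if "y \<in> A" for y
    using \<delta>_real[OF that] by (metis Reals_cnj_iff of_real_Re)
  then have nz: "Re (\<delta> x) \<noteq> 0" using \<delta>_nonzero[OF x] x by (metis of_real_0)
  have "((\<lambda>y. complex_of_real (Re (\<delta> y))) has_derivative (\<lambda>v. of_real (Re (dir_deriv \<delta> x v)))) (at x)"
    by (rule bounded_linear.has_derivative[OF bounded_linear_of_real re])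
  then have "(\<delta> has_derivative (\<lambda>v. of_real (Re (dir_deriv \<delta> x v)))) (at x)"
    by (rule has_derivative_transform_within_open[OF _ open_A x]) (simp flip: \<delta>)
  then have dre: "dir_deriv \<delta> x v = of_real (Re (dir_deriv \<delta> x v))" for v
    by (rule dir_deriv_eqI)
  define m where "m = real CARD('n) + 1"
  have m: "m > 0" by (simp add: m_def add_nonneg_pos)
  have "((\<lambda>r. exp (- ln (r\<^sup>2) / (2 * m))) has_real_derivative exp (- ln (r\<^sup>2) / (2 * m)) * (- 1 / r / m)) (at r)"
    if "r \<noteq> 0" for r
  proof -
    have "((\<lambda>r. r\<^sup>2) has_real_derivative 2 * r) (at r)" by (auto intro!: derivative_eq_intros)
    from DERIV_chain2[OF DERIV_ln_divide this] that
    have "((\<lambda>r. ln (r\<^sup>2)) has_real_derivative 1 / r\<^sup>2 * (2 * r)) (at r)" by simp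
    then have "((\<lambda>r. exp (- ln (r\<^sup>2) / (2 * m))) has_real_derivative
        exp (- ln (r\<^sup>2) / (2 * m)) * (- (1 / r\<^sup>2 * (2 * r)) / (2 * m))) (at r)"
      using m by (intro DERIV_chain2[OF DERIV_exp] DERIV_cdivide DERIV_minus)
    moreover have "- (1 / r\<^sup>2 * (2 * r)) / (2 * m) = - 1 / r / m"
      using that m by (simp add: power2_eq_square)
    ultimately show ?thesis by (simp only:)
  qed
  from DERIV_compose_FDERIV[OF this[OF nz] re]
  have "((\<lambda>y. exp (- ln ((Re (\<delta> y))\<^sup>2) / (2 * m))) has_derivative
      (\<lambda>v. exp (- ln ((Re (\<delta> x))\<^sup>2) / (2 * m)) * (- Re (dir_deriv \<delta> x v) / Re (\<delta> x) / m))) (at x)"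
    by (simp add: mult.commute)
  from bounded_linear.has_derivative[OF bounded_linear_of_real this]
  have "(P has_derivative (\<lambda>v. complex_of_real (exp (- ln ((Re (\<delta> x))\<^sup>2) / (2 * m)) * (- Re (dir_deriv \<delta> x v) / Re (\<delta> x) / m)))) (at x)"
    unfolding P_def [abs_def] m_def .
  moreover have "complex_of_real (exp (- ln ((Re (\<delta> x))\<^sup>2) / (2 * m)) * (- Re (dir_deriv \<delta> x v) / Re (\<delta> x) / m))
     = P x * (- dir_deriv \<delta> x v / \<delta> x / (of_nat CARD('n) + 1))" for v
    by (simp add: P_def m_def flip: dre \<delta>[OF x])
  ultimately show ?thesis by simp
qed

lemma smooth_P: "smooth A P"
proof (rule smooth_linearized_ode[OF open_A has_derivative_P])
  show "smooth A (\<lambda>x. - dir_deriv \<delta> x v / \<delta> x / (of_nat CARD('n) + 1))" for v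
    using smooth_\<delta> \<delta>_nonzero card_plus_1_nonzero
    by (intro smooth_divide smooth_minus smooth_dir_deriv smooth_const open_A)
qed

lemma P_differentiable: "x \<in> A \<Longrightarrow> P differentiable (at x)"
  by (rule smooth_differentiable[OF smooth_P])

lemma wd_P: "x \<in> A \<Longrightarrow> wd v P x = P x * \<beta> v x"
proof -
  assume x: "x \<in> A"
  have "(p * (- a / d / m) - \<i> * (p * (- b / d / m))) / 2 = p * (- ((a - \<i> * b) / 2) / d / m)" for p a b d m
    by (cases "d = 0"; cases "m = 0") (simp_all add: field_simps)
  then show ?thesis
    unfolding \<beta>_wd[OF x] wd_def dir_deriv_eqI[OF has_derivative_P[OF x]] .
qed

lemma wd_wd_P:
  assumes x: "x \<in> A"
  shows "wd v (wd w P) x = (\<Sum>k\<in>UNIV. A2 v w k x * wd (axis k 1) P x) + B2 v w x * P x"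
proof -
  have "wd v (wd w P) x = wd v (\<lambda>y. P y * \<beta> w y) x"
    by (intro wd_cong_open[OF open_A x] wd_P)
  also have "\<dots> = P x * wd v (\<beta> w) x + P x * \<beta> v x * \<beta> w x"
    by (simp add: wd_mult P_differentiable \<beta>_differentiable x wd_P)
  finally have 1: "wd v (wd w P) x = P x * (wd v (\<beta> w) x + \<beta> v x * \<beta> w x)" by (simp add: algebra_simps)
  have "(\<Sum>k\<in>UNIV. A2 v w k x * wd (axis k 1) P x)
      = P x * ((\<Sum>k\<in>UNIV. gam x v w $ k * \<beta> (axis k 1) x) + \<beta> v x * (\<Sum>k\<in>UNIV. w $ k * \<beta> (axis k 1) x)
        + \<beta> w x * (\<Sum>k\<in>UNIV. v $ k * \<beta> (axis k 1) x))"
    by (simp add: A2_def wd_P x algebra_simps sum.distrib sum_distrib_left)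
  then have 2: "(\<Sum>k\<in>UNIV. A2 v w k x * wd (axis k 1) P x)
      = P x * ((\<Sum>k\<in>UNIV. gam x v w $ k * \<beta> (axis k 1) x) + \<beta> v x * \<beta> w x + \<beta> w x * \<beta> v x)"
    by (simp flip: \<beta>_expand[OF x])
  show ?thesis unfolding 1 2 B2_def by (simp add: algebra_simps)
qed

text \<open>The conjugate derivative of the Christoffel symbol, known from constant curvature,
  cancels those of the two \<beta> terms.\<close>

lemma A2_holomorphic:
  assumes x: "x \<in> A"
  shows "A2 v w k differentiable (at x)" "wdb u (A2 v w k) x = 0"
proof -
  have "smooth A (A2 v w k)" unfolding A2_def [abs_def]
    by (intro smooth_add smooth_mult smooth_gam smooth_\<beta> smooth_const open_A)
  then show "A2 v w k differentiable (at x)" using smooth_differentiable x by blast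
  show "wdb u (A2 v w k) x = 0" unfolding A2_def [abs_def]
    using x by (simp add: wdb_add wdb_mult gam_differentiable \<beta>_differentiable wdb_gam wdb_\<beta> algebra_simps)
qed

text \<open>Since mixed derivatives commute, the term \<open>wd v (\<beta> w)\<close> contributes
  c/2 times h(\<open>gam x v w\<close>, u); \<open>wdb_\<beta>\<close> and constant curvature make
  the other terms cancel it.\<close>

lemma B2_holomorphic:
  assumes x: "x \<in> A"
  shows "B2 v w differentiable (at x)" "wdb u (B2 v w) x = 0"
proof -
  have "smooth A (B2 v w)" unfolding B2_def [abs_def]
    by (intro smooth_diff smooth_mult smooth_sum smooth_gam smooth_\<beta> smooth_wd open_A)
  then show "B2 v w differentiable (at x)" using smooth_differentiable x by blast
  have d: "wd v (\<beta> w) differentiable (at x)" by (rule smooth_differentiable[OF smooth_wd[OF smooth_\<beta>] x])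
  have 1: "wdb u (wd v (\<beta> w)) x = c / 2 * h x (gam x v w) u"
  proof -
    have "wdb u (wd v (\<beta> w)) x = wd v (wdb u (\<beta> w)) x" by (rule wd_commute(3)[OF smooth_\<beta> x])
    also have "\<dots> = wd v (\<lambda>y. c / 2 * h y w u) x" by (intro wd_cong_open[OF open_A x] wdb_\<beta>)
    also have "\<dots> = c / 2 * wd v (\<lambda>y. h y w u) x" by (rule wd_cmult[OF h_differentiable[OF x]])
    finally show ?thesis unfolding h_gam[OF x] .
  qed
  have "wdb u (\<lambda>y. \<Sum>k\<in>UNIV. gam y v w $ k * \<beta> (axis k 1) y) x
      = (\<Sum>k\<in>UNIV. gam x v w $ k * (c / 2 * h x (axis k 1) u)
        - c / 2 * (h x v u * w $ k + h x w u * v $ k) * \<beta> (axis k 1) x)"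
    using x by (simp add: wdb_sum wdb_mult gam_differentiable \<beta>_differentiable wdb_\<beta> wdb_gam)
  also have "\<dots> = c / 2 * ((\<Sum>k\<in>UNIV. gam x v w $ k * h x (axis k 1) u)
       - h x v u * (\<Sum>k\<in>UNIV. w $ k * \<beta> (axis k 1) x) - h x w u * (\<Sum>k\<in>UNIV. v $ k * \<beta> (axis k 1) x))"
    by (simp add: algebra_simps sum_subtractf sum.distrib sum_distrib_left)
  also have "\<dots> = c / 2 * (h x (gam x v w) u - h x v u * \<beta> w x - h x w u * \<beta> v x)"
    by (simp flip: \<beta>_expand[OF x] h_expand_left[OF x])
  finally have 2: "wdb u (\<lambda>y. \<Sum>k\<in>UNIV. gam y v w $ k * \<beta> (axis k 1) y) x
     = c / 2 * (h x (gam x v w) u - h x v u * \<beta> w x - h x w u * \<beta> v x)" .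
  have d2: "(\<lambda>y. \<Sum>k\<in>UNIV. gam y v w $ k * \<beta> (axis k 1) y) differentiable (at x)"
    by (intro smooth_differentiable[OF _ x] smooth_sum smooth_mult smooth_gam smooth_\<beta> open_A)
  have d1: "(\<lambda>y. \<beta> v y * \<beta> w y) differentiable (at x)"
    using x \<beta>_differentiable by (intro differentiable_mult) auto
  have 3: "wdb u (\<lambda>y. \<beta> v y * \<beta> w y) x = \<beta> v x * (c / 2 * h x w u) + (c / 2 * h x v u) * \<beta> w x"
    using x by (simp add: wdb_mult \<beta>_differentiable wdb_\<beta>)
  show "wdb u (B2 v w) x = 0"
    unfolding B2_def [abs_def] wdb_diff[OF differentiable_diff[OF d d1] d2] wdb_diff[OF d d1] 1 2 3
    by (simp add: algebra_simps)
qed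

end

section \<open>Solitons immersed in a space form\<close>

lemma norm_complex_scale: "norm (c *s v) = norm c * norm (v :: complex^'n)"
  by (simp add: norm_vec_def norm_mult L2_set_right_distrib)

text \<open>The derivative in s at 0 is a uniform limit of difference quotients, each holomorphic in
  t. The error is uniform in t because Cauchy's inequality bounds the second derivative in s by the
  maximum of |f|.\<close>

lemma slice_deriv_holomorphic:
  fixes f :: "complex \<Rightarrow> complex \<Rightarrow> complex"
  assumes r: "r > 0" and cont: "continuous_on (cball 0 r \<times> cball 0 r) (\<lambda>x. f (fst x) (snd x))"
    and h1: "\<And>s. s \<in> ball 0 r \<Longrightarrow> (\<lambda>t. f t s) holomorphic_on ball 0 r"
    and h2: "\<And>t. t \<in> ball 0 r \<Longrightarrow> f t holomorphic_on ball 0 r"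
  shows "(\<lambda>t. deriv (f t) 0) holomorphic_on ball 0 r"
proof -
  have "compact ((\<lambda>x. f (fst x) (snd x)) ` (cball 0 r \<times> cball 0 r))"
    by (intro compact_continuous_image cont compact_Times compact_cball)
  then have "bounded ((\<lambda>x. f (fst x) (snd x)) ` (cball 0 r \<times> cball 0 r))" by (rule compact_imp_bounded)
  then obtain B where B: "\<And>t s. t \<in> cball 0 r \<Longrightarrow> s \<in> cball 0 r \<Longrightarrow> norm (f t s) \<le> B"
    unfolding bounded_iff by force
  \<comment> \<open>Cauchy's bound for a second derivative on discs of radius r/2, whose centres
    must therefore have norm below r/2.\<close>
  define K where "K = fact 2 * B / (r / 2) ^ 2"
  have B0: "0 \<le> B" using B[of 0 0] r by (auto intro: order_trans[OF norm_ge_zero])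
  then have K0: "K \<ge> 0" using r by (simp add: K_def)
  have taylor: "norm (f t s - (f t 0 + deriv (f t) 0 * s)) \<le> K * norm s ^ 2"
    if t: "t \<in> ball 0 r" and s: "s \<in> ball 0 (r / 2)" for t s
  proof -
    have h: "(deriv ^^ i) (f t) holomorphic_on ball 0 r" for i
      by (rule holomorphic_higher_deriv[OF h2[OF t] open_ball])
    have "norm ((deriv ^^ 0) (f t) s - (\<Sum>i\<le>1. (deriv ^^ i) (f t) 0 * (s - 0) ^ i / fact i)) \<le> K * norm (s - 0) ^ Suc 1 / fact 1"
    proof (rule complex_Taylor[of "ball 0 (r / 2)"])
      fix i :: nat and x :: complex assume x: "x \<in> ball 0 (r / 2)"
      have "x \<in> ball 0 r" using x r by simp
      from holomorphic_derivI[OF h open_ball this]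
      show "((deriv ^^ i) (f t) has_field_derivative (deriv ^^ Suc i) (f t) x) (at x within ball 0 (r / 2))"
        by (simp add: has_field_derivative_at_within)
    next
      fix x :: complex assume x: "x \<in> ball 0 (r / 2)"
      have sub: "y \<in> ball 0 r" if "dist x y \<le> r / 2" for y
      proof -
        have "norm y \<le> norm x + dist x y" using norm_triangle_ineq2[of y x] by (simp add: dist_norm norm_minus_commute)
        then show ?thesis using x that by simp
      qed
      have "norm ((deriv ^^ 2) (f t) x) \<le> fact 2 * B / (r / 2) ^ 2"
      proof (rule Cauchy_inequality)
        have "ball x (r / 2) \<subseteq> ball 0 r" "cball x (r / 2) \<subseteq> ball 0 r" using sub by auto
        then show "f t holomorphic_on ball x (r / 2)" "continuous_on (cball x (r / 2)) (f t)"
          using h2[OF t] holomorphic_on_subset holomorphic_on_imp_continuous_on by blast+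
        show "norm (f t y) \<le> B" if "norm (x - y) = r / 2" for y
          using B[of t y] t sub[of y] that by (simp add: dist_norm)
      qed (use r in simp)
      then show "norm ((deriv ^^ Suc 1) (f t) x) \<le> K" by (simp add: K_def numeral_2_eq_2)
    qed (use s r in auto)
    then show ?thesis by (simp add: numeral_2_eq_2)
  qed
  define \<sigma> where "\<sigma> n = r / 4 * inverse (real (Suc n))" for n :: nat
  have \<sigma>: "\<sigma> n > 0" "\<sigma> n < r / 2" for n
  proof -
    show "\<sigma> n > 0" using r by (simp add: \<sigma>_def)
    have "\<sigma> n \<le> r / 4 * 1" unfolding \<sigma>_def using r by (intro mult_left_mono) (auto intro: inverse_le_1_iff[THEN iffD2])
    then show "\<sigma> n < r / 2" using r by simp
  qed
  define G where "G n t = (f t (of_real (\<sigma> n)) - f t 0) / of_real (\<sigma> n)" for n t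
  have err: "norm (G n t - deriv (f t) 0) \<le> K * \<sigma> n" if t: "t \<in> ball 0 r" for n t
  proof -
    have "of_real (\<sigma> n) \<in> ball (0::complex) (r / 2)" using \<sigma>[of n] by simp
    note T = taylor[OF t this]
    have "G n t - deriv (f t) 0 = (f t (of_real (\<sigma> n)) - (f t 0 + deriv (f t) 0 * of_real (\<sigma> n))) / of_real (\<sigma> n)"
      using \<sigma>(1)[of n] by (simp add: G_def diff_divide_distrib add_divide_distrib)
    then have "norm (G n t - deriv (f t) 0) = norm (f t (of_real (\<sigma> n)) - (f t 0 + deriv (f t) 0 * of_real (\<sigma> n))) / \<sigma> n"
      using \<sigma>(1)[of n] by (simp add: norm_divide)
    also have "\<dots> \<le> K * (\<sigma> n)\<^sup>2 / \<sigma> n" using T \<sigma>(1)[of n] by (intro divide_right_mono) auto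
    finally show ?thesis using \<sigma>(1)[of n] by (simp add: power2_eq_square)
  qed
  have lim: "(\<lambda>n. K * \<sigma> n) \<longlonglongrightarrow> 0"
    unfolding \<sigma>_def by (intro tendsto_mult_right_zero LIMSEQ_inverse_real_of_nat)
  show ?thesis
  proof (rule holomorphic_uniform_sequence[OF open_ball])
    fix n
    have "of_real (\<sigma> n) \<in> ball (0::complex) r" "(0::complex) \<in> ball 0 r" using \<sigma>[of n] r by auto
    from h1[OF this(1)] h1[OF this(2)] show "G n holomorphic_on ball 0 r"
      unfolding G_def [abs_def] using \<sigma>(1)[of n] by (intro holomorphic_intros) auto
  next
    fix x :: complex assume "x \<in> ball 0 r"
    then obtain d where d: "d > 0" "cball x d \<subseteq> ball 0 r" using open_contains_cball open_ball by blast
    have "uniform_limit (cball x d) G (\<lambda>t. deriv (f t) 0) sequentially"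
    proof (rule uniform_limitI)
      fix e :: real assume e: "e > 0"
      have "\<forall>\<^sub>F n in sequentially. K * \<sigma> n < e" by (rule order_tendstoD(2)[OF lim e])
      then show "\<forall>\<^sub>F n in sequentially. \<forall>t\<in>cball x d. dist (G n t) (deriv (f t) 0) < e"
      proof eventually_elim
        case (elim n)
        show ?case
        proof
          fix t assume "t \<in> cball x d"
          then have "t \<in> ball 0 r" using d(2) by blast
          from err[OF this, of n] elim show "dist (G n t) (deriv (f t) 0) < e" by (simp add: dist_norm)
        qed
      qed
    qed
    then show "\<exists>d>0. cball x d \<subseteq> ball 0 r \<and> uniform_limit (cball x d) G (\<lambda>t. deriv (f t) 0) sequentially"
      using d by blast
  qed
qed

lemma holomorphic_map_onD:
  assumes "holomorphic_map_on U F" "x \<in> U"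
  shows "(F has_derivative dir_deriv F x) (at x)" "dir_deriv F x (c *s v) = c *s dir_deriv F x v"
    "dir_deriv F x (v + w) = dir_deriv F x v + dir_deriv F x w"
proof -
  obtain D where D: "(F has_derivative D) (at x)" "\<And>a v. D (a *s v) = a *s D v"
    using assms unfolding holomorphic_map_on_def by blast
  then show d: "(F has_derivative dir_deriv F x) (at x)" by (intro has_derivative_dir_deriv) (auto simp: differentiable_def)
  show "dir_deriv F x (c *s v) = c *s dir_deriv F x v" using D dir_deriv_eqI[OF D(1)] by simp
  show "dir_deriv F x (v + w) = dir_deriv F x v + dir_deriv F x w" by (rule linear_add[OF has_derivative_linear[OF d]])
qed

lemma has_derivative_vec_nth_complex:
  fixes F :: "'a::real_normed_vector \<Rightarrow> complex^'k"
  shows "(F has_derivative D) (at x) \<Longrightarrow> ((\<lambda>y. F y $ a) has_derivative (\<lambda>v. D v $ a)) (at x)"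
  by (rule bounded_linear.has_derivative[OF bounded_linear_vec_nth])

lemma holomorphic_map_on_expand:
  fixes F :: "complex^'n \<Rightarrow> complex^'k"
  assumes "holomorphic_map_on U F" "x \<in> U"
  shows "dir_deriv F x v = (\<Sum>b\<in>UNIV. v $ b *s dir_deriv F x (axis b 1))"
proof -
  note l = has_derivative_linear[OF holomorphic_map_onD(1)[OF assms]]
  show ?thesis
    by (subst basis_expansion[of v, symmetric]) (simp add: linear_sum[OF l] holomorphic_map_onD(2)[OF assms])
qed

lemma wd_holomorphic_map:
  fixes F :: "complex^'n \<Rightarrow> complex^'k"
  assumes "holomorphic_map_on U F" "x \<in> U"
  shows "(\<lambda>y. F y $ k) differentiable (at x)" "wd v (\<lambda>y. F y $ k) x = dir_deriv F x v $ k" "wdb v (\<lambda>y. F y $ k) x = 0"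
proof -
  note d = has_derivative_vec_nth_complex[OF holomorphic_map_onD(1)[OF assms], of k]
  show "(\<lambda>y. F y $ k) differentiable (at x)" using d by (auto simp: differentiable_def)
  show "wd v (\<lambda>y. F y $ k) x = dir_deriv F x v $ k" "wdb v (\<lambda>y. F y $ k) x = 0"
    unfolding wd_def wdb_def dir_deriv_eqI[OF d] holomorphic_map_onD(2)[OF assms] by (simp_all add: mult.assoc[symmetric])
qed

lemma has_derivative_disc: "((\<lambda>t. x + t *s v) has_derivative (\<lambda>h. h *s v)) (at t)" for x v :: "complex^'n"
proof -
  have "linear (\<lambda>t. t *s v)" by (rule linearI) (simp_all add: vector_sadd_rdistrib vec_eq_iff)
  then have "bounded_linear (\<lambda>t. t *s v)" by (simp add: linear_conv_bounded_linear)
  from bounded_linear.has_derivative[OF this has_derivative_ident]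
  show ?thesis by (auto intro!: derivative_eq_intros)
qed

lemma hw_chain:
  assumes "(\<gamma> has_derivative (\<lambda>h. h *s u)) (at t)" "f differentiable (at (\<gamma> t))"
  shows "hw (\<lambda>t. f (\<gamma> t)) (wd u f (\<gamma> t)) (wdb u f (\<gamma> t)) t"
  unfolding hw_def
  using has_derivative_compose[OF assms(1) has_derivative_dir_deriv[OF assms(2)]]
  by (simp add: dir_deriv_scale[OF assms(2)] mult.commute)

lemma holomorphic_on_complex_line:
  fixes F :: "complex^'n \<Rightarrow> complex^'k"
  assumes F: "holomorphic_map_on U F" and U: "\<And>t. t \<in> A \<Longrightarrow> x + t *s v \<in> U" and A: "open A"
  shows "(\<lambda>t. F (x + t *s v) $ a) holomorphic_on A"
    and "t \<in> A \<Longrightarrow> ((\<lambda>t. F (x + t *s v) $ a) has_field_derivative dir_deriv F (x + t *s v) v $ a) (at t)"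
proof -
  show d: "((\<lambda>t. F (x + t *s v) $ a) has_field_derivative dir_deriv F (x + t *s v) v $ a) (at t)" if "t \<in> A" for t
    unfolding hw_holomorphic
    using hw_chain[OF has_derivative_disc wd_holomorphic_map(1)[OF F U[OF that]]] wd_holomorphic_map(2,3)[OF F U[OF that]] by simp
  show "(\<lambda>t. F (x + t *s v) $ a) holomorphic_on A"
    unfolding holomorphic_on_open[OF A] using d by blast
qed

text \<open>\<open>holomorphic_map_on\<close> asserts complex differentiability at each point only.
  That the derivative of F in a direction e transverse to the disc varies holomorphically along it
  is derived from F(x0 + t v + s e) as a function of t and s.\<close>

lemma transverse_derivative_holomorphic:
  fixes F :: "complex^'n \<Rightarrow> complex^'k"
  assumes F: "holomorphic_map_on U F" and U: "open U" and x0: "x0 \<in> U"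
  shows "\<exists>\<rho>>0. (\<forall>t\<in>ball 0 \<rho>. x0 + t *s v \<in> U) \<and>
    (\<forall>e a. (\<lambda>t. dir_deriv F (x0 + t *s v) e $ a) holomorphic_on ball 0 \<rho>)"
proof -
  obtain \<epsilon> where \<epsilon>: "\<epsilon> > 0" "ball x0 \<epsilon> \<subseteq> U" using U x0 open_contains_ball by blast
  \<comment> \<open>For norm e at most 1 this keeps x0 + t v + s e within \<epsilon>/2 of x0; the 1
    accounts for e.\<close>
  define r where "r = \<epsilon> / (2 * (norm v + 1))"
  have r: "r > 0" using \<epsilon>(1) by (simp add: r_def add_nonneg_pos)
  have inU: "x0 + t *s v + s *s e \<in> U" if "t \<in> cball 0 r" "s \<in> cball 0 r" "norm e \<le> 1" for t s e
  proof -
    have "norm (t *s v + s *s e) \<le> norm t * norm v + norm s * norm e"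
      using norm_triangle_ineq[of "t *s v" "s *s e"] by (simp add: norm_complex_scale)
    also have "\<dots> \<le> r * norm v + r * 1" using that r by (intro add_mono mult_mono) auto
    also have "\<dots> = r * (norm v + 1)" by (simp only: distrib_left)
    also have "\<dots> = \<epsilon> / 2"
    proof -
      have "norm v + 1 \<noteq> 0" using norm_ge_zero[of v] by linarith
      moreover have "a / (2 * b) * b = a / 2" if "b \<noteq> 0" for a b :: real using that by simp
      ultimately show ?thesis unfolding r_def by blast
    qed
    also have "\<dots> < \<epsilon>" using \<epsilon>(1) by simp
    finally have "dist (x0 + (t *s v + s *s e)) x0 < \<epsilon>" by (simp only: dist_norm add_diff_cancel_left')
    then have "x0 + (t *s v + s *s e) \<in> ball x0 \<epsilon>" by (simp only: mem_ball dist_commute)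
    then show ?thesis using \<epsilon>(2) by (auto simp: add.assoc)
  qed
  have hol: "(\<lambda>t. dir_deriv F (x0 + t *s v) e $ a) holomorphic_on ball 0 r" if e: "norm e \<le> 1" for e a
  proof -
    define f where "f t s = F (x0 + t *s v + s *s e) $ a" for t s
    have f': "f t s = F ((x0 + s *s e) + t *s v) $ a" for t s by (simp add: f_def algebra_simps)
    have contF: "continuous_on U F"
      using holomorphic_map_onD(1)[OF F] by (meson continuous_at_imp_continuous_on has_derivative_continuous)
    have h1: "(\<lambda>t. f t s) holomorphic_on ball 0 r" if "s \<in> ball 0 r" for s
      unfolding f' using that inU[OF _ _ e, of _ s]
      by (intro holomorphic_on_complex_line(1)[OF F]) (auto simp: algebra_simps)
    have h2: "f t holomorphic_on ball 0 r" if "t \<in> ball 0 r" for t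
      unfolding f_def [abs_def] using that inU[OF _ _ e, of t]
      by (intro holomorphic_on_complex_line(1)[OF F]) auto
    have cs: "continuous_on S (\<lambda>x. g x *s w)" if "continuous_on S g" for S :: "(complex \<times> complex) set" and g and w :: "complex^'n"
      using that by (intro continuous_on_vec_lambda[of S "\<lambda>i x. (g x *s w) $ i", simplified vec_lambda_eta] ) (auto intro!: continuous_intros)
    have "continuous_on (cball 0 r \<times> cball 0 r) (\<lambda>x. F (x0 + fst x *s v + snd x *s e))"
      by (rule continuous_on_compose2[OF contF])
        (use inU[OF _ _ e] in \<open>auto intro!: continuous_on_add cs continuous_on_fst continuous_on_snd continuous_on_const continuous_on_id\<close>)
    then have "continuous_on (cball 0 r \<times> cball 0 r) (\<lambda>x. f (fst x) (snd x))"
      unfolding f_def by (rule bounded_linear.continuous_on[OF bounded_linear_vec_nth])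
    from slice_deriv_holomorphic[OF r this h1 h2]
    have "(\<lambda>t. deriv (f t) 0) holomorphic_on ball 0 r" .
    moreover have "deriv (f t) 0 = dir_deriv F (x0 + t *s v) e $ a" if t: "t \<in> ball 0 r" for t
    proof (rule DERIV_imp_deriv)
      show "(f t has_field_derivative dir_deriv F (x0 + t *s v) e $ a) (at 0)"
        using holomorphic_on_complex_line(2)[OF F _ open_ball, of 0 r "x0 + t *s v" e 0 a] inU[OF _ _ e, of t] t r
        unfolding f_def [abs_def] by auto
    qed
    ultimately show ?thesis by (rule holomorphic_transform)
  qed
  \<comment> \<open>Every direction is a positive multiple of one of norm at most 1, so the radius
    need not depend on e.\<close>
  have hol': "(\<lambda>t. dir_deriv F (x0 + t *s v) e $ a) holomorphic_on ball 0 r" for e a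
  proof -
    define n where "n = norm e + 1"
    have n: "n > 0" by (simp add: n_def add_nonneg_pos)
    have tU: "x0 + t *s v \<in> U" if "t \<in> ball 0 r" for t using inU[of t 0 0] that r by auto
    have "norm ((1 / n) *\<^sub>R e) \<le> 1" using n by (simp add: n_def)
    from hol[OF this, of a]
    have "(\<lambda>t. of_real n * dir_deriv F (x0 + t *s v) ((1 / n) *\<^sub>R e) $ a) holomorphic_on ball 0 r"
      by (intro holomorphic_intros)
    moreover have "of_real n * dir_deriv F (x0 + t *s v) ((1 / n) *\<^sub>R e) $ a = dir_deriv F (x0 + t *s v) e $ a"
      if "t \<in> ball 0 r" for t
    proof -
      have "dir_deriv F (x0 + t *s v) ((1 / n) *\<^sub>R e) = (1 / n) *\<^sub>R dir_deriv F (x0 + t *s v) e"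
        by (rule linear_cmul[OF has_derivative_linear[OF holomorphic_map_onD(1)[OF F tU[OF that]]]])
      then have "dir_deriv F (x0 + t *s v) ((1 / n) *\<^sub>R e) $ a = of_real (1 / n) * dir_deriv F (x0 + t *s v) e $ a"
        using scaleR_conv_of_real[of "1 / n" "dir_deriv F (x0 + t *s v) e $ a"]
        by (simp only: vector_scaleR_component)
      then show ?thesis using n by simp
    qed
    ultimately show ?thesis by (rule holomorphic_transform)
  qed
  have "x0 + t *s v \<in> U" if "t \<in> ball 0 r" for t using inU[of t 0 0] that r by auto
  then show ?thesis using r hol' by blast
qed

section \<open>Ricci tensor and Lie derivative on the diagonal\<close>

context pseudo_kahler_domain
begin

text \<open>\<delta> is real, so conjugation exchanges \<open>wd\<close> and \<open>wdb\<close>.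
  This is the source of the symmetry of the Ricci tensor.\<close>

lemma cnj_trace:
  assumes x: "x \<in> A"
  shows "cnj (wdb v (\<lambda>y. wd w \<delta> y / \<delta> y) x) = wdb w (\<lambda>y. wd v \<delta> y / \<delta> y) x"
proof -
  have d: "\<delta> differentiable (at x)" "wd u \<delta> differentiable (at x)" "wdb u \<delta> differentiable (at x)" for u
    by (intro smooth_differentiable[OF _ x] smooth_wd smooth_wdb smooth_\<delta>)+
  have c: "cnj (wd u \<delta> y) = wdb u \<delta> y" if y: "y \<in> A" for u y
  proof -
    have "wdb u \<delta> y = wdb u (\<lambda>y. cnj (\<delta> y)) y"
      by (intro wd_cong_open[OF open_A y]) (simp add: \<delta>_real)
    also have "\<dots> = cnj (wd u \<delta> y)" by (rule wdb_cnj) (rule smooth_differentiable[OF smooth_\<delta> y])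
    finally show ?thesis by simp
  qed
  then have c': "cnj (wdb u \<delta> x) = wd u \<delta> x" for u using x by (metis complex_cnj_cnj)
  have "cnj (wdb v (wd w \<delta>) x) = wd v (\<lambda>y. cnj (wd w \<delta> y)) x" by (rule wd_cnj[OF d(2), symmetric])
  also have "\<dots> = wd v (wdb w \<delta>) x" by (intro wd_cong_open[OF open_A x] c)
  also have "\<dots> = wdb w (wd v \<delta>) x" by (rule wd_commute(3)[OF smooth_\<delta> x, symmetric])
  finally have 1: "cnj (wdb v (wd w \<delta>) x) = wdb w (wd v \<delta>) x" .
  show ?thesis
    unfolding wdb_divide[OF d(2,1) \<delta>_nonzero[OF x]] using x
    by (simp add: 1 c c' \<delta>_real mult.commute)
qed

lemma ricci_sym: "x \<in> A \<Longrightarrow> ricci g x v w = ricci g x w v"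
  using arg_cong[OF cnj_trace[of x v w], of Re] by (simp add: ricci_eq_trace trace_S)

lemma ricci_add_left: "x \<in> A \<Longrightarrow> ricci g x (v + v') w = ricci g x v w + ricci g x v' w"
  by (simp add: ricci_eq_trace S_add_1 sum.distrib)

lemma ricci_diagonal: "x \<in> A \<Longrightarrow> wdb v (\<lambda>y. wd v \<delta> y / \<delta> y) x = of_real (- ricci g x v v / 2)"
  using cnj_trace[of x v v] by (simp add: ricci_eq_trace trace_S complex_eq_iff)

lemma ricci_eq_multiple:
  assumes x: "x \<in> A" and diag: "\<And>v. ricci g x v v = \<mu> * g x v v"
  shows "ricci g x v w = \<mu> * g x v w"
proof -
  have "ricci g x (v + w) (v + w) = ricci g x v v + ricci g x w w + 2 * ricci g x v w"
    using x by (simp add: ricci_add_left ricci_sym[of x _ "v + w"] ricci_sym[of x w v])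
  moreover have "g x (v + w) (v + w) = g x v v + g x w w + 2 * g x v w"
    using g_sym[OF x, of w v] by (simp add: bilinear_ladd[OF g_bilinear[OF x]] bilinear_radd[OF g_bilinear[OF x]])
  ultimately show ?thesis using diag[of "v + w"] diag[of v] diag[of w] by (simp add: algebra_simps)
qed

text \<open>The derivative of h(X, v) along v has one part from the derivative of X and one from
  that of the metric; by \<open>Re_wd_h\<close> the real part of the latter is half the derivative
  of g(v, v) along X.\<close>

lemma lie_derivative_diagonal:
  assumes x: "x \<in> A" and X: "holomorphic_map_on A X"
  shows "lie_derivative X g x v v = 2 * Re (wd v (\<lambda>y. h y (X y) v) x)"
proof -
  note hX = wd_holomorphic_map[OF X x]
  have "wd v (\<lambda>y. h y (X y) v) x = h x (dir_deriv X x v) v + wd v (\<lambda>y. h y (X x) v) x"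
    using wd_h_field(1)[OF x hX(1), of v v] by (simp only: hX(2) vec_lambda_eta)
  moreover have "dir_deriv (\<lambda>y. g y (X x) v) x v = dir_deriv (\<lambda>y. g y v (X x)) x v"
    by (intro dir_deriv_cong_open[OF open_A x] g_sym)
  ultimately show ?thesis
    using Re_wd_h[OF x, of v "X x" v] g_sym[OF x, of v "dir_deriv X x v"] by (simp add: lie_derivative_def)
qed

lemma holomorphic_field_differentiable:
  assumes "x \<in> A" "holomorphic_map_on A X"
  shows "(\<lambda>y. h y (X y) v) differentiable (at x)"
proof -
  have "(\<lambda>y. \<Sum>a\<in>UNIV. X y $ a * h y (axis a 1) v) differentiable (at x)"
    using wd_holomorphic_map(1)[OF assms(2,1)] h_differentiable[OF assms(1)] by simp
  moreover have "(\<lambda>y. h y (X y) v) differentiable (at x) \<longleftrightarrow> (\<lambda>y. \<Sum>a\<in>UNIV. X y $ a * h y (axis a 1) v) differentiable (at x)"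
    by (rule differentiable_cong_open[OF open_A assms(1)]) (rule h_expand_left)
  ultimately show ?thesis by (rule iffD2[rotated])
qed

end

section \<open>A soliton in one chart and its restriction to a disc\<close>

locale local_soliton = m: pseudo_kahler_domain U g + s: constant_holomorphic_curvature V gs c
  for U :: "(complex^'n) set" and g and V :: "(complex^'k) set" and gs and c +
  fixes F :: "complex^'n \<Rightarrow> complex^'k" and X :: "complex^'n \<Rightarrow> complex^'n" and l :: real
  assumes F_hol: "holomorphic_map_on U F" and F_in: "\<And>x. x \<in> U \<Longrightarrow> F x \<in> V"
    and isometry: "\<And>x v w. x \<in> U \<Longrightarrow> g x v w = gs (F x) (dir_deriv F x v) (dir_deriv F x w)"
    and X_hol: "holomorphic_map_on U X"
    and pos: "\<And>x v. x \<in> U \<Longrightarrow> v \<noteq> 0 \<Longrightarrow> g x v v > 0"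
    and sol: "\<And>x v w. x \<in> U \<Longrightarrow> ricci g x v w = l * g x v w + lie_derivative X g x v w"

text \<open>\<open>Z_hol\<close> concerns the derivative of F in all directions e, since both the
  determinant of g and the field X involve directions transverse to the disc.\<close>

locale soliton_disc = local_soliton U g V gs c F X l
  for U :: "(complex^'n) set" and g and V :: "(complex^'k) set" and gs c F X l +
  fixes x0 v :: "complex^'n" and \<rho> :: real
  assumes \<rho>: "\<rho> > 0" and in_U: "\<And>t. t \<in> ball 0 \<rho> \<Longrightarrow> x0 + t *s v \<in> U"
    and Z_hol: "\<And>e a. (\<lambda>t. dir_deriv F (x0 + t *s v) e $ a) holomorphic_on ball 0 \<rho>"
begin

abbreviation d where "d t \<equiv> x0 + t *s v"
abbreviation \<gamma> where "\<gamma> t \<equiv> F (d t)"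
abbreviation Z where "Z e t \<equiv> dir_deriv F (d t) e"

lemma \<gamma>_in: "t \<in> ball 0 \<rho> \<Longrightarrow> \<gamma> t \<in> V"
  using F_in in_U by blast

lemma \<gamma>_derivative: "t \<in> ball 0 \<rho> \<Longrightarrow> ((\<lambda>t. \<gamma> t) has_derivative (\<lambda>h. h *s Z v t)) (at t)"
  using has_derivative_compose[OF has_derivative_disc holomorphic_map_onD(1)[OF F_hol in_U], of t]
  by (simp add: holomorphic_map_onD(2)[OF F_hol in_U])

lemma m_hw: "f differentiable (at (d t)) \<Longrightarrow> hw (\<lambda>t. f (d t)) (wd v f (d t)) (wdb v f (d t)) t"
  by (rule hw_chain[OF has_derivative_disc])

lemma s_hw: "t \<in> ball 0 \<rho> \<Longrightarrow> f differentiable (at (\<gamma> t)) \<Longrightarrow>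
    hw (\<lambda>t. f (\<gamma> t)) (wd (Z v t) f (\<gamma> t)) (wdb (Z v t) f (\<gamma> t)) t"
  by (rule hw_chain[OF \<gamma>_derivative])

lemma holomorphic_hw: "f holomorphic_on ball 0 \<rho> \<Longrightarrow> t \<in> ball 0 \<rho> \<Longrightarrow> hw f (deriv f t) 0 t"
  unfolding hw_holomorphic[symmetric] by (rule holomorphic_derivI[OF _ open_ball])

lemma holomorphic_along:
  assumes "\<And>y. y \<in> V \<Longrightarrow> f differentiable (at y)" "\<And>y u. y \<in> V \<Longrightarrow> wdb u f y = 0"
  shows "(\<lambda>t. f (\<gamma> t)) holomorphic_on ball 0 \<rho>"
  unfolding holomorphic_on_open[OF open_ball] hw_holomorphic
proof
  fix t :: complex assume t: "t \<in> ball 0 \<rho>"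
  show "\<exists>f'. hw (\<lambda>t. f (\<gamma> t)) f' 0 t"
    using s_hw[OF t assms(1)[OF \<gamma>_in[OF t]]] unfolding assms(2)[OF \<gamma>_in[OF t]] by blast
qed

lemma h_pullback: "t \<in> ball 0 \<rho> \<Longrightarrow> m.h (d t) a b = s.h (\<gamma> t) (Z a t) (Z b t)"
  using in_U by (simp add: herm_def isometry holomorphic_map_onD(2)[OF F_hol])

text \<open>The field X carried to the space form, where u can be computed from its
  geometry.\<close>

definition \<zeta> where "\<zeta> t = Z (X (d t)) t"

lemma \<zeta>_holomorphic: "(\<lambda>t. \<zeta> t $ a) holomorphic_on ball 0 \<rho>"
proof -
  have "(\<lambda>t. \<Sum>b\<in>UNIV. X (d t) $ b * Z (axis b 1) t $ a) holomorphic_on ball 0 \<rho>"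
    by (intro holomorphic_intros Z_hol holomorphic_on_complex_line(1)[OF X_hol in_U open_ball])
  moreover have "(\<Sum>b\<in>UNIV. X (d t) $ b * Z (axis b 1) t $ a) = \<zeta> t $ a" if "t \<in> ball 0 \<rho>" for t
    unfolding \<zeta>_def by (subst (2) holomorphic_map_on_expand[OF F_hol in_U[OF that]]) simp
  ultimately show ?thesis by (rule holomorphic_transform)
qed

text \<open>\<open>E\<close> is the t-derivative of log |\<delta>| along the disc, \<open>u1\<close>
  is that of \<open>u\<close>, and 2 Re \<open>u1\<close> is the Lie derivative of g on (v,
  v).\<close>

definition E where "E t = wd v m.\<delta> (d t) / m.\<delta> (d t)"
definition u where "u t = m.h (d t) (X (d t)) v"
definition u1 where "u1 t = wd v (\<lambda>y. m.h y (X y) v) (d t)"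

lemma u_hw: "t \<in> ball 0 \<rho> \<Longrightarrow> \<exists>b. hw u (u1 t) b t"
  unfolding u_def [abs_def] u1_def
  using m_hw[OF m.holomorphic_field_differentiable[OF in_U X_hol]] by blast

lemma u_pullback: "t \<in> ball 0 \<rho> \<Longrightarrow> u t = s.h (\<gamma> t) (\<zeta> t) (Z v t)"
  unfolding u_def \<zeta>_def by (rule h_pullback)

lemma ricci_u1: "t \<in> ball 0 \<rho> \<Longrightarrow> ricci g (d t) v v = l * g (d t) v v + 2 * Re (u1 t)"
  by (simp add: sol in_U u1_def m.lie_derivative_diagonal[OF in_U X_hol])

lemma h_vv: "t \<in> ball 0 \<rho> \<Longrightarrow> m.h (d t) v v = of_real (g (d t) v v)"
  using m.h_cnj[OF in_U, of t v v] by (simp add: complex_eq_iff)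

text \<open>The mixed derivative of log |\<delta>| is -Ric(v, v)/2, and the soliton equation
  replaces the Ricci tensor.\<close>

lemma E_hw: assumes t: "t \<in> ball 0 \<rho>"
  shows "\<exists>a. hw E a (- (of_real l * m.h (d t) v v) / 2 - of_real (Re (u1 t))) t"
proof -
  have "(\<lambda>y. wd v m.\<delta> y / m.\<delta> y) differentiable (at (d t))"
    by (intro smooth_differentiable[OF _ in_U[OF t]] smooth_divide smooth_wd m.smooth_\<delta> m.\<delta>_nonzero)
  from m_hw[OF this] have "hw E (wd v (\<lambda>y. wd v m.\<delta> y / m.\<delta> y) (d t)) (of_real (- ricci g (d t) v v / 2)) t"
    unfolding E_def [abs_def] m.ricci_diagonal[OF in_U[OF t]] .
  moreover have e: "of_real (- ricci g (d t) v v / 2) = - (of_real l * m.h (d t) v v) / 2 - complex_of_real (Re (u1 t))"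
    by (simp add: ricci_u1[OF t] h_vv[OF t] field_simps)
  ultimately show ?thesis unfolding e by blast
qed

lemma \<delta>_hw: assumes t: "t \<in> ball 0 \<rho>"
  shows "\<exists>b. hw (\<lambda>t. m.\<delta> (d t)) (E t * m.\<delta> (d t)) b t"
  using m_hw[OF smooth_differentiable[OF m.smooth_\<delta> in_U[OF t]]] m.\<delta>_nonzero[OF in_U[OF t]]
  unfolding E_def by auto

end

section \<open>The soliton equation along a disc\<close>

context soliton_disc
begin

lemma frd_pullback:
  assumes "\<rho>' \<le> \<rho>" and f: "\<And>i j. frd \<rho>' (f i j)"
  shows "frd \<rho>' (\<lambda>t. \<Sum>i\<in>UNIV. \<Sum>j\<in>UNIV. Z a t $ i * cnj (Z b t $ j) * f i j t)"
    and "frd \<rho>' (\<lambda>t. \<Sum>i\<in>UNIV. \<Sum>j\<in>UNIV. \<zeta> t $ i * cnj (Z b t $ j) * f i j t)"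
  using frd_mono[OF frd_holomorphic[OF Z_hol] assms(1)] frd_mono[OF frd_holomorphic[OF \<zeta>_holomorphic] assms(1)] f
  by (intro frd_sum frd_mult frd_cnj; blast)+

lemma h_expand_both:
  assumes t: "t \<in> ball 0 \<rho>"
  shows "s.h (\<gamma> t) a b = (\<Sum>i\<in>UNIV. \<Sum>j\<in>UNIV. a $ i * cnj (b $ j) * s.h (\<gamma> t) (axis i 1) (axis j 1))"
  unfolding s.h_expand_left[OF \<gamma>_in[OF t], of a b] unfolding s.h_expand_right[OF \<gamma>_in[OF t], of _ b]
  by (simp add: sum_distrib_left mult.assoc)

text \<open>The conjugate derivative of f / p is k u. As mixed derivatives of finite rank quotients
  commute, the conjugate derivative of its t-derivative a is the t-derivative of k u.\<close>

lemma u_real_part_hw: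
  assumes "frd \<rho>' f" "frd \<rho>' p" "\<And>t. t \<in> ball 0 \<rho>' \<Longrightarrow> p t \<noteq> 0" and \<rho>': "\<rho>' \<le> \<rho>"
    and f: "\<And>t. t \<in> ball 0 \<rho>' \<Longrightarrow> \<exists>a. hw (\<lambda>t. f t / p t) a (k * u t) t"
  shows "\<exists>a. (\<forall>t\<in>ball 0 \<rho>'. hw (\<lambda>t. f t / p t) (a t) (k * u t) t \<and> (\<exists>b. hw a b (k * u1 t) t))"
proof -
  obtain a b m where abm: "\<forall>t\<in>ball 0 \<rho>'. hw (\<lambda>t. f t / p t) (a t) (b t) t \<and> (\<exists>b. hw a b (m t) t) \<and> (\<exists>a. hw b (m t) a t)"
    using frd_quotient_commute[OF assms(1-3)] by blast
  have b: "b t = k * u t" if t: "t \<in> ball 0 \<rho>'" for t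
    using f[OF t] abm t hw_unique(2) by blast
  have "m t = k * u1 t" if t: "t \<in> ball 0 \<rho>'" for t
  proof -
    have tr: "t \<in> ball 0 \<rho>" using t \<rho>' by auto
    obtain z where "hw b (m t) z t" using abm t by blast
    then have 1: "hw (\<lambda>t. k * u t) (m t) z t" by (rule hw_cong[OF _ open_ball t]) (rule b)
    obtain y where "hw u (u1 t) y t" using u_hw[OF tr] by blast
    from hw_unique(1)[OF 1 hw_cmult[OF this, of k]] show ?thesis .
  qed
  then show ?thesis using abm b by (intro exI[of _ a]) auto
qed

lemma cnj_u_hw: "t \<in> ball 0 \<rho> \<Longrightarrow> \<exists>a. hw (\<lambda>t. cnj (u t)) a (cnj (u1 t)) t"
  using u_hw hw_cnj by blast

text \<open>For c = 0 the Christoffel symbols are holomorphic, so the entries of the metric along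
  the disc solve a holomorphic linear equation and have finite rank. The splitting then kills the
  mixed derivative of N, which is Ric(v, v)/2.\<close>

lemma flat_splits:
  assumes c: "c = 0"
  shows "l * g x0 v v + 2 * Re (u1 0) = 0"
proof -
  define H where "H a b t = s.h (\<gamma> t) (axis a 1) (axis b 1)" for a b t
  define M where "M a k t = (\<Sum>i\<in>UNIV. Z v t $ i * s.gam (\<gamma> t) (axis i 1) (axis a 1) $ k)" for a k t
  have "(\<lambda>t. s.gam (\<gamma> t) (axis i 1) (axis a 1) $ k) holomorphic_on ball 0 \<rho>" for i a k
    by (rule holomorphic_along[OF s.gam_differentiable]) (simp_all add: s.wdb_gam c)
  then have M: "M a k holomorphic_on ball 0 \<rho>" for a k
    unfolding M_def [abs_def] by (intro holomorphic_intros Z_hol)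
  obtain \<rho>' where \<rho>': "\<rho>' > 0" "\<rho>' \<le> \<rho>"
    and ode: "\<And>W. \<forall>i. \<forall>t\<in>ball 0 \<rho>. \<exists>b. hw (W i) (\<Sum>j\<in>UNIV. M i j t * W j t) b t \<Longrightarrow> \<forall>i. frd \<rho>' (W i)"
    using frd_of_linear_ode[of \<rho> M, OF \<rho> M] by blast
  have H_frd: "frd \<rho>' (H a b)" for a b
  proof -
    have "\<exists>z. hw (H i b) (\<Sum>j\<in>UNIV. M i j t * H j b t) z t" if t: "t \<in> ball 0 \<rho>" for i t
    proof -
      note d = s.h_differentiable[OF \<gamma>_in[OF t], of "axis i 1" "axis b 1"]
      have "wd (Z v t) (\<lambda>y. s.h y (axis i 1) (axis b 1)) (\<gamma> t)
          = (\<Sum>m\<in>UNIV. Z v t $ m * (\<Sum>j\<in>UNIV. s.gam (\<gamma> t) (axis m 1) (axis i 1) $ j * H j b t))"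
        unfolding wd_expand[OF d, of "Z v t"] H_def
        by (simp add: s.h_gam[OF \<gamma>_in[OF t], symmetric] flip: s.h_expand_left[OF \<gamma>_in[OF t]])
      also have "\<dots> = (\<Sum>j\<in>UNIV. M i j t * H j b t)"
        by (simp add: M_def sum_distrib_left sum_distrib_right mult.assoc) (rule sum.swap)
      finally have e: "wd (Z v t) (\<lambda>y. s.h y (axis i 1) (axis b 1)) (\<gamma> t) = (\<Sum>j\<in>UNIV. M i j t * H j b t)" .
      have "H i b = (\<lambda>t. s.h (\<gamma> t) (axis i 1) (axis b 1))" by (simp add: H_def fun_eq_iff)
      then show ?thesis using s_hw[OF t d] unfolding e by auto
    qed
    then have "\<forall>a. frd \<rho>' (H a b)" by (intro ode) blast
    then show ?thesis ..
  qed
  have tr: "t \<in> ball 0 \<rho>" if "t \<in> ball 0 \<rho>'" for t :: complex using that \<rho>' by auto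
  have mh: "frd \<rho>' (\<lambda>t. m.h (d t) a b)" for a b
  proof (rule frd_cong[OF frd_pullback(1)[OF \<rho>'(2), of H a b]])
    show "frd \<rho>' (H i j)" for i j by (rule H_frd)
    show "m.h (d t) a b = (\<Sum>i\<in>UNIV. \<Sum>j\<in>UNIV. Z a t $ i * cnj (Z b t $ j) * H i j t)" if t: "t \<in> ball 0 \<rho>'" for t
      unfolding h_pullback[OF tr[OF t]] H_def by (rule h_expand_both[OF tr[OF t]])
  qed
  have q: "frd \<rho>' (\<lambda>t. m.\<delta> (d t))"
    unfolding m.\<delta>_def m.Hm_def by (intro frd_det) (simp add: mh)
  have "frd \<rho>' u"
  proof (rule frd_cong[OF frd_pullback(2)[OF \<rho>'(2), of H v]])
    show "frd \<rho>' (H i j)" for i j by (rule H_frd)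
    show "u t = (\<Sum>i\<in>UNIV. \<Sum>j\<in>UNIV. \<zeta> t $ i * cnj (Z v t $ j) * H i j t)" if t: "t \<in> ball 0 \<rho>'" for t
      unfolding u_pullback[OF tr[OF t]] H_def by (rule h_expand_both[OF tr[OF t]])
  qed
  then obtain Gu where Gu: "fr2 \<rho>' Gu" "\<And>t. t \<in> ball 0 \<rho>' \<Longrightarrow> u t = Gu t (cnj t)" unfolding frd_def by blast
  \<comment> \<open>Potentials by integration: I has s-derivative u, and K has the mixed derivative
    h(v, v).\<close>
  obtain I where I: "fr2 \<rho>' I" "\<And>w s. w \<in> ball 0 \<rho>' \<Longrightarrow> s \<in> ball 0 \<rho>' \<Longrightarrow> D2 I w s = Gu w s"
    using fr2_primitive(1)[OF Gu(1)] by blast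
  obtain Gg where Gg: "fr2 \<rho>' Gg" "\<And>t. t \<in> ball 0 \<rho>' \<Longrightarrow> m.h (d t) v v = Gg t (cnj t)" using mh[of v v] unfolding frd_def by blast
  obtain J where J: "fr2 \<rho>' J" "\<And>w s. w \<in> ball 0 \<rho>' \<Longrightarrow> s \<in> ball 0 \<rho>' \<Longrightarrow> D2 J w s = Gg w s"
    using fr2_primitive(1)[OF Gg(1)] by blast
  obtain K where K: "fr2 \<rho>' K" "\<And>w s. w \<in> ball 0 \<rho>' \<Longrightarrow> s \<in> ball 0 \<rho>' \<Longrightarrow> D1 K w s = J w s"
    using fr2_primitive(2)[OF J(1)] by blast
  define f where "f t = I t (cnj t)" for t
  define D where "D t = K t (cnj t)" for t
  define Jd where "Jd t = J t (cnj t)" for t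
  have fI: "frd \<rho>' f" and fD: "frd \<rho>' D" using frdI[OF I(1)] frdI[OF K(1)] by (auto simp: f_def D_def)
  have "\<exists>a. hw (\<lambda>t. f t / 1) a (1 * u t) t" if t: "t \<in> ball 0 \<rho>'" for t
    using fr2_hw[OF I(1) t] I(2)[of t "cnj t"] Gu(2)[OF t] t unfolding f_def [abs_def] by auto
  from u_real_part_hw[OF fI frd_const[of \<rho>' 1] one_neq_zero \<rho>'(2) this]
  obtain a where "\<forall>t\<in>ball 0 \<rho>'. hw (\<lambda>t. f t / 1) (a t) (1 * u t) t \<and> (\<exists>b. hw a b (1 * u1 t) t)" by blast
  then have a: "hw f (a t) (u t) t" "\<exists>b. hw a b (u1 t) t" if "t \<in> ball 0 \<rho>'" for t
    using that unfolding div_by_1 mult_1_left by blast+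
  have D_hw: "\<exists>b. hw D (Jd t) b t" and Jd_hw: "\<exists>b. hw Jd b (m.h (d t) v v) t" if t: "t \<in> ball 0 \<rho>'" for t
    using fr2_hw[OF K(1) t] K(2)[of t "cnj t"] fr2_hw[OF J(1) t] J(2)[of t "cnj t"] Gg(2)[OF t] t
    unfolding D_def [abs_def] Jd_def [abs_def] by auto
  \<comment> \<open>The mixed derivative is half of l h(v, v) + u1 + cnj u1, that is, Ric(v, v)/2.
    The summand \<open>cnj (f t)\<close> supplies the conjugate of u1.\<close>
  define N where "N t = (1 / 2) * ((of_real l * D t + f t) + cnj (f t))" for t
  define Rt where "Rt t = (1 / 2) * ((of_real l * Jd t + a t) + cnj (u t))" for t
  have Rt_hw: "\<exists>b. hw Rt b ((1 / 2) * ((of_real l * m.h (d t) v v + u1 t) + cnj (u1 t))) t" if t: "t \<in> ball 0 \<rho>'" for t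
  proof -
    obtain b1 b2 b3 where b: "hw Jd b1 (m.h (d t) v v) t" "hw a b2 (u1 t) t" "hw (\<lambda>t. cnj (u t)) b3 (cnj (u1 t)) t"
      using Jd_hw[OF t] a(2)[OF t] cnj_u_hw[OF tr[OF t]] by blast
    show ?thesis unfolding Rt_def [abs_def]
      by (rule exI) (rule hw_cmult[OF hw_add[OF hw_add[OF hw_cmult[OF b(1)] b(2)] b(3)]])
  qed
  have z: "(0::complex) \<in> ball 0 \<rho>'" using \<rho>'(1) by simp
  obtain b where b: "hw Rt b ((1 / 2) * ((of_real l * m.h (d 0) v v + u1 0) + cnj (u1 0))) 0" using Rt_hw[OF z] by blast
  have "(1 / 2) * ((of_real l * m.h (d 0) v v + u1 0) + cnj (u1 0)) = 0"
  \<comment> \<open>Here log P is 0 and q is \<delta> itself, since the metric already has finite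
    rank without clearing denominators.\<close>
  proof (rule disc_equation_splits(1)[where r = 0 and B = "\<lambda>_. 0" and Q = E and P = "\<lambda>_. 1" and N = N, OF \<rho>'(1) _ frd_const q _ _ _ _ _ _ b])
    show "frd \<rho>' N" unfolding N_def by (intro frd_mult frd_add frd_const frd_cnj fI fD)
    fix t :: complex assume t: "t \<in> ball 0 \<rho>'"
    show "m.\<delta> (d t) \<noteq> 0" by (rule m.\<delta>_nonzero[OF in_U[OF tr[OF t]]])
    obtain b1 where b: "hw D (Jd t) b1 t" using D_hw[OF t] by blast
    show "\<exists>x. hw (\<lambda>t. N t / 1) (Rt t) x t"
      unfolding N_def Rt_def div_by_1
      by (rule exI) (rule hw_cmult[OF hw_add[OF hw_add[OF hw_cmult[OF b] a(1)[OF t]] hw_cnj[OF a(1)[OF t]]]])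
    show "\<exists>y. hw (\<lambda>_. 1) (0 * 1) y t" using hw_const by auto
    show "\<exists>z. hw (\<lambda>t. m.\<delta> (d t)) (E t * m.\<delta> (d t)) z t" by (rule \<delta>_hw[OF tr[OF t]])
    obtain b1 b2 where "hw Rt b1 ((1 / 2) * ((of_real l * m.h (d t) v v + u1 t) + cnj (u1 t))) t"
      "hw E b2 (- (of_real l * m.h (d t) v v) / 2 - of_real (Re (u1 t))) t" using Rt_hw[OF t] E_hw[OF tr[OF t]] by blast
    from hw_add[OF this] have "hw (\<lambda>t. Rt t + 0 * 0 + E t) (b1 + b2)
       ((1 / 2) * ((of_real l * m.h (d t) v v + u1 t) + cnj (u1 t)) + (- (of_real l * m.h (d t) v v) / 2 - of_real (Re (u1 t)))) t"
      by simp
    moreover have "(1 / 2) * ((of_real l * m.h (d t) v v + u1 t) + cnj (u1 t)) + (- (of_real l * m.h (d t) v v) / 2 - of_real (Re (u1 t))) = 0"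
      by (simp add: complex_eq_iff add_divide_distrib)
    ultimately show "\<exists>k. hw (\<lambda>t. Rt t + 0 * 0 + E t) k 0 t" by auto
  qed simp
  then have "Re ((1 / 2) * ((of_real l * m.h (d 0) v v + u1 0) + cnj (u1 0))) = 0" by simp
  moreover have "m.h (d 0) v v = of_real (g (d 0) v v)" by (rule h_vv) (use \<rho> in simp)
  moreover have "d 0 = x0" by simp
  ultimately show ?thesis by simp
qed

section \<open>The function P along the disc\<close>

definition p where "p t = s.P (\<gamma> t)"
definition pd where "pd a t = wd (axis a 1) s.P (\<gamma> t)"
definition pdb where "pdb b t = wdb (axis b 1) s.P (\<gamma> t)"
definition pdd where "pdd b a t = wdb (axis b 1) (wd (axis a 1) s.P) (\<gamma> t)"

text \<open>By \<open>wd_wd_P\<close>, P and its first derivatives form a closed linear system in t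
  with holomorphic coefficients. Conjugate derivatives commute with \<open>wd\<close> and annihilate
  the coefficients, so \<open>pdb\<close> and \<open>pdd\<close> satisfy the same system.\<close>

lemma p_frd:
  "\<exists>\<rho>'>0. \<rho>' \<le> \<rho> \<and> frd \<rho>' p \<and> (\<forall>a. frd \<rho>' (pd a)) \<and> (\<forall>b. frd \<rho>' (pdb b)) \<and> (\<forall>a b. frd \<rho>' (pdd b a))"
proof -
  \<comment> \<open>The index \<open>None\<close> stands for P itself and \<open>Some k\<close> for
    its derivative in the direction \<open>axis k 1\<close>.\<close>
  define M where "M i j t = (case i of
      None \<Rightarrow> (case j of None \<Rightarrow> 0 | Some k \<Rightarrow> Z v t $ k)
    | Some b \<Rightarrow> (case j of None \<Rightarrow> \<Sum>a\<in>UNIV. Z v t $ a * s.B2 (axis a 1) (axis b 1) (\<gamma> t)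
        | Some k \<Rightarrow> \<Sum>a\<in>UNIV. Z v t $ a * s.A2 (axis a 1) (axis b 1) k (\<gamma> t)))" for i j :: "'k option" and t
  have "(\<lambda>t. s.A2 (axis a 1) (axis b 1) k (\<gamma> t)) holomorphic_on ball 0 \<rho>"
    "(\<lambda>t. s.B2 (axis a 1) (axis b 1) (\<gamma> t)) holomorphic_on ball 0 \<rho>" for a b k
    using holomorphic_along[OF s.A2_holomorphic] holomorphic_along[OF s.B2_holomorphic] by blast+
  then have M: "M i j holomorphic_on ball 0 \<rho>" for i j
    unfolding M_def [abs_def] by (cases i; cases j; simp only: option.case; intro holomorphic_intros Z_hol)
  obtain \<rho>' where \<rho>': "\<rho>' > 0" "\<rho>' \<le> \<rho>"
    and ode: "\<And>W. \<forall>i. \<forall>t\<in>ball 0 \<rho>. \<exists>b. hw (W i) (\<Sum>j\<in>UNIV. M i j t * W j t) b t \<Longrightarrow> \<forall>i. frd \<rho>' (W i)"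
    using frd_of_linear_ode[of \<rho> M, OF \<rho> M] by blast
  have sum_option: "(\<Sum>j\<in>UNIV. G j) = G None + (\<Sum>k\<in>UNIV. G (Some k))" for G :: "'k option \<Rightarrow> complex"
    by (simp add: UNIV_option_conv sum.reindex)
  have sd: "s.P differentiable (at y)" "wd e s.P differentiable (at y)" "wdb e s.P differentiable (at y)"
    "wdb e (wd e' s.P) differentiable (at y)" if "y \<in> V" for y e e'
    by (intro smooth_differentiable[OF _ that] smooth_wd smooth_wdb s.smooth_P)+
  have swap: "(\<Sum>a\<in>UNIV. z a * ((\<Sum>k\<in>UNIV. A a k * w k) + B a * w0)) = (\<Sum>a\<in>UNIV. z a * B a) * w0 + (\<Sum>k\<in>UNIV. (\<Sum>a\<in>UNIV. z a * A a k) * w k)"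
    for z :: "'k \<Rightarrow> complex" and A and B and w :: "'k \<Rightarrow> complex" and w0
  proof -
    have "(\<Sum>k\<in>UNIV. (\<Sum>a\<in>UNIV. z a * A a k) * w k) = (\<Sum>a\<in>UNIV. \<Sum>k\<in>UNIV. z a * (A a k * w k))"
      by (simp add: sum_distrib_right mult.assoc) (rule sum.swap)
    then show ?thesis by (simp add: distrib_left sum.distrib sum_distrib_left sum_distrib_right mult.assoc)
  qed
  define W where "W i t = (case i of None \<Rightarrow> p t | Some a \<Rightarrow> pd a t)" for i t
  define Wb where "Wb b i t = (case i of None \<Rightarrow> pdb b t | Some a \<Rightarrow> pdd b a t)" for b i t
  have "\<exists>z. hw (W i) (\<Sum>j\<in>UNIV. M i j t * W j t) z t" if t: "t \<in> ball 0 \<rho>" for i t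
  proof (cases i)
    case None
    have "wd (Z v t) s.P (\<gamma> t) = (\<Sum>j\<in>UNIV. M i j t * W j t)"
      unfolding sum_option wd_expand[OF sd(1)[OF \<gamma>_in[OF t]], of "Z v t"] by (simp add: M_def W_def pd_def None)
    moreover have "W i = (\<lambda>t. s.P (\<gamma> t))" by (simp add: W_def p_def None fun_eq_iff)
    ultimately show ?thesis using s_hw[OF t sd(1)[OF \<gamma>_in[OF t]]] by auto
  next
    case (Some b)
    have "wd (Z v t) (wd (axis b 1) s.P) (\<gamma> t) = (\<Sum>j\<in>UNIV. M i j t * W j t)"
      unfolding sum_option wd_expand[OF sd(2)[OF \<gamma>_in[OF t]], of "Z v t"]
      unfolding s.wd_wd_P[OF \<gamma>_in[OF t]] swap
      by (simp add: M_def W_def pd_def p_def Some)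
    moreover have "W i = (\<lambda>t. wd (axis b 1) s.P (\<gamma> t))" by (simp add: W_def pd_def Some fun_eq_iff)
    ultimately show ?thesis using s_hw[OF t sd(2)[OF \<gamma>_in[OF t], of "axis b 1"]] by auto
  qed
  then have W: "\<forall>i. frd \<rho>' (W i)" by (intro ode) blast
  have "\<exists>z. hw (Wb e i) (\<Sum>j\<in>UNIV. M i j t * Wb e j t) z t" if t: "t \<in> ball 0 \<rho>" for e i t
  proof (cases i)
    case None
    have "wd a (wdb (axis e 1) s.P) (\<gamma> t) = wdb (axis e 1) (wd a s.P) (\<gamma> t)" for a
      by (rule wd_commute(3)[OF s.smooth_P \<gamma>_in[OF t], symmetric])
    then have "wd (Z v t) (wdb (axis e 1) s.P) (\<gamma> t) = (\<Sum>j\<in>UNIV. M i j t * Wb e j t)"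
      unfolding sum_option wd_expand[OF sd(3)[OF \<gamma>_in[OF t]], of "Z v t"] by (simp add: M_def Wb_def pdd_def None)
    moreover have "Wb e i = (\<lambda>t. wdb (axis e 1) s.P (\<gamma> t))" by (simp add: Wb_def pdb_def None fun_eq_iff)
    ultimately show ?thesis using s_hw[OF t sd(3)[OF \<gamma>_in[OF t], of "axis e 1"]] by auto
  next
    case (Some b)
    have "wd (axis a 1) (wdb (axis e 1) (wd (axis b 1) s.P)) (\<gamma> t)
      = (\<Sum>k\<in>UNIV. s.A2 (axis a 1) (axis b 1) k (\<gamma> t) * pdd e k t) + s.B2 (axis a 1) (axis b 1) (\<gamma> t) * pdb e t" for a
    proof -
      note y = \<gamma>_in[OF t]
      have "wd (axis a 1) (wdb (axis e 1) (wd (axis b 1) s.P)) (\<gamma> t) = wdb (axis e 1) (wd (axis a 1) (wd (axis b 1) s.P)) (\<gamma> t)"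
        by (rule wd_commute(3)[OF smooth_wd[OF s.smooth_P] y, symmetric])
      also have "\<dots> = wdb (axis e 1) (\<lambda>y. (\<Sum>k\<in>UNIV. s.A2 (axis a 1) (axis b 1) k y * wd (axis k 1) s.P y)
          + s.B2 (axis a 1) (axis b 1) y * s.P y) (\<gamma> t)"
        by (intro wd_cong_open[OF s.open_A y] s.wd_wd_P)
      also have "\<dots> = (\<Sum>k\<in>UNIV. s.A2 (axis a 1) (axis b 1) k (\<gamma> t) * pdd e k t) + s.B2 (axis a 1) (axis b 1) (\<gamma> t) * pdb e t"
        using s.A2_holomorphic[OF y] s.B2_holomorphic[OF y] sd(1,2)[OF y]
        by (simp add: wdb_add wdb_sum wdb_mult pdd_def pdb_def)
      finally show ?thesis .
    qed
    then have "wd (Z v t) (wdb (axis e 1) (wd (axis b 1) s.P)) (\<gamma> t) = (\<Sum>j\<in>UNIV. M i j t * Wb e j t)"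
      unfolding sum_option wd_expand[OF sd(4)[OF \<gamma>_in[OF t]], of "Z v t"]
      by (simp add: swap M_def Wb_def Some)
    moreover have "Wb e i = (\<lambda>t. wdb (axis e 1) (wd (axis b 1) s.P) (\<gamma> t))" by (simp add: Wb_def pdd_def Some fun_eq_iff)
    ultimately show ?thesis using s_hw[OF t sd(4)[OF \<gamma>_in[OF t], of "axis e 1" "axis b 1"]] by auto
  qed
  then have Wb: "\<forall>i. frd \<rho>' (Wb b i)" for b by (intro ode) blast
  have "frd \<rho>' p" using W[rule_format, of None] by (simp add: W_def [abs_def])
  moreover have "frd \<rho>' (pd a)" for a using W[rule_format, of "Some a"] by (simp add: W_def [abs_def])
  moreover have "frd \<rho>' (pdb b)" for b using Wb[rule_format, of b None] by (simp add: Wb_def [abs_def])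
  moreover have "frd \<rho>' (pdd b a)" for a b using Wb[rule_format, of b "Some a"] by (simp add: Wb_def [abs_def])
  ultimately show ?thesis using \<rho>' by blast
qed

lemma p_nonzero: "p t \<noteq> 0" and p_cnj: "cnj (p t) = p t"
  by (simp_all add: p_def s.P_nonzero s.P_cnj)

text \<open>The mixed derivative of log P, multiplied by P^2. The right-hand side has finite rank,
  while h alone is a quotient.\<close>

lemma metric_p:
  assumes t: "t \<in> ball 0 \<rho>"
  shows "c / 2 * (p t * p t) * s.h (\<gamma> t) (axis a 1) (axis b 1) = p t * pdd b a t - pd a t * pdb b t"
proof -
  note y = \<gamma>_in[OF t]
  have "pdd b a t = wdb (axis b 1) (\<lambda>y. s.P y * s.\<beta> (axis a 1) y) (\<gamma> t)"
    unfolding pdd_def by (intro wd_cong_open[OF s.open_A y] s.wd_P)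
  also have "\<dots> = p t * (c / 2 * s.h (\<gamma> t) (axis a 1) (axis b 1)) + pdb b t * s.\<beta> (axis a 1) (\<gamma> t)"
    using y by (simp add: wdb_mult s.P_differentiable s.\<beta>_differentiable s.wdb_\<beta> p_def pdb_def)
  finally show ?thesis by (simp add: pd_def s.wd_P[OF y] p_def algebra_simps)
qed

text \<open>The t-derivative of log P along the disc, by \<open>s.wd_P\<close>.\<close>

definition B where "B t = s.\<beta> (Z v t) (\<gamma> t)"

lemma \<beta>_sum_hw:
  assumes t: "t \<in> ball 0 \<rho>" and y: "\<And>a. y a holomorphic_on ball 0 \<rho>"
  shows "\<exists>z. hw (\<lambda>t. \<Sum>a\<in>UNIV. y a t * s.\<beta> (axis a 1) (\<gamma> t)) z (c / 2 * s.h (\<gamma> t) (\<chi> a. y a t) (Z v t)) t"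
proof -
  have "hw (\<lambda>t. \<Sum>a\<in>UNIV. y a t * s.\<beta> (axis a 1) (\<gamma> t))
    (\<Sum>a\<in>UNIV. y a t * wd (Z v t) (s.\<beta> (axis a 1)) (\<gamma> t) + deriv (y a) t * s.\<beta> (axis a 1) (\<gamma> t))
    (\<Sum>a\<in>UNIV. y a t * wdb (Z v t) (s.\<beta> (axis a 1)) (\<gamma> t) + 0 * s.\<beta> (axis a 1) (\<gamma> t)) t"
    by (intro hw_sum hw_mult holomorphic_hw y t s_hw s.\<beta>_differentiable \<gamma>_in)
  moreover have e: "(\<Sum>a\<in>UNIV. y a t * wdb (Z v t) (s.\<beta> (axis a 1)) (\<gamma> t) + 0 * s.\<beta> (axis a 1) (\<gamma> t))
     = c / 2 * s.h (\<gamma> t) (\<chi> a. y a t) (Z v t)"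
    unfolding s.h_expand_left[OF \<gamma>_in[OF t], of "\<chi> a. y a t"] s.wdb_\<beta>[OF \<gamma>_in[OF t]]
    by (simp add: sum_distrib_left algebra_simps)
  ultimately show ?thesis unfolding e by blast
qed

lemma B_hw: assumes t: "t \<in> ball 0 \<rho>" shows "\<exists>z. hw B z (c / 2 * m.h (d t) v v) t"
proof -
  obtain z where "hw (\<lambda>t. \<Sum>a\<in>UNIV. Z v t $ a * s.\<beta> (axis a 1) (\<gamma> t)) z (c / 2 * s.h (\<gamma> t) (\<chi> a. Z v t $ a) (Z v t)) t"
    using \<beta>_sum_hw[OF t, of "\<lambda>a t. Z v t $ a"] Z_hol by blast
  then have "hw B z (c / 2 * s.h (\<gamma> t) (\<chi> a. Z v t $ a) (Z v t)) t"
    by (rule hw_cong[OF _ open_ball t]) (simp only: B_def s.\<beta>_expand[OF \<gamma>_in, symmetric])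
  then show ?thesis unfolding h_pullback[OF t] vec_lambda_eta by blast
qed

lemma p_hw: assumes t: "t \<in> ball 0 \<rho>" shows "\<exists>y. hw p (B t * p t) y t"
  using s_hw[OF t s.P_differentiable[OF \<gamma>_in[OF t]]] unfolding s.wd_P[OF \<gamma>_in[OF t]] B_def p_def [abs_def]
  by (auto simp: mult.commute)

text \<open>Re u1 is half of the Lie derivative of g on (v, v) and occurs as the mixed derivative of
  N / p, so the first conclusion of \<open>disc_equation_splits\<close> gives 0. The second one
  concerns the mixed derivative of log P, which is c/2 times g(v, v).\<close>

lemma curved_splits:
  assumes c: "c \<noteq> 0"
  shows "Re (u1 0) = 0"
    and "\<not> (\<exists>m j::nat. m > 0 \<and> complex_of_real (l / c - 2 * real CARD('n)) * of_nat m + of_nat j = 0) \<Longrightarrow> g x0 v v = 0"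
proof -
  obtain \<rho>' where \<rho>': "\<rho>' > 0" "\<rho>' \<le> \<rho>" and p: "frd \<rho>' p" and pd: "\<And>a. frd \<rho>' (pd a)"
    and pdb: "\<And>b. frd \<rho>' (pdb b)" and pdd: "\<And>a b. frd \<rho>' (pdd b a)" using p_frd by blast
  have tr: "t \<in> ball 0 \<rho>" if "t \<in> ball 0 \<rho>'" for t :: complex using that \<rho>' by auto
  \<comment> \<open>By \<open>metric_p\<close> the entries of the metric times \<open>cc\<close>
    have finite rank, so the n-th power of \<open>cc\<close> clears the denominators of the
    determinant.\<close>
  define cc where "cc t = complex_of_real c / 2 * (p t * p t)" for t
  define q where "q t = cc t ^ CARD('n) * m.\<delta> (d t)" for t
  have cc: "cc t \<noteq> 0" for t using c p_nonzero by (simp add: cc_def)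
  have mh: "frd \<rho>' (\<lambda>t. cc t * m.h (d t) a b)" for a b
  proof (rule frd_cong[OF frd_pullback(1)[OF \<rho>'(2), of "\<lambda>i j t. p t * pdd j i t - pd i t * pdb j t" a b]])
    show "frd \<rho>' (\<lambda>t. p t * pdd j i t - pd i t * pdb j t)" for i j by (intro frd_diff frd_mult p pd pdb pdd)
    show "cc t * m.h (d t) a b = (\<Sum>i\<in>UNIV. \<Sum>j\<in>UNIV. Z a t $ i * cnj (Z b t $ j) * (p t * pdd j i t - pd i t * pdb j t))"
      if t: "t \<in> ball 0 \<rho>'" for t
      unfolding h_pullback[OF tr[OF t]] h_expand_both[OF tr[OF t], of "Z a t" "Z b t"] metric_p[OF tr[OF t], symmetric] cc_def
      by (simp only: sum_distrib_left mult.assoc mult.left_commute of_real_divide of_real_numeral)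
  qed
  have q_frd: "frd \<rho>' q"
  proof (rule frd_cong)
    show "frd \<rho>' (\<lambda>t. det (\<chi> b. cc t *s m.Hm (d t) $ b))"
      by (intro frd_det) (simp add: m.Hm_def mh)
    show "q t = det (\<chi> b. cc t *s m.Hm (d t) $ b)" for t
      unfolding det_rows_mul q_def m.\<delta>_def by simp
  qed
  \<comment> \<open>f is the derivative of P in the direction \<zeta>, so f / p is \<beta> on
    \<zeta>, with conjugate derivative c/2 times u.\<close>
  define f where "f t = (\<Sum>a\<in>UNIV. \<zeta> t $ a * pd a t)" for t
  have f_frd: "frd \<rho>' f" unfolding f_def
    by (intro frd_sum frd_mult pd frd_mono[OF frd_holomorphic[OF \<zeta>_holomorphic] \<rho>'(2)])
  have "\<exists>a. hw (\<lambda>t. f t / p t) a (c / 2 * u t) t" if t: "t \<in> ball 0 \<rho>'" for t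
  proof -
    obtain z where "hw (\<lambda>t. \<Sum>a\<in>UNIV. \<zeta> t $ a * s.\<beta> (axis a 1) (\<gamma> t)) z (c / 2 * s.h (\<gamma> t) (\<chi> a. \<zeta> t $ a) (Z v t)) t"
      using \<beta>_sum_hw[OF tr[OF t], of "\<lambda>a t. \<zeta> t $ a"] \<zeta>_holomorphic by blast
    then have "hw (\<lambda>t. f t / p t) z (c / 2 * s.h (\<gamma> t) (\<chi> a. \<zeta> t $ a) (Z v t)) t"
    proof (rule hw_cong[OF _ open_ball t])
      fix t :: complex assume t: "t \<in> ball 0 \<rho>'"
      show "(\<Sum>a\<in>UNIV. \<zeta> t $ a * s.\<beta> (axis a 1) (\<gamma> t)) = f t / p t"
        using p_nonzero[of t] s.wd_P[OF \<gamma>_in[OF tr[OF t]]]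
        by (simp add: f_def pd_def p_def sum_divide_distrib)
    qed
    then show ?thesis unfolding u_pullback[OF tr[OF t]] vec_lambda_eta by blast
  qed
  from u_real_part_hw[OF f_frd p p_nonzero \<rho>'(2) this]
  obtain a where a: "\<And>t. t \<in> ball 0 \<rho>' \<Longrightarrow> hw (\<lambda>t. f t / p t) (a t) (c / 2 * u t) t"
    "\<And>t. t \<in> ball 0 \<rho>' \<Longrightarrow> \<exists>b. hw a b (c / 2 * u1 t) t" by blast
  \<comment> \<open>As p is real, N / p is 1/c times the sum of f / p and its conjugate, and its
    mixed derivative is Re u1.\<close>
  define N where "N t = (1 / complex_of_real c) * (f t + cnj (f t))" for t
  define Rt where "Rt t = (1 / complex_of_real c) * (a t + cnj (c / 2 * u t))" for t
  have Rt_hw: "\<exists>b. hw Rt b (of_real (Re (u1 t))) t" if t: "t \<in> ball 0 \<rho>'" for t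
  proof -
    obtain b1 b2 where "hw a b1 (c / 2 * u1 t) t" "hw u (u1 t) b2 t"
      using a(2)[OF t] u_hw[OF tr[OF t]] by blast
    from hw_cmult[OF hw_add[OF this(1) hw_cnj[OF hw_cmult[OF this(2)]]], of "1 / complex_of_real c" "c / 2"]
    have "hw Rt ((1 / complex_of_real c) * (b1 + cnj (c / 2 * b2))) ((1 / complex_of_real c) * (c / 2 * u1 t + cnj (c / 2 * u1 t))) t"
      unfolding Rt_def [abs_def] .
    moreover have "(1 / complex_of_real c) * (c / 2 * u1 t + cnj (c / 2 * u1 t)) = of_real (Re (u1 t))"
      using c by (simp add: complex_eq_iff field_simps)
    ultimately show ?thesis by auto
  qed
  define n where "n = complex_of_nat CARD('n)"
  \<comment> \<open>The mixed derivative of log q consists of 2n times c/2 g(v, v) from the powers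
    of P and of -l/2 g(v, v) - Re u1 from the determinant; r log P cancels the terms in g.\<close>
  define r where "r = complex_of_real (l / c - 2 * real CARD('n))"
  define Q where "Q t = 2 * n * B t + E t" for t
  have z: "(0::complex) \<in> ball 0 \<rho>'" using \<rho>'(1) by simp
  have N_frd: "frd \<rho>' N" unfolding N_def by (intro frd_mult frd_add frd_const frd_cnj f_frd)
  have q_nz: "q t \<noteq> 0" if "t \<in> ball 0 \<rho>'" for t
    using cc m.\<delta>_nonzero[OF in_U[OF tr[OF that]]] by (simp add: q_def)
  have N_hw: "\<exists>x. hw (\<lambda>t. N t / p t) (Rt t) x t" if t: "t \<in> ball 0 \<rho>'" for t
  proof -
    have e: "(\<lambda>t. N t / p t) = (\<lambda>t. (1 / complex_of_real c) * (f t / p t + cnj (f t / p t)))"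
      by (simp add: N_def fun_eq_iff p_cnj add_divide_distrib distrib_left)
    show ?thesis unfolding e Rt_def
      by (rule exI) (rule hw_cmult[OF hw_add[OF a(1)[OF t] hw_cnj[OF a(1)[OF t]]]])
  qed
  have q_hw: "\<exists>z. hw q (Q t * q t) z t" if t: "t \<in> ball 0 \<rho>'" for t
  proof -
    obtain y z where y: "hw p (B t * p t) y t" and z: "hw (\<lambda>t. m.\<delta> (d t)) (E t * m.\<delta> (d t)) z t"
      using p_hw \<delta>_hw tr[OF t] by blast
    from hw_cmult[OF hw_mult[OF y y], of "complex_of_real c / 2"]
    obtain y' where "hw cc (complex_of_real c / 2 * (p t * (B t * p t) + B t * p t * p t)) y' t"
      unfolding cc_def [abs_def] by blast
    moreover have "complex_of_real c / 2 * (p t * (B t * p t) + B t * p t * p t) = 2 * B t * cc t"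
      by (simp add: cc_def)
    ultimately have "hw cc (2 * B t * cc t) y' t" by (simp only:)
    from hw_mult[OF hw_power[OF this cc, of "CARD('n)"] z] obtain z' where
      "hw q (cc t ^ CARD('n) * (E t * m.\<delta> (d t)) + n * (2 * B t * cc t / cc t) * cc t ^ CARD('n) * m.\<delta> (d t)) z' t"
      unfolding q_def [abs_def] n_def by blast
    moreover have "2 * B t * cc t / cc t = 2 * B t" using cc[of t] by simp
    then have "cc t ^ CARD('n) * (E t * m.\<delta> (d t)) + n * (2 * B t * cc t / cc t) * cc t ^ CARD('n) * m.\<delta> (d t) = Q t * q t"
      unfolding Q_def q_def by (simp only: algebra_simps)
    ultimately show ?thesis by auto
  qed
  have \<kappa>: "\<exists>k. hw (\<lambda>t. Rt t + r * B t + Q t) k 0 t" if t: "t \<in> ball 0 \<rho>'" for t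
  proof -
    obtain b1 b2 b3 where b: "hw Rt b1 (of_real (Re (u1 t))) t" "hw B b2 (c / 2 * m.h (d t) v v) t"
      "hw E b3 (- (of_real l * m.h (d t) v v) / 2 - of_real (Re (u1 t))) t"
      using Rt_hw[OF t] B_hw[OF tr[OF t]] E_hw[OF tr[OF t]] by blast
    from hw_add[OF hw_add[OF b(1) hw_cmult[OF b(2), of r]] hw_add[OF hw_cmult[OF b(2), of "2 * n"] b(3)]]
    obtain k where "hw (\<lambda>t. Rt t + r * B t + Q t) k (of_real (Re (u1 t)) + r * (c / 2 * m.h (d t) v v)
       + (2 * n * (c / 2 * m.h (d t) v v) + (- (of_real l * m.h (d t) v v) / 2 - of_real (Re (u1 t))))) t"
      unfolding Q_def [abs_def] by blast
    moreover have "r * c = l - 2 * n * c" using c by (simp add: r_def n_def field_simps)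
    then have "(r * c) * (m.h (d t) v v / 2) = (l - 2 * n * c) * (m.h (d t) v v / 2)" by (simp only:)
    then have "of_real (Re (u1 t)) + r * (c / 2 * m.h (d t) v v)
       + (2 * n * (c / 2 * m.h (d t) v v) + (- (of_real l * m.h (d t) v v) / 2 - of_real (Re (u1 t)))) = 0"
      by (simp add: algebra_simps)
    ultimately show ?thesis by auto
  qed
  note splits = disc_equation_splits[OF \<rho>'(1) N_frd p q_frd p_nonzero q_nz N_hw p_hw[OF tr] q_hw \<kappa>]
  show "Re (u1 0) = 0"
  proof -
    obtain b where "hw Rt b (of_real (Re (u1 0))) 0" using Rt_hw[OF z] by blast
    from splits(1)[OF _ _ _ _ _ this] show ?thesis by simp
  qed
  show "g x0 v v = 0" if irr: "\<not> (\<exists>m j::nat. m > 0 \<and> complex_of_real (l / c - 2 * real CARD('n)) * of_nat m + of_nat j = 0)"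
  proof -
    obtain b where "hw B b (c / 2 * m.h (d 0) v v) 0" using B_hw[OF tr[OF z]] by blast
    from splits(2)[OF _ _ _ _ _ irr[folded r_def] this] have "c / 2 * m.h (d 0) v v = 0" by simp
    then show ?thesis using c h_vv[OF tr[OF z]] by simp
  qed
qed

end

section \<open>The Einstein equation and the rational constant\<close>

context local_soliton
begin

lemma exists_disc: "x0 \<in> U \<Longrightarrow> \<exists>\<rho>. soliton_disc U g V gs c F X l x0 v \<rho>"
proof -
  assume x0: "x0 \<in> U"
  obtain \<rho> where \<rho>: "\<rho> > 0" "\<forall>t\<in>ball 0 \<rho>. x0 + t *s v \<in> U"
    "\<forall>e a. (\<lambda>t. dir_deriv F (x0 + t *s v) e $ a) holomorphic_on ball 0 \<rho>"
    using transverse_derivative_holomorphic[OF F_hol m.open_A x0] by blast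
  then have "soliton_disc U g V gs c F X l x0 v \<rho>" by unfold_locales auto
  then show ?thesis ..
qed

text \<open>By polarization v = w suffices, and the disc in direction v applies: for c \<noteq> 0
  the Lie derivative vanishes there, for c = 0 the whole Ricci tensor does.\<close>

theorem einstein:
  assumes x0: "x0 \<in> U"
  shows "ricci g x0 v w = (if c = 0 then 0 else l) * g x0 v w"
proof (rule m.ricci_eq_multiple[OF x0])
  fix v
  obtain \<rho> where "soliton_disc U g V gs c F X l x0 v \<rho>" using exists_disc[OF x0] by blast
  then interpret soliton_disc U g V gs c F X l x0 v \<rho> .
  have "ricci g x0 v v = l * g x0 v v + 2 * Re (u1 0)" using ricci_u1[of 0] \<rho> by simp
  then show "ricci g x0 v v = (if c = 0 then 0 else l) * g x0 v v"
    using flat_splits curved_splits(1) by simp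
qed

text \<open>Definiteness of g enters here: g(v, v) > 0 contradicts the conclusion of
  \<open>curved_splits(2)\<close>, so its hypothesis fails and r m + j = 0 with m > 0. Since r = l/c
  - 2n, this reads l/c = 2n - j/m.\<close>

theorem rational_constant:
  assumes x0: "x0 \<in> U" and c: "c \<noteq> 0"
  shows "l / c \<in> \<rat>"
proof -
  define v :: "complex^'n" where "v = axis undefined 1"
  have v: "v \<noteq> 0" by (simp add: v_def axis_eq_0_iff)
  obtain \<rho> where "soliton_disc U g V gs c F X l x0 v \<rho>" using exists_disc[OF x0] by blast
  then interpret soliton_disc U g V gs c F X l x0 v \<rho> .
  obtain m j :: nat where m: "m > 0" and e: "complex_of_real (l / c - 2 * real CARD('n)) * of_nat m + of_nat j = 0"
    using curved_splits(2)[OF c] pos[OF x0 v] by auto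
  have "complex_of_real ((l / c - 2 * real CARD('n)) * real m + real j) = 0" using e by simp
  then have "(l / c - 2 * real CARD('n)) * real m + real j = 0" by (simp only: of_real_eq_0_iff)
  then have "l / c = 2 * real CARD('n) - real j / real m" using m by (simp add: field_simps)
  also have "\<dots> \<in> \<rat>" by (intro Rats_diff Rats_mult Rats_divide) simp_all
  finally show ?thesis .
qed

end

section \<open>Charts\<close>

lemma chart_inv_image:
  assumes "inj_on (snd C) (fst C)" "p \<in> fst C"
  shows "chart_inv C (snd C p) = p"
  unfolding chart_inv_def by (rule inv_into_f_f[OF assms])

lemma chart_image_open:
  assumes M: "complex_manifold M \<A>" and C: "C \<in> \<A>" and W: "openin M W" "W \<subseteq> fst C"
  shows "open (snd C ` W)" and "inj_on (snd C) (fst C)"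
proof -
  have C': "openin M (fst C)" "open (chart_range C)"
    "homeomorphic_map (subtopology M (fst C)) (top_of_set (chart_range C)) (snd C)"
    using M C by (auto simp: complex_manifold_def)
  have ts: "topspace (subtopology M (fst C)) = fst C" using openin_subset[OF C'(1)] by auto
  have "openin (subtopology M (fst C)) W" using W C'(1) by (simp add: openin_open_subtopology)
  moreover have "open_map (subtopology M (fst C)) (top_of_set (chart_range C)) (snd C)"
    using C'(3) by (simp add: homeomorphic_eq_everything_map)
  ultimately have "openin (top_of_set (chart_range C)) (snd C ` W)" by (simp add: open_map_def)
  then show "open (snd C ` W)" using C'(2) openin_open_trans by blast
  show "inj_on (snd C) (fst C)" using C'(3) ts by (simp add: homeomorphic_eq_everything_map)
qed

text \<open>The smaller open set is needed since a chart of M may not be mapped into a single chart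
  of S.\<close>

lemma pseudo_kahler_metric_domain:
  fixes \<A> :: "('m, 'n::finite) chart set"
  assumes "pseudo_kahler_metric \<A> g" "C \<in> \<A>" "open U" "U \<subseteq> chart_range C"
  shows "pseudo_kahler_domain U (g C)"
proof
  have mono: "Ck_on k U f" if "Ck_on k (chart_range C) f" for k and f :: "complex^'n \<Rightarrow> real"
    using that assms(4) by (induction k arbitrary: f) (auto intro: continuous_on_subset)
  show "open U" by fact
  show "pseudo_riemannian_on U (g C)"
  proof -
    have "pseudo_riemannian_on (chart_range C) (g C)" using assms(1,2) by (simp add: pseudo_kahler_metric_def)
    then show ?thesis using assms(4) unfolding pseudo_riemannian_on_def Cinf_on_def by (auto intro!: mono)
  qed
qed (use assms in \<open>auto simp: pseudo_kahler_metric_def subset_eq\<close>)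

text \<open>U is the part of the chart C that \<phi> maps into one chart around the image of the
  given point. The constant l is the same for all charts, so local results combine.\<close>

lemma immersed_soliton_chart:
  fixes \<A> :: "('m, 'n::finite) chart set" and \<B> :: "('s, 'k::finite) chart set"
  assumes M: "complex_manifold M \<A>" and S: "complex_space_form S \<B> gs (2 * c)"
    and g: "kahler_metric \<A> g" and X: "holomorphic_vector_field \<A> X"
    and sol: "\<And>C x v w. C \<in> \<A> \<Longrightarrow> x \<in> chart_range C \<Longrightarrow>
        ricci (g C) x v w = l * g C x v w + lie_derivative (X C) (g C) x v w"
    and \<phi>: "kahler_immersion M \<A> g S \<B> gs \<phi>" and C: "C \<in> \<A>" and x0: "x0 \<in> chart_range C"
  shows "\<exists>U C' F. local_soliton U (g C) (chart_range C') (gs C') c F (X C) l \<and> x0 \<in> U"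
proof -
  obtain p where p: "p \<in> fst C" "x0 = snd C p" using x0 by (auto simp: chart_range_def)
  have MC: "openin M (fst C)" using M C by (auto simp: complex_manifold_def)
  have cont: "continuous_map M S \<phi>" using \<phi> by (simp add: kahler_immersion_def)
  have SM: "complex_manifold S \<B>" and pk: "pseudo_kahler_metric \<B> gs"
    and curv: "\<And>C x v. C \<in> \<B> \<Longrightarrow> x \<in> chart_range C \<Longrightarrow> gs C x v v \<noteq> 0 \<Longrightarrow> sectional_curvature (gs C) x v (\<i> *s v) = 2 * c"
    using S by (auto simp: complex_space_form_def)
  have "p \<in> topspace M" using openin_subset[OF MC] p by blast
  then have "\<phi> p \<in> topspace S" using cont by (auto simp: continuous_map_def)
  then obtain C' where C': "C' \<in> \<B>" "\<phi> p \<in> fst C'" using SM unfolding complex_manifold_def by blast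
  have SC: "openin S (fst C')" "open (chart_range C')" using SM C' by (auto simp: complex_manifold_def)
  define W where "W = fst C \<inter> \<phi> -` fst C'"
  have "W = fst C \<inter> {x \<in> topspace M. \<phi> x \<in> fst C'}" using openin_subset[OF MC] by (auto simp: W_def)
  then have W: "openin M W" "W \<subseteq> fst C"
    using openin_Int[OF MC openin_continuous_map_preimage[OF cont SC(1)]] by (auto simp: W_def)
  define U where "U = snd C ` W"
  define F where "F = local_rep C C' \<phi>"
  have U: "open U" "U \<subseteq> chart_range C"
    using chart_image_open(1)[OF M C W] W(2) by (auto simp: U_def chart_range_def)
  note inj = chart_image_open(2)[OF M C W]
  have F: "holomorphic_map_on U F" "\<And>x v w. x \<in> U \<Longrightarrow> g C x v w = gs C' (F x) (dir_deriv F x v) (dir_deriv F x w)"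
    using \<phi> C C'(1) unfolding kahler_immersion_def U_def W_def F_def by blast+
  have F_in: "F x \<in> chart_range C'" if x: "x \<in> U" for x
  proof -
    obtain y where y: "y \<in> fst C" "\<phi> y \<in> fst C'" "x = snd C y" using x unfolding U_def W_def by blast
    then have "F x = snd C' (\<phi> y)" by (simp add: F_def local_rep_def chart_inv_image[OF inj])
    then show ?thesis using y by (simp add: chart_range_def)
  qed
  have pkU: "pseudo_kahler_domain U (g C)"
    using g C U by (intro pseudo_kahler_metric_domain) (auto simp: kahler_metric_def)
  have pkS: "pseudo_kahler_domain (chart_range C') (gs C')"
    by (rule pseudo_kahler_metric_domain[OF pk C'(1) SC(2) order_refl])
  have "holomorphic_map_on U (X C)"
    using X C U(2) unfolding holomorphic_vector_field_def holomorphic_map_on_def by blast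
  moreover have "g C x v v > 0" if "x \<in> U" "v \<noteq> 0" for x v
    using g C that U(2) unfolding kahler_metric_def by blast
  ultimately have "local_soliton U (g C) (chart_range C') (gs C') c F (X C) l"
    using pkU pkS curv[OF C'(1)] F F_in sol[OF C] U(2)
    by (intro local_soliton.intro local_soliton_axioms.intro constant_holomorphic_curvature.intro
        constant_holomorphic_curvature_axioms.intro) auto
  moreover have "x0 \<in> U" using p C'(2) by (auto simp: U_def W_def)
  ultimately show ?thesis by blast
qed

theorem theorem1p1:
  fixes M :: "'m topology" and \<A> :: "('m, 'n::finite) chart set"
    and g :: "('m, 'n) metric_field" and X :: "('m, 'n) vector_field"
    and S :: "'s topology" and \<B> :: "('s, 'k::finite) chart set"
    and g\<^sub>c :: "('s, 'k) metric_field" and c :: real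
  assumes "complex_manifold M \<A>"
    and "kahler_ricci_soliton \<A> g X"
    and "complex_space_form S \<B> g\<^sub>c (2 * c)"
    and "\<exists>\<phi>. kahler_immersion M \<A> g S \<B> g\<^sub>c \<phi>"
  shows "\<exists>\<mu>. kahler_einstein \<A> g \<mu> \<and> (\<exists>q\<in>\<rat>. \<mu> = q * c)"
proof -
  obtain \<phi> where \<phi>: "kahler_immersion M \<A> g S \<B> g\<^sub>c \<phi>" using assms(4) ..
  obtain l where g: "kahler_metric \<A> g" "holomorphic_vector_field \<A> X"
    and sol: "\<And>C x v w. C \<in> \<A> \<Longrightarrow> x \<in> chart_range C \<Longrightarrow>
        ricci (g C) x v w = l * g C x v w + lie_derivative (X C) (g C) x v w"
    using assms(2) unfolding kahler_ricci_soliton_def by blast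
  have chart: "\<exists>U C' F. local_soliton U (g C) (chart_range C') (g\<^sub>c C') c F (X C) l \<and> x \<in> U"
    if "C \<in> \<A>" "x \<in> chart_range C" for C x
    using immersed_soliton_chart[OF assms(1,3) g sol \<phi> that] .
  define \<mu> where "\<mu> = (if c = 0 then 0 else l)"
  have E: "ricci (g C) x v w = \<mu> * g C x v w" if Cx: "C \<in> \<A>" "x \<in> chart_range C" for C x v w
  proof -
    obtain U C' F where L: "local_soliton U (g C) (chart_range C') (g\<^sub>c C') c F (X C) l" "x \<in> U"
      using chart[OF Cx] by (elim exE conjE)
    show ?thesis unfolding \<mu>_def by (rule local_soliton.einstein[OF L])
  qed
  show ?thesis
  proof (cases "c = 0 \<or> (\<forall>C\<in>\<A>. chart_range C = {})")
    case True
    \<comment> \<open>For c = 0 the Einstein constant is 0. Without points in the charts every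
      constant is an Einstein constant, and 0 is chosen because \<open>\<mu>\<close> need not be a
      rational multiple of c then.\<close>
    then have "ricci (g C) x v w = 0 * g C x v w" if "C \<in> \<A>" "x \<in> chart_range C" for C x v w
      using E[OF that] that by (auto simp: \<mu>_def)
    then show ?thesis using g(1) by (intro exI[of _ 0]) (auto simp: kahler_einstein_def intro: bexI[of _ 0])
  next
    case False
    then obtain C x where c: "c \<noteq> 0" and Cx: "C \<in> \<A>" "x \<in> chart_range C" by blast
    obtain U C' F where L: "local_soliton U (g C) (chart_range C') (g\<^sub>c C') c F (X C) l" "x \<in> U"
      using chart[OF Cx] by (elim exE conjE)
    have "l / c \<in> \<rat>" by (rule local_soliton.rational_constant[OF L c])
    moreover have "\<mu> = l / c * c" using c by (simp add: \<mu>_def)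
    moreover have "kahler_einstein \<A> g \<mu>" unfolding kahler_einstein_def using g(1) E by blast
    ultimately show ?thesis by blast
  qed
qed

end
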